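(* Let $G$ be a compact group and let $\alpha:G\to\operatorname{Aut}(A)$ be an action of $G$ on a unital separable $C^*$-algebra $A$. Then $\alpha$ has the weak tracial Rokhlin property if and only if the map $1_{C(G)}\otimes\operatorname{id}_A:(A,\alpha)\to(C(G)\otimes A,\sigma\otimes\alpha)$, $a\mapsto 1_{C(G)}\otimes a$, is $G$-tracially sequentially-split by order zero.
   Context: Actions of topological groups are continuous. Fix a free ultrafilter $\omega$ on $\mathbb{N}$. For a $C^*$-algebra $A$, $A_\omega=\ell^\infty(\mathbb{N},A)/\{(a_n)_n:\lim_{\omega}\|a_n\|=0\}$; $A$ is embedded in $A_\omega$ as constant sequences, and $A_\omega\cap A'$ is the relative commutant of $A$ in $A_\omega$. An action $\alpha$ on $A$ induces an action $\alpha_\omega$ (by automorphisms) on $A_\omega$ and on $A_\omega\cap A'$ by acting on representing sequences. For positive elements $a,b$ of a $C^*$-algebra $D$, $a\lesssim b$ (in $D$) means that there is a sequence $(x_n)$ in $D$ with $\|x_nbx_n^*-a\|\to0$. An order zero map is a completely positive map $\psi:A\to B$ between $C^*$-algebras such that $\psi(a)\psi(b)=\psi(b)\psi(a)=0$ whenever $a,b\in A^+$ satisfy $ab=ba=0$. The shift action $\sigma$ of $G$ on $C(G)$ is $\sigma_g(f)=f(g^{-1}\,\cdot)$. Weak tracial Rokhlin property: $\alpha$ has the weak tracial Rokhlin property if for every nonzero positive $x\in A_\omega$ there exists a contractive equivariant order zero map $\phi:(C(G),\sigma)\to(A_\omega\cap A',\alpha_\omega)$ such that $1-\phi(1_{C(G)})\lesssim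 x$ in $A_\omega$. $G$-tracially sequentially-split by order zero: for continuous actions $\alpha:G\to\operatorname{Aut}(A)$, $\beta:G\to\operatorname{Aut}(B)$ on unital $C^*$-algebras, an equivariant $*$-homomorphism $\phi:(A,\alpha)\to(B,\beta)$ is $G$-tracially sequentially-split by order zero if for every nonzero positive $x\in A_\omega$ there exist an equivariant order zero map $\psi:(B,\beta)\to(A_\omega,\alpha_\omega)$ and a positive element $g\in A_\omega\cap A'$ such that (1) $\psi(\phi(a))=ga=ag$ for all $a\in A$, and (2) $1_{A_\omega}-g\lesssim x$ in $A_\omega$. *)

theory Defs
  imports "HOL-Analysis.Analysis" "HOL-Algebra.QuotRing" "HOL-Algebra.Module"
begin

section \<open>Unital C*-algebras on carrier sets\<close>

record 'a star_alg = "(complex, 'a) module" +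
  adj :: "'a \<Rightarrow> 'a"

record 'a cstar = "'a star_alg" +
  nrm :: "'a \<Rightarrow> real"

definition complex_cstar :: "complex cstar" where
  "complex_cstar = \<lparr>carrier = UNIV, monoid.mult = (*), one = 1, zero = 0, add = (+),
     smult = (*), adj = cnj, nrm = cmod\<rparr>"

definition cdist :: "('a, 's) cstar_scheme \<Rightarrow> 'a \<Rightarrow> 'a \<Rightarrow> real" where
  "cdist D x y = (if x \<in> carrier D \<and> y \<in> carrier D then nrm D (x \<ominus>\<^bsub>D\<^esub> y) else 0)"

definition norm_topology :: "('a, 's) cstar_scheme \<Rightarrow> 'a topology" where
  "norm_topology D = Metric_space.mtopology (carrier D) (cdist D)"

text \<open>The zero algebra is not excluded.\<close>

locale unital_cstar_algebra = ring D + module complex_cstar D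
  for D :: "('a, 's) cstar_scheme" (structure) +
  assumes smult_mult_left: "\<lbrakk>x \<in> carrier D; y \<in> carrier D\<rbrakk> \<Longrightarrow> (c \<odot> x) \<otimes> y = c \<odot> (x \<otimes> y)"
    and smult_mult_right: "\<lbrakk>x \<in> carrier D; y \<in> carrier D\<rbrakk> \<Longrightarrow> x \<otimes> (c \<odot> y) = c \<odot> (x \<otimes> y)"
    and adj_closed: "x \<in> carrier D \<Longrightarrow> adj D x \<in> carrier D"
    and adj_adj: "x \<in> carrier D \<Longrightarrow> adj D (adj D x) = x"
    and adj_add: "\<lbrakk>x \<in> carrier D; y \<in> carrier D\<rbrakk> \<Longrightarrow> adj D (x \<oplus> y) = adj D x \<oplus> adj D y"
    and adj_smult: "x \<in> carrier D \<Longrightarrow> adj D (c \<odot> x) = cnj c \<odot> adj D x"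
    and adj_mult: "\<lbrakk>x \<in> carrier D; y \<in> carrier D\<rbrakk> \<Longrightarrow> adj D (x \<otimes> y) = adj D y \<otimes> adj D x"
    and nrm_nonneg: "x \<in> carrier D \<Longrightarrow> 0 \<le> nrm D x"
    and nrm_eq_0_iff: "x \<in> carrier D \<Longrightarrow> nrm D x = 0 \<longleftrightarrow> x = \<zero>"
    and nrm_triangle: "\<lbrakk>x \<in> carrier D; y \<in> carrier D\<rbrakk> \<Longrightarrow> nrm D (x \<oplus> y) \<le> nrm D x + nrm D y"
    and nrm_smult: "x \<in> carrier D \<Longrightarrow> nrm D (c \<odot> x) = cmod c * nrm D x"
    and nrm_mult: "\<lbrakk>x \<in> carrier D; y \<in> carrier D\<rbrakk> \<Longrightarrow> nrm D (x \<otimes> y) \<le> nrm D x * nrm D y"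
    and cstar_identity: "x \<in> carrier D \<Longrightarrow> nrm D (adj D x \<otimes> x) = (nrm D x)\<^sup>2"
    and complete: "Metric_space.mcomplete (carrier D) (cdist D)"

definition separable_cstar :: "('a, 's) cstar_scheme \<Rightarrow> bool" where
  "separable_cstar D \<longleftrightarrow>
     (\<exists>S. countable S \<and> S \<subseteq> carrier D \<and> norm_topology D closure_of S = carrier D)"

definition spectrum :: "('a, 's) star_alg_scheme \<Rightarrow> 'a \<Rightarrow> complex set" where
  "spectrum D a = {c. (c \<odot>\<^bsub>D\<^esub> \<one>\<^bsub>D\<^esub>) \<ominus>\<^bsub>D\<^esub> a \<notin> Units D}"

definition positive :: "('a, 's) star_alg_scheme \<Rightarrow> 'a \<Rightarrow> bool" where
  "positive D a \<longleftrightarrow> a \<in> carrier D \<and> adj D a = a \<and> spectrum D a \<subseteq> complex_of_real ` {0..}"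

definition cuntz_le :: "('a, 's) cstar_scheme \<Rightarrow> 'a \<Rightarrow> 'a \<Rightarrow> bool" where
  "cuntz_le D a b \<longleftrightarrow> positive D a \<and> positive D b \<and>
     (\<exists>x :: nat \<Rightarrow> 'a. (\<forall>n. x n \<in> carrier D) \<and>
        (\<lambda>n. nrm D ((x n \<otimes>\<^bsub>D\<^esub> b \<otimes>\<^bsub>D\<^esub> adj D (x n)) \<ominus>\<^bsub>D\<^esub> a)) \<longlonglongrightarrow> 0)"

section \<open>Maps between C*-algebras\<close>

definition linear_maps ::
    "('a, 's) star_alg_scheme \<Rightarrow> ('b, 't) star_alg_scheme \<Rightarrow> ('a \<Rightarrow> 'b) set" where
  "linear_maps D E = {f \<in> carrier D \<rightarrow> carrier E.
     (\<forall>x\<in>carrier D. \<forall>y\<in>carrier D. f (x \<oplus>\<^bsub>D\<^esub> y) = f x \<oplus>\<^bsub>E\<^esub> f y) \<and>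
     (\<forall>c. \<forall>x\<in>carrier D. f (c \<odot>\<^bsub>D\<^esub> x) = c \<odot>\<^bsub>E\<^esub> f x)}"

text \<open>A *-homomorphism need not preserve the unit.\<close>

definition star_homs ::
    "('a, 's) star_alg_scheme \<Rightarrow> ('b, 't) star_alg_scheme \<Rightarrow> ('a \<Rightarrow> 'b) set" where
  "star_homs D E = {f \<in> linear_maps D E.
     (\<forall>x\<in>carrier D. \<forall>y\<in>carrier D. f (x \<otimes>\<^bsub>D\<^esub> y) = f x \<otimes>\<^bsub>E\<^esub> f y) \<and>
     (\<forall>x\<in>carrier D. f (adj D x) = adj E (f x))}"

definition star_auts :: "('a, 's) star_alg_scheme \<Rightarrow> ('a \<Rightarrow> 'a) set" where
  "star_auts D = {f \<in> star_homs D D. bij_betw f (carrier D) (carrier D)}"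

text \<open>The *-algebra of n by n matrices over D. Positivity in it is purely algebraic
  (self-adjoint with spectrum in the nonnegative reals), so no norm is needed.\<close>

definition mat_alg :: "nat \<Rightarrow> ('a, 's) star_alg_scheme \<Rightarrow> (nat \<times> nat \<Rightarrow> 'a) star_alg" where
  "mat_alg n D = \<lparr>carrier = ({..<n} \<times> {..<n}) \<rightarrow>\<^sub>E carrier D,
     monoid.mult = (\<lambda>x y. \<lambda>(i, j)\<in>{..<n} \<times> {..<n}. \<Oplus>\<^bsub>D\<^esub>k\<in>{..<n}. x (i, k) \<otimes>\<^bsub>D\<^esub> y (k, j)),
     one = (\<lambda>(i, j)\<in>{..<n} \<times> {..<n}. if i = j then \<one>\<^bsub>D\<^esub> else \<zero>\<^bsub>D\<^esub>),
     zero = (\<lambda>p\<in>{..<n} \<times> {..<n}. \<zero>\<^bsub>D\<^esub>),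
     add = (\<lambda>x y. \<lambda>p\<in>{..<n} \<times> {..<n}. x p \<oplus>\<^bsub>D\<^esub> y p),
     smult = (\<lambda>c x. \<lambda>p\<in>{..<n} \<times> {..<n}. c \<odot>\<^bsub>D\<^esub> x p),
     adj = (\<lambda>x. \<lambda>(i, j)\<in>{..<n} \<times> {..<n}. adj D (x (j, i)))\<rparr>"

definition completely_positive ::
    "('a, 's) star_alg_scheme \<Rightarrow> ('b, 't) star_alg_scheme \<Rightarrow> ('a \<Rightarrow> 'b) \<Rightarrow> bool" where
  "completely_positive D E f \<longleftrightarrow> f \<in> linear_maps D E \<and>
     (\<forall>n x. positive (mat_alg n D) x \<longrightarrow>
        positive (mat_alg n E) (\<lambda>p\<in>{..<n} \<times> {..<n}. f (x p)))"

definition order_zero ::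
    "('a, 's) star_alg_scheme \<Rightarrow> ('b, 't) star_alg_scheme \<Rightarrow> ('a \<Rightarrow> 'b) \<Rightarrow> bool" where
  "order_zero D E f \<longleftrightarrow> completely_positive D E f \<and>
     (\<forall>a b. positive D a \<and> positive D b \<and> a \<otimes>\<^bsub>D\<^esub> b = \<zero>\<^bsub>D\<^esub> \<and> b \<otimes>\<^bsub>D\<^esub> a = \<zero>\<^bsub>D\<^esub> \<longrightarrow>
        f a \<otimes>\<^bsub>E\<^esub> f b = \<zero>\<^bsub>E\<^esub> \<and> f b \<otimes>\<^bsub>E\<^esub> f a = \<zero>\<^bsub>E\<^esub>)"

definition contractive ::
    "('a, 's) cstar_scheme \<Rightarrow> ('b, 't) cstar_scheme \<Rightarrow> ('a \<Rightarrow> 'b) \<Rightarrow> bool" where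
  "contractive D E f \<longleftrightarrow> (\<forall>x\<in>carrier D. nrm E (f x) \<le> nrm D x)"

section \<open>Compact groups and their actions\<close>

locale compact_group = group G
  for G :: "('g, 'm) monoid_scheme" (structure) and T :: "'g topology" +
  assumes topspace_eq: "topspace T = carrier G"
    and continuous_mult: "continuous_map (prod_topology T T) T (\<lambda>(g, h). g \<otimes> h)"
    and continuous_inv: "continuous_map T T (\<lambda>g. inv g)"
    and compact: "compact_space T"
    and Hausdorff: "Hausdorff_space T"

definition cstar_action ::
    "('g, 'm) monoid_scheme \<Rightarrow> 'g topology \<Rightarrow> ('a, 's) cstar_scheme \<Rightarrow> ('g \<Rightarrow> 'a \<Rightarrow> 'a) \<Rightarrow> bool" where
  "cstar_action G T D \<alpha> \<longleftrightarrow>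
     (\<forall>g\<in>carrier G. \<alpha> g \<in> star_auts D) \<and>
     (\<forall>g\<in>carrier G. \<forall>h\<in>carrier G. \<forall>a\<in>carrier D. \<alpha> (g \<otimes>\<^bsub>G\<^esub> h) a = \<alpha> g (\<alpha> h a)) \<and>
     (\<forall>a\<in>carrier D. continuous_map T (norm_topology D) (\<lambda>g. \<alpha> g a))"

definition equivariant ::
    "('g, 'm) monoid_scheme \<Rightarrow> ('a, 's) star_alg_scheme \<Rightarrow> ('g \<Rightarrow> 'a \<Rightarrow> 'a) \<Rightarrow> ('g \<Rightarrow> 'b \<Rightarrow> 'b)
      \<Rightarrow> ('a \<Rightarrow> 'b) \<Rightarrow> bool" where
  "equivariant G D \<alpha> \<beta> f \<longleftrightarrow> (\<forall>g\<in>carrier G. \<forall>a\<in>carrier D. f (\<alpha> g a) = \<beta> g (f a))"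

section \<open>Function algebras and tensor products with C(G)\<close>

text \<open>Bounded functions from X to D with pointwise operations and supremum norm; functions are
  normalised to be undefined outside X. (Junk if X is empty.)\<close>

definition linf :: "'x set \<Rightarrow> ('a, 's) cstar_scheme \<Rightarrow> ('x \<Rightarrow> 'a) cstar" where
  "linf X D = \<lparr>carrier = {f \<in> X \<rightarrow>\<^sub>E carrier D. bdd_above ((\<lambda>x. nrm D (f x)) ` X)},
     monoid.mult = (\<lambda>f h. \<lambda>x\<in>X. f x \<otimes>\<^bsub>D\<^esub> h x),
     one = (\<lambda>x\<in>X. \<one>\<^bsub>D\<^esub>),
     zero = (\<lambda>x\<in>X. \<zero>\<^bsub>D\<^esub>),
     add = (\<lambda>f h. \<lambda>x\<in>X. f x \<oplus>\<^bsub>D\<^esub> h x),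
     smult = (\<lambda>c f. \<lambda>x\<in>X. c \<odot>\<^bsub>D\<^esub> f x),
     adj = (\<lambda>f. \<lambda>x\<in>X. adj D (f x)),
     nrm = (\<lambda>f. SUP x\<in>X. nrm D (f x))\<rparr>"

definition cont_alg :: "'g topology \<Rightarrow> ('g \<Rightarrow> complex) cstar" where
  "cont_alg T = (linf (topspace T) complex_cstar)
     \<lparr>carrier := {f \<in> extensional (topspace T). continuous_map T euclidean f}\<rparr>"

definition shift :: "('g, 'm) monoid_scheme \<Rightarrow> 'g \<Rightarrow> ('g \<Rightarrow> complex) \<Rightarrow> ('g \<Rightarrow> complex)" where
  "shift G g f = (\<lambda>h\<in>carrier G. f (inv\<^bsub>G\<^esub> g \<otimes>\<^bsub>G\<^esub> h))"

text \<open>The algebraic tensor product of C(T) and D embeds in the bounded D-valued functions on T,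
  the elementary tensor of f and a becoming the function sending h to f(h)a. The C*-algebra
  C(T) is nuclear, so the restricted supremum norm is the only C*-norm on the algebraic tensor
  product, and its completion is the closure taken below.\<close>

definition elem_tensor ::
    "'g topology \<Rightarrow> ('a, 's) cstar_scheme \<Rightarrow> ('g \<Rightarrow> complex) \<Rightarrow> 'a \<Rightarrow> ('g \<Rightarrow> 'a)" where
  "elem_tensor T D f a = (\<lambda>h\<in>topspace T. f h \<odot>\<^bsub>D\<^esub> a)"

definition alg_tensor :: "'g topology \<Rightarrow> ('a, 's) cstar_scheme \<Rightarrow> ('g \<Rightarrow> 'a) set" where
  "alg_tensor T D = {\<Oplus>\<^bsub>linf (topspace T) D\<^esub>i\<in>{..<n}. elem_tensor T D (f i) (a i) | (n :: nat) f a.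
     (\<forall>i<n. f i \<in> carrier (cont_alg T)) \<and> (\<forall>i<n. a i \<in> carrier D)}"

definition cont_tensor :: "'g topology \<Rightarrow> ('a, 's) cstar_scheme \<Rightarrow> ('g \<Rightarrow> 'a) cstar" where
  "cont_tensor T D = (linf (topspace T) D)
     \<lparr>carrier := norm_topology (linf (topspace T) D) closure_of alg_tensor T D\<rparr>"

text \<open>The tensor product of the shift with an action: it sends the elementary tensor of f and a
  to that of \<open>shift G g f\<close> and \<open>\<alpha> g a\<close>.\<close>

definition shift_tensor ::
    "('g, 'm) monoid_scheme \<Rightarrow> ('g \<Rightarrow> 'a \<Rightarrow> 'a) \<Rightarrow> 'g \<Rightarrow> ('g \<Rightarrow> 'a) \<Rightarrow> ('g \<Rightarrow> 'a)" where
  "shift_tensor G \<alpha> g F = (\<lambda>h\<in>carrier G. \<alpha> g (F (inv\<^bsub>G\<^esub> g \<otimes>\<^bsub>G\<^esub> h)))"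

lemma shift_tensor_elem_tensor:
  assumes "compact_group G T" "cstar_action G T D \<alpha>"
    and "g \<in> carrier G" "f \<in> carrier (cont_alg T)" "a \<in> carrier D"
  shows "shift_tensor G \<alpha> g (elem_tensor T D f a) = elem_tensor T D (shift G g f) (\<alpha> g a)"
proof -
  interpret compact_group G T by fact
  have "\<alpha> g (c \<odot>\<^bsub>D\<^esub> a) = c \<odot>\<^bsub>D\<^esub> \<alpha> g a" for c
    using assms(2,3,5) by (auto simp: cstar_action_def star_auts_def star_homs_def linear_maps_def)
  then show ?thesis
    using assms(3) by (auto simp: shift_tensor_def elem_tensor_def shift_def topspace_eq fun_eq_iff)
qed

section \<open>Ultrapowers\<close>

definition free_ultrafilter :: "nat filter \<Rightarrow> bool" where
  "free_ultrafilter \<omega> \<longleftrightarrow> \<omega> \<noteq> bot \<and>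
     (\<forall>P. eventually P \<omega> \<or> eventually (\<lambda>n. \<not> P n) \<omega>) \<and>
     (\<forall>k. eventually (\<lambda>n. n \<noteq> k) \<omega>)"

text \<open>The quotient by a closed two-sided ideal, with cosets as elements and the quotient norm.\<close>

definition quot_cstar :: "('a, 's) cstar_scheme \<Rightarrow> 'a set \<Rightarrow> 'a set cstar" where
  "quot_cstar D I = \<lparr>carrier = carrier (D Quot I),
     monoid.mult = monoid.mult (D Quot I),
     one = one (D Quot I),
     zero = zero (D Quot I),
     add = add (D Quot I),
     smult = (\<lambda>c X. \<Union>x\<in>X. I +>\<^bsub>D\<^esub> (c \<odot>\<^bsub>D\<^esub> x)),
     adj = (\<lambda>X. adj D ` X),
     nrm = (\<lambda>X. INF x\<in>X. nrm D x)\<rparr>"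

definition null_seqs :: "nat filter \<Rightarrow> ('a, 's) cstar_scheme \<Rightarrow> (nat \<Rightarrow> 'a) set" where
  "null_seqs \<omega> D = {s \<in> carrier (linf UNIV D). ((\<lambda>n. nrm D (s n)) \<longlongrightarrow> 0) \<omega>}"

definition ultrapower :: "nat filter \<Rightarrow> ('a, 's) cstar_scheme \<Rightarrow> (nat \<Rightarrow> 'a) set cstar" where
  "ultrapower \<omega> D = quot_cstar (linf UNIV D) (null_seqs \<omega> D)"

definition const_seq :: "nat filter \<Rightarrow> ('a, 's) cstar_scheme \<Rightarrow> 'a \<Rightarrow> (nat \<Rightarrow> 'a) set" where
  "const_seq \<omega> D a = null_seqs \<omega> D +>\<^bsub>linf UNIV D\<^esub> (\<lambda>n. a)"

definition rel_commutant :: "nat filter \<Rightarrow> ('a, 's) cstar_scheme \<Rightarrow> (nat \<Rightarrow> 'a) set cstar" where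
  "rel_commutant \<omega> D = (ultrapower \<omega> D)\<lparr>carrier := {x \<in> carrier (ultrapower \<omega> D).
     \<forall>a\<in>carrier D. x \<otimes>\<^bsub>ultrapower \<omega> D\<^esub> const_seq \<omega> D a = const_seq \<omega> D a \<otimes>\<^bsub>ultrapower \<omega> D\<^esub> x}\<rparr>"

text \<open>Each \<open>\<alpha> g\<close> is an automorphism, so it maps a coset of null sequences onto a coset.\<close>

definition ultra_action ::
    "('g \<Rightarrow> 'a \<Rightarrow> 'a) \<Rightarrow> 'g \<Rightarrow> (nat \<Rightarrow> 'a) set \<Rightarrow> (nat \<Rightarrow> 'a) set" where
  "ultra_action \<alpha> g X = (\<lambda>s n. \<alpha> g (s n)) ` X"

section \<open>The two properties\<close>

definition weak_tracial_Rokhlin ::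
    "nat filter \<Rightarrow> ('g, 'm) monoid_scheme \<Rightarrow> 'g topology \<Rightarrow> ('a, 's) cstar_scheme
      \<Rightarrow> ('g \<Rightarrow> 'a \<Rightarrow> 'a) \<Rightarrow> bool" where
  "weak_tracial_Rokhlin \<omega> G T A \<alpha> \<longleftrightarrow>
     (\<forall>x. positive (ultrapower \<omega> A) x \<and> x \<noteq> \<zero>\<^bsub>ultrapower \<omega> A\<^esub> \<longrightarrow>
        (\<exists>\<phi>. order_zero (cont_alg T) (rel_commutant \<omega> A) \<phi> \<and>
             contractive (cont_alg T) (rel_commutant \<omega> A) \<phi> \<and>
             equivariant G (cont_alg T) (shift G) (ultra_action \<alpha>) \<phi> \<and>
             cuntz_le (ultrapower \<omega> A)
               (\<one>\<^bsub>ultrapower \<omega> A\<^esub> \<ominus>\<^bsub>ultrapower \<omega> A\<^esub> \<phi> \<one>\<^bsub>cont_alg T\<^esub>) x))"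

definition tracially_seq_split ::
    "nat filter \<Rightarrow> ('g, 'm) monoid_scheme \<Rightarrow> ('a, 's) cstar_scheme \<Rightarrow> ('g \<Rightarrow> 'a \<Rightarrow> 'a)
      \<Rightarrow> ('b, 't) cstar_scheme \<Rightarrow> ('g \<Rightarrow> 'b \<Rightarrow> 'b) \<Rightarrow> ('a \<Rightarrow> 'b) \<Rightarrow> bool" where
  "tracially_seq_split \<omega> G A \<alpha> B \<beta> \<phi> \<longleftrightarrow>
     \<phi> \<in> star_homs A B \<and> equivariant G A \<alpha> \<beta> \<phi> \<and>
     (\<forall>x. positive (ultrapower \<omega> A) x \<and> x \<noteq> \<zero>\<^bsub>ultrapower \<omega> A\<^esub> \<longrightarrow>
        (\<exists>\<psi> g. order_zero B (ultrapower \<omega> A) \<psi> \<and>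
             equivariant G B \<beta> (ultra_action \<alpha>) \<psi> \<and>
             positive (rel_commutant \<omega> A) g \<and>
             (\<forall>a\<in>carrier A. \<psi> (\<phi> a) = g \<otimes>\<^bsub>ultrapower \<omega> A\<^esub> const_seq \<omega> A a \<and>
                             \<psi> (\<phi> a) = const_seq \<omega> A a \<otimes>\<^bsub>ultrapower \<omega> A\<^esub> g) \<and>
             cuntz_le (ultrapower \<omega> A) (\<one>\<^bsub>ultrapower \<omega> A\<^esub> \<ominus>\<^bsub>ultrapower \<omega> A\<^esub> g) x))"

end

theory Submission
  imports Defs
begin

lemma carrier_complex_cstar [simp]: "carrier complex_cstar = UNIV"
  by (simp add: complex_cstar_def)

text \<open>A C*-algebra here is a structure on a carrier set, and positivity in matrix algebras is defined by
the spectrum alone. The first half of this theory develops, from the axioms, just enough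
C*-theory to handle such positivity; the second half proves the equivalence.

\<^bold>\<open>Positivity.\<close> For a self-adjoint \<open>a\<close>, being the square of a self-adjoint element
is equivalent to \<open>\<parallel>M - a\<parallel> \<le> M\<close> for \<open>M \<ge> \<parallel>a\<parallel>\<close>; this rests on the elementary inequality
\<open>\<parallel>x\<^sup>2\<parallel> \<le> \<parallel>x\<^sup>2 + y\<^sup>2\<parallel>\<close> (\<open>nm_sum_squares\<close>) and on an iteration for the square root of \<open>1 - y\<close>
(\<open>sqrt_one_minus\<close>). Hence the squares form a closed convex cone, and an infimum argument
(\<open>psd_of_units\<close>) identifies this cone with the elements of nonnegative spectrum, without any
spectral radius formula. The matrices over a C*-algebra act on columns, and the operator norm
makes them a C*-algebra (\<open>mat_cstar_alg\<close>), so the same results apply to them. Bounded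
sequences modulo null sequences are a C*-algebra as well (\<open>U_cstar_alg\<close>), and the tensor
product with \<open>C(G)\<close> consists of the continuous functions on \<open>G\<close> (\<open>cont_tensor_eq\<close>).

\<^bold>\<open>From the Rokhlin property to splitting.\<close> Given an order zero map \<open>\<phi>\<close> on \<open>C(G)\<close> with values in the
relative commutant, \<open>\<psi>(f \<otimes> a) = \<phi>(f)a\<close> should define the splitting, with \<open>g = \<phi>(1)\<close>. A finite sum
of elementary tensors is uniformly close to \<open>\<Sum> u\<^sub>k \<otimes> F(t\<^sub>k)\<close> for a fine partition of unity
\<open>u\<^sub>k\<close>, and \<open>\<parallel>\<Sum> \<phi>(u\<^sub>k) b\<^sub>k\<parallel> \<le> max \<parallel>b\<^sub>k\<parallel>\<close> because the \<open>\<phi>(u\<^sub>k)\<close> are positive, commute with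
the algebra and add up to a contraction (\<open>convex_bound\<close>). So \<open>\<psi>\<close> is well defined and bounded,
and it is completely positive because the Riemann sums are. Order zero follows from
\<open>\<psi>(F)\<psi>(H) = \<phi>(1)\<psi>(FH)\<close>, which reduces to \<open>\<phi>(k)\<phi>(h) = \<phi>(1)\<phi>(kh)\<close> on \<open>C(G)\<close>. The latter
(\<open>P_mult\<close>) is proved by slicing the range of \<open>k\<close> into \<open>N\<close> tents: the two sides differ by a
quantity that is bounded after multiplication by \<open>N\<close>.

\<^bold>\<open>From splitting to the Rokhlin property.\<close> Put \<open>\<phi>(f) = \<psi>(f \<otimes> 1)\<close>. The point is that the values
commute with the algebra. Complete positivity turns the Gram matrix of \<open>1\<close>, \<open>1 \<otimes> a\<close> and \<open>F\<close> into a
Gram matrix of three columns; since \<open>\<psi>(1 \<otimes> a) = ga = ag\<close>, the second column is the first one times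
\<open>a\<close>, which yields \<open>\<psi>((1 \<otimes> a)\<^sup>* F) = a\<^sup>* \<psi>(F)\<close> and its mirror image (\<open>bimodule\<close>). The same device
with \<open>1\<close> and \<open>f \<otimes> 1\<close> gives contractivity. A matrix over the relative commutant that is positive
in the ultrapower has its square root over the relative commutant, so complete positivity
descends to the relative commutant.\<close>

section \<open>Arithmetic and norm convergence in a C*-algebra\<close>

text \<open>The scalars form a second ring inside the locale of C*-algebras. Wrapping the axioms keeps the ring
laws of the algebra as the only ones in scope and turns scalars into plain complex numbers.\<close>

locale cstar_alg =
  fixes D :: "('a, 's) cstar_scheme" (structure)
  assumes ucs: "unital_cstar_algebra D"
begin

lemma is_ring: "ring D"
  using ucs unfolding unital_cstar_algebra_def by blast

sublocale ring D by (rule is_ring)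

lemma is_module: "module complex_cstar D"
  using ucs unfolding unital_cstar_algebra_def by blast

abbreviation cr where "cr \<equiv> carrier D"
abbreviation st where "st \<equiv> adj D"
abbreviation nm where "nm \<equiv> nrm D"

lemma sc_closed [simp, intro]: "x \<in> cr \<Longrightarrow> c \<odot> x \<in> cr"
  using module.smult_closed[OF is_module] by simp
lemma sc_addl: "x \<in> cr \<Longrightarrow> (c + d) \<odot> x = c \<odot> x \<oplus> d \<odot> x"
  using module.smult_l_distr[OF is_module, of c d x] by (simp add: complex_cstar_def)
lemma sc_addr: "x \<in> cr \<Longrightarrow> y \<in> cr \<Longrightarrow> c \<odot> (x \<oplus> y) = c \<odot> x \<oplus> c \<odot> y"
  using module.smult_r_distr[OF is_module, of c x y] by (simp add: complex_cstar_def)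
lemma sc_sc: "x \<in> cr \<Longrightarrow> c \<odot> (d \<odot> x) = (c * d) \<odot> x"
  using module.smult_assoc1[OF is_module, of c d x] by (simp add: complex_cstar_def)
lemma sc_one [simp]: "x \<in> cr \<Longrightarrow> 1 \<odot> x = x"
  using module.smult_one[OF is_module, of x] by (simp add: complex_cstar_def)
lemma sc_zero [simp]: "x \<in> cr \<Longrightarrow> 0 \<odot> x = \<zero>"
  using module.smult_l_null[OF is_module, of x] by (simp add: complex_cstar_def)
lemma sc_rzero [simp]: "c \<odot> \<zero> = \<zero>"
  using module.smult_r_null[OF is_module, of c] by (simp add: complex_cstar_def)
lemma sc_rneg: "x \<in> cr \<Longrightarrow> c \<odot> (\<ominus> x) = \<ominus> (c \<odot> x)"
  using module.smult_r_minus[OF is_module, of c x] by (simp add: complex_cstar_def)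
lemma sc_neg: "x \<in> cr \<Longrightarrow> \<ominus> x = (- 1) \<odot> x"
proof -
  assume x: "x \<in> cr"
  have "(-1) \<odot> x \<oplus> x = ((-1) + 1) \<odot> x"
    using sc_addl[OF x, of "-1" 1] x by simp
  then have "(-1) \<odot> x \<oplus> x = \<zero>" using x by simp
  then show ?thesis using x by (metis sc_closed minus_equality)
qed
lemma sc_lneg: "x \<in> cr \<Longrightarrow> (- c) \<odot> x = \<ominus> (c \<odot> x)"
  by (simp add: sc_neg sc_sc)

lemma sc_ml: "x \<in> cr \<Longrightarrow> y \<in> cr \<Longrightarrow> (c \<odot> x) \<otimes> y = c \<odot> (x \<otimes> y)"
  using unital_cstar_algebra.smult_mult_left[OF ucs] .
lemma sc_mr: "x \<in> cr \<Longrightarrow> y \<in> cr \<Longrightarrow> x \<otimes> (c \<odot> y) = c \<odot> (x \<otimes> y)"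
  using unital_cstar_algebra.smult_mult_right[OF ucs] .
lemma st_closed [simp, intro]: "x \<in> cr \<Longrightarrow> st x \<in> cr"
  using unital_cstar_algebra.adj_closed[OF ucs] .
lemma st_st [simp]: "x \<in> cr \<Longrightarrow> st (st x) = x"
  using unital_cstar_algebra.adj_adj[OF ucs] .
lemma st_add: "x \<in> cr \<Longrightarrow> y \<in> cr \<Longrightarrow> st (x \<oplus> y) = st x \<oplus> st y"
  using unital_cstar_algebra.adj_add[OF ucs] .
lemma st_sc: "x \<in> cr \<Longrightarrow> st (c \<odot> x) = cnj c \<odot> st x"
  using unital_cstar_algebra.adj_smult[OF ucs] .
lemma st_mult: "x \<in> cr \<Longrightarrow> y \<in> cr \<Longrightarrow> st (x \<otimes> y) = st y \<otimes> st x"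
  using unital_cstar_algebra.adj_mult[OF ucs] .
lemma st_neg: "x \<in> cr \<Longrightarrow> st (\<ominus> x) = \<ominus> st x"
  by (simp add: sc_neg st_sc)
lemma st_zero [simp]: "st \<zero> = \<zero>"
  using st_sc[of \<zero> 0] by simp
lemma st_one [simp]: "st \<one> = \<one>"
proof -
  have "st \<one> = st \<one> \<otimes> st (st \<one>)" by simp
  also have "\<dots> = st (st \<one> \<otimes> \<one>)" by (rule st_mult[symmetric]) auto
  also have "\<dots> = \<one>" by simp
  finally show ?thesis .
qed
lemma st_minus: "x \<in> cr \<Longrightarrow> y \<in> cr \<Longrightarrow> st (x \<ominus> y) = st x \<ominus> st y"
  by (simp add: a_minus_def st_add st_neg)

lemma nm_ge0 [simp, intro]: "x \<in> cr \<Longrightarrow> 0 \<le> nm x"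
  using unital_cstar_algebra.nrm_nonneg[OF ucs] .
lemma nm_eq0: "x \<in> cr \<Longrightarrow> nm x = 0 \<longleftrightarrow> x = \<zero>"
  using unital_cstar_algebra.nrm_eq_0_iff[OF ucs] .
lemma nm_zero [simp]: "nm \<zero> = 0" by (simp add: nm_eq0)
lemma nm_tri: "x \<in> cr \<Longrightarrow> y \<in> cr \<Longrightarrow> nm (x \<oplus> y) \<le> nm x + nm y"
  using unital_cstar_algebra.nrm_triangle[OF ucs] .
lemma nm_sc: "x \<in> cr \<Longrightarrow> nm (c \<odot> x) = cmod c * nm x"
  using unital_cstar_algebra.nrm_smult[OF ucs] .
lemma nm_mult: "x \<in> cr \<Longrightarrow> y \<in> cr \<Longrightarrow> nm (x \<otimes> y) \<le> nm x * nm y"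
  using unital_cstar_algebra.nrm_mult[OF ucs] .
lemma nm_cs: "x \<in> cr \<Longrightarrow> nm (st x \<otimes> x) = (nm x)\<^sup>2"
  using unital_cstar_algebra.cstar_identity[OF ucs] .
lemma nm_neg [simp]: "x \<in> cr \<Longrightarrow> nm (\<ominus> x) = nm x"
  by (simp add: sc_neg nm_sc)
lemma nm_tri': "x \<in> cr \<Longrightarrow> y \<in> cr \<Longrightarrow> nm (x \<ominus> y) \<le> nm x + nm y"
  using nm_tri[of x "\<ominus> y"] by (simp add: a_minus_def)
lemma neg_minus: "x \<in> cr \<Longrightarrow> y \<in> cr \<Longrightarrow> \<ominus> (x \<ominus> y) = y \<ominus> x"
  by (simp add: a_minus_def minus_add a_comm)
lemma nm_minus_commute: "x \<in> cr \<Longrightarrow> y \<in> cr \<Longrightarrow> nm (x \<ominus> y) = nm (y \<ominus> x)"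
  by (metis nm_neg neg_minus minus_closed)
lemma minus_add_cancel: "x \<in> cr \<Longrightarrow> y \<in> cr \<Longrightarrow> (x \<ominus> y) \<oplus> y = x"
  by (simp add: a_minus_def a_assoc l_neg)
lemma nm_tri3: "x \<in> cr \<Longrightarrow> y \<in> cr \<Longrightarrow> z \<in> cr \<Longrightarrow> nm (x \<ominus> z) \<le> nm (x \<ominus> y) + nm (y \<ominus> z)"
proof -
  assume a: "x \<in> cr" "y \<in> cr" "z \<in> cr"
  have "x \<ominus> z = (x \<ominus> y) \<oplus> (y \<ominus> z)"
    using a by (metis a_minus_def a_assoc a_inv_closed minus_add_cancel minus_closed)
  then show ?thesis using a by (simp add: nm_tri)
qed
lemma nm_le_diff: "x \<in> cr \<Longrightarrow> y \<in> cr \<Longrightarrow> nm x \<le> nm y + nm (x \<ominus> y)"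
  using nm_tri[of "x \<ominus> y" y] by (simp add: minus_add_cancel)
lemma nm_diff_abs: "x \<in> cr \<Longrightarrow> y \<in> cr \<Longrightarrow> \<bar>nm x - nm y\<bar> \<le> nm (x \<ominus> y)"
  using nm_le_diff[of x y] nm_le_diff[of y x] nm_minus_commute[of x y] by auto
lemma minus_eq0: "x \<in> cr \<Longrightarrow> y \<in> cr \<Longrightarrow> x \<ominus> y = \<zero> \<Longrightarrow> x = y"
  using minus_add_cancel[of x y] by simp
lemma nm_st [simp]: "x \<in> cr \<Longrightarrow> nm (st x) = nm x"
proof -
  have *: "nm x \<le> nm (st x)" if x: "x \<in> cr" for x
  proof (cases "nm x = 0")
    case False
    have "(nm x)\<^sup>2 \<le> nm (st x) * nm x" using nm_cs[OF x] nm_mult[of "st x" x] x by simp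
    then show ?thesis using False nm_ge0[OF x] by (simp add: power2_eq_square)
  qed (use x in auto)
  show "x \<in> cr \<Longrightarrow> ?thesis" using *[of x] *[of "st x"] by simp
qed
lemma nm_one_le: "nm \<one> \<le> 1"
proof -
  have "(nm \<one>)\<^sup>2 = nm \<one>" using nm_cs[of \<one>] by simp
  then have "nm \<one> * (nm \<one> - 1) = 0" by (simp add: algebra_simps power2_eq_square)
  then show ?thesis by (auto simp: )
qed
lemma nm_one_sc: "nm (c \<odot> \<one>) \<le> cmod c"
  using nm_one_le by (simp add: nm_sc mult_left_le)

definition tends :: "(nat \<Rightarrow> 'a) \<Rightarrow> 'a \<Rightarrow> bool" where
  "tends x l \<longleftrightarrow> (\<forall>n. x n \<in> cr) \<and> l \<in> cr \<and> (\<lambda>n. nm (x n \<ominus> l)) \<longlonglongrightarrow> 0"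

lemma metric: "Metric_space cr (cdist D)"
proof
  show "0 \<le> cdist D x y" for x y by (simp add: cdist_def)
  show "cdist D x y = cdist D y x" for x y by (simp add: cdist_def nm_minus_commute)
  show "cdist D x y = 0 \<longleftrightarrow> x = y" if "x \<in> cr" "y \<in> cr" for x y
    using that by (auto simp: cdist_def nm_eq0 minus_eq0 a_minus_def r_neg)
  show "cdist D x z \<le> cdist D x y + cdist D y z" if "x \<in> cr" "y \<in> cr" "z \<in> cr" for x y z
    using that by (simp add: cdist_def nm_tri3)
qed

sublocale MS: Metric_space cr "cdist D" by (rule metric)

lemma cauchy_tends:
  assumes x: "\<And>n. x n \<in> cr"
    and c: "\<And>e. e > 0 \<Longrightarrow> \<exists>N. \<forall>m\<ge>N. \<forall>n\<ge>N. nm (x m \<ominus> x n) < e"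
  shows "\<exists>l. tends x l"
proof -
  have "MS.MCauchy x"
    unfolding MS.MCauchy_def using x c by (auto simp: cdist_def)
  then obtain l where l: "limitin MS.mtopology x l sequentially"
    using unital_cstar_algebra.complete[OF ucs] unfolding MS.mcomplete_def by blast
  have "l \<in> cr" and *: "\<And>e. e > 0 \<Longrightarrow> \<forall>\<^sub>F n in sequentially. cdist D (x n) l < e"
    using l unfolding MS.limitin_metric by (auto elim: eventually_mono)
  have "(\<lambda>n. nm (x n \<ominus> l)) \<longlonglongrightarrow> 0"
  proof (rule tendstoI)
    fix e :: real assume "e > 0"
    from *[OF this] show "\<forall>\<^sub>F n in sequentially. dist (nm (x n \<ominus> l)) 0 < e"
      using x \<open>l \<in> cr\<close> by (simp add: cdist_def)
  qed
  then show ?thesis using x \<open>l \<in> cr\<close> unfolding tends_def by blast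
qed

text \<open>The Neumann series and the square root are obtained as limits of recursions whose increments are
bounded by those of the same recursion over the reals, so a real majorant is the convenient
criterion.\<close>

lemma dominated_tends:
  assumes x: "\<And>n. x n \<in> cr" and d: "\<And>n. nm (x (Suc n) \<ominus> x n) \<le> r (Suc n) - r n"
    and b: "\<And>n. r n \<le> (B::real)"
  shows "\<exists>l. tends x l"
proof (rule cauchy_tends[OF x])
  have inc: "incseq r"
  proof (rule incseq_SucI)
    show "r n \<le> r (Suc n)" for n using d[of n] nm_ge0[OF minus_closed[OF x x]] by (meson diff_ge_0_iff_ge order_trans)
  qed
  obtain L where "r \<longlonglongrightarrow> L" using incseq_convergent[OF inc] b by blast
  then have C: "Cauchy r" by (simp add: LIMSEQ_imp_Cauchy)
  have le: "nm (x (n + k) \<ominus> x n) \<le> r (n + k) - r n" for n k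
  proof (induction k)
    case 0 then show ?case using x by (simp add: a_minus_def r_neg)
  next
    case (Suc k)
    have "nm (x (n + Suc k) \<ominus> x n) \<le> nm (x (Suc (n + k)) \<ominus> x (n+k)) + nm (x (n+k) \<ominus> x n)"
      using nm_tri3 x by simp
    then show ?case using Suc d[of "n+k"] by simp
  qed
  fix e :: real assume "e > 0"
  then obtain N where N: "\<And>m n. m \<ge> N \<Longrightarrow> n \<ge> N \<Longrightarrow> dist (r m) (r n) < e"
    using C unfolding Cauchy_def by blast
  have "nm (x m \<ominus> x n) < e" if "m \<ge> N" "n \<ge> N" for m n
  proof (cases "n \<le> m")
    case True
    then have "nm (x m \<ominus> x n) \<le> r m - r n" using le[of n "m - n"] by simp
    then show ?thesis using N[OF that] by (simp add: dist_real_def)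
  next
    case False
    then have "nm (x n \<ominus> x m) \<le> r n - r m" using le[of m "n - m"] by simp
    then show ?thesis using N[OF that] nm_minus_commute[of "x m" "x n"] x by (simp add: dist_real_def)
  qed
  then show "\<exists>N. \<forall>m\<ge>N. \<forall>n\<ge>N. nm (x m \<ominus> x n) < e" by blast
qed

lemma tendsD: "tends x l \<Longrightarrow> x n \<in> cr" "tends x l \<Longrightarrow> l \<in> cr" "tends x l \<Longrightarrow> (\<lambda>n. nm (x n \<ominus> l)) \<longlonglongrightarrow> 0"
  unfolding tends_def by auto

lemma tendsI: "(\<And>n. x n \<in> cr) \<Longrightarrow> l \<in> cr \<Longrightarrow> (\<And>n. nm (x n \<ominus> l) \<le> r n) \<Longrightarrow> r \<longlonglongrightarrow> 0 \<Longrightarrow> tends x l"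
  unfolding tends_def
  by (auto intro!: tendsto_sandwich[where f="\<lambda>_. 0" and h = r and g="\<lambda>n. nm (x n \<ominus> l)"])

lemma tends_unique: "tends x l \<Longrightarrow> tends x k \<Longrightarrow> l = k"
proof -
  assume a: "tends x l" "tends x k"
  have "(\<lambda>n. nm (x n \<ominus> l) + nm (x n \<ominus> k)) \<longlonglongrightarrow> 0 + 0"
    using a by (intro tendsto_add tendsD)
  moreover have "nm (l \<ominus> k) \<le> nm (x n \<ominus> l) + nm (x n \<ominus> k)" for n
    using nm_tri3[of l "x n" k] nm_minus_commute[of l "x n"] a by (simp add: tendsD)
  ultimately have "nm (l \<ominus> k) \<le> 0 + 0"
    by (intro LIMSEQ_le_const[where X="\<lambda>n. nm (x n \<ominus> l) + nm (x n \<ominus> k)"]) auto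
  moreover have "nm (l \<ominus> k) \<ge> 0" using a by (simp add: tendsD)
  ultimately have "nm (l \<ominus> k) = 0" by linarith
  then show ?thesis using nm_eq0 a by (metis minus_eq0 tendsD(2) minus_closed)
qed

lemma tends_const: "l \<in> cr \<Longrightarrow> tends (\<lambda>n. l) l"
  unfolding tends_def by (simp add: a_minus_def r_neg)

lemma add_minus_swap: "x \<in> cr \<Longrightarrow> y \<in> cr \<Longrightarrow> z \<in> cr \<Longrightarrow> w \<in> cr \<Longrightarrow>
  (x \<oplus> y) \<ominus> (z \<oplus> w) = (x \<ominus> z) \<oplus> (y \<ominus> w)"
  by (simp add: a_minus_def minus_add a_ac)

lemma mult_minus_split: "x \<in> cr \<Longrightarrow> y \<in> cr \<Longrightarrow> z \<in> cr \<Longrightarrow> w \<in> cr \<Longrightarrow>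
  (x \<otimes> y) \<ominus> (z \<otimes> w) = (x \<ominus> z) \<otimes> y \<oplus> z \<otimes> (y \<ominus> w)"
proof -
  assume a: "x \<in> cr" "y \<in> cr" "z \<in> cr" "w \<in> cr"
  have "(x \<ominus> z) \<otimes> y \<oplus> z \<otimes> (y \<ominus> w) = x \<otimes> y \<oplus> ((\<ominus> (z \<otimes> y)) \<oplus> z \<otimes> y) \<oplus> \<ominus> (z \<otimes> w)"
    using a by (simp add: a_minus_def l_distr r_distr l_minus r_minus a_assoc)
  then show ?thesis using a by (simp add: l_neg a_minus_def)
qed

lemma tends_add: "tends x l \<Longrightarrow> tends y k \<Longrightarrow> tends (\<lambda>n. x n \<oplus> y n) (l \<oplus> k)"
  by (rule tendsI[where r="\<lambda>n. nm (x n \<ominus> l) + nm (y n \<ominus> k)"])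
     (auto simp: tendsD add_minus_swap nm_tri intro!: tendsto_add_zero tendsD)

lemma tends_bounded: "tends x l \<Longrightarrow> \<exists>B. \<forall>n. nm (x n) \<le> B"
proof -
  assume a: "tends x l"
  obtain K where K: "\<And>n. norm (nm (x n \<ominus> l)) \<le> K"
    using convergent_imp_Bseq[OF convergentI[OF tendsD(3)[OF a]]] unfolding Bseq_def by blast
  have "nm (x n) \<le> nm l + K" for n
    using nm_le_diff[of "x n" l] K[of n] a by (auto simp: tendsD)
  then show ?thesis by blast
qed

lemma tends_mult: assumes a: "tends x l" "tends y k" shows "tends (\<lambda>n. x n \<otimes> y n) (l \<otimes> k)"
proof -
  obtain B where B: "\<And>n. nm (y n) \<le> B" using tends_bounded[OF a(2)] by blast
  show ?thesis
  proof (rule tendsI[where r="\<lambda>n. nm (x n \<ominus> l) * B + nm l * nm (y n \<ominus> k)"])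
    fix n
    have m: "x n \<in> cr" "y n \<in> cr" "l \<in> cr" "k \<in> cr" using a by (auto simp: tendsD)
    have "nm (x n \<otimes> y n \<ominus> l \<otimes> k) \<le> nm ((x n \<ominus> l) \<otimes> y n) + nm (l \<otimes> (y n \<ominus> k))"
      using m by (simp add: mult_minus_split nm_tri)
    also have "\<dots> \<le> nm (x n \<ominus> l) * nm (y n) + nm l * nm (y n \<ominus> k)"
      using m by (intro add_mono nm_mult) auto
    also have "\<dots> \<le> nm (x n \<ominus> l) * B + nm l * nm (y n \<ominus> k)"
      using B m by (intro add_mono mult_left_mono) auto
    finally show "nm (x n \<otimes> y n \<ominus> l \<otimes> k) \<le> \<dots>" .
  next
    have "(\<lambda>n. nm (x n \<ominus> l) * B + nm l * nm (y n \<ominus> k)) \<longlonglongrightarrow> 0 * B + nm l * 0"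
      using a by (intro tendsto_intros tendsD)
    then show "(\<lambda>n. nm (x n \<ominus> l) * B + nm l * nm (y n \<ominus> k)) \<longlonglongrightarrow> 0" by simp
  qed (use a in \<open>auto simp: tendsD\<close>)
qed

lemma sc_minus: "x \<in> cr \<Longrightarrow> y \<in> cr \<Longrightarrow> c \<odot> (x \<ominus> y) = c \<odot> x \<ominus> c \<odot> y"
  by (simp add: a_minus_def sc_addr sc_rneg)

lemma tends_sc: assumes a: "tends x l" shows "tends (\<lambda>n. c \<odot> x n) (c \<odot> l)"
proof (rule tendsI[where r="\<lambda>n. cmod c * nm (x n \<ominus> l)"])
  show "(\<lambda>n. cmod c * nm (x n \<ominus> l)) \<longlonglongrightarrow> 0"
    using tendsto_mult[OF tendsto_const[of "cmod c"] tendsD(3)[OF a]] by simp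
  show "nm (c \<odot> x n \<ominus> c \<odot> l) \<le> cmod c * nm (x n \<ominus> l)" for n
    using a by (simp add: tendsD nm_sc sc_minus[symmetric])
qed (use a in \<open>auto simp: tendsD\<close>)

lemma tends_neg: "tends x l \<Longrightarrow> tends (\<lambda>n. \<ominus> x n) (\<ominus> l)"
  using tends_sc[of x l "-1"] by (simp add: sc_neg tendsD)

lemma tends_minus: "tends x l \<Longrightarrow> tends y k \<Longrightarrow> tends (\<lambda>n. x n \<ominus> y n) (l \<ominus> k)"
  unfolding a_minus_def by (intro tends_add tends_neg)

lemma tends_st: assumes a: "tends x l" shows "tends (\<lambda>n. st (x n)) (st l)"
  by (rule tendsI[where r="\<lambda>n. nm (x n \<ominus> l)"]) (use a in \<open>auto simp: tendsD st_minus[symmetric]\<close>)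

lemma tends_Suc: "tends x l \<Longrightarrow> tends (\<lambda>n. x (Suc n)) l"
  unfolding tends_def using LIMSEQ_Suc by fast

lemma tends_nm: "tends x l \<Longrightarrow> (\<lambda>n. nm (x n)) \<longlonglongrightarrow> nm l"
proof -
  assume a: "tends x l"
  have "(\<lambda>n. nm (x n) - nm l) \<longlonglongrightarrow> 0"
    by (rule Lim_null_comparison[OF _ tendsD(3)[OF a]]) (use a in \<open>auto simp: nm_diff_abs tendsD\<close>)
  then show ?thesis by (simp add: LIM_zero_iff)
qed

lemma tends_nm_le: "tends x l \<Longrightarrow> (\<And>n. nm (x n) \<le> B) \<Longrightarrow> nm l \<le> B"
  by (rule LIMSEQ_le_const2[OF tends_nm]) auto

lemma tends_commute: "tends x l \<Longrightarrow> w \<in> cr \<Longrightarrow> (\<And>n. x n \<otimes> w = w \<otimes> x n) \<Longrightarrow> l \<otimes> w = w \<otimes> l"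
proof -
  assume a: "tends x l" "w \<in> cr" "\<And>n. x n \<otimes> w = w \<otimes> x n"
  have "tends (\<lambda>n. x n \<otimes> w) (l \<otimes> w)" using a by (intro tends_mult tends_const)
  moreover have "tends (\<lambda>n. w \<otimes> x n) (w \<otimes> l)" using a by (intro tends_mult tends_const)
  ultimately show ?thesis using a(3) tends_unique by simp
qed

section \<open>The cone of squares\<close>

abbreviation rl :: "real \<Rightarrow> 'a" where "rl t \<equiv> complex_of_real t \<odot> \<one>"

lemma st_rl [simp]: "st (rl t) = rl t" by (simp add: st_sc)
lemma nm_rl: "nm (rl t) \<le> \<bar>t\<bar>" using nm_one_sc[of "complex_of_real t"] by simp
lemma rl_add: "rl (s + t) = rl s \<oplus> rl t" by (simp add: sc_addl)
lemma rl_diff: "rl (s - t) = rl s \<ominus> rl t"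
  using sc_addl[of \<one> "complex_of_real s" "- complex_of_real t"] by (simp add: sc_lneg a_minus_def)

lemmas expand = l_distr r_distr sc_ml sc_mr sc_addr sc_sc m_assoc

lemma half_half: "x \<in> cr \<Longrightarrow> (1/2) \<odot> (x \<oplus> x) = x"
  using sc_addl[of x "1/2" "1/2"] by (simp add: sc_addr)

lemma minus_self [simp]: "x \<in> cr \<Longrightarrow> x \<ominus> x = \<zero>"
  by (simp add: a_minus_def r_neg)

lemma nm_sa_sq: "x \<in> cr \<Longrightarrow> st x = x \<Longrightarrow> nm (x \<otimes> x) = (nm x)\<^sup>2"
  using nm_cs[of x] by simp

text \<open>The element \<open>w = x + \<i>y\<close> satisfies \<open>w\<^sup>*w = x\<^sup>2 + y\<^sup>2\<close>, and \<open>x\<close> is the mean of \<open>w\<close> and \<open>w\<^sup>*\<close>,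
which have the same norm. The order theory below rests on this inequality.\<close>

lemma nm_sum_squares:
  assumes x: "x \<in> cr" "st x = x" and y: "y \<in> cr" "st y = y" and c: "x \<otimes> y = y \<otimes> x"
  shows "nm (x \<otimes> x) \<le> nm (x \<otimes> x \<oplus> y \<otimes> y)"
proof -
  define w where "w = x \<oplus> \<i> \<odot> y"
  have w: "w \<in> cr" using x y by (simp add: w_def)
  have sw: "st w = x \<oplus> (- \<i>) \<odot> y" using x y by (simp add: w_def st_add st_sc)
  have z: "\<i> \<odot> (y \<otimes> x) \<oplus> (- \<i>) \<odot> (y \<otimes> x) = \<zero>"
    using sc_addl[of "y \<otimes> x" "\<i>" "-\<i>"] x y by simp
  have "st w \<otimes> w = x \<otimes> x \<oplus> (\<i> \<odot> (y \<otimes> x) \<oplus> (- \<i>) \<odot> (y \<otimes> x)) \<oplus> y \<otimes> y"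
    unfolding sw unfolding w_def using x(1) y(1) c by (simp add: expand a_ac)
  then have e: "st w \<otimes> w = x \<otimes> x \<oplus> y \<otimes> y" using z x y by simp
  have z2: "\<i> \<odot> y \<oplus> (- \<i>) \<odot> y = \<zero>"
    using sc_addl[of y "\<i>" "-\<i>"] y by simp
  have "w \<oplus> st w = (x \<oplus> x) \<oplus> (\<i> \<odot> y \<oplus> (- \<i>) \<odot> y)"
    unfolding sw unfolding w_def using x(1) y(1) by (simp add: a_ac)
  then have "x = (1/2) \<odot> (w \<oplus> st w)" using z2 x half_half by simp
  then have "nm x \<le> 1/2 * (nm w + nm (st w))"
    using nm_tri[of w "st w"] w by (simp add: nm_sc)
  then have "nm x \<le> nm w" using w by simp
  then have "(nm x)\<^sup>2 \<le> (nm w)\<^sup>2" using x by (intro power_mono) auto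
  then show ?thesis using e nm_cs[OF w] nm_sa_sq[OF x] by simp
qed

text \<open>With \<open>z = 1 - s\<close>, the equation \<open>z\<^sup>2 = 1 - y\<close> becomes the fixed point equation \<open>s = (y + s\<^sup>2)/2\<close>. The
iteration from \<open>0\<close> is dominated by the one over the reals with \<open>y = 1\<close>, which increases and stays
below \<open>1\<close>. Since the iterates are polynomials in \<open>y\<close>, the limit commutes with whatever commutes
with \<open>y\<close>.\<close>

lemma sqrt_one_minus:
  assumes y: "y \<in> cr" "st y = y" "nm y \<le> 1"
  shows "\<exists>z\<in>cr. st z = z \<and> z \<otimes> z = \<one> \<ominus> y \<and> nm (\<one> \<ominus> z) \<le> 1 \<and>
           (\<forall>w\<in>cr. y \<otimes> w = w \<otimes> y \<longrightarrow> z \<otimes> w = w \<otimes> z)"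
proof -
  define s where "s = rec_nat \<zero> (\<lambda>_ v. (1/2) \<odot> (y \<oplus> v \<otimes> v))"
  define r :: "nat \<Rightarrow> real" where "r = rec_nat 0 (\<lambda>_ v. (1 + v * v) / 2)"
  have s0: "s 0 = \<zero>" and sS: "\<And>n. s (Suc n) = (1/2) \<odot> (y \<oplus> s n \<otimes> s n)" by (simp_all add: s_def)
  have r0: "r 0 = 0" and rS: "\<And>n. r (Suc n) = (1 + r n * r n) / 2" by (simp_all add: r_def)
  have sc: "s n \<in> cr" for n by (induction n) (use y in \<open>auto simp: s0 sS\<close>)
  have r1: "0 \<le> r n \<and> r n \<le> 1" for n
    by (induction n) (auto simp: r0 rS mult_le_one)
  have sr: "nm (s n) \<le> r n" for n
  proof (induction n)
    case (Suc n)
    have "nm (s (Suc n)) \<le> 1/2 * (nm y + nm (s n \<otimes> s n))"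
      using y sc[of n] nm_tri[of y "s n \<otimes> s n"] by (simp add: sS nm_sc)
    also have "\<dots> \<le> 1/2 * (1 + r n * r n)"
      using y sc[of n] Suc nm_mult[of "s n" "s n"] mult_mono[OF Suc Suc] r1[of n]
      by (intro mult_left_mono add_mono) auto
    finally show ?case by (simp add: rS)
  qed (simp add: s0 r0)
  have d: "nm (s (Suc n) \<ominus> s n) \<le> r (Suc n) - r n" for n
  proof (induction n)
    case 0
    have "s (Suc 0) \<ominus> s 0 = s (Suc 0)" using sc by (simp add: s0 a_minus_def)
    then show ?case using sr[of "Suc 0"] by (simp add: r0)
  next
    case (Suc n)
    let ?a = "s (Suc n)" and ?b = "s n"
    have m: "?a \<in> cr" "?b \<in> cr" by (auto intro: sc)
    have "(y \<oplus> ?a \<otimes> ?a) \<ominus> (y \<oplus> ?b \<otimes> ?b) = (?a \<otimes> ?a) \<ominus> (?b \<otimes> ?b)"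
      using m y by (simp add: add_minus_swap)
    then have "s (Suc (Suc n)) \<ominus> s (Suc n) = (1/2) \<odot> ((?a \<otimes> ?a) \<ominus> (?b \<otimes> ?b))"
      using m y sS by (metis sc_minus add.m_closed m_closed)
    also have "\<dots> = (1/2) \<odot> ((?a \<ominus> ?b) \<otimes> ?a \<oplus> ?b \<otimes> (?a \<ominus> ?b))"
      using m by (simp add: mult_minus_split)
    finally have "nm (s (Suc (Suc n)) \<ominus> s (Suc n)) =
        1/2 * nm ((?a \<ominus> ?b) \<otimes> ?a \<oplus> ?b \<otimes> (?a \<ominus> ?b))" using m by (simp add: nm_sc)
    also have "\<dots> \<le> 1/2 * (nm (?a \<ominus> ?b) * nm ?a + nm ?b * nm (?a \<ominus> ?b))"
    proof -
      have "nm ((?a \<ominus> ?b) \<otimes> ?a \<oplus> ?b \<otimes> (?a \<ominus> ?b)) \<le>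
          nm ((?a \<ominus> ?b) \<otimes> ?a) + nm (?b \<otimes> (?a \<ominus> ?b))" using m by (simp add: nm_tri)
      also have "\<dots> \<le> nm (?a \<ominus> ?b) * nm ?a + nm ?b * nm (?a \<ominus> ?b)"
        using m by (intro add_mono nm_mult) auto
      finally show ?thesis by simp
    qed
    also have "\<dots> \<le> 1/2 * ((r (Suc n) - r n) * r (Suc n) + r n * (r (Suc n) - r n))"
    proof -
      have p: "0 \<le> r (Suc n) - r n" using order_trans[OF nm_ge0 Suc] m by simp
      have "nm (?a \<ominus> ?b) * nm ?a \<le> (r (Suc n) - r n) * r (Suc n)"
        by (rule mult_mono[OF Suc sr p]) (use m in simp)
      moreover have "nm ?b * nm (?a \<ominus> ?b) \<le> r n * (r (Suc n) - r n)"
        by (rule mult_mono[OF sr Suc]) (use m r1 in auto)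
      ultimately show ?thesis by simp
    qed
    also have "\<dots> = r (Suc (Suc n)) - r (Suc n)"
    proof -
      have "r (Suc (Suc n)) - r (Suc n) = (1 + r (Suc n) * r (Suc n)) / 2 - (1 + r n * r n) / 2"
        using rS[of n] rS[of "Suc n"] by metis
      then show ?thesis by (simp add: algebra_simps diff_divide_distrib add_divide_distrib)
    qed
    finally show ?case .
  qed
  obtain l where l: "tends s l" using dominated_tends[where x=s and r=r and B=1] sc d r1 by blast
  have lc: "l \<in> cr" using l by (rule tendsD)
  have "tends (\<lambda>n. s (Suc n)) ((1/2) \<odot> (y \<oplus> l \<otimes> l))"
    unfolding sS using l y by (intro tends_sc tends_add tends_mult tends_const)
  then have fix_l: "l = (1/2) \<odot> (y \<oplus> l \<otimes> l)" using tends_unique tends_Suc[OF l] by blast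
  have ss: "st (s n) = s n" for n
    by (induction n) (use y sc in \<open>auto simp: s0 sS st_sc st_add st_mult\<close>)
  have sl: "st l = l" using tends_unique[OF l, of "st l"] tends_st[OF l] by (simp add: ss)
  have nl: "nm l \<le> 1" by (rule tends_nm_le[OF l]) (use sr r1 order_trans in blast)
  have cm: "l \<otimes> w = w \<otimes> l" if w: "w \<in> cr" "y \<otimes> w = w \<otimes> y" for w
  proof (rule tends_commute[OF l w(1)])
    show "s n \<otimes> w = w \<otimes> s n" for n
    proof (induction n)
      case (Suc n)
      have "(s n \<otimes> s n) \<otimes> w = w \<otimes> (s n \<otimes> s n)" using Suc w sc[of n] by (metis m_assoc)
      then show ?case using w y sc[of n] by (simp add: sS sc_ml sc_mr l_distr r_distr)
    qed (use w in \<open>simp add: s0\<close>)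
  qed
  have ll: "l \<oplus> l = y \<oplus> l \<otimes> l"
  proof -
    have "l \<oplus> l = (1/2) \<odot> ((y \<oplus> l \<otimes> l) \<oplus> (y \<oplus> l \<otimes> l))"
      using fix_l y lc by (metis sc_addr add.m_closed m_closed)
    then show ?thesis using half_half y lc by simp
  qed
  define z where "z = \<one> \<ominus> l"
  have "z \<otimes> z = \<one> \<oplus> ((\<ominus> (l \<oplus> l)) \<oplus> l \<otimes> l)"
    unfolding z_def using lc by (simp add: a_minus_def l_distr r_distr l_minus r_minus a_ac minus_add)
  also have "\<dots> = \<one> \<oplus> (\<ominus> y \<oplus> (\<ominus> (l \<otimes> l) \<oplus> l \<otimes> l))"
    unfolding ll using lc y by (simp add: minus_add a_assoc)
  also have "\<dots> = \<one> \<ominus> y" using lc y by (simp add: l_neg a_minus_def)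
  finally have zz: "z \<otimes> z = \<one> \<ominus> y" .
  have z: "z \<in> cr" "st z = z" using lc sl by (simp_all add: z_def st_minus)
  have oz: "\<one> \<ominus> z = l" unfolding z_def a_minus_def using lc by (simp add: minus_add a_assoc[symmetric] r_neg)
  have zc: "z \<otimes> w = w \<otimes> z" if "w \<in> cr" "y \<otimes> w = w \<otimes> y" for w
    using cm[OF that] that lc by (simp add: z_def a_minus_def l_distr r_distr l_minus r_minus)
  show ?thesis using z zz oz zc nl by auto
qed

text \<open>The square root of \<open>1 - x\<^sup>2\<close> commutes with \<open>x\<close>, and the two squares add up to \<open>1\<close>.\<close>

lemma nm_one_minus_sq:
  assumes x: "x \<in> cr" "st x = x" "nm x \<le> 1"
  shows "nm (\<one> \<ominus> x \<otimes> x) \<le> 1"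
proof -
  have n: "nm (x \<otimes> x) \<le> 1" using x nm_sa_sq[OF x(1,2)] by (simp add: power_le_one)
  have xx: "x \<otimes> x \<in> cr" "st (x \<otimes> x) = x \<otimes> x" using x by (simp_all add: st_mult)
  then obtain z where z: "z \<in> cr" "st z = z" "z \<otimes> z = \<one> \<ominus> x \<otimes> x"
    "\<forall>w\<in>cr. (x \<otimes> x) \<otimes> w = w \<otimes> (x \<otimes> x) \<longrightarrow> z \<otimes> w = w \<otimes> z"
    using sqrt_one_minus[OF xx n] by blast
  have "(x \<otimes> x) \<otimes> x = x \<otimes> (x \<otimes> x)" using x by (simp add: m_assoc)
  then have "z \<otimes> x = x \<otimes> z" using z(4) x(1) by blast
  then have "nm (z \<otimes> z) \<le> nm (z \<otimes> z \<oplus> x \<otimes> x)" using z x by (intro nm_sum_squares)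
  also have "z \<otimes> z \<oplus> x \<otimes> x = \<one>" using z(3) x(1) by (simp add: minus_add_cancel)
  finally show ?thesis using z(3) nm_one_le by simp
qed

text \<open>Positivity as being a square; \<open>positive_iff_psd\<close> shows that it is the spectral notion.\<close>

definition psd :: "'a \<Rightarrow> bool" where
  "psd a \<longleftrightarrow> (\<exists>z\<in>cr. st z = z \<and> a = z \<otimes> z)"

lemma psd_closed [simp]: "psd a \<Longrightarrow> a \<in> cr" unfolding psd_def by auto
lemma psd_sa: "psd a \<Longrightarrow> st a = a" unfolding psd_def by (auto simp: st_mult)
lemma psd_sq: "z \<in> cr \<Longrightarrow> st z = z \<Longrightarrow> psd (z \<otimes> z)" unfolding psd_def by auto

lemma psd_scale:
  assumes a: "psd a" and t: "t \<ge> 0" shows "psd (complex_of_real t \<odot> a)"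
proof -
  obtain z where z: "z \<in> cr" "st z = z" "a = z \<otimes> z" using a unfolding psd_def by auto
  let ?w = "complex_of_real (sqrt t) \<odot> z"
  have "?w \<otimes> ?w = complex_of_real t \<odot> a" using z t by (simp add: expand flip: of_real_mult)
  then show ?thesis using psd_sq[of ?w] z by (simp add: st_sc)
qed

text \<open>Rescaling by \<open>M\<close> reduces this to the square root of \<open>1 - y\<close> with \<open>\<parallel>y\<parallel> \<le> 1\<close>. The norm estimate for
the root is what makes the root itself positive.\<close>

lemma sqrt_of_near:
  assumes a: "a \<in> cr" "st a = a" "M > 0" "nm (rl M \<ominus> a) \<le> M"
  shows "\<exists>z\<in>cr. st z = z \<and> z \<otimes> z = a \<and> nm (rl (sqrt M) \<ominus> z) \<le> sqrt M \<and>
           (\<forall>w\<in>cr. a \<otimes> w = w \<otimes> a \<longrightarrow> z \<otimes> w = w \<otimes> z)"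
proof -
  let ?m = "complex_of_real (1/M)" and ?q = "complex_of_real (sqrt M)"
  define y where "y = ?m \<odot> (rl M \<ominus> a)"
  have y: "y \<in> cr" "st y = y" using a by (simp_all add: y_def st_sc st_minus)
  have ny: "nm y \<le> 1" using a by (simp add: y_def nm_sc norm_divide)
  have ye: "y = \<one> \<ominus> ?m \<odot> a" unfolding y_def using a by (simp add: sc_minus sc_sc)
  have oy: "\<one> \<ominus> y = ?m \<odot> a"
    unfolding ye a_minus_def using a by (simp add: minus_add a_assoc[symmetric] r_neg)
  obtain z where z: "z \<in> cr" "st z = z" "z \<otimes> z = \<one> \<ominus> y" "nm (\<one> \<ominus> z) \<le> 1"
    "\<forall>w\<in>cr. y \<otimes> w = w \<otimes> y \<longrightarrow> z \<otimes> w = w \<otimes> z" using sqrt_one_minus[OF y ny] by blast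
  show ?thesis
  proof (intro bexI[of _ "?q \<odot> z"] conjI ballI impI)
    show "?q \<odot> z \<in> cr" "st (?q \<odot> z) = ?q \<odot> z" using z(1,2) by (simp_all add: st_sc)
    have "(?q \<odot> z) \<otimes> (?q \<odot> z) = complex_of_real M \<odot> (z \<otimes> z)"
      using z(1) a by (simp add: sc_ml sc_mr sc_sc flip: of_real_mult)
    also have "\<dots> = a" using z(3) oy a(1,3) by (simp add: sc_sc)
    finally show "(?q \<odot> z) \<otimes> (?q \<odot> z) = a" .
    have "rl (sqrt M) \<ominus> ?q \<odot> z = ?q \<odot> (\<one> \<ominus> z)" using z(1) by (simp add: sc_minus)
    then show "nm (rl (sqrt M) \<ominus> ?q \<odot> z) \<le> sqrt M" using z(1,4) a(3) by (simp add: nm_sc mult_left_le)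
    fix w assume w: "w \<in> cr" "a \<otimes> w = w \<otimes> a"
    have "y \<otimes> w = w \<otimes> y" unfolding ye using a(1) w
      by (simp add: a_minus_def l_distr r_distr l_minus r_minus sc_ml sc_mr)
    then have "z \<otimes> w = w \<otimes> z" using z(5) w(1) by blast
    then show "(?q \<odot> z) \<otimes> w = w \<otimes> (?q \<odot> z)" using z(1) w(1) by (simp add: sc_ml sc_mr)
  qed
qed

lemma psd_near: "a \<in> cr \<Longrightarrow> st a = a \<Longrightarrow> M > 0 \<Longrightarrow> nm (rl M \<ominus> a) \<le> M \<Longrightarrow> psd a"
  using sqrt_of_near[of a M] psd_sq by metis

text \<open>Together with the converse above, this describes the squares by a norm inequality, from which
convexity and closedness of the cone can be read off.\<close>

lemma near_psd: assumes a: "psd a" and M: "nm a \<le> M" shows "nm (rl M \<ominus> a) \<le> M"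
proof (cases "M > 0")
  case True
  obtain z where z: "z \<in> cr" "st z = z" "a = z \<otimes> z" using a unfolding psd_def by auto
  let ?w = "complex_of_real (1 / sqrt M) \<odot> z"
  have ww: "?w \<otimes> ?w = complex_of_real (1/M) \<odot> a" using z True
    by (simp add: expand flip: of_real_mult)
  have w: "?w \<in> cr" "st ?w = ?w" using z by (simp_all add: st_sc)
  have "(nm ?w)\<^sup>2 \<le> 1" using nm_sa_sq[OF w] ww M True a by (simp add: nm_sc norm_divide field_simps)
  then have "nm ?w \<le> 1" using w by (simp add: abs_square_le_1)
  then have n: "nm (\<one> \<ominus> complex_of_real (1/M) \<odot> a) \<le> 1" using nm_one_minus_sq[OF w] ww by simp
  have "rl M \<ominus> a = complex_of_real M \<odot> (\<one> \<ominus> complex_of_real (1/M) \<odot> a)"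
    using a True by (simp add: sc_minus sc_sc)
  then show ?thesis using n True a by (simp add: nm_sc mult_left_le)
next
  case False
  moreover have "nm a \<ge> 0" using a by simp
  ultimately have "M = 0" "nm a = 0" using M by linarith+
  then have "M = 0" "a = \<zero>" using nm_eq0[of a] a by auto
  then show ?thesis by (simp add: a_minus_def)
qed

lemma psd_sqrt:
  assumes a: "psd a"
  shows "\<exists>z. psd z \<and> z \<otimes> z = a \<and> (\<forall>w\<in>cr. a \<otimes> w = w \<otimes> a \<longrightarrow> z \<otimes> w = w \<otimes> z)"
proof -
  have p: "nm a + 1 > 0" using nm_ge0[of a] a by (simp add: add_nonneg_pos)
  obtain z where z: "z \<in> cr" "st z = z" "z \<otimes> z = a" "nm (rl (sqrt (nm a + 1)) \<ominus> z) \<le> sqrt (nm a + 1)"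
       "\<forall>w\<in>cr. a \<otimes> w = w \<otimes> a \<longrightarrow> z \<otimes> w = w \<otimes> z"
    using sqrt_of_near[OF psd_closed[OF a] psd_sa[OF a] p near_psd[OF a, of "nm a + 1"]] by (metis less_add_one less_eq_real_def)
  have "psd z" by (rule psd_near[OF z(1,2) _ z(4)]) (use p in simp)
  then show ?thesis using z by blast
qed

lemma psd_add: assumes a: "psd a" and b: "psd b" shows "psd (a \<oplus> b)"
proof (rule psd_near[where M = "nm a + nm b + 1"])
  show "a \<oplus> b \<in> cr" "st (a \<oplus> b) = a \<oplus> b" using a b by (auto simp: st_add psd_sa)
  show "nm a + nm b + 1 > 0" using a b nm_ge0[of a] nm_ge0[of b] by (simp add: add_nonneg_pos)
  have "rl (nm a + nm b + 1) \<ominus> (a \<oplus> b) = (rl (nm a + 1) \<ominus> a) \<oplus> (rl (nm b) \<ominus> b)"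
    using a b by (simp add: a_minus_def minus_add rl_add sc_addl a_ac)
  then have "nm (rl (nm a + nm b + 1) \<ominus> (a \<oplus> b)) \<le> nm (rl (nm a + 1) \<ominus> a) + nm (rl (nm b) \<ominus> b)"
    using a b by (metis nm_tri minus_closed psd_closed sc_closed one_closed)
  then show "nm (rl (nm a + nm b + 1) \<ominus> (a \<oplus> b)) \<le> nm a + nm b + 1"
    using near_psd[OF a, of "nm a + 1"] near_psd[OF b, of "nm b"] by simp
qed

lemma psd_lim: assumes l: "tends x l" and p: "\<And>n. psd (x n)" shows "psd l"
proof -
  obtain B where B: "\<And>n. nm (x n) \<le> B" using tends_bounded[OF l] by blast
  have sl: "st l = l" using tends_unique[OF l, of "st l"] tends_st[OF l] by (simp add: psd_sa p)
  have c: "tends (\<lambda>n. rl (\<bar>B\<bar>+1) \<ominus> x n) (rl (\<bar>B\<bar>+1) \<ominus> l)" using l by (intro tends_minus tends_const) auto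
  show ?thesis
  proof (rule psd_near[of _ "\<bar>B\<bar>+1"])
    show "nm (rl (\<bar>B\<bar>+1) \<ominus> l) \<le> \<bar>B\<bar>+1"
    proof (rule tends_nm_le[OF c])
      fix n show "nm (rl (\<bar>B\<bar>+1) \<ominus> x n) \<le> \<bar>B\<bar>+1"
        by (rule near_psd[OF p]) (use B[of n] in linarith)
    qed
  qed (use sl l in \<open>auto simp: tendsD\<close>)
qed

lemma psd_zero [simp]: "psd \<zero>" using psd_sq[of \<zero>] by simp
lemma psd_one [simp]: "psd \<one>" using psd_sq[of \<one>] by simp
lemma psd_rl [simp]: "t \<ge> 0 \<Longrightarrow> psd (rl t)" by (simp add: psd_scale)

lemma psd_mult_commute:
  assumes a: "psd a" and b: "psd b" and c: "a \<otimes> b = b \<otimes> a" shows "psd (a \<otimes> b)"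
proof -
  obtain z where z: "psd z" "z \<otimes> z = a" "\<forall>w\<in>cr. a \<otimes> w = w \<otimes> a \<longrightarrow> z \<otimes> w = w \<otimes> z"
    using psd_sqrt[OF a] by blast
  obtain y where y: "psd y" "y \<otimes> y = b" "\<forall>w\<in>cr. b \<otimes> w = w \<otimes> b \<longrightarrow> y \<otimes> w = w \<otimes> y"
    using psd_sqrt[OF b] by blast
  have "z \<otimes> b = b \<otimes> z" using z(3) c b psd_closed by blast
  then have zy: "y \<otimes> z = z \<otimes> y" using y(3) psd_closed[OF z(1)] by metis
  have m: "z \<in> cr" "y \<in> cr" using z(1) y(1) by auto
  have "(z \<otimes> y) \<otimes> (z \<otimes> y) = z \<otimes> ((y \<otimes> z) \<otimes> y)" using m by (simp add: m_assoc)
  also have "\<dots> = (z \<otimes> z) \<otimes> (y \<otimes> y)" unfolding zy using m by (simp add: m_assoc)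
  finally have "(z \<otimes> y) \<otimes> (z \<otimes> y) = a \<otimes> b" using z(2) y(2) by simp
  moreover have "st (z \<otimes> y) = z \<otimes> y" using m zy by (simp add: st_mult psd_sa[OF z(1)] psd_sa[OF y(1)])
  ultimately show ?thesis using psd_sq[of "z \<otimes> y"] m by simp
qed

section \<open>Invertibility and the spectrum of positive elements\<close>

lemma cancels:
  assumes "x \<in> cr" "y \<in> cr"
  shows "x \<oplus> (y \<oplus> \<ominus> x) = y" "\<ominus> x \<oplus> (y \<oplus> x) = y" "x \<oplus> (\<ominus> x \<oplus> y) = y" "\<ominus> x \<oplus> (x \<oplus> y) = y"
proof -
  show "x \<oplus> (\<ominus> x \<oplus> y) = y" "\<ominus> x \<oplus> (x \<oplus> y) = y"
    using assms by (simp_all add: a_assoc[symmetric] r_neg l_neg)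
  then show "x \<oplus> (y \<oplus> \<ominus> x) = y" "\<ominus> x \<oplus> (y \<oplus> x) = y"
    using assms by (simp_all add: a_comm[of y])
qed

lemmas abel = a_minus_def minus_add a_ac cancels r_neg l_neg

lemma UnitsI: "x \<in> cr \<Longrightarrow> y \<in> cr \<Longrightarrow> x \<otimes> y = \<one> \<Longrightarrow> y \<otimes> x = \<one> \<Longrightarrow> x \<in> Units D"
  unfolding Units_def by auto

lemma Units_scale: assumes x: "x \<in> Units D" and c: "c \<noteq> 0" shows "c \<odot> x \<in> Units D"
proof (rule UnitsI)
  have m: "x \<in> cr" "inv x \<in> cr" using x by auto
  show "c \<odot> x \<in> cr" "(1/c) \<odot> inv x \<in> cr" using m by auto
  show "c \<odot> x \<otimes> ((1/c) \<odot> inv x) = \<one>" "((1/c) \<odot> inv x) \<otimes> (c \<odot> x) = \<one>"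
    using m c x by (simp_all add: sc_ml sc_mr sc_sc)
qed

lemma Units_neg: assumes "x \<in> Units D" shows "\<ominus> x \<in> Units D"
proof -
  have "x \<in> cr" using assms by auto
  then show ?thesis using Units_scale[OF assms, of "-1"] by (simp add: sc_neg)
qed

lemma Units_commuting_factor:
  assumes x: "x \<in> cr" and y: "y \<in> cr" and c: "x \<otimes> y = y \<otimes> x" and u: "x \<otimes> y \<in> Units D"
  shows "x \<in> Units D"
proof -
  define b where "b = inv (x \<otimes> y)"
  have b: "b \<in> cr" "x \<otimes> y \<otimes> b = \<one>" "b \<otimes> (x \<otimes> y) = \<one>" using u by (simp_all add: b_def)
  have r: "x \<otimes> (y \<otimes> b) = \<one>" using b x y by (simp add: m_assoc)
  have l: "(b \<otimes> y) \<otimes> x = \<one>" using b x y c by (simp add: m_assoc)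
  have "b \<otimes> y = b \<otimes> y \<otimes> (x \<otimes> (y \<otimes> b))" using r b x y by simp
  also have "\<dots> = (b \<otimes> y \<otimes> x) \<otimes> (y \<otimes> b)" using b x y by (simp add: m_assoc)
  also have "\<dots> = y \<otimes> b" using l b x y by simp
  finally have "b \<otimes> y = y \<otimes> b" .
  then show ?thesis using UnitsI[of x "y \<otimes> b"] r l x y b by simp
qed

lemma Units_commute_inv:
  assumes x: "x \<in> Units D" and w: "w \<in> cr" and c: "x \<otimes> w = w \<otimes> x"
  shows "inv x \<otimes> w = w \<otimes> inv x"
proof -
  have m: "x \<in> cr" "inv x \<in> cr" using x by auto
  have "inv x \<otimes> w = inv x \<otimes> (w \<otimes> x) \<otimes> inv x" using m w x by (simp add: m_assoc)
  also have "\<dots> = (inv x \<otimes> x) \<otimes> (w \<otimes> inv x)" unfolding c[symmetric] using m w by (simp only: m_assoc m_closed)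
  also have "\<dots> = w \<otimes> inv x" using m w x by simp
  finally show ?thesis .
qed

text \<open>The partial sums of the series satisfy \<open>s\<^sub>n\<^sub>+\<^sub>1 = 1 + y s\<^sub>n\<close>.\<close>

lemma neumann: assumes y: "y \<in> cr" and n: "nm y < 1" shows "\<one> \<ominus> y \<in> Units D"
proof -
  define s where "s = rec_nat \<zero> (\<lambda>_ v. \<one> \<oplus> y \<otimes> v)"
  define r :: "nat \<Rightarrow> real" where "r = rec_nat 0 (\<lambda>_ v. 1 + nm y * v)"
  have s0: "s 0 = \<zero>" and sS: "\<And>n. s (Suc n) = \<one> \<oplus> y \<otimes> s n" by (simp_all add: s_def)
  have r0: "r 0 = 0" and rS: "\<And>n. r (Suc n) = 1 + nm y * r n" by (simp_all add: r_def)
  have sc: "s n \<in> cr" for n by (induction n) (use y in \<open>auto simp: s0 sS\<close>)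
  have ny: "0 \<le> nm y" using y by simp
  have rb: "r n \<le> 1 / (1 - nm y)" for n
  proof (induction n)
    case (Suc n)
    have "r (Suc n) \<le> 1 + nm y * (1 / (1 - nm y))"
      unfolding rS using Suc ny by (intro add_left_mono mult_left_mono) auto
    also have "\<dots> = 1 / (1 - nm y)" using n by (simp add: field_simps)
    finally show ?case .
  qed (use n in \<open>simp add: r0\<close>)
  have d: "nm (s (Suc n) \<ominus> s n) \<le> r (Suc n) - r n" for n
  proof (induction n)
    case 0
    then show ?case using nm_one_le y by (simp add: s0 sS r0 rS a_minus_def)
  next
    case (Suc n)
    have m: "s (Suc n) \<in> cr" "s n \<in> cr" by (auto intro: sc)
    have "s (Suc (Suc n)) \<ominus> s (Suc n) = (\<one> \<oplus> y \<otimes> s (Suc n)) \<ominus> (\<one> \<oplus> y \<otimes> s n)"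
      using sS by metis
    also have "\<dots> = y \<otimes> (s (Suc n) \<ominus> s n)"
      using m y by (simp add: add_minus_swap) (simp add: a_minus_def r_distr r_minus)
    finally have "nm (s (Suc (Suc n)) \<ominus> s (Suc n)) \<le> nm y * nm (s (Suc n) \<ominus> s n)"
      using nm_mult m y by simp
    also have "\<dots> \<le> nm y * (r (Suc n) - r n)" using Suc ny by (intro mult_left_mono)
    also have "\<dots> = r (Suc (Suc n)) - r (Suc n)" using rS[of "Suc n"] rS[of n] by (simp add: algebra_simps)
    finally show ?case .
  qed
  obtain l where l: "tends s l" using dominated_tends[where x=s and r=r] sc d rb by blast
  have lc: "l \<in> cr" using l by (rule tendsD)
  have "tends (\<lambda>n. s (Suc n)) (\<one> \<oplus> y \<otimes> l)"
    unfolding sS using l y by (intro tends_add tends_mult tends_const) auto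
  then have fl: "l = \<one> \<oplus> y \<otimes> l" using tends_unique tends_Suc[OF l] by blast
  have cm: "l \<otimes> y = y \<otimes> l"
  proof (rule tends_commute[OF l y])
    show "s n \<otimes> y = y \<otimes> s n" for n
    proof (induction n)
      case (Suc n)
      have "s (Suc n) \<otimes> y = y \<oplus> y \<otimes> (s n \<otimes> y)" using y sc[of n] by (simp add: sS l_distr m_assoc)
      also have "\<dots> = y \<otimes> s (Suc n)" using y sc[of n] Suc by (simp add: sS r_distr)
      finally show ?case .
    qed (use y in \<open>simp add: s0\<close>)
  qed
  have lm: "l \<ominus> y \<otimes> l = \<one>"
  proof -
    have "l \<ominus> y \<otimes> l = (\<one> \<oplus> y \<otimes> l) \<ominus> y \<otimes> l" using fl by simp
    also have "\<dots> = \<one>" using lc y by (simp add: a_minus_def a_assoc r_neg)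
    finally show ?thesis .
  qed
  show ?thesis
  proof (rule UnitsI[of _ l])
    have "(\<one> \<ominus> y) \<otimes> l = l \<ominus> y \<otimes> l" using lc y by (simp add: a_minus_def l_distr l_minus)
    then show "(\<one> \<ominus> y) \<otimes> l = \<one>" using lm by simp
    have "l \<otimes> (\<one> \<ominus> y) = l \<ominus> l \<otimes> y" using lc y by (simp add: a_minus_def r_distr r_minus)
    then show "l \<otimes> (\<one> \<ominus> y) = \<one>" using lm cm by simp
  qed (use lc y in auto)
qed

text \<open>Divided by \<open>\<parallel>a\<parallel> + t\<close>, the element \<open>a + t\<close> lies at distance less than \<open>1\<close> from the unit.\<close>

lemma psd_shift_unit: assumes a: "psd a" and t: "t > 0" shows "a \<oplus> rl t \<in> Units D"
proof -
  let ?M = "nm a" let ?c = "nm a + t"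
  have M: "?M \<ge> 0" using a by simp
  define y where "y = complex_of_real (1/?c) \<odot> (rl ?M \<ominus> a)"
  have ac: "a \<in> cr" using a by simp
  have y: "y \<in> cr" using ac by (simp add: y_def)
  have "nm y = nm (rl ?M \<ominus> a) / ?c" using ac M t by (simp add: y_def nm_sc norm_divide flip: of_real_add)
  also have "\<dots> \<le> ?M / ?c" using near_psd[OF a order_refl] M t by (intro divide_right_mono) auto
  also have "\<dots> < 1" using M t by simp
  finally have u: "\<one> \<ominus> y \<in> Units D" using neumann y by blast
  have cn: "complex_of_real ?c \<noteq> 0" using M t by (metis add_nonneg_pos less_irrefl of_real_eq_0_iff)
  have "complex_of_real ?c \<odot> y = rl ?M \<ominus> a" unfolding y_def using ac cn by (simp add: sc_sc)
  then have "complex_of_real ?c \<odot> (\<one> \<ominus> y) = rl ?c \<ominus> (rl ?M \<ominus> a)" using y by (simp add: sc_minus)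
  also have "\<dots> = (rl t \<oplus> rl ?M) \<ominus> (rl ?M \<ominus> a)" by (simp only: rl_add[symmetric] add.commute)
  also have "\<dots> = rl t \<oplus> (rl ?M \<oplus> (\<ominus> rl ?M \<oplus> a))" using ac by (simp add: a_minus_def minus_add a_assoc)
  also have "\<dots> = a \<oplus> rl t" using ac by (simp add: abel)
  finally show ?thesis using Units_scale[OF u cn] by simp
qed

text \<open>For \<open>c = r + \<i>b\<close> and \<open>w = z - r\<close>, the product \<open>(w + \<i>b)(w - \<i>b) = w\<^sup>2 + b\<^sup>2\<close> is invertible.\<close>

lemma sa_nonreal_unit:
  assumes z: "z \<in> cr" "st z = z" and c: "Im c \<noteq> 0"
  shows "c \<odot> \<one> \<ominus> z \<in> Units D"
proof -
  define w where "w = z \<ominus> rl (Re c)"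
  have w: "w \<in> cr" "st w = w" using z by (simp_all add: w_def st_minus)
  let ?i = "(\<i> * Im c) \<odot> \<one>"
  have u: "w \<otimes> w \<oplus> rl ((Im c)\<^sup>2) \<in> Units D" using psd_shift_unit[OF psd_sq[OF w], of "(Im c)\<^sup>2"] c by (simp del: of_real_power)
  have k: "(?i \<oplus> w) \<otimes> ((\<ominus> ?i) \<oplus> w) = w \<otimes> w \<oplus> rl ((Im c)\<^sup>2)"
  proof -
    have e: "?i \<otimes> (\<ominus> ?i) = rl ((Im c)\<^sup>2)"
    proof -
      have "- (\<i> * complex_of_real (Im c) * (\<i> * complex_of_real (Im c))) = complex_of_real ((Im c)\<^sup>2)"
        by (simp add: power2_eq_square algebra_simps)
      then show ?thesis by (simp add: sc_neg sc_sc sc_ml del: of_real_power)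
    qed
    have "(?i \<oplus> w) \<otimes> ((\<ominus> ?i) \<oplus> w) = (?i \<otimes> (\<ominus> ?i)) \<oplus> ((w \<otimes> (\<ominus> ?i)) \<oplus> ?i \<otimes> w) \<oplus> w \<otimes> w"
      using w by (simp add: l_distr r_distr a_ac)
    also have "(w \<otimes> (\<ominus> ?i)) \<oplus> ?i \<otimes> w = \<zero>" using w by (simp add: r_minus sc_ml sc_mr l_neg)
    finally show ?thesis using e w by (simp add: a_comm)
  qed
  have k': "((\<ominus> ?i) \<oplus> w) \<otimes> (?i \<oplus> w) = (?i \<oplus> w) \<otimes> ((\<ominus> ?i) \<oplus> w)"
    using w by (simp add: l_distr r_distr r_minus l_minus sc_ml sc_mr sc_addr sc_rneg minus_add a_ac)
  have "(\<ominus> ?i) \<oplus> w \<in> Units D"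
    by (rule Units_commuting_factor[of _ "?i \<oplus> w"]) (use w k k' u in auto)
  then have v: "\<ominus> ((\<ominus> ?i) \<oplus> w) \<in> Units D" by (rule Units_neg)
  have "c \<odot> \<one> = rl (Re c) \<oplus> ?i" using sc_addl[of \<one> "complex_of_real (Re c)" "\<i> * Im c"] complex_eq[of c] by simp
  then have "c \<odot> \<one> \<ominus> z = \<ominus> ((\<ominus> ?i) \<oplus> w)" unfolding w_def using z
    by (simp add: a_minus_def minus_add a_ac)
  then show ?thesis using v by simp
qed

text \<open>Write \<open>c = m\<^sup>2\<close> with \<open>m\<close> not real and factor \<open>c - z\<^sup>2 = (m - z)(m + z)\<close>.\<close>

lemma psd_spectrum: assumes a: "psd a" and c: "c \<notin> complex_of_real ` {0..}"
  shows "c \<odot> \<one> \<ominus> a \<in> Units D"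
proof -
  obtain z where z: "z \<in> cr" "st z = z" "a = z \<otimes> z" using a unfolding psd_def by auto
  define m where "m = csqrt c"
  have mm: "m * m = c" using power2_csqrt[of c] by (simp add: m_def power2_eq_square)
  have im: "Im m \<noteq> 0"
  proof
    assume "Im m = 0"
    then have "m = complex_of_real (Re m)" by (simp add: complex_eq_iff)
    then have "c = complex_of_real (Re m * Re m)" using mm by (metis of_real_mult)
    then show False using c by (metis atLeast_iff image_eqI zero_le_square)
  qed
  have u1: "m \<odot> \<one> \<ominus> z \<in> Units D" using sa_nonreal_unit[OF z(1,2) im] .
  have "(-m) \<odot> \<one> \<ominus> z \<in> Units D" using sa_nonreal_unit[OF z(1,2)] im by simp
  then have "\<ominus> ((-m) \<odot> \<one> \<ominus> z) \<in> Units D" by (rule Units_neg)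
  also have "\<ominus> ((-m) \<odot> \<one> \<ominus> z) = m \<odot> \<one> \<oplus> z" using z(1) by (simp add: a_minus_def minus_add sc_lneg)
  finally have u2: "m \<odot> \<one> \<oplus> z \<in> Units D" .
  have "(m \<odot> \<one> \<ominus> z) \<otimes> (m \<odot> \<one> \<oplus> z) = (m \<odot> \<one> \<otimes> (m \<odot> \<one>)) \<oplus> (m \<odot> z \<oplus> (\<ominus> (m \<odot> z))) \<oplus> (\<ominus> (z \<otimes> z))"
    using z(1) by (simp add: a_minus_def l_distr r_distr l_minus r_minus sc_ml sc_mr sc_addr sc_rneg a_ac)
  also have "\<dots> = c \<odot> \<one> \<ominus> a" using z(1,3) mm by (simp add: r_neg sc_ml sc_sc a_minus_def)
  finally show ?thesis using Units_m_closed[OF u1 u2] by simp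
qed

text \<open>If \<open>a = z\<^sup>2\<close> is invertible and \<open>s\<close> is the square root of \<open>1 - d a\<^sup>-\<^sup>1\<close> for a small \<open>d\<close>, then
\<open>a - d = (zs)\<^sup>2\<close>.\<close>

lemma psd_unit_lower:
  assumes a: "psd a" and u: "a \<in> Units D"
  shows "\<exists>d>0. psd (a \<ominus> rl d)"
proof -
  obtain z where z: "z \<in> cr" "st z = z" "a = z \<otimes> z" using a unfolding psd_def by auto
  define b where "b = inv a"
  have b: "b \<in> cr" "a \<otimes> b = \<one>" "b \<otimes> a = \<one>" using u by (simp_all add: b_def)
  have ac: "a \<in> cr" using a by simp
  have "st b \<otimes> a = \<one>" using st_mult[OF ac b(1)] b(2) psd_sa[OF a] by simp
  then have sb: "st b = b" using inv_unique[of "st b" a b] b ac by simp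
  have za: "a \<otimes> z = z \<otimes> a" using z by (simp add: m_assoc)
  then have bz: "b \<otimes> z = z \<otimes> b" using Units_commute_inv[OF u z(1) za] by (simp add: b_def)
  define d where "d = 1 / (nm b + 1)"
  have nb: "nm b \<ge> 0" using b by simp
  have d: "d > 0" using nb by (simp add: d_def)
  define y where "y = complex_of_real d \<odot> b"
  have y: "y \<in> cr" "st y = y" using b sb by (simp_all add: y_def st_sc)
  have "nm y = nm b / (nm b + 1)" using nb d unfolding y_def nm_sc[OF b(1)] norm_of_real
    by (simp add: d_def)
  then have ny: "nm y \<le> 1" using nb by simp
  obtain s where s: "s \<in> cr" "st s = s" "s \<otimes> s = \<one> \<ominus> y"
    "\<forall>w\<in>cr. y \<otimes> w = w \<otimes> y \<longrightarrow> s \<otimes> w = w \<otimes> s" using sqrt_one_minus[OF y ny] by blast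
  have "y \<otimes> z = z \<otimes> y" using bz b z by (simp add: y_def sc_ml sc_mr)
  then have sz: "s \<otimes> z = z \<otimes> s" using s(4) z(1) by blast
  have "(z \<otimes> s) \<otimes> (z \<otimes> s) = z \<otimes> ((s \<otimes> z) \<otimes> s)" using z(1) s(1) by (simp add: m_assoc)
  also have "\<dots> = a \<otimes> (\<one> \<ominus> y)" unfolding sz s(3)[symmetric] using z(1,3) s(1) by (simp add: m_assoc)
  also have "\<dots> = a \<ominus> complex_of_real d \<odot> (a \<otimes> b)"
    using ac b y by (simp add: a_minus_def r_distr r_minus) (simp add: y_def sc_mr)
  also have "\<dots> = a \<ominus> rl d" using b by simp
  finally have e: "(z \<otimes> s) \<otimes> (z \<otimes> s) = a \<ominus> rl d" .
  have "st (z \<otimes> s) = z \<otimes> s" using z(1,2) s(1,2) sz by (simp add: st_mult)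
  then have "psd (a \<ominus> rl d)" using psd_sq[of "z \<otimes> s"] z(1) s(1) e by simp
  then show ?thesis using d by blast
qed

text \<open>Let \<open>t\<^sub>0\<close> be the infimum of the \<open>t \<ge> 0\<close> for which \<open>a + t\<close> is a square. The cone is closed, so
\<open>a + t\<^sub>0\<close> is a square. If \<open>t\<^sub>0\<close> were positive, \<open>a + t\<^sub>0\<close> would also be invertible, and
\<open>psd_unit_lower\<close> would allow a smaller value of \<open>t\<close>.\<close>

lemma psd_of_units:
  assumes a: "a \<in> cr" "st a = a" and u: "\<And>t. t > 0 \<Longrightarrow> a \<oplus> rl t \<in> Units D"
  shows "psd a"
proof -
  define S where "S = {t. 0 \<le> t \<and> psd (a \<oplus> rl t)}"
  define M where "M = nm a + 1"
  have M: "M > 0" using a nm_ge0[of a] by (simp add: M_def add_nonneg_pos)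
  have "rl M \<ominus> (a \<oplus> rl M) = \<ominus> a" using a by (simp add: abel)
  then have "psd (a \<oplus> rl M)" using a M by (intro psd_near[of _ M]) (auto simp: st_add, simp add: M_def)
  then have "M \<in> S" using M by (simp add: S_def)
  then have ne: "S \<noteq> {}" by blast
  have bb: "bdd_below S" by (rule bdd_belowI[of _ 0]) (simp add: S_def)
  define t0 where "t0 = Inf S"
  have t0: "t0 \<ge> 0" unfolding t0_def by (rule cInf_greatest[OF ne]) (simp add: S_def)
  have "\<exists>t\<in>S. t < t0 + 1 / real (Suc n)" for n
    using cInf_lessD[OF ne, of "t0 + 1 / real (Suc n)"] by (simp add: t0_def)
  then obtain t where t: "\<And>n. t n \<in> S" "\<And>n. t n < t0 + 1 / real (Suc n)" by metis
  have tl: "t0 \<le> t n" for n unfolding t0_def using cInf_lower[OF t(1) bb] .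
  have "tends (\<lambda>n. a \<oplus> rl (t n)) (a \<oplus> rl t0)"
  proof (rule tendsI[where r="\<lambda>n. 1 / real (Suc n)"])
    show "nm (a \<oplus> rl (t n) \<ominus> (a \<oplus> rl t0)) \<le> 1 / real (Suc n)" for n
    proof -
      have "a \<oplus> rl (t n) \<ominus> (a \<oplus> rl t0) = rl (t n - t0)"
        using a unfolding rl_diff by (simp add: add_minus_swap)
      then show ?thesis using nm_rl[of "t n - t0"] t(2)[of n] tl[of n] by simp
    qed
    show "(\<lambda>n. 1 / real (Suc n)) \<longlonglongrightarrow> 0" using LIMSEQ_inverse_real_of_nat by (simp add: inverse_eq_divide)
  qed (use a in auto)
  then have p0: "psd (a \<oplus> rl t0)" by (rule psd_lim) (use t(1) in \<open>auto simp: S_def\<close>)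
  have "t0 = 0"
  proof (rule ccontr)
    assume "t0 \<noteq> 0"
    then have t0p: "t0 > 0" using t0 by simp
    then obtain d where d: "d > 0" "psd (a \<oplus> rl t0 \<ominus> rl d)" using psd_unit_lower[OF p0 u] by blast
    define e where "e = min d t0"
    have e: "e > 0" "e \<le> d" "e \<le> t0" using d t0p by (auto simp: e_def)
    have "psd ((a \<oplus> rl t0 \<ominus> rl d) \<oplus> rl (d - e))" using d e by (intro psd_add psd_rl) auto
    also have "(a \<oplus> rl t0 \<ominus> rl d) \<oplus> rl (d - e) = a \<oplus> rl (t0 + ((-d) + (d - e)))"
      unfolding rl_add[of t0] rl_add[of "-d"] using a by (simp add: a_minus_def sc_lneg a_assoc)
    also have "t0 + ((-d) + (d - e)) = t0 - e" by simp
    finally have "t0 - e \<in> S" using e by (simp add: S_def)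
    then have "t0 \<le> t0 - e" unfolding t0_def using cInf_lower[OF _ bb] by blast
    then show False using e by simp
  qed
  then show ?thesis using p0 a by simp
qed

lemma positive_iff_psd: "positive D a \<longleftrightarrow> psd a"
proof
  assume p: "positive D a"
  have a: "a \<in> cr" "st a = a" using p by (simp_all add: positive_def)
  show "psd a"
  proof (rule psd_of_units[OF a])
    fix t :: real assume t: "t > 0"
    have "complex_of_real (- t) \<notin> complex_of_real ` {0..}" using t by (auto simp del: of_real_minus)
    then have "complex_of_real (-t) \<odot> \<one> \<ominus> a \<in> Units D" using p unfolding positive_def spectrum_def by blast
    then have "\<ominus> (complex_of_real (-t) \<odot> \<one> \<ominus> a) \<in> Units D" by (rule Units_neg)
    also have "\<ominus> (complex_of_real (-t) \<odot> \<one> \<ominus> a) = a \<oplus> rl t" using a by (simp add: a_minus_def minus_add sc_lneg a_comm)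
    finally show "a \<oplus> rl t \<in> Units D" .
  qed
next
  assume "psd a"
  then show "positive D a" unfolding positive_def spectrum_def using psd_spectrum psd_sa by auto
qed

lemma psd_antisym: assumes a: "psd a" and b: "psd (\<ominus> a)" shows "a = \<zero>"
proof -
  obtain z where z: "psd z" "z \<otimes> z = a" "\<forall>w\<in>cr. a \<otimes> w = w \<otimes> a \<longrightarrow> z \<otimes> w = w \<otimes> z"
    using psd_sqrt[OF a] by blast
  obtain y where y: "psd y" "y \<otimes> y = \<ominus> a" "\<forall>w\<in>cr. (\<ominus> a) \<otimes> w = w \<otimes> (\<ominus> a) \<longrightarrow> y \<otimes> w = w \<otimes> y"
    using psd_sqrt[OF b] by blast
  have ac: "a \<in> cr" using a by simp
  have zc: "z \<in> cr" and yc: "y \<in> cr" using z(1) y(1) by auto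
  have "(\<ominus> a) \<otimes> y = y \<otimes> (\<ominus> a)" using y(2)[symmetric] yc by (simp add: m_assoc)
  then have "a \<otimes> y = y \<otimes> a" using ac yc by (metis l_minus r_minus minus_minus m_closed)
  then have "z \<otimes> y = y \<otimes> z" using z(3) yc by blast
  then have "nm (z \<otimes> z) \<le> nm (z \<otimes> z \<oplus> y \<otimes> y)"
    using zc yc psd_sa[OF z(1)] psd_sa[OF y(1)] by (intro nm_sum_squares)
  then have "nm a \<le> 0" using z(2) y(2) ac by (simp add: r_neg)
  then have "nm a = 0" using nm_ge0[OF ac] by linarith
  then show ?thesis using nm_eq0 ac by simp
qed

text \<open>The roots of \<open>a\<close> and of \<open>\<parallel>b\<parallel> - a\<close> commute and their squares add up to the scalar \<open>\<parallel>b\<parallel>\<close>.\<close>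

lemma psd_mono: assumes a: "psd a" and b: "psd (b \<ominus> a)" and bc: "b \<in> cr" shows "nm a \<le> nm b"
proof -
  have ac: "a \<in> cr" using a by simp
  have "b = a \<oplus> (b \<ominus> a)" using ac bc by (metis a_comm minus_add_cancel minus_closed)
  then have pb: "psd b" using psd_add[OF a b] by simp
  define M where "M = nm b"
  have M: "M \<ge> 0" using bc by (simp add: M_def)
  have sm: "st (rl M \<ominus> b) = rl M \<ominus> b" using bc psd_sa[OF pb] by (simp add: st_minus)
  have "psd (rl M \<ominus> b)"
  proof (cases "M = 0")
    case True
    then have "b = \<zero>" using nm_eq0 bc by (simp add: M_def)
    then show ?thesis using True by (simp add: a_minus_def)
  next
    case False
    have "rl M \<ominus> (rl M \<ominus> b) = b" using bc by (simp add: a_minus_def minus_add a_assoc[symmetric] r_neg)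
    then show ?thesis using False M sm bc by (intro psd_near[of _ M]) (auto simp: M_def less_le)
  qed
  then have "psd ((rl M \<ominus> b) \<oplus> (b \<ominus> a))" using b by (rule psd_add)
  also have "(rl M \<ominus> b) \<oplus> (b \<ominus> a) = rl M \<oplus> (\<ominus> b \<oplus> (b \<oplus> \<ominus> a))"
    using ac bc by (simp add: a_minus_def a_assoc)
  also have "\<dots> = rl M \<ominus> a" using ac bc by (simp add: cancels a_minus_def)
  finally have q: "psd (rl M \<ominus> a)" .
  obtain z where z: "psd z" "z \<otimes> z = a" "\<forall>w\<in>cr. a \<otimes> w = w \<otimes> a \<longrightarrow> z \<otimes> w = w \<otimes> z"
    using psd_sqrt[OF a] by blast
  obtain y where y: "psd y" "y \<otimes> y = rl M \<ominus> a" 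
     "\<forall>w\<in>cr. (rl M \<ominus> a) \<otimes> w = w \<otimes> (rl M \<ominus> a) \<longrightarrow> y \<otimes> w = w \<otimes> y"
    using psd_sqrt[OF q] by blast
  have zc: "z \<in> cr" and yc: "y \<in> cr" using z(1) y(1) by auto
  have "a \<otimes> z = z \<otimes> a" using z(2) zc by (metis m_assoc)
  then have "(rl M \<ominus> a) \<otimes> z = z \<otimes> (rl M \<ominus> a)" using zc ac
    by (simp add: a_minus_def l_distr r_distr l_minus r_minus sc_ml sc_mr)
  then have "y \<otimes> z = z \<otimes> y" using y(3) zc by blast
  then have "nm (z \<otimes> z) \<le> nm (z \<otimes> z \<oplus> y \<otimes> y)"
    using zc yc psd_sa[OF z(1)] psd_sa[OF y(1)] by (intro nm_sum_squares) simp_all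
  also have "z \<otimes> z \<oplus> y \<otimes> y = rl M" using z(2) y(2) ac by (metis a_comm minus_add_cancel minus_closed one_closed sc_closed)
  finally show ?thesis using z(2) nm_rl[of M] M by (simp add: M_def)
qed

lemma rl_minus_psd: assumes a: "a \<in> cr" "st a = a" and M: "nm a \<le> M" shows "psd (rl M \<ominus> a)"
proof (cases "M > 0")
  case True
  have "rl M \<ominus> (rl M \<ominus> a) = a" using a by (simp add: a_minus_def minus_add a_assoc[symmetric] r_neg)
  then show ?thesis using True M a by (intro psd_near[of _ M]) (auto simp: st_minus)
next
  case False
  then have "nm a = 0" "M = 0" using M nm_ge0[OF a(1)] by linarith+
  then show ?thesis using nm_eq0 a by (simp add: a_minus_def)
qed

text \<open>The inverse is \<open>t\<^sup>-\<^sup>1(1 - y\<^sup>*(yy\<^sup>* + t)\<^sup>-\<^sup>1y)\<close>.\<close>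

lemma unit_one_plus_flip:
  assumes y: "y \<in> cr" and t: "t > 0" and u: "y \<otimes> st y \<oplus> rl t \<in> Units D"
  shows "st y \<otimes> y \<oplus> rl t \<in> Units D"
proof -
  define b where "b = inv (y \<otimes> st y \<oplus> rl t)"
  let ?s = "st y" let ?T = "complex_of_real t"
  have b: "b \<in> cr" "(y \<otimes> ?s \<oplus> rl t) \<otimes> b = \<one>" "b \<otimes> (y \<otimes> ?s \<oplus> rl t) = \<one>"
    using u by (simp_all add: b_def)
  have sc: "?s \<in> cr" using y by simp
  have e1: "y \<otimes> (?s \<otimes> b) \<oplus> ?T \<odot> b = \<one>" using b(1,2) y sc by (simp add: l_distr sc_ml m_assoc)
  have e2: "b \<otimes> (y \<otimes> ?s) \<oplus> ?T \<odot> b = \<one>" using b(1,3) y sc by (simp add: r_distr sc_mr)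
  have k1: "(?s \<otimes> y \<oplus> rl t) \<otimes> (?s \<otimes> b \<otimes> y) = ?s \<otimes> y"
  proof -
    have "(?s \<otimes> y \<oplus> rl t) \<otimes> (?s \<otimes> b \<otimes> y) = ?s \<otimes> ((y \<otimes> (?s \<otimes> b) \<oplus> ?T \<odot> b) \<otimes> y)"
      using y sc b(1) by (simp add: l_distr r_distr sc_ml sc_mr m_assoc)
    then show ?thesis using e1 y by simp
  qed
  have k2: "(?s \<otimes> b \<otimes> y) \<otimes> (?s \<otimes> y \<oplus> rl t) = ?s \<otimes> y"
  proof -
    have "(?s \<otimes> b \<otimes> y) \<otimes> (?s \<otimes> y \<oplus> rl t) = ?s \<otimes> ((b \<otimes> (y \<otimes> ?s) \<oplus> ?T \<odot> b) \<otimes> y)"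
      using y sc b(1) by (simp add: l_distr r_distr sc_ml sc_mr m_assoc)
    then show ?thesis using e2 y by simp
  qed
  let ?w = "\<one> \<ominus> ?s \<otimes> b \<otimes> y" let ?a = "?s \<otimes> y"
  have wc: "?w \<in> cr" and ac: "?a \<in> cr" using y sc b(1) by auto
  have l1: "(?a \<oplus> rl t) \<otimes> ?w = (?a \<oplus> rl t) \<ominus> ?a"
    using k1 ac y sc b(1) by (simp add: a_minus_def r_distr[of _ _ "?a \<oplus> rl t"] r_minus)
  have l2: "?w \<otimes> (?a \<oplus> rl t) = (?a \<oplus> rl t) \<ominus> ?a"
    using k2 ac y sc b(1) by (simp add: a_minus_def l_distr[of _ _ "?a \<oplus> rl t"] l_minus)
  have l3: "(?a \<oplus> rl t) \<ominus> ?a = rl t" using ac by (simp add: abel)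
  show ?thesis
  proof (rule UnitsI[of _ "complex_of_real (1/t) \<odot> ?w"])
    show "(?a \<oplus> rl t) \<otimes> (complex_of_real (1/t) \<odot> ?w) = \<one>"
      using l1 l3 wc ac t by (simp add: sc_mr sc_sc)
    show "(complex_of_real (1/t) \<odot> ?w) \<otimes> (?a \<oplus> rl t) = \<one>"
      using l2 l3 wc ac t by (simp add: sc_ml sc_sc)
  qed (use wc ac in auto)
qed

text \<open>Take \<open>p\<close> and \<open>q\<close> to be the halves of \<open>c + a\<close> and \<open>c - a\<close>, with \<open>c\<close> the positive root of \<open>a\<^sup>2\<close>. They
are positive because \<open>(p + t)(q + t) = t(c + t)\<close> is invertible for every \<open>t > 0\<close>, hence so are both
factors.\<close>

lemma sa_decompose:
  assumes a: "a \<in> cr" "st a = a"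
  shows "\<exists>p q. psd p \<and> psd q \<and> a = p \<ominus> q \<and> p \<otimes> q = \<zero> \<and> q \<otimes> p = \<zero>"
proof -
  obtain c where c: "psd c" "c \<otimes> c = a \<otimes> a" "\<forall>w\<in>cr. (a \<otimes> a) \<otimes> w = w \<otimes> (a \<otimes> a) \<longrightarrow> c \<otimes> w = w \<otimes> c"
    using psd_sqrt[OF psd_sq[OF a]] by blast
  have cc: "c \<in> cr" "st c = c" using psd_sa[OF c(1)] c(1) by auto
  have "(a \<otimes> a) \<otimes> a = a \<otimes> (a \<otimes> a)" using a by (simp add: m_assoc)
  then have ca: "c \<otimes> a = a \<otimes> c" using c(3) a(1) by blast
  let ?h = "complex_of_real (1/2)"
  define p where "p = ?h \<odot> (c \<oplus> a)"
  define q where "q = ?h \<odot> (c \<ominus> a)"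
  have p: "p \<in> cr" "st p = p" using a cc by (simp_all add: p_def st_sc st_add)
  have q: "q \<in> cr" "st q = q" using a cc by (simp_all add: q_def st_sc st_minus)
  have z1: "(c \<oplus> a) \<otimes> (c \<ominus> a) = \<zero>"
  proof -
    have "(c \<oplus> a) \<otimes> (c \<ominus> a) = (c \<otimes> c \<oplus> \<ominus> (a \<otimes> a)) \<oplus> (a \<otimes> c \<oplus> \<ominus> (c \<otimes> a))"
      using a(1) cc(1) by (simp add: a_minus_def l_distr r_distr l_minus r_minus minus_add a_ac)
    then show ?thesis using c(2) ca a(1) cc(1) by (simp add: r_neg)
  qed
  have z2: "(c \<ominus> a) \<otimes> (c \<oplus> a) = \<zero>"
  proof -
    have "(c \<ominus> a) \<otimes> (c \<oplus> a) = (c \<otimes> c \<oplus> \<ominus> (a \<otimes> a)) \<oplus> (c \<otimes> a \<oplus> \<ominus> (a \<otimes> c))"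
      using a(1) cc(1) by (simp add: a_minus_def l_distr r_distr l_minus r_minus minus_add a_ac)
    then show ?thesis using c(2) ca a(1) cc(1) by (simp add: r_neg)
  qed
  have pq: "p \<otimes> q = \<zero>" "q \<otimes> p = \<zero>"
    using z1 z2 a(1) cc(1) by (simp_all add: p_def q_def sc_ml sc_mr sc_sc)
  have pmq: "p \<ominus> q = a"
  proof -
    have "p \<ominus> q = ?h \<odot> ((c \<oplus> a) \<ominus> (c \<ominus> a))" using a(1) cc(1) by (simp add: p_def q_def sc_minus)
    also have "(c \<oplus> a) \<ominus> (c \<ominus> a) = a \<oplus> a" using a(1) cc(1)
      by (simp add: abel)
    finally show ?thesis using half_half a(1) by simp
  qed
  have ppq: "p \<oplus> q = c"
  proof -
    have "p \<oplus> q = ?h \<odot> ((c \<oplus> a) \<oplus> (c \<ominus> a))" using a(1) cc(1) by (simp add: p_def q_def sc_addr)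
    also have "(c \<oplus> a) \<oplus> (c \<ominus> a) = c \<oplus> c" using a(1) cc(1)
      by (simp add: abel)
    finally show ?thesis using half_half cc(1) by simp
  qed
  have u: "(p \<oplus> rl t) \<otimes> (q \<oplus> rl t) \<in> Units D" "(p \<oplus> rl t) \<otimes> (q \<oplus> rl t) = (q \<oplus> rl t) \<otimes> (p \<oplus> rl t)"
    if t: "t > 0" for t
  proof -
    let ?T = "complex_of_real t"
    have e: "(p \<oplus> rl t) \<otimes> (q \<oplus> rl t) = ?T \<odot> (c \<oplus> rl t)"
      using p q pq by (simp add: l_distr r_distr sc_ml sc_mr ppq[symmetric] sc_addr sc_sc a_ac)
    have e': "(q \<oplus> rl t) \<otimes> (p \<oplus> rl t) = ?T \<odot> (c \<oplus> rl t)"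
      using p q pq by (simp add: l_distr r_distr sc_ml sc_mr ppq[symmetric] sc_addr sc_sc a_ac)
    show "(p \<oplus> rl t) \<otimes> (q \<oplus> rl t) \<in> Units D"
      unfolding e using t by (intro Units_scale psd_shift_unit c(1)) auto
    show "(p \<oplus> rl t) \<otimes> (q \<oplus> rl t) = (q \<oplus> rl t) \<otimes> (p \<oplus> rl t)" using e e' by simp
  qed
  have "psd p"
    by (rule psd_of_units[OF p], rule Units_commuting_factor[OF _ _ u(2) u(1)]) (use p q in auto)
  moreover have "psd q"
    by (rule psd_of_units[OF q], rule Units_commuting_factor[OF _ _ u(2)[symmetric]])
       (use p q u in auto)
  ultimately show ?thesis using pq pmq by metis
qed

text \<open>Decompose \<open>x\<^sup>*x = p - q\<close> and put \<open>y = xq\<close>, so that \<open>y\<^sup>*y = -q\<^sup>3\<close>. Since \<open>y\<^sup>*y + yy\<^sup>*\<close> is half a sum of two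
squares, \<open>yy\<^sup>*\<close> is positive; then so is \<open>y\<^sup>*y\<close>, because the two have the same nonzero spectrum. Hence
\<open>q\<^sup>3\<close> and its negative are both positive, and \<open>q = 0\<close>.\<close>

lemma psd_st_mult: assumes x: "x \<in> cr" shows "psd (st x \<otimes> x)"
proof -
  let ?a = "st x \<otimes> x"
  have a: "?a \<in> cr" "st ?a = ?a" using x by (simp_all add: st_mult)
  obtain p q where pq: "psd p" "psd q" "?a = p \<ominus> q" "p \<otimes> q = \<zero>" "q \<otimes> p = \<zero>"
    using sa_decompose[OF a] by blast
  have p: "p \<in> cr" and q: "q \<in> cr" "st q = q" using pq(1,2) by (auto simp: psd_sa)
  define y where "y = x \<otimes> q"
  have y: "y \<in> cr" using x q by (simp add: y_def)
  define c where "c = q \<otimes> (q \<otimes> q)"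
  have pc: "psd c" unfolding c_def using q pq(2) by (intro psd_mult_commute psd_sq) (auto simp: m_assoc)
  have cc: "c \<in> cr" using pc by simp
  have yy: "st y \<otimes> y = \<ominus> c"
  proof -
    have "st y \<otimes> y = q \<otimes> (?a \<otimes> q)" using x q by (simp add: y_def st_mult m_assoc)
    also have "\<dots> = q \<otimes> (p \<otimes> q \<ominus> q \<otimes> q)" unfolding pq(3) using p q by (simp add: a_minus_def l_distr l_minus)
    also have "\<dots> = \<ominus> c" using pq(4) q by (simp add: a_minus_def r_minus c_def)
    finally show ?thesis .
  qed
  define h where "h = y \<oplus> st y"
  define k where "k = \<i> \<odot> (y \<ominus> st y)"
  have h: "h \<in> cr" "st h = h" using y by (simp_all add: h_def st_add a_comm)
  have k: "k \<in> cr" "st k = k" using y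
    by (simp_all add: k_def st_sc st_minus sc_lneg) (metis neg_minus sc_rneg minus_closed st_closed)
  let ?P = "st y \<otimes> y" and ?Q = "y \<otimes> st y" and ?R = "y \<otimes> y" and ?S = "st y \<otimes> st y"
  have m: "?P \<in> cr" "?Q \<in> cr" "?R \<in> cr" "?S \<in> cr" using y by auto
  have hh: "h \<otimes> h = (?R \<oplus> ?S) \<oplus> (?P \<oplus> ?Q)" using y by (simp add: h_def l_distr r_distr a_ac)
  have "(y \<ominus> st y) \<otimes> (y \<ominus> st y) = (?R \<oplus> ?S) \<oplus> \<ominus> (?P \<oplus> ?Q)"
    using y by (simp add: a_minus_def l_distr r_distr l_minus r_minus minus_add a_ac)
  then have kk: "k \<otimes> k = \<ominus> (?R \<oplus> ?S) \<oplus> (?P \<oplus> ?Q)"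
    using y m by (simp add: k_def sc_ml sc_mr sc_sc sc_neg[symmetric] minus_add)
  have "h \<otimes> h \<oplus> k \<otimes> k = ((?R \<oplus> ?S) \<oplus> \<ominus> (?R \<oplus> ?S)) \<oplus> ((?P \<oplus> ?Q) \<oplus> (?P \<oplus> ?Q))"
    unfolding hh kk using m by (simp only: a_ac a_closed a_inv_closed)
  also have "\<dots> = (?P \<oplus> ?Q) \<oplus> (?P \<oplus> ?Q)" using m by (simp add: r_neg)
  finally have "(1/2) \<odot> (h \<otimes> h \<oplus> k \<otimes> k) = ?P \<oplus> ?Q" using half_half m by simp
  then have "psd (?P \<oplus> ?Q)" using psd_scale[OF psd_add[OF psd_sq[OF h] psd_sq[OF k]], of "1/2"] by simp
  then have "psd ((?P \<oplus> ?Q) \<oplus> c)" using pc by (rule psd_add)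
  also have "(?P \<oplus> ?Q) \<oplus> c = ?Q" unfolding yy using m cc by (simp add: abel)
  finally have pQ: "psd ?Q" .
  have "psd ?P"
  proof (rule psd_of_units)
    show "?P \<oplus> rl t \<in> Units D" if "t > 0" for t
      by (rule unit_one_plus_flip[OF y that psd_shift_unit[OF pQ that]])
  qed (use y in \<open>auto simp: st_mult\<close>)
  then have "psd (\<ominus> c)" using yy by simp
  then have "c = \<zero>" using psd_antisym[OF pc] by simp
  then have "q \<otimes> q \<otimes> (q \<otimes> q) = \<zero>" using q by (simp add: c_def m_assoc)
  then have "(nm (q \<otimes> q))\<^sup>2 = 0" using nm_sa_sq[of "q \<otimes> q"] q by (simp add: st_mult)
  then have "(nm q)\<^sup>2 = 0" using nm_sa_sq[of q] q by simp
  then have "q = \<zero>" using nm_eq0 q by simp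
  then have "?a = p" using pq(3) p by (simp add: a_minus_def)
  then show ?thesis using pq(1) by simp
qed

lemma psd_conj: assumes a: "psd a" and x: "x \<in> cr" shows "psd (st x \<otimes> a \<otimes> x)"
proof -
  obtain z where z: "z \<in> cr" "st z = z" "a = z \<otimes> z" using a unfolding psd_def by auto
  have "st (z \<otimes> x) \<otimes> (z \<otimes> x) = st x \<otimes> a \<otimes> x" using z x by (simp add: st_mult m_assoc)
  then show ?thesis using psd_st_mult[of "z \<otimes> x"] z x by simp
qed

section \<open>Columns over a C*-algebra and the operator norm\<close>

abbreviation fsum :: "nat \<Rightarrow> (nat \<Rightarrow> 'a) \<Rightarrow> 'a" where "fsum n f \<equiv> finsum D f {..<n}"

lemma fsum_0 [simp]: "fsum 0 f = \<zero>" by simp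

lemma fsum_Suc: assumes "\<And>i. i < Suc n \<Longrightarrow> f i \<in> cr" shows "fsum (Suc n) f = fsum n f \<oplus> f n"
proof -
  have "fsum (Suc n) f = f n \<oplus> fsum n f"
    unfolding lessThan_Suc by (rule finsum_insert) (use assms in auto)
  also have "\<dots> = fsum n f \<oplus> f n" using assms by (intro a_comm finsum_closed) auto
  finally show ?thesis .
qed

lemma fsum_closed [simp, intro]: "(\<And>i. i < n \<Longrightarrow> f i \<in> cr) \<Longrightarrow> fsum n f \<in> cr"
  by (intro finsum_closed) auto

lemma fsum_cong: "(\<And>i. i < n \<Longrightarrow> f i = g i) \<Longrightarrow> (\<And>i. i < n \<Longrightarrow> g i \<in> cr) \<Longrightarrow> fsum n f = fsum n g"
  by (rule finsum_cong') auto

lemma fsum_add: "(\<And>i. i < n \<Longrightarrow> f i \<in> cr) \<Longrightarrow> (\<And>i. i < n \<Longrightarrow> g i \<in> cr) \<Longrightarrow>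
    fsum n (\<lambda>i. f i \<oplus> g i) = fsum n f \<oplus> fsum n g"
  by (rule finsum_addf) auto

lemma fsum_zero: "(\<And>i. i < n \<Longrightarrow> f i = \<zero>) \<Longrightarrow> fsum n f = \<zero>"
  by (induction n) (auto simp: fsum_Suc)

lemma fsum_mr: "(\<And>i. i < n \<Longrightarrow> f i \<in> cr) \<Longrightarrow> a \<in> cr \<Longrightarrow> fsum n f \<otimes> a = fsum n (\<lambda>i. f i \<otimes> a)"
  by (induction n) (auto simp: fsum_Suc l_distr)

lemma fsum_ml: "(\<And>i. i < n \<Longrightarrow> f i \<in> cr) \<Longrightarrow> a \<in> cr \<Longrightarrow> a \<otimes> fsum n f = fsum n (\<lambda>i. a \<otimes> f i)"
  by (induction n) (auto simp: fsum_Suc r_distr)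

lemma fsum_sc: "(\<And>i. i < n \<Longrightarrow> f i \<in> cr) \<Longrightarrow> c \<odot> fsum n f = fsum n (\<lambda>i. c \<odot> f i)"
  by (induction n) (auto simp: fsum_Suc sc_addr)

lemma fsum_st: "(\<And>i. i < n \<Longrightarrow> f i \<in> cr) \<Longrightarrow> st (fsum n f) = fsum n (\<lambda>i. st (f i))"
  by (induction n) (auto simp: fsum_Suc st_add)

lemma fsum_neg: "(\<And>i. i < n \<Longrightarrow> f i \<in> cr) \<Longrightarrow> \<ominus> (fsum n f) = fsum n (\<lambda>i. \<ominus> (f i))"
  by (induction n) (auto simp: fsum_Suc minus_add)

lemma fsum_minus: "(\<And>i. i < n \<Longrightarrow> f i \<in> cr) \<Longrightarrow> (\<And>i. i < n \<Longrightarrow> g i \<in> cr) \<Longrightarrow>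
    fsum n (\<lambda>i. f i \<ominus> g i) = fsum n f \<ominus> fsum n g"
  unfolding a_minus_def by (simp add: fsum_add fsum_neg)

lemma fsum_swap: "(\<And>i j. i < n \<Longrightarrow> j < m \<Longrightarrow> f i j \<in> cr) \<Longrightarrow>
   fsum n (\<lambda>i. fsum m (f i)) = fsum m (\<lambda>j. fsum n (\<lambda>i. f i j))"
proof (induction n)
  case 0
  show ?case by (simp add: fsum_zero)
next
  case (Suc n)
  have "fsum (Suc n) (\<lambda>i. fsum m (f i)) = fsum m (\<lambda>j. fsum n (\<lambda>i. f i j)) \<oplus> fsum m (f n)"
    using Suc by (simp add: fsum_Suc)
  also have "\<dots> = fsum m (\<lambda>j. fsum n (\<lambda>i. f i j) \<oplus> f n j)"
    using Suc.prems by (intro fsum_add[symmetric]) auto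
  also have "\<dots> = fsum m (\<lambda>j. fsum (Suc n) (\<lambda>i. f i j))"
    using Suc.prems by (intro fsum_cong) (auto simp: fsum_Suc)
  finally show ?case .
qed

lemma fsum_nm: "(\<And>i. i < n \<Longrightarrow> f i \<in> cr) \<Longrightarrow> nm (fsum n f) \<le> (\<Sum>i<n. nm (f i))"
proof (induction n)
  case (Suc n)
  have "nm (fsum (Suc n) f) \<le> nm (fsum n f) + nm (f n)" using Suc.prems by (simp add: fsum_Suc nm_tri)
  then show ?case using Suc by fastforce
qed simp

lemma fsum_psd: "(\<And>i. i < n \<Longrightarrow> psd (f i)) \<Longrightarrow> psd (fsum n f)"
  by (induction n) (auto simp: fsum_Suc psd_add)

lemma fsum_psd_term: "(\<And>i. i < n \<Longrightarrow> psd (f i)) \<Longrightarrow> j < n \<Longrightarrow> psd (fsum n f \<ominus> f j)"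
proof (induction n)
  case (Suc n)
  have c: "f i \<in> cr" if "i < Suc n" for i using Suc.prems that by simp
  show ?case
  proof (cases "j = n")
    case True
    have "fsum (Suc n) f \<ominus> f j = fsum n f" using c True by (simp add: fsum_Suc abel)
    then show ?thesis using Suc.prems fsum_psd[of n f] by simp
  next
    case False
    have "fsum (Suc n) f \<ominus> f j = (fsum n f \<ominus> f j) \<oplus> f n" using c Suc.prems by (simp add: fsum_Suc abel)
    then show ?thesis using Suc False psd_add by simp
  qed
qed simp

lemma fsum_delta: "j < n \<Longrightarrow> x \<in> cr \<Longrightarrow> fsum n (\<lambda>i. if i = j then x else \<zero>) = x"
proof (induction n)
  case (Suc n)
  have s: "fsum (Suc n) (\<lambda>i. if i = j then x else \<zero>) =
     fsum n (\<lambda>i. if i = j then x else \<zero>) \<oplus> (if n = j then x else \<zero>)"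
    using Suc.prems by (intro fsum_Suc) auto
  show ?case
  proof (cases "n = j")
    case True
    then have "fsum n (\<lambda>i. if i = j then x else \<zero>) = \<zero>" by (intro fsum_zero) auto
    then show ?thesis using s True Suc.prems by simp
  next
    case False
    then show ?thesis using s Suc by simp
  qed
qed simp

text \<open>Columns of length \<open>n\<close> are functions of which only the first \<open>n\<close> values count; the inner product takes
values in the algebra and is linear in its second argument.\<close>

definition isvec :: "nat \<Rightarrow> (nat \<Rightarrow> 'a) \<Rightarrow> bool" where "isvec n v \<longleftrightarrow> (\<forall>i<n. v i \<in> cr)"
definition ip :: "nat \<Rightarrow> (nat \<Rightarrow> 'a) \<Rightarrow> (nat \<Rightarrow> 'a) \<Rightarrow> 'a" where "ip n v w = fsum n (\<lambda>i. st (v i) \<otimes> w i)"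
definition vnorm :: "nat \<Rightarrow> (nat \<Rightarrow> 'a) \<Rightarrow> real" where "vnorm n v = sqrt (nm (ip n v v))"

lemma vecD [simp]: "isvec n v \<Longrightarrow> i < n \<Longrightarrow> v i \<in> cr" by (simp add: isvec_def)
lemma ip_closed [simp, intro]: "isvec n v \<Longrightarrow> isvec n w \<Longrightarrow> ip n v w \<in> cr" by (simp add: ip_def)
lemma ip_st: "isvec n v \<Longrightarrow> isvec n w \<Longrightarrow> st (ip n v w) = ip n w v"
  unfolding ip_def by (subst fsum_st) (auto simp: st_mult intro!: fsum_cong)
lemma ip_mr: "isvec n v \<Longrightarrow> isvec n w \<Longrightarrow> a \<in> cr \<Longrightarrow> ip n v (\<lambda>i. w i \<otimes> a) = ip n v w \<otimes> a"
  unfolding ip_def by (subst fsum_mr) (auto simp: m_assoc intro!: fsum_cong)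
lemma ip_ml: "isvec n v \<Longrightarrow> isvec n w \<Longrightarrow> a \<in> cr \<Longrightarrow> ip n (\<lambda>i. v i \<otimes> a) w = st a \<otimes> ip n v w"
  unfolding ip_def by (subst fsum_ml) (auto simp: m_assoc st_mult intro!: fsum_cong)
lemma ip_scr: "isvec n v \<Longrightarrow> isvec n w \<Longrightarrow> ip n v (\<lambda>i. c \<odot> w i) = c \<odot> ip n v w"
  unfolding ip_def by (subst fsum_sc) (auto simp: sc_mr intro!: fsum_cong)
lemma ip_scl: "isvec n v \<Longrightarrow> isvec n w \<Longrightarrow> ip n (\<lambda>i. c \<odot> v i) w = cnj c \<odot> ip n v w"
  unfolding ip_def by (subst fsum_sc) (auto simp: sc_ml st_sc intro!: fsum_cong)
lemma fsum_addI: "(\<And>i. i < n \<Longrightarrow> h i = f i \<oplus> g i) \<Longrightarrow> (\<And>i. i < n \<Longrightarrow> f i \<in> cr) \<Longrightarrow> (\<And>i. i < n \<Longrightarrow> g i \<in> cr) \<Longrightarrow>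
    fsum n h = fsum n f \<oplus> fsum n g"
  using fsum_cong[of n h "\<lambda>i. f i \<oplus> g i"] fsum_add[of n f g] by simp
lemma fsum_minusI: "(\<And>i. i < n \<Longrightarrow> h i = f i \<ominus> g i) \<Longrightarrow> (\<And>i. i < n \<Longrightarrow> f i \<in> cr) \<Longrightarrow> (\<And>i. i < n \<Longrightarrow> g i \<in> cr) \<Longrightarrow>
    fsum n h = fsum n f \<ominus> fsum n g"
  using fsum_cong[of n h "\<lambda>i. f i \<ominus> g i"] fsum_minus[of n f g] by simp
lemma ip_addr: "isvec n v \<Longrightarrow> isvec n w \<Longrightarrow> isvec n u \<Longrightarrow> ip n v (\<lambda>i. w i \<oplus> u i) = ip n v w \<oplus> ip n v u"
  unfolding ip_def by (intro fsum_addI) (auto simp: r_distr)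
lemma ip_addl: "isvec n v \<Longrightarrow> isvec n w \<Longrightarrow> isvec n u \<Longrightarrow> ip n (\<lambda>i. w i \<oplus> u i) v = ip n w v \<oplus> ip n u v"
  unfolding ip_def by (intro fsum_addI) (auto simp: st_add l_distr)
lemma ip_minusr: "isvec n v \<Longrightarrow> isvec n w \<Longrightarrow> isvec n u \<Longrightarrow> ip n v (\<lambda>i. w i \<ominus> u i) = ip n v w \<ominus> ip n v u"
  unfolding ip_def by (intro fsum_minusI) (auto simp: a_minus_def r_distr r_minus)
lemma ip_minusl: "isvec n v \<Longrightarrow> isvec n w \<Longrightarrow> isvec n u \<Longrightarrow> ip n (\<lambda>i. w i \<ominus> u i) v = ip n w v \<ominus> ip n u v"
  unfolding ip_def by (intro fsum_minusI) (auto simp: a_minus_def st_add st_neg l_distr l_minus)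
lemma vec_ops [simp]: "isvec n v \<Longrightarrow> a \<in> cr \<Longrightarrow> isvec n (\<lambda>i. v i \<otimes> a)" "isvec n v \<Longrightarrow> isvec n (\<lambda>i. c \<odot> v i)"
  "isvec n v \<Longrightarrow> isvec n w \<Longrightarrow> isvec n (\<lambda>i. v i \<oplus> w i)"  "isvec n v \<Longrightarrow> isvec n w \<Longrightarrow> isvec n (\<lambda>i. v i \<ominus> w i)"
  by (auto simp: isvec_def)
lemma ip_psd: "isvec n v \<Longrightarrow> psd (ip n v v)"
  unfolding ip_def by (intro fsum_psd psd_st_mult) auto

text \<open>With \<open>a = \<langle>v, w\<rangle>\<close>, positivity of the inner square of \<open>Kw - va\<close> gives \<open>a\<^sup>*a \<le> K\<langle>w, w\<rangle>\<close>. A strictly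
positive bound \<open>K\<close> in place of \<open>\<parallel>\<langle>v, v\<rangle>\<parallel>\<close> avoids a separate treatment of \<open>v = 0\<close>.\<close>

lemma cauchy_schwarz_aux:
  assumes v: "isvec n v" and w: "isvec n w" and K: "K > 0" "nm (ip n v v) \<le> K"
  shows "(nm (ip n v w))\<^sup>2 \<le> K * nm (ip n w w)"
proof -
  let ?K = "complex_of_real K"
  define p a q where "p = ip n v v" and "a = ip n v w" and "q = ip n w w"
  have m: "p \<in> cr" "a \<in> cr" "q \<in> cr" using v w by (simp_all add: p_def a_def q_def)
  have sp: "st p = p" using v by (simp add: p_def ip_st)
  have sa: "ip n w v = st a" using v w by (simp add: a_def ip_st)
  define z where "z = (\<lambda>i. ?K \<odot> w i \<ominus> v i \<otimes> a)"
  have e: "ip n z z = (?K \<odot> (?K \<odot> q) \<ominus> ?K \<odot> (st a \<otimes> a)) \<ominus> (?K \<odot> (st a \<otimes> a) \<ominus> st a \<otimes> (p \<otimes> a))"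
    unfolding z_def using v w m
    by (simp add: ip_minusr ip_minusl ip_scr ip_scl ip_mr ip_ml sa p_def[symmetric] q_def[symmetric] a_def[symmetric]
       sc_ml sc_mr sc_minus sc_sc m_assoc)
  have "psd (rl K \<ominus> p)" using rl_minus_psd[OF m(1) sp] K(2) by (simp add: p_def)
  then have "psd (st a \<otimes> (rl K \<ominus> p) \<otimes> a)" using m by (intro psd_conj)
  also have "st a \<otimes> (rl K \<ominus> p) \<otimes> a = ?K \<odot> (st a \<otimes> a) \<ominus> st a \<otimes> (p \<otimes> a)"
    using m by (simp add: a_minus_def l_distr r_distr l_minus r_minus sc_ml sc_mr m_assoc)
  finally have P: "psd (?K \<odot> (st a \<otimes> a) \<ominus> st a \<otimes> (p \<otimes> a))" .
  have "psd (ip n z z)" unfolding z_def using v w m by (intro ip_psd) auto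
  from psd_add[OF this P] have "psd (?K \<odot> (?K \<odot> q) \<ominus> ?K \<odot> (st a \<otimes> a))"
    unfolding e using m by (simp add: minus_add_cancel)
  then have "psd (?K \<odot> (?K \<odot> q \<ominus> st a \<otimes> a))" using m by (simp add: sc_minus)
  then have "psd (complex_of_real (1/K) \<odot> (?K \<odot> (?K \<odot> q \<ominus> st a \<otimes> a)))" using K(1) by (rule_tac psd_scale[where t = "1/K"]) auto
  moreover have "complex_of_real (1/K) \<odot> (?K \<odot> (?K \<odot> q \<ominus> st a \<otimes> a)) = ?K \<odot> q \<ominus> st a \<otimes> a"
    using K(1) m by (subst sc_sc) simp_all
  ultimately have "psd (?K \<odot> q \<ominus> st a \<otimes> a)" by simp
  then have "nm (st a \<otimes> a) \<le> nm (?K \<odot> q)" using m by (intro psd_mono psd_st_mult) auto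
  then show ?thesis using nm_cs m K by (simp add: nm_sc a_def q_def)
qed

lemma vnorm_ge0 [simp]: "isvec n v \<Longrightarrow> 0 \<le> vnorm n v" by (simp add: vnorm_def)
lemma vnorm_sq: "isvec n v \<Longrightarrow> (vnorm n v)\<^sup>2 = nm (ip n v v)" by (simp add: vnorm_def)

lemma cauchy_schwarz:
  assumes v: "isvec n v" and w: "isvec n w" shows "nm (ip n v w) \<le> vnorm n v * vnorm n w"
proof -
  have "(nm (ip n v w))\<^sup>2 \<le> nm (ip n v v) * nm (ip n w w)"
  proof (rule tendsto_lowerbound[where F = "at_right 0"])
    show "((\<lambda>e. (nm (ip n v v) + e) * nm (ip n w w)) \<longlongrightarrow> nm (ip n v v) * nm (ip n w w)) (at_right 0)"
      by (auto intro!: tendsto_eq_intros)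
    show "\<forall>\<^sub>F e in at_right 0. (nm (ip n v w))\<^sup>2 \<le> (nm (ip n v v) + e) * nm (ip n w w)"
      unfolding eventually_at_filter
    proof (rule always_eventually, safe)
      fix e :: real assume "0 < e"
      then show "(nm (ip n v w))\<^sup>2 \<le> (nm (ip n v v) + e) * nm (ip n w w)"
        using v w by (intro cauchy_schwarz_aux) (auto simp: add_nonneg_pos)
    qed
  qed simp
  also have "\<dots> = (vnorm n v * vnorm n w)\<^sup>2" using v w by (simp add: power_mult_distrib vnorm_sq)
  finally show ?thesis using v w by (meson power2_le_imp_le mult_nonneg_nonneg vnorm_ge0)
qed

lemma vnorm_le_sum: assumes v: "isvec n v" shows "vnorm n v \<le> (\<Sum>i<n. nm (v i))"
proof -
  have "(vnorm n v)\<^sup>2 \<le> (\<Sum>i<n. nm (st (v i) \<otimes> v i))" using v unfolding vnorm_sq[OF v] ip_def by (intro fsum_nm) auto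
  also have "\<dots> = (\<Sum>i<n. (nm (v i))\<^sup>2)" using v by (intro sum.cong) (auto simp: nm_cs)
  also have "\<dots> \<le> (\<Sum>i<n. nm (v i))\<^sup>2"
    using v
  proof (induction n)
    case (Suc n)
    have "0 \<le> (\<Sum>i<n. nm (v i)) * nm (v n)" using Suc.prems
      by (intro mult_nonneg_nonneg sum_nonneg nm_ge0) auto
    moreover have "(\<Sum>i<n. (nm (v i))\<^sup>2) \<le> (\<Sum>i<n. nm (v i))\<^sup>2"
      using Suc by (auto simp: isvec_def)
    ultimately show ?case by (simp add: power2_sum)
  qed simp
  finally show ?thesis using v by (meson power2_le_imp_le sum_nonneg lessThan_iff nm_ge0 vecD)
qed

lemma nm_le_vnorm: assumes v: "isvec n v" and i: "i < n" shows "nm (v i) \<le> vnorm n v"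
proof -
  have "nm (st (v i) \<otimes> v i) \<le> nm (ip n v v)"
  proof (rule psd_mono)
    show "psd (ip n v v \<ominus> st (v i) \<otimes> v i)" unfolding ip_def
      by (rule fsum_psd_term[where f="\<lambda>i. st (v i) \<otimes> v i"]) (use v i in \<open>auto intro: psd_st_mult\<close>)
  qed (use v i in \<open>auto intro: psd_st_mult\<close>)
  then have "(nm (v i))\<^sup>2 \<le> (vnorm n v)\<^sup>2" using v i by (simp add: nm_cs vnorm_sq)
  then show ?thesis using v by (meson power2_le_imp_le vnorm_ge0)
qed

lemma vnorm_scale: "isvec n v \<Longrightarrow> vnorm n (\<lambda>i. c \<odot> v i) = cmod c * vnorm n v"
  unfolding vnorm_def
  by (simp add: ip_scr ip_scl sc_sc nm_sc norm_mult real_sqrt_mult)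

lemma vnorm_tri: assumes v: "isvec n v" and w: "isvec n w" shows "vnorm n (\<lambda>i. v i \<oplus> w i) \<le> vnorm n v + vnorm n w"
proof -
  have "(vnorm n (\<lambda>i. v i \<oplus> w i))\<^sup>2 = nm ((ip n v v \<oplus> ip n v w) \<oplus> (ip n w v \<oplus> ip n w w))"
    using v w by (simp add: vnorm_sq ip_addr ip_addl)
       (simp add: a_ac)
  also have "\<dots> \<le> (nm (ip n v v) + nm (ip n v w)) + (nm (ip n w v) + nm (ip n w w))"
    using v w by (meson add_mono nm_tri order_trans a_closed ip_closed)
  also have "\<dots> \<le> ((vnorm n v)\<^sup>2 + vnorm n v * vnorm n w) + (vnorm n w * vnorm n v + (vnorm n w)\<^sup>2)"
    using v w by (intro add_mono cauchy_schwarz) (auto simp: vnorm_sq)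
  also have "\<dots> = (vnorm n v + vnorm n w)\<^sup>2" by (simp add: power2_eq_square algebra_simps)
  finally show ?thesis using v w by (meson power2_le_imp_le add_nonneg_nonneg vnorm_ge0)
qed

definition is_mat :: "nat \<Rightarrow> (nat \<times> nat \<Rightarrow> 'a) \<Rightarrow> bool" where
  "is_mat n X \<longleftrightarrow> (\<forall>i<n. \<forall>j<n. X (i, j) \<in> cr)"
definition mat_vec :: "nat \<Rightarrow> (nat \<times> nat \<Rightarrow> 'a) \<Rightarrow> (nat \<Rightarrow> 'a) \<Rightarrow> nat \<Rightarrow> 'a" where
  "mat_vec n X v = (\<lambda>i. fsum n (\<lambda>j. X (i, j) \<otimes> v j))"
definition op_norm :: "nat \<Rightarrow> (nat \<times> nat \<Rightarrow> 'a) \<Rightarrow> real" where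
  "op_norm n X = (SUP v\<in>{v. isvec n v \<and> vnorm n v \<le> 1}. vnorm n (mat_vec n X v))"

lemma is_matD [simp]: "is_mat n X \<Longrightarrow> i < n \<Longrightarrow> j < n \<Longrightarrow> X (i, j) \<in> cr" by (simp add: is_mat_def)
lemma mat_vec_vec [simp]: "is_mat n X \<Longrightarrow> isvec n v \<Longrightarrow> isvec n (mat_vec n X v)"
  by (simp add: isvec_def mat_vec_def is_mat_def)

lemma mat_vec_bound: assumes X: "is_mat n X" and v: "isvec n v"
  shows "vnorm n (mat_vec n X v) \<le> (\<Sum>i<n. \<Sum>j<n. nm (X (i, j))) * vnorm n v"
proof -
  have "vnorm n (mat_vec n X v) \<le> (\<Sum>i<n. nm (mat_vec n X v i))" using X v by (intro vnorm_le_sum) simp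
  also have "\<dots> \<le> (\<Sum>i<n. \<Sum>j<n. nm (X (i, j)) * vnorm n v)"
  proof (intro sum_mono)
    fix i assume i: "i \<in> {..<n}"
    have "nm (mat_vec n X v i) \<le> (\<Sum>j<n. nm (X (i, j) \<otimes> v j))"
      unfolding mat_vec_def using X v i by (intro fsum_nm) auto
    also have "\<dots> \<le> (\<Sum>j<n. nm (X (i, j)) * vnorm n v)"
    proof (intro sum_mono)
      fix j assume j: "j \<in> {..<n}"
      have "nm (X (i, j) \<otimes> v j) \<le> nm (X (i, j)) * nm (v j)" using X v i j by (intro nm_mult) auto
      also have "\<dots> \<le> nm (X (i, j)) * vnorm n v" using X v i j by (intro mult_left_mono nm_le_vnorm) auto
      finally show "nm (X (i, j) \<otimes> v j) \<le> \<dots>" .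
    qed
    finally show "nm (mat_vec n X v i) \<le> (\<Sum>j<n. nm (X (i, j)) * vnorm n v)" .
  qed
  finally show ?thesis by (simp add: sum_distrib_right)
qed

lemma vec_zero: "isvec n (\<lambda>i. \<zero>)" "vnorm n (\<lambda>i. \<zero>) = 0"
  by (auto simp: isvec_def vnorm_def ip_def fsum_zero)

lemma op_norm_bdd: assumes X: "is_mat n X" shows "bdd_above ((\<lambda>v. vnorm n (mat_vec n X v)) ` {v. isvec n v \<and> vnorm n v \<le> 1})"
proof (rule bdd_aboveI2)
  fix v assume v: "v \<in> {v. isvec n v \<and> vnorm n v \<le> 1}"
  have "vnorm n (mat_vec n X v) \<le> (\<Sum>i<n. \<Sum>j<n. nm (X (i, j))) * vnorm n v" using v X mat_vec_bound by blast
  also have "\<dots> \<le> (\<Sum>i<n. \<Sum>j<n. nm (X (i, j))) * 1"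
    using v X by (intro mult_left_mono sum_nonneg) auto
  finally show "vnorm n (mat_vec n X v) \<le> (\<Sum>i<n. \<Sum>j<n. nm (X (i, j)))" by simp
qed

lemma op_norm_ge0: assumes X: "is_mat n X" shows "0 \<le> op_norm n X"
proof -
  have "vnorm n (mat_vec n X (\<lambda>i. \<zero>)) \<le> op_norm n X" unfolding op_norm_def
    by (rule cSUP_upper[OF _ op_norm_bdd[OF X]]) (simp add: vec_zero)
  then show ?thesis using X vec_zero by (meson mat_vec_vec order_trans vnorm_ge0)
qed

lemma mat_vec_scale: "is_mat n X \<Longrightarrow> isvec n v \<Longrightarrow> i < n \<Longrightarrow> mat_vec n X (\<lambda>j. c \<odot> v j) i = c \<odot> mat_vec n X v i"
  unfolding mat_vec_def by (subst fsum_sc) (auto simp: sc_mr intro!: fsum_cong)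

lemma vnorm_cong: "(\<And>i. i < n \<Longrightarrow> v i = w i) \<Longrightarrow> isvec n w \<Longrightarrow> vnorm n v = vnorm n w"
  unfolding vnorm_def ip_def by (subst fsum_cong[where g = "\<lambda>i. st (w i) \<otimes> w i"]) auto

lemma op_norm_bound: assumes X: "is_mat n X" and v: "isvec n v" shows "vnorm n (mat_vec n X v) \<le> op_norm n X * vnorm n v"
proof (cases "vnorm n v = 0")
  case True
  then show ?thesis using mat_vec_bound[OF X v] by simp
next
  case False
  then have p: "vnorm n v > 0" using vnorm_ge0[OF v] by linarith
  let ?c = "complex_of_real (1 / vnorm n v)"
  have cn: "cmod ?c = 1 / vnorm n v" unfolding norm_of_real using p by simp
  have u: "isvec n (\<lambda>i. ?c \<odot> v i)" "vnorm n (\<lambda>i. ?c \<odot> v i) \<le> 1"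
    using v p vnorm_scale[OF v, of ?c] unfolding cn by auto
  have "vnorm n (mat_vec n X (\<lambda>i. ?c \<odot> v i)) \<le> op_norm n X" unfolding op_norm_def
    by (rule cSUP_upper[OF _ op_norm_bdd[OF X]]) (use u in simp)
  also have "vnorm n (mat_vec n X (\<lambda>i. ?c \<odot> v i)) = vnorm n (\<lambda>i. ?c \<odot> mat_vec n X v i)"
    using X v by (intro vnorm_cong mat_vec_scale) auto
  also have "\<dots> = (1 / vnorm n v) * vnorm n (mat_vec n X v)" using vnorm_scale[of n "mat_vec n X v" ?c] X v unfolding cn by simp
  finally show ?thesis using p by (simp add: field_simps)
qed

lemma op_norm_least: assumes K: "\<And>v. isvec n v \<Longrightarrow> vnorm n (mat_vec n X v) \<le> K * vnorm n v" and K0: "K \<ge> 0"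
  shows "op_norm n X \<le> K"
  unfolding op_norm_def
proof (rule cSUP_least)
  show "{v. isvec n v \<and> vnorm n v \<le> 1} \<noteq> {}" using vec_zero by fastforce
  fix v assume "v \<in> {v. isvec n v \<and> vnorm n v \<le> 1}"
  then have "isvec n v" "K * vnorm n v \<le> K" using K0 by (auto simp: mult_left_le)
  then show "vnorm n (mat_vec n X v) \<le> K" using K[of v] by linarith
qed

lemma op_norm_le_sum: assumes X: "is_mat n X" shows "op_norm n X \<le> (\<Sum>i<n. \<Sum>j<n. nm (X (i, j)))"
  using mat_vec_bound[OF X] X by (intro op_norm_least) (auto intro!: sum_nonneg)

definition unit_vec :: "nat \<Rightarrow> nat \<Rightarrow> 'a" where "unit_vec j = (\<lambda>i. if i = j then \<one> else \<zero>)"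

lemma unit_vec: assumes "j < n" shows "isvec n (unit_vec j)" "vnorm n (unit_vec j) \<le> 1"
proof -
  show v: "isvec n (unit_vec j)" by (simp add: isvec_def unit_vec_def)
  have "vnorm n (unit_vec j) \<le> (\<Sum>i<n. nm (unit_vec j i))" using v by (rule vnorm_le_sum)
  also have "\<dots> = (\<Sum>i<n. if i = j then nm \<one> else 0)" by (intro sum.cong) (auto simp: unit_vec_def)
  also have "\<dots> \<le> 1" using nm_one_le assms by (simp add: sum.delta)
  finally show "vnorm n (unit_vec j) \<le> 1" .
qed

lemma mat_vec_unit_vec: assumes X: "is_mat n X" and ij: "i < n" "j < n" shows "mat_vec n X (unit_vec j) i = X (i, j)"
proof -
  have "mat_vec n X (unit_vec j) i = fsum n (\<lambda>k. if k = j then X (i, j) else \<zero>)"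
    unfolding mat_vec_def using X ij by (intro fsum_cong) (auto simp: unit_vec_def)
  then show ?thesis using fsum_delta X ij by simp
qed

lemma entry_le_op_norm: assumes X: "is_mat n X" and ij: "i < n" "j < n" shows "nm (X (i, j)) \<le> op_norm n X"
proof -
  have "nm (X (i, j)) \<le> vnorm n (mat_vec n X (unit_vec j))"
    using nm_le_vnorm[of n "mat_vec n X (unit_vec j)" i] X ij unit_vec mat_vec_unit_vec[OF X ij] by simp
  also have "\<dots> \<le> op_norm n X * vnorm n (unit_vec j)" using X ij unit_vec by (intro op_norm_bound)
  also have "\<dots> \<le> op_norm n X * 1" using unit_vec[OF ij(2)] op_norm_ge0[OF X] by (intro mult_left_mono)
  finally show ?thesis by simp
qed

end

section \<open>Matrix algebras\<close>

text \<open>Positivity of matrices makes no reference to a norm. Adding the operator norm on columns gives a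
C*-algebra with the same positive elements.\<close>

definition mat_cstar :: "nat \<Rightarrow> ('a, 's) cstar_scheme \<Rightarrow> (nat \<times> nat \<Rightarrow> 'a) cstar" where
  "mat_cstar n D = star_alg.extend (mat_alg n D) \<lparr>nrm = cstar_alg.op_norm D n\<rparr>"

lemma mat_cstar_simps:
  "carrier (mat_cstar n D) = carrier (mat_alg n D)"
  "monoid.mult (mat_cstar n D) = monoid.mult (mat_alg n D)"
  "one (mat_cstar n D) = one (mat_alg n D)"
  "zero (mat_cstar n D) = zero (mat_alg n D)"
  "add (mat_cstar n D) = add (mat_alg n D)"
  "smult (mat_cstar n D) = smult (mat_alg n D)"
  "adj (mat_cstar n D) = adj (mat_alg n D)"
  "nrm (mat_cstar n D) = cstar_alg.op_norm D n"
  by (simp_all add: mat_cstar_def star_alg.defs mat_alg_def)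

lemma positive_star_alg_cong:
  fixes D :: "('a, 's) star_alg_scheme" and E :: "('a, 't) star_alg_scheme"
  assumes "carrier D = carrier E" "monoid.mult D = monoid.mult E" "one D = one E"
    "add D = add E" "zero D = zero E" "smult D = smult E" "adj D = adj E"
  shows "positive D x \<longleftrightarrow> positive E x"
  using assms by (simp add: positive_def spectrum_def Units_def a_minus_def a_inv_def m_inv_def)

lemma positive_mat_cstar: "positive (mat_alg n D) x \<longleftrightarrow> positive (mat_cstar n D) x"
  by (rule positive_star_alg_cong) (simp_all add: mat_cstar_simps)

text \<open>Completeness is only asked for sequences with geometrically decreasing increments, as every Cauchy
sequence has such a subsequence.\<close>

lemma cstar_algI:
  fixes E :: "('b, 't) cstar_scheme" (structure)
  assumes r: "ring E" and md: "module complex_cstar E"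
    and "\<And>x y c. x \<in> carrier E \<Longrightarrow> y \<in> carrier E \<Longrightarrow> (c \<odot> x) \<otimes> y = c \<odot> (x \<otimes> y)"
    and "\<And>x y c. x \<in> carrier E \<Longrightarrow> y \<in> carrier E \<Longrightarrow> x \<otimes> (c \<odot> y) = c \<odot> (x \<otimes> y)"
    and "\<And>x. x \<in> carrier E \<Longrightarrow> adj E x \<in> carrier E"
    and "\<And>x. x \<in> carrier E \<Longrightarrow> adj E (adj E x) = x"
    and "\<And>x y. x \<in> carrier E \<Longrightarrow> y \<in> carrier E \<Longrightarrow> adj E (x \<oplus> y) = adj E x \<oplus> adj E y"
    and "\<And>x c. x \<in> carrier E \<Longrightarrow> adj E (c \<odot> x) = cnj c \<odot> adj E x"
    and "\<And>x y. x \<in> carrier E \<Longrightarrow> y \<in> carrier E \<Longrightarrow> adj E (x \<otimes> y) = adj E y \<otimes> adj E x"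
    and ge0: "\<And>x. x \<in> carrier E \<Longrightarrow> 0 \<le> nrm E x"
    and eq0: "\<And>x. x \<in> carrier E \<Longrightarrow> nrm E x = 0 \<longleftrightarrow> x = \<zero>"
    and tri: "\<And>x y. x \<in> carrier E \<Longrightarrow> y \<in> carrier E \<Longrightarrow> nrm E (x \<oplus> y) \<le> nrm E x + nrm E y"
    and sm: "\<And>x c. x \<in> carrier E \<Longrightarrow> nrm E (c \<odot> x) = cmod c * nrm E x"
    and "\<And>x y. x \<in> carrier E \<Longrightarrow> y \<in> carrier E \<Longrightarrow> nrm E (x \<otimes> y) \<le> nrm E x * nrm E y"
    and "\<And>x. x \<in> carrier E \<Longrightarrow> nrm E (adj E x \<otimes> x) = (nrm E x)\<^sup>2"
    and fast: "\<And>s. (\<And>n. s n \<in> carrier E) \<Longrightarrow> (\<And>n. nrm E (s (Suc n) \<ominus> s n) \<le> (1/2) ^ n)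
       \<Longrightarrow> \<exists>l\<in>carrier E. (\<lambda>n. nrm E (s n \<ominus> l)) \<longlonglongrightarrow> 0"
  shows "cstar_alg E"
proof -
  interpret R: ring E by (rule r)
  interpret M: module complex_cstar E by (rule md)
  have neg: "\<ominus> x = (-1) \<odot> x" if x: "x \<in> carrier E" for x
  proof -
    have "(-1) \<odot> x \<oplus> x = (-1 + 1) \<odot> x"
      using M.smult_l_distr[of "-1" 1 x] M.smult_one[of x] x by (simp add: complex_cstar_def)
    also have "\<dots> = \<zero>" using M.smult_l_null[of x] x by (simp add: complex_cstar_def)
    finally show ?thesis using x M.smult_closed[of "-1" x] R.minus_equality by simp
  qed
  have sym: "nrm E (x \<ominus> y) = nrm E (y \<ominus> x)" if m: "x \<in> carrier E" "y \<in> carrier E" for x y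
  proof -
    have "y \<ominus> x = \<ominus> (x \<ominus> y)" using m by (simp add: a_minus_def R.minus_add R.a_comm)
    then show ?thesis using neg[of "x \<ominus> y"] sm[of "x \<ominus> y" "-1"] m by simp
  qed
  have split: "x \<ominus> z = (x \<ominus> y) \<oplus> (y \<ominus> z)" if m: "x \<in> carrier E" "y \<in> carrier E" "z \<in> carrier E" for x y z
    using m by (simp add: a_minus_def R.a_assoc R.r_neg1)
  have t3: "nrm E (x \<ominus> z) \<le> nrm E (x \<ominus> y) + nrm E (y \<ominus> z)"
    if m: "x \<in> carrier E" "y \<in> carrier E" "z \<in> carrier E" for x y z
    using tri[of "x \<ominus> y" "y \<ominus> z"] split[OF m] m by simp
  interpret MS: Metric_space "carrier E" "cdist E"
  proof
    fix x y z
    show "0 \<le> cdist E x y" by (simp add: cdist_def ge0)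
    show "cdist E x y = cdist E y x" using sym by (simp add: cdist_def)
    show "cdist E x y = 0 \<longleftrightarrow> x = y" if m: "x \<in> carrier E" "y \<in> carrier E"
    proof -
      have "x \<ominus> y = \<zero> \<longleftrightarrow> x = y" proof
        assume "x \<ominus> y = \<zero>"
        then have "(x \<ominus> y) \<oplus> y = \<zero> \<oplus> y" by simp
        then show "x = y" using m by (simp add: a_minus_def R.a_assoc R.l_neg)
      qed (use m in \<open>simp add: a_minus_def R.r_neg\<close>)
      then show ?thesis using m eq0[of "x \<ominus> y"] by (simp add: cdist_def)
    qed
    show "cdist E x z \<le> cdist E x y + cdist E y z"
      if "x \<in> carrier E" "y \<in> carrier E" "z \<in> carrier E"
      using t3 that by (simp add: cdist_def)
  qed
  have "MS.mcomplete"
    unfolding MS.mcomplete_def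
  proof (intro allI impI)
    fix s assume s: "MS.MCauchy s"
    have sc: "s k \<in> carrier E" for k using s unfolding MS.MCauchy_def by auto
    have "\<exists>N. \<forall>m\<ge>N. \<forall>n\<ge>N. cdist E (s m) (s n) < (1/2) ^ k" for k
      using s unfolding MS.MCauchy_def by (metis zero_less_divide_1_iff zero_less_numeral zero_less_power)
    then obtain N where N: "\<And>k m n. m \<ge> N k \<Longrightarrow> n \<ge> N k \<Longrightarrow> cdist E (s m) (s n) < (1/2) ^ k" by metis
    define K where "K = (\<lambda>k. Max (N ` {..k}))"
    have KN: "N j \<le> K k" if "j \<le> k" for j k using that by (auto simp: K_def)
    have fsum: "nrm E (s (K (Suc k)) \<ominus> s (K k)) \<le> (1/2) ^ k" for k
      using N[of k "K (Suc k)" "K k"] KN[of k k] KN[of k "Suc k"] sc by (simp add: cdist_def)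
    obtain l where l: "l \<in> carrier E" "(\<lambda>k. nrm E (s (K k) \<ominus> l)) \<longlonglongrightarrow> 0"
      using fast[of "\<lambda>k. s (K k)"] fsum sc by auto
    have "(\<lambda>n. cdist E (s n) l) \<longlonglongrightarrow> 0"
    proof (rule LIMSEQ_I)
      fix e :: real assume e: "e > 0"
      obtain k1 where k1: "\<And>k. k \<ge> k1 \<Longrightarrow> nrm E (s (K k) \<ominus> l) < e/2"
        using LIMSEQ_D[OF l(2), of "e/2"] e
        by (metis abs_ge_self diff_zero half_gt_zero order_le_less_trans real_norm_def)
      obtain k2 where k2: "(1/2) ^ k2 < e/2" using real_arch_pow_inv[of "e/2" "1/2"] e by auto
      define k where "k = max k1 k2"
      have kk: "(1/2) ^ k \<le> (1/2 :: real) ^ k2" unfolding k_def by (intro power_decreasing) auto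
      have "norm (cdist E (s n) l - 0) < e" if n: "n \<ge> N k" for n
      proof -
        have "nrm E (s n \<ominus> s (K k)) < (1/2) ^ k" using N[of k n "K k"] n KN[of k k] sc by (simp add: cdist_def)
        then have "nrm E (s n \<ominus> s (K k)) < e/2" using kk k2 by linarith
        moreover have "nrm E (s (K k) \<ominus> l) < e/2" using k1 by (simp add: k_def)
        ultimately have "nrm E (s n \<ominus> l) < e" using t3[OF sc sc l(1), of n "K k"] by linarith
        then show ?thesis using sc l ge0[of "s n \<ominus> l"] by (simp add: cdist_def)
      qed
      then show "\<exists>no. \<forall>n\<ge>no. norm (cdist E (s n) l - 0) < e" by blast
    qed
    then have "limitin MS.mtopology s l sequentially"
      unfolding MS.limitin_metric using l sc by (auto simp: order_tendsto_iff elim: eventually_mono)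
    then show "\<exists>l. limitin MS.mtopology s l sequentially" by blast
  qed
  then have "unital_cstar_algebra E"
    using assms(1-15) unfolding unital_cstar_algebra_def unital_cstar_algebra_axioms_def by blast
  then show ?thesis by (rule cstar_alg.intro)
qed

context cstar_alg
begin

abbreviation "MM n \<equiv> mat_cstar n D"

lemma mat_carrier: "X \<in> carrier (MM n) \<longleftrightarrow> X \<in> extensional ({..<n} \<times> {..<n}) \<and> is_mat n X"
  by (auto simp: mat_cstar_simps mat_alg_def is_mat_def PiE_iff)

lemma mat_eqI: "X \<in> carrier (MM n) \<Longrightarrow> Y \<in> carrier (MM n) \<Longrightarrow>
   (\<And>i j. i < n \<Longrightarrow> j < n \<Longrightarrow> X (i, j) = Y (i, j)) \<Longrightarrow> X = Y"
  unfolding mat_carrier by (rule extensionalityI[of X "{..<n} \<times> {..<n}" Y]) auto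

lemma mat_mult: "i < n \<Longrightarrow> j < n \<Longrightarrow> (X \<otimes>\<^bsub>MM n\<^esub> Y) (i, j) = fsum n (\<lambda>k. X (i, k) \<otimes> Y (k, j))"
  by (simp add: mat_cstar_simps mat_alg_def)
lemma mat_add: "i < n \<Longrightarrow> j < n \<Longrightarrow> (X \<oplus>\<^bsub>MM n\<^esub> Y) (i, j) = X (i, j) \<oplus> Y (i, j)"
  by (simp add: mat_cstar_simps mat_alg_def)
lemma mat_smult: "i < n \<Longrightarrow> j < n \<Longrightarrow> (c \<odot>\<^bsub>MM n\<^esub> Y) (i, j) = c \<odot> Y (i, j)"
  by (simp add: mat_cstar_simps mat_alg_def)
lemma mat_adj: "i < n \<Longrightarrow> j < n \<Longrightarrow> (adj (MM n) Y) (i, j) = st (Y (j, i))"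
  by (simp add: mat_cstar_simps mat_alg_def)
lemma mat_one: "i < n \<Longrightarrow> j < n \<Longrightarrow> \<one>\<^bsub>MM n\<^esub> (i, j) = (if i = j then \<one> else \<zero>)"
  by (simp add: mat_cstar_simps mat_alg_def)
lemma mat_zero: "i < n \<Longrightarrow> j < n \<Longrightarrow> \<zero>\<^bsub>MM n\<^esub> (i, j) = \<zero>"
  by (simp add: mat_cstar_simps mat_alg_def)
lemmas mat_ops = mat_mult mat_add mat_smult mat_adj mat_one mat_zero

lemma mat_ext: "X \<otimes>\<^bsub>MM n\<^esub> Y \<in> extensional ({..<n} \<times> {..<n})" "X \<oplus>\<^bsub>MM n\<^esub> Y \<in> extensional ({..<n} \<times> {..<n})"
  "c \<odot>\<^bsub>MM n\<^esub> Y \<in> extensional ({..<n} \<times> {..<n})" "adj (MM n) Y \<in> extensional ({..<n} \<times> {..<n})"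
  "\<one>\<^bsub>MM n\<^esub> \<in> extensional ({..<n} \<times> {..<n})" "\<zero>\<^bsub>MM n\<^esub> \<in> extensional ({..<n} \<times> {..<n})"
  by (simp_all add: mat_cstar_simps mat_alg_def)

lemma mat_closed [simp, intro]:
  "X \<in> carrier (MM n) \<Longrightarrow> Y \<in> carrier (MM n) \<Longrightarrow> X \<otimes>\<^bsub>MM n\<^esub> Y \<in> carrier (MM n)"
  "X \<in> carrier (MM n) \<Longrightarrow> Y \<in> carrier (MM n) \<Longrightarrow> X \<oplus>\<^bsub>MM n\<^esub> Y \<in> carrier (MM n)"
  "X \<in> carrier (MM n) \<Longrightarrow> c \<odot>\<^bsub>MM n\<^esub> X \<in> carrier (MM n)"
  "X \<in> carrier (MM n) \<Longrightarrow> adj (MM n) X \<in> carrier (MM n)"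
  "\<one>\<^bsub>MM n\<^esub> \<in> carrier (MM n)" "\<zero>\<^bsub>MM n\<^esub> \<in> carrier (MM n)"
  by (simp_all add: mat_carrier mat_ext is_mat_def mat_ops)

lemma mat_entry [simp]: "X \<in> carrier (MM n) \<Longrightarrow> i < n \<Longrightarrow> j < n \<Longrightarrow> X (i, j) \<in> cr"
  by (simp add: mat_carrier is_mat_def)

lemma mat_is_mat [simp]: "X \<in> carrier (MM n) \<Longrightarrow> is_mat n X"
  by (simp add: mat_carrier)

lemma fsum_delta_mult: "i < n \<Longrightarrow> (\<And>k. k < n \<Longrightarrow> f k \<in> cr) \<Longrightarrow> fsum n (\<lambda>k. (if i = k then \<one> else \<zero>) \<otimes> f k) = f i"
proof -
  assume a: "i < n" "\<And>k. k < n \<Longrightarrow> f k \<in> cr"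
  have "fsum n (\<lambda>k. (if i = k then \<one> else \<zero>) \<otimes> f k) = fsum n (\<lambda>k. if k = i then f i else \<zero>)"
    using a by (intro fsum_cong) auto
  then show ?thesis using fsum_delta a by simp
qed

lemma fsum_mult_delta: "i < n \<Longrightarrow> (\<And>k. k < n \<Longrightarrow> f k \<in> cr) \<Longrightarrow> fsum n (\<lambda>k. f k \<otimes> (if k = i then \<one> else \<zero>)) = f i"
proof -
  assume a: "i < n" "\<And>k. k < n \<Longrightarrow> f k \<in> cr"
  have "fsum n (\<lambda>k. f k \<otimes> (if k = i then \<one> else \<zero>)) = fsum n (\<lambda>k. if k = i then f i else \<zero>)"
    using a by (intro fsum_cong) auto
  then show ?thesis using fsum_delta a by simp
qed

lemma fsum_mlI: "a \<in> cr \<Longrightarrow> (\<And>i. i < n \<Longrightarrow> f i \<in> cr) \<Longrightarrow> (\<And>i. i < n \<Longrightarrow> h i = a \<otimes> f i) \<Longrightarrow> fsum n h = a \<otimes> fsum n f"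
  using fsum_ml[of n f a] fsum_cong[of n h "\<lambda>i. a \<otimes> f i"] by simp

lemma fsum_mrI: "a \<in> cr \<Longrightarrow> (\<And>i. i < n \<Longrightarrow> f i \<in> cr) \<Longrightarrow> (\<And>i. i < n \<Longrightarrow> h i = f i \<otimes> a) \<Longrightarrow> fsum n h = fsum n f \<otimes> a"
  using fsum_mr[of n f a] fsum_cong[of n h "\<lambda>i. f i \<otimes> a"] by simp

lemma mat_assoc:
  assumes X: "X \<in> carrier (MM n)" and Y: "Y \<in> carrier (MM n)" and Z: "Z \<in> carrier (MM n)"
  shows "X \<otimes>\<^bsub>MM n\<^esub> Y \<otimes>\<^bsub>MM n\<^esub> Z = X \<otimes>\<^bsub>MM n\<^esub> (Y \<otimes>\<^bsub>MM n\<^esub> Z)"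
proof (rule mat_eqI)
  fix i j assume ij: "i < n" "j < n"
  have "(X \<otimes>\<^bsub>MM n\<^esub> Y \<otimes>\<^bsub>MM n\<^esub> Z) (i, j) = fsum n (\<lambda>k. (X \<otimes>\<^bsub>MM n\<^esub> Y) (i, k) \<otimes> Z (k, j))"
    using ij by (simp add: mat_mult)
  also have "\<dots> = fsum n (\<lambda>k. fsum n (\<lambda>l. X (i, l) \<otimes> Y (l, k) \<otimes> Z (k, j)))"
    using X Y Z ij by (intro fsum_cong) (auto simp: mat_mult intro!: fsum_mrI[symmetric])
  also have "\<dots> = fsum n (\<lambda>l. fsum n (\<lambda>k. X (i, l) \<otimes> Y (l, k) \<otimes> Z (k, j)))"
    using X Y Z ij by (intro fsum_swap) auto
  also have "\<dots> = fsum n (\<lambda>l. X (i, l) \<otimes> (Y \<otimes>\<^bsub>MM n\<^esub> Z) (l, j))"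
    using X Y Z ij by (intro fsum_cong) (auto simp: mat_mult m_assoc intro!: fsum_mlI)
  also have "\<dots> = (X \<otimes>\<^bsub>MM n\<^esub> (Y \<otimes>\<^bsub>MM n\<^esub> Z)) (i, j)" using ij by (simp add: mat_mult)
  finally show "(X \<otimes>\<^bsub>MM n\<^esub> Y \<otimes>\<^bsub>MM n\<^esub> Z) (i, j) = (X \<otimes>\<^bsub>MM n\<^esub> (Y \<otimes>\<^bsub>MM n\<^esub> Z)) (i, j)" .
qed (use X Y Z in auto)

lemma mat_ring: "ring (MM n)"
proof (rule ringI)
  show "abelian_group (MM n)"
  proof (rule abelian_groupI)
    fix X assume X: "X \<in> carrier (MM n)"
    show "\<exists>Y\<in>carrier (MM n). Y \<oplus>\<^bsub>MM n\<^esub> X = \<zero>\<^bsub>MM n\<^esub>"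
      by (rule bexI[of _ "(-1) \<odot>\<^bsub>MM n\<^esub> X"], rule mat_eqI)
         (use X in \<open>auto simp: mat_ops sc_neg[symmetric] l_neg\<close>)
  qed (auto intro!: mat_eqI simp: mat_ops a_ac)
  show "monoid (MM n)"
  proof (rule monoidI)
    show "\<one>\<^bsub>MM n\<^esub> \<otimes>\<^bsub>MM n\<^esub> X = X" if X: "X \<in> carrier (MM n)" for X
    proof (rule mat_eqI)
      fix i j assume ij: "i < n" "j < n"
      have "(\<one>\<^bsub>MM n\<^esub> \<otimes>\<^bsub>MM n\<^esub> X) (i, j) = fsum n (\<lambda>k. (if i = k then \<one> else \<zero>) \<otimes> X (k, j))"
        unfolding mat_mult[OF ij] using X ij by (intro fsum_cong) (auto simp: mat_one)
      then show "(\<one>\<^bsub>MM n\<^esub> \<otimes>\<^bsub>MM n\<^esub> X) (i, j) = X (i, j)" using X ij by (simp only: fsum_delta_mult mat_entry)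
    qed (use X in auto)
    show "X \<otimes>\<^bsub>MM n\<^esub> \<one>\<^bsub>MM n\<^esub> = X" if X: "X \<in> carrier (MM n)" for X
    proof (rule mat_eqI)
      fix i j assume ij: "i < n" "j < n"
      have "(X \<otimes>\<^bsub>MM n\<^esub> \<one>\<^bsub>MM n\<^esub>) (i, j) = fsum n (\<lambda>k. X (i, k) \<otimes> (if k = j then \<one> else \<zero>))"
        unfolding mat_mult[OF ij] using X ij by (intro fsum_cong) (auto simp: mat_one)
      then show "(X \<otimes>\<^bsub>MM n\<^esub> \<one>\<^bsub>MM n\<^esub>) (i, j) = X (i, j)" using X ij by (simp only: fsum_mult_delta mat_entry)
    qed (use X in auto)
  qed (auto intro: mat_assoc)
  fix X Y Z assume X: "X \<in> carrier (MM n)" and Y: "Y \<in> carrier (MM n)" and Z: "Z \<in> carrier (MM n)"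
  show "(X \<oplus>\<^bsub>MM n\<^esub> Y) \<otimes>\<^bsub>MM n\<^esub> Z = X \<otimes>\<^bsub>MM n\<^esub> Z \<oplus>\<^bsub>MM n\<^esub> Y \<otimes>\<^bsub>MM n\<^esub> Z"
    using X Y Z by (intro mat_eqI) (auto simp: mat_mult mat_add l_distr intro!: fsum_addI)
  show "Z \<otimes>\<^bsub>MM n\<^esub> (X \<oplus>\<^bsub>MM n\<^esub> Y) = Z \<otimes>\<^bsub>MM n\<^esub> X \<oplus>\<^bsub>MM n\<^esub> Z \<otimes>\<^bsub>MM n\<^esub> Y"
    using X Y Z by (intro mat_eqI) (auto simp: mat_mult mat_add r_distr intro!: fsum_addI)
qed

lemma complex_cring: "cring complex_cstar"
  using is_module unfolding module_def by blast

lemma mat_module: "module complex_cstar (MM n)"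
proof -
  interpret M: ring "MM n" by (rule mat_ring)
  show ?thesis
    by (intro moduleI complex_cring M.abelian_group_axioms)
       (auto intro!: mat_eqI simp: complex_cstar_def mat_ops sc_addl sc_addr sc_sc)
qed

lemma mat_vec_adj:
  assumes X: "X \<in> carrier (MM n)" and v: "isvec n v" and w: "isvec n w"
  shows "ip n (mat_vec n X v) w = ip n v (mat_vec n (adj (MM n) X) w)"
proof -
  have "ip n (mat_vec n X v) w = fsum n (\<lambda>i. fsum n (\<lambda>j. st (v j) \<otimes> (st (X (i, j)) \<otimes> w i)))"
    unfolding ip_def mat_vec_def using X v w by (intro fsum_cong) (auto simp: fsum_st st_mult m_assoc intro!: fsum_mrI[symmetric])
  also have "\<dots> = fsum n (\<lambda>j. fsum n (\<lambda>i. st (v j) \<otimes> (st (X (i, j)) \<otimes> w i)))"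
    using X v w by (intro fsum_swap) auto
  also have "\<dots> = ip n v (mat_vec n (adj (MM n) X) w)"
    unfolding ip_def mat_vec_def using X v w by (intro fsum_cong) (auto simp: mat_adj intro!: fsum_mlI)
  finally show ?thesis .
qed

lemma mat_vec_mult:
  assumes X: "X \<in> carrier (MM n)" and Y: "Y \<in> carrier (MM n)" and v: "isvec n v" and i: "i < n"
  shows "mat_vec n (X \<otimes>\<^bsub>MM n\<^esub> Y) v i = mat_vec n X (mat_vec n Y v) i"
proof -
  have "mat_vec n (X \<otimes>\<^bsub>MM n\<^esub> Y) v i = fsum n (\<lambda>j. fsum n (\<lambda>k. X (i, k) \<otimes> (Y (k, j) \<otimes> v j)))"
    unfolding mat_vec_def using X Y v i by (intro fsum_cong) (auto simp: mat_mult m_assoc intro!: fsum_mrI[symmetric])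
  also have "\<dots> = fsum n (\<lambda>k. fsum n (\<lambda>j. X (i, k) \<otimes> (Y (k, j) \<otimes> v j)))"
    using X Y v i by (intro fsum_swap) auto
  also have "\<dots> = mat_vec n X (mat_vec n Y v) i"
    unfolding mat_vec_def using X Y v i by (intro fsum_cong) (auto intro!: fsum_mlI)
  finally show ?thesis .
qed

lemma vnorm_ip_le: "isvec n v \<Longrightarrow> isvec n w \<Longrightarrow> ip n v v = ip n u w \<Longrightarrow> isvec n u \<Longrightarrow> (vnorm n v)\<^sup>2 \<le> vnorm n u * vnorm n w"
  using cauchy_schwarz[of n u w] by (simp add: vnorm_sq)

lemma op_norm_mult: assumes X: "X \<in> carrier (MM n)" and Y: "Y \<in> carrier (MM n)"
  shows "op_norm n (X \<otimes>\<^bsub>MM n\<^esub> Y) \<le> op_norm n X * op_norm n Y"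
proof (rule op_norm_least)
  fix v assume v: "isvec n v"
  have "vnorm n (mat_vec n (X \<otimes>\<^bsub>MM n\<^esub> Y) v) = vnorm n (mat_vec n X (mat_vec n Y v))"
    using X Y v by (intro vnorm_cong mat_vec_mult) auto
  also have "\<dots> \<le> op_norm n X * vnorm n (mat_vec n Y v)" using X Y v by (intro op_norm_bound) auto
  also have "\<dots> \<le> op_norm n X * (op_norm n Y * vnorm n v)" using X Y v by (intro mult_left_mono op_norm_bound op_norm_ge0) auto
  finally show "vnorm n (mat_vec n (X \<otimes>\<^bsub>MM n\<^esub> Y) v) \<le> op_norm n X * op_norm n Y * vnorm n v" by simp
qed (use X Y op_norm_ge0 in auto)

text \<open>Cauchy-Schwarz applied to \<open>\<parallel>Xv\<parallel>\<^sup>2 = \<parallel>\<langle>v, X\<^sup>*Xv\<rangle>\<parallel>\<close>.\<close>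

lemma op_norm_cs_le: assumes X: "X \<in> carrier (MM n)"
  shows "(op_norm n X)\<^sup>2 \<le> op_norm n (adj (MM n) X \<otimes>\<^bsub>MM n\<^esub> X)"
proof -
  let ?P = "adj (MM n) X \<otimes>\<^bsub>MM n\<^esub> X"
  have P: "?P \<in> carrier (MM n)" using X by simp
  have "op_norm n X \<le> sqrt (op_norm n ?P)"
  proof (rule op_norm_least)
    fix v assume v: "isvec n v"
    have "ip n (mat_vec n X v) (mat_vec n X v) = ip n v (mat_vec n (adj (MM n) X) (mat_vec n X v))"
      using X v by (intro mat_vec_adj) auto
    also have "\<dots> = ip n v (mat_vec n ?P v)"
      unfolding ip_def using X v P mat_vec_mult[of "adj (MM n) X" n X v]
        vecD[OF mat_vec_vec[OF mat_is_mat[OF P] v]]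
      by (intro fsum_cong) auto
    finally have "(vnorm n (mat_vec n X v))\<^sup>2 \<le> vnorm n v * vnorm n (mat_vec n ?P v)"
      using X v P by (intro vnorm_ip_le) auto
    also have "\<dots> \<le> vnorm n v * (op_norm n ?P * vnorm n v)" using P v by (intro mult_left_mono op_norm_bound) auto
    also have "\<dots> = (sqrt (op_norm n ?P) * vnorm n v)\<^sup>2" using op_norm_ge0[of n ?P] P
      by (simp add: power_mult_distrib power2_eq_square[of "vnorm n v"])
    finally show "vnorm n (mat_vec n X v) \<le> sqrt (op_norm n ?P) * vnorm n v"
      using v P by (meson power2_le_imp_le mult_nonneg_nonneg vnorm_ge0 real_sqrt_ge_zero op_norm_ge0 mat_is_mat)
  qed (use P op_norm_ge0 in auto)
  then have "(op_norm n X)\<^sup>2 \<le> (sqrt (op_norm n ?P))\<^sup>2" using X op_norm_ge0 by (intro power_mono) auto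
  then show ?thesis using op_norm_ge0[of n ?P] P by simp
qed

lemma mat_adj_adj: "X \<in> carrier (MM n) \<Longrightarrow> adj (MM n) (adj (MM n) X) = X"
  by (intro mat_eqI) (auto simp: mat_adj)

lemma op_norm_adj_ge: assumes X: "X \<in> carrier (MM n)" shows "op_norm n X \<le> op_norm n (adj (MM n) X)"
proof (cases "op_norm n X = 0")
  case True
  then show ?thesis using X op_norm_ge0[of n "adj (MM n) X"] by simp
next
  case False
  then have p: "op_norm n X > 0" using X op_norm_ge0[of n X] by simp
  have "(op_norm n X)\<^sup>2 \<le> op_norm n (adj (MM n) X) * op_norm n X"
    using op_norm_cs_le[OF X] op_norm_mult[of "adj (MM n) X" n X] X by simp
  then show ?thesis using p by (simp add: power2_eq_square)
qed

lemma op_norm_cs: assumes X: "X \<in> carrier (MM n)"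
  shows "op_norm n (adj (MM n) X \<otimes>\<^bsub>MM n\<^esub> X) = (op_norm n X)\<^sup>2"
proof -
  have "op_norm n (adj (MM n) X) = op_norm n X"
    using op_norm_adj_ge[OF X] op_norm_adj_ge[of "adj (MM n) X" n] X mat_adj_adj[OF X] by simp
  then show ?thesis using op_norm_cs_le[OF X] op_norm_mult[of "adj (MM n) X" n X] X by (simp add: power2_eq_square)
qed

lemma op_norm_tri: assumes X: "X \<in> carrier (MM n)" and Y: "Y \<in> carrier (MM n)"
  shows "op_norm n (X \<oplus>\<^bsub>MM n\<^esub> Y) \<le> op_norm n X + op_norm n Y"
proof (rule op_norm_least)
  fix v assume v: "isvec n v"
  have "vnorm n (mat_vec n (X \<oplus>\<^bsub>MM n\<^esub> Y) v) = vnorm n (\<lambda>i. mat_vec n X v i \<oplus> mat_vec n Y v i)"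
    by (rule vnorm_cong) (use X Y v in \<open>auto simp: mat_vec_def mat_add l_distr isvec_def intro!: fsum_addI\<close>)
  also have "\<dots> \<le> vnorm n (mat_vec n X v) + vnorm n (mat_vec n Y v)" using X Y v by (intro vnorm_tri) auto
  also have "\<dots> \<le> op_norm n X * vnorm n v + op_norm n Y * vnorm n v" using X Y v by (intro add_mono op_norm_bound) auto
  finally show "vnorm n (mat_vec n (X \<oplus>\<^bsub>MM n\<^esub> Y) v) \<le> (op_norm n X + op_norm n Y) * vnorm n v" by (simp add: algebra_simps)
qed (use X Y op_norm_ge0 in auto)

lemma op_norm_smult_le: assumes X: "X \<in> carrier (MM n)" shows "op_norm n (c \<odot>\<^bsub>MM n\<^esub> X) \<le> cmod c * op_norm n X"
proof (rule op_norm_least)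
  fix v assume v: "isvec n v"
  have "vnorm n (mat_vec n (c \<odot>\<^bsub>MM n\<^esub> X) v) = vnorm n (\<lambda>i. c \<odot> mat_vec n X v i)"
    by (rule vnorm_cong) (use X v in \<open>auto simp: mat_vec_def mat_smult fsum_sc sc_ml isvec_def intro!: fsum_cong\<close>)
  also have "\<dots> = cmod c * vnorm n (mat_vec n X v)" using X v by (intro vnorm_scale) auto
  also have "\<dots> \<le> cmod c * (op_norm n X * vnorm n v)" using X v by (intro mult_left_mono op_norm_bound) auto
  finally show "vnorm n (mat_vec n (c \<odot>\<^bsub>MM n\<^esub> X) v) \<le> cmod c * op_norm n X * vnorm n v" by simp
qed (use X op_norm_ge0 in auto)

lemma op_norm_smult: assumes X: "X \<in> carrier (MM n)" shows "op_norm n (c \<odot>\<^bsub>MM n\<^esub> X) = cmod c * op_norm n X"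
proof (cases "c = 0")
  case True
  have "0 \<odot>\<^bsub>MM n\<^esub> X \<in> carrier (MM n)" using X by simp
  then show ?thesis using op_norm_smult_le[OF X, of 0] op_norm_ge0[of n "0 \<odot>\<^bsub>MM n\<^esub> X"] True by simp
next
  case False
  have "(1/c) \<odot>\<^bsub>MM n\<^esub> (c \<odot>\<^bsub>MM n\<^esub> X) = X" using X False by (intro mat_eqI) (auto simp: mat_smult sc_sc)
  then have "op_norm n X \<le> cmod (1/c) * op_norm n (c \<odot>\<^bsub>MM n\<^esub> X)"
    using op_norm_smult_le[of "c \<odot>\<^bsub>MM n\<^esub> X" n "1/c"] X by simp
  then have "cmod c * op_norm n X \<le> op_norm n (c \<odot>\<^bsub>MM n\<^esub> X)" using False by (simp add: norm_divide field_simps)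
  then show ?thesis using op_norm_smult_le[OF X, of c] by simp
qed

lemma op_norm_zero_iff: assumes X: "X \<in> carrier (MM n)" shows "op_norm n X = 0 \<longleftrightarrow> X = \<zero>\<^bsub>MM n\<^esub>"
proof
  assume z: "op_norm n X = 0"
  show "X = \<zero>\<^bsub>MM n\<^esub>"
  proof (rule mat_eqI)
    fix i j assume ij: "i < n" "j < n"
    have "nm (X (i, j)) \<le> 0" using entry_le_op_norm[of n X i j] X ij z by simp
    then have "nm (X (i, j)) = 0" using nm_ge0[of "X (i, j)"] X ij by (simp add: order_antisym)
    then show "X (i, j) = \<zero>\<^bsub>MM n\<^esub> (i, j)" using nm_eq0 X ij by (simp add: mat_zero)
  qed (use X in auto)
next
  assume z: "X = \<zero>\<^bsub>MM n\<^esub>"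
  have "op_norm n X \<le> (\<Sum>i<n. \<Sum>j<n. nm (X (i, j)))" using X by (intro op_norm_le_sum) simp
  also have "\<dots> = 0" unfolding z by (intro sum.neutral ballI) (simp add: mat_zero)
  finally show "op_norm n X = 0" using op_norm_ge0[of n X] X by simp
qed

lemma mat_minus: assumes X: "X \<in> carrier (MM n)" and Y: "Y \<in> carrier (MM n)" and ij: "i < n" "j < n"
  shows "(X \<ominus>\<^bsub>MM n\<^esub> Y) (i, j) = X (i, j) \<ominus> Y (i, j)"
proof -
  interpret M: ring "MM n" by (rule mat_ring)
  have "\<ominus>\<^bsub>MM n\<^esub> Y = (-1) \<odot>\<^bsub>MM n\<^esub> Y"
    by (rule M.minus_equality, rule mat_eqI) (use X Y in \<open>auto simp: mat_ops sc_neg[symmetric] l_neg\<close>)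
  then show ?thesis using X Y ij by (simp add: a_minus_def mat_ops sc_neg)
qed

lemma fast_tends:
  assumes x: "\<And>n. x n \<in> cr" and d: "\<And>n. nm (x (Suc n) \<ominus> x n) \<le> (1/2) ^ n"
  shows "\<exists>l. tends x l"
proof (rule dominated_tends[where r = "\<lambda>n. 2 - 2 * (1/2) ^ n" and B = 2])
  show "nm (x (Suc n) \<ominus> x n) \<le> 2 - 2 * (1/2) ^ Suc n - (2 - 2 * (1/2) ^ n)" for n
    using d[of n] by simp
qed (use x in auto)

lemma mat_cstar_alg: "cstar_alg (MM n)"
proof -
  interpret R: ring "MM n" by (rule mat_ring)
  have nr: "nrm (MM n) = op_norm n" by (simp add: mat_cstar_simps)
  show ?thesis
  proof (rule cstar_algI, goal_cases)
    case 1 show ?case by (rule mat_ring)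
  next
    case 2 show ?case by (rule mat_module)
  next
    case (3 X Y c) then show ?case by (intro mat_eqI) (auto simp: mat_ops sc_ml fsum_sc intro!: fsum_cong)
  next
    case (4 X Y c) then show ?case by (intro mat_eqI) (auto simp: mat_ops sc_mr fsum_sc intro!: fsum_cong)
  next
    case (5 X) then show ?case by simp
  next
    case (6 X) then show ?case by (rule mat_adj_adj)
  next
    case (7 X Y) then show ?case by (intro mat_eqI) (auto simp: mat_ops st_add)
  next
    case (8 X c) then show ?case by (intro mat_eqI) (auto simp: mat_ops st_sc)
  next
    case (9 X Y) then show ?case by (intro mat_eqI) (auto simp: mat_ops fsum_st st_mult intro!: fsum_cong)
  next
    case (10 X) then show ?case by (simp add: nr op_norm_ge0)
  next
    case (11 X) then show ?case by (simp add: nr op_norm_zero_iff)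
  next
    case (12 X Y) then show ?case by (simp add: nr op_norm_tri)
  next
    case (13 X c) then show ?case by (simp add: nr op_norm_smult)
  next
    case (14 X Y) then show ?case by (simp add: nr op_norm_mult)
  next
    case (15 X) then show ?case by (simp add: nr op_norm_cs)
  next
    case (16 s)
    then have sc: "s k \<in> carrier (MM n)" for k by blast
    have "\<exists>l. tends (\<lambda>k. s k (i, j)) l" if ij: "i < n" "j < n" for i j
    proof (rule fast_tends)
      show "s k (i, j) \<in> cr" for k using mat_entry[OF sc ij] .
      show "nm (s (Suc k) (i, j) \<ominus> s k (i, j)) \<le> (1/2) ^ k" for k
      proof -
        have "nm ((s (Suc k) \<ominus>\<^bsub>MM n\<^esub> s k) (i, j)) \<le> op_norm n (s (Suc k) \<ominus>\<^bsub>MM n\<^esub> s k)"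
          using sc ij by (intro entry_le_op_norm) auto
        also have "\<dots> \<le> (1/2) ^ k" using 16(2)[of k] by (simp add: nr)
        finally show ?thesis using sc ij by (simp add: mat_minus)
      qed
    qed
    then obtain L where L: "\<And>i j. i < n \<Longrightarrow> j < n \<Longrightarrow> tends (\<lambda>k. s k (i, j)) (L i j)" by metis
    define X where "X = (\<lambda>p\<in>{..<n}\<times>{..<n}. L (fst p) (snd p))"
    have X: "X \<in> carrier (MM n)" using L tendsD(2) by (auto simp: mat_carrier X_def is_mat_def)
    have "(\<lambda>k. op_norm n (s k \<ominus>\<^bsub>MM n\<^esub> X)) \<longlonglongrightarrow> 0"
    proof (rule tendsto_sandwich[where f="\<lambda>_. 0" and h="\<lambda>k. \<Sum>i<n. \<Sum>j<n. nm (s k (i, j) \<ominus> L i j)"])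
      show "\<forall>\<^sub>F k in sequentially. op_norm n (s k \<ominus>\<^bsub>MM n\<^esub> X) \<le> (\<Sum>i<n. \<Sum>j<n. nm (s k (i, j) \<ominus> L i j))"
      proof (rule always_eventually, rule allI)
        fix k
        have "op_norm n (s k \<ominus>\<^bsub>MM n\<^esub> X) \<le> (\<Sum>i<n. \<Sum>j<n. nm ((s k \<ominus>\<^bsub>MM n\<^esub> X) (i, j)))"
          using sc X by (intro op_norm_le_sum) simp
        also have "\<dots> = (\<Sum>i<n. \<Sum>j<n. nm (s k (i, j) \<ominus> L i j))"
          using sc X by (intro sum.cong) (auto simp: mat_minus X_def)
        finally show "op_norm n (s k \<ominus>\<^bsub>MM n\<^esub> X) \<le> (\<Sum>i<n. \<Sum>j<n. nm (s k (i, j) \<ominus> L i j))" .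
      qed
      show "(\<lambda>k. \<Sum>i<n. \<Sum>j<n. nm (s k (i, j) \<ominus> L i j)) \<longlonglongrightarrow> 0"
        using L tendsD(3) by (intro tendsto_null_sum) auto
      show "\<forall>\<^sub>F k in sequentially. 0 \<le> op_norm n (s k \<ominus>\<^bsub>MM n\<^esub> X)"
        using sc X by (intro always_eventually allI op_norm_ge0) simp
    qed auto
    then show ?case using X by (auto simp: nr)
  qed
qed

lemma fast_tends_bound:
  assumes x: "\<And>n. x n \<in> cr" and d: "\<And>n. nm (x (Suc n) \<ominus> x n) \<le> (1/2) ^ n" and l: "tends x l"
  shows "nm (x n \<ominus> l) \<le> 2 * (1/2) ^ n"
proof -
  have le: "nm (x (k + n) \<ominus> x n) \<le> 2 * (1/2) ^ n - 2 * (1/2) ^ (k + n)" for k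
  proof (induction k)
    case (Suc k)
    have "nm (x (Suc k + n) \<ominus> x n) \<le> nm (x (Suc (k + n)) \<ominus> x (k + n)) + nm (x (k + n) \<ominus> x n)"
      using nm_tri3 x by simp
    then show ?case using Suc d[of "k + n"] by simp
  qed (use x in simp)
  have c: "tends (\<lambda>k. x (k + n)) l"
    using l LIMSEQ_ignore_initial_segment[of "\<lambda>k. nm (x k \<ominus> l)" 0 n] by (simp add: tends_def)
  have c2: "tends (\<lambda>k. x (k + n) \<ominus> x n) (l \<ominus> x n)" using c x by (intro tends_minus tends_const)
  have "nm (l \<ominus> x n) \<le> 2 * (1/2) ^ n"
  proof (rule tends_nm_le[OF c2])
    show "nm (x (k + n) \<ominus> x n) \<le> 2 * (1/2) ^ n" for k
      using le[of k] zero_le_power[of "1/2::real" "k + n"] by linarith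
  qed
  then show ?thesis using nm_minus_commute[of l "x n"] x tendsD(2)[OF l] by simp
qed

section \<open>Closed subalgebras and bounded functions\<close>

definition sub_alg :: "'a set \<Rightarrow> bool" where
  "sub_alg S \<longleftrightarrow> S \<subseteq> cr \<and> \<one> \<in> S \<and> (\<forall>x\<in>S. \<forall>y\<in>S. x \<oplus> y \<in> S \<and> x \<otimes> y \<in> S) \<and>
     (\<forall>c. \<forall>x\<in>S. c \<odot> x \<in> S) \<and> (\<forall>x\<in>S. st x \<in> S) \<and>
     (\<forall>s l. (\<forall>n. s n \<in> S) \<and> tends s l \<longrightarrow> l \<in> S)"

lemma sub_algD:
  assumes "sub_alg S"
  shows "\<And>x. x \<in> S \<Longrightarrow> x \<in> cr" "\<one> \<in> S" "\<And>x y. x \<in> S \<Longrightarrow> y \<in> S \<Longrightarrow> x \<oplus> y \<in> S"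
    "\<And>x y. x \<in> S \<Longrightarrow> y \<in> S \<Longrightarrow> x \<otimes> y \<in> S" "\<And>c x. x \<in> S \<Longrightarrow> c \<odot> x \<in> S"
    "\<And>x. x \<in> S \<Longrightarrow> st x \<in> S" "\<And>s l. (\<And>n. s n \<in> S) \<Longrightarrow> tends s l \<Longrightarrow> l \<in> S"
    "\<zero> \<in> S" "\<And>x. x \<in> S \<Longrightarrow> \<ominus> x \<in> S" "\<And>x y. x \<in> S \<Longrightarrow> y \<in> S \<Longrightarrow> x \<ominus> y \<in> S"
proof -
  show 1: "\<And>x. x \<in> S \<Longrightarrow> x \<in> cr" and o: "\<one> \<in> S" and p: "\<And>x y. x \<in> S \<Longrightarrow> y \<in> S \<Longrightarrow> x \<oplus> y \<in> S"
    and "\<And>x y. x \<in> S \<Longrightarrow> y \<in> S \<Longrightarrow> x \<otimes> y \<in> S" and 5: "\<And>c x. x \<in> S \<Longrightarrow> c \<odot> x \<in> S"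
    and "\<And>x. x \<in> S \<Longrightarrow> st x \<in> S" and "\<And>s l. (\<And>n. s n \<in> S) \<Longrightarrow> tends s l \<Longrightarrow> l \<in> S"
    using assms unfolding sub_alg_def by blast+
  show "\<zero> \<in> S" using 5[OF o, of 0] by simp
  show n: "\<And>x. x \<in> S \<Longrightarrow> \<ominus> x \<in> S" using 5 1 by (metis sc_neg)
  show "\<And>x y. x \<in> S \<Longrightarrow> y \<in> S \<Longrightarrow> x \<ominus> y \<in> S" using p n by (simp add: a_minus_def)
qed

lemmas sub_algS = sub_algD(1-6,8-10)

lemma sub_abelian_group: assumes S: "sub_alg S" shows "abelian_group (D\<lparr>carrier := S\<rparr>)"
proof (rule abelian_groupI)
  fix x assume "x \<in> carrier (D\<lparr>carrier := S\<rparr>)"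
  then show "\<exists>y\<in>carrier (D\<lparr>carrier := S\<rparr>). y \<oplus>\<^bsub>D\<lparr>carrier := S\<rparr>\<^esub> x = \<zero>\<^bsub>D\<lparr>carrier := S\<rparr>\<^esub>"
    using sub_algS[OF S] by (intro bexI[of _ "\<ominus> x"]) (auto simp: l_neg)
qed (use sub_algS[OF S] in \<open>auto simp: a_ac\<close>)

lemma sub_minus: assumes S: "sub_alg S" and "x \<in> S" "y \<in> S"
  shows "x \<ominus>\<^bsub>D\<lparr>carrier := S\<rparr>\<^esub> y = x \<ominus> y"
proof -
  interpret A: abelian_group "D\<lparr>carrier := S\<rparr>" by (rule sub_abelian_group[OF S])
  have "\<ominus>\<^bsub>D\<lparr>carrier := S\<rparr>\<^esub> y = \<ominus> y"
    using A.minus_equality[of "\<ominus> y" y] sub_algD[OF S] assms by (simp add: l_neg)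
  then show ?thesis by (simp add: a_minus_def)
qed

lemma sub_ring: assumes S: "sub_alg S" shows "ring (D\<lparr>carrier := S\<rparr>)"
  by (intro ringI sub_abelian_group[OF S] monoidI)
     (use sub_algS[OF S] in \<open>auto simp: m_assoc l_distr r_distr\<close>)

lemma sub_cstar_alg: assumes S: "sub_alg S" shows "cstar_alg (D\<lparr>carrier := S\<rparr>)"
proof -
  note d = sub_algS[OF S]
  have md: "module complex_cstar (D\<lparr>carrier := S\<rparr>)"
    by (intro moduleI complex_cring sub_abelian_group[OF S])
       (use d in \<open>auto simp: complex_cstar_def sc_addl sc_addr sc_sc\<close>)
  show ?thesis
  proof (rule cstar_algI[OF sub_ring[OF S] md], goal_cases)
    case (14 s)
    then have s: "\<And>n. s n \<in> S" "\<And>n. s n \<in> cr" "\<And>n. nm (s (Suc n) \<ominus> s n) \<le> (1/2) ^ n"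
      using d(1) by (auto simp: sub_minus[OF S])
    obtain l where l: "tends s l" using fast_tends[OF s(2,3)] by blast
    then have "l \<in> S" using sub_algD(7)[OF S] s(1) by blast
    then show ?case using tendsD(3)[OF l] s(1) by (auto simp: sub_minus[OF S])
  qed (use d in \<open>auto simp: sc_ml sc_mr st_add st_sc st_mult nm_eq0 nm_tri nm_sc nm_mult nm_cs\<close>)
qed

lemma sub_finsum: assumes S: "sub_alg S" and f: "\<And>i. i < n \<Longrightarrow> f i \<in> S"
  shows "finsum (D\<lparr>carrier := S\<rparr>) f {..<n} = fsum n f" "fsum n f \<in> S"
proof -
  interpret E: cstar_alg "D\<lparr>carrier := S\<rparr>" by (rule sub_cstar_alg[OF S])
  have "finsum (D\<lparr>carrier := S\<rparr>) f {..<n} = fsum n f \<and> fsum n f \<in> S" using f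
  proof (induction n)
    case (Suc n)
    then show ?case using E.fsum_Suc[of n f] fsum_Suc[of n f] sub_algD(1,3)[OF S] by auto
  qed (use sub_algD(8)[OF S] in simp)
  then show "finsum (D\<lparr>carrier := S\<rparr>) f {..<n} = fsum n f" "fsum n f \<in> S" by auto
qed

abbreviation "LL X \<equiv> linf X D"

lemma linf_carrier: "f \<in> carrier (LL X) \<longleftrightarrow>
    f \<in> extensional X \<and> (\<forall>x\<in>X. f x \<in> cr) \<and> (\<exists>B. \<forall>x\<in>X. nm (f x) \<le> B)"
  by (auto simp: linf_def PiE_iff bdd_above_def)

lemma linfI: "f \<in> extensional X \<Longrightarrow> (\<And>x. x \<in> X \<Longrightarrow> f x \<in> cr) \<Longrightarrow> (\<And>x. x \<in> X \<Longrightarrow> nm (f x) \<le> B) \<Longrightarrow>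
   f \<in> carrier (LL X)"
  unfolding linf_carrier by blast

lemma linf_at [simp]: "f \<in> carrier (LL X) \<Longrightarrow> x \<in> X \<Longrightarrow> f x \<in> cr"
  by (simp add: linf_carrier)

lemma linf_bounded: "f \<in> carrier (LL X) \<Longrightarrow> \<exists>B. \<forall>x\<in>X. nm (f x) \<le> B"
  by (simp add: linf_carrier)

lemma linf_eqI: "f \<in> carrier (LL X) \<Longrightarrow> g \<in> carrier (LL X) \<Longrightarrow> (\<And>x. x \<in> X \<Longrightarrow> f x = g x) \<Longrightarrow> f = g"
  unfolding linf_carrier by (rule extensionalityI[of f X g]) auto

lemma linf_ops:
  "x \<in> X \<Longrightarrow> (f \<otimes>\<^bsub>LL X\<^esub> g) x = f x \<otimes> g x" "x \<in> X \<Longrightarrow> (f \<oplus>\<^bsub>LL X\<^esub> g) x = f x \<oplus> g x"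
  "x \<in> X \<Longrightarrow> (c \<odot>\<^bsub>LL X\<^esub> f) x = c \<odot> f x" "x \<in> X \<Longrightarrow> adj (LL X) f x = st (f x)"
  "x \<in> X \<Longrightarrow> \<one>\<^bsub>LL X\<^esub> x = \<one>" "x \<in> X \<Longrightarrow> \<zero>\<^bsub>LL X\<^esub> x = \<zero>"
  by (simp_all add: linf_def)

lemma linf_ext: "f \<otimes>\<^bsub>LL X\<^esub> g \<in> extensional X" "f \<oplus>\<^bsub>LL X\<^esub> g \<in> extensional X" "c \<odot>\<^bsub>LL X\<^esub> f \<in> extensional X"
  "adj (LL X) f \<in> extensional X" "\<one>\<^bsub>LL X\<^esub> \<in> extensional X" "\<zero>\<^bsub>LL X\<^esub> \<in> extensional X"
  by (simp_all add: linf_def)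

lemma linf_closed [simp, intro]:
  assumes f: "f \<in> carrier (LL X)"
  shows "g \<in> carrier (LL X) \<Longrightarrow> f \<otimes>\<^bsub>LL X\<^esub> g \<in> carrier (LL X)" "g \<in> carrier (LL X) \<Longrightarrow> f \<oplus>\<^bsub>LL X\<^esub> g \<in> carrier (LL X)"
    "c \<odot>\<^bsub>LL X\<^esub> f \<in> carrier (LL X)" "adj (LL X) f \<in> carrier (LL X)"
proof -
  obtain B where B: "\<forall>x\<in>X. nm (f x) \<le> B" using linf_bounded[OF f] by blast
  show "f \<otimes>\<^bsub>LL X\<^esub> g \<in> carrier (LL X)" "f \<oplus>\<^bsub>LL X\<^esub> g \<in> carrier (LL X)" if g: "g \<in> carrier (LL X)"
  proof -
    obtain C where C: "\<forall>x\<in>X. nm (g x) \<le> C" using linf_bounded[OF g] by blast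
    show "f \<otimes>\<^bsub>LL X\<^esub> g \<in> carrier (LL X)"
    proof (rule linfI[where B = "\<bar>B\<bar> * \<bar>C\<bar>"])
      fix x assume x: "x \<in> X"
      have "nm (f x \<otimes> g x) \<le> nm (f x) * nm (g x)" using f g x by (intro nm_mult) auto
      also have "\<dots> \<le> \<bar>B\<bar> * \<bar>C\<bar>" using B C f g x by (intro mult_mono) (auto intro: order_trans)
      finally show "nm ((f \<otimes>\<^bsub>LL X\<^esub> g) x) \<le> \<bar>B\<bar> * \<bar>C\<bar>" using x by (simp add: linf_ops)
    qed (use f g in \<open>auto simp: linf_ext linf_ops\<close>)
    show "f \<oplus>\<^bsub>LL X\<^esub> g \<in> carrier (LL X)"
    proof (rule linfI[where B = "B + C"])
      fix x assume x: "x \<in> X"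
      have "nm (f x \<oplus> g x) \<le> nm (f x) + nm (g x)" using f g x by (intro nm_tri) auto
      also have "\<dots> \<le> B + C" using B C x by (intro add_mono) auto
      finally show "nm ((f \<oplus>\<^bsub>LL X\<^esub> g) x) \<le> B + C" using x by (simp add: linf_ops)
    qed (use f g in \<open>auto simp: linf_ext linf_ops\<close>)
  qed
  show "c \<odot>\<^bsub>LL X\<^esub> f \<in> carrier (LL X)"
    by (rule linfI[where B = "cmod c * B"]) (use f B in \<open>auto simp: linf_ext linf_ops nm_sc mult_left_mono\<close>)
  show "adj (LL X) f \<in> carrier (LL X)"
    by (rule linfI[where B = B]) (use f B in \<open>auto simp: linf_ext linf_ops\<close>)
qed

lemma linf_closed_0 [simp, intro]: "\<one>\<^bsub>LL X\<^esub> \<in> carrier (LL X)" "\<zero>\<^bsub>LL X\<^esub> \<in> carrier (LL X)"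
  by (rule linfI[where B = 1]; simp add: linf_ext linf_ops nm_one_le)+

lemma linf_le: "f \<in> carrier (LL X) \<Longrightarrow> x \<in> X \<Longrightarrow> nm (f x) \<le> nrm (LL X) f"
  using linf_bounded[of f X] by (auto simp: linf_def bdd_above_def intro!: cSUP_upper)

lemma linf_least: "X \<noteq> {} \<Longrightarrow> (\<And>x. x \<in> X \<Longrightarrow> nm (f x) \<le> K) \<Longrightarrow> nrm (LL X) f \<le> K"
  by (simp add: linf_def cSUP_least)

lemma linf_abelian_group: "abelian_group (LL X)"
proof (rule abelian_groupI)
  fix f assume f: "f \<in> carrier (LL X)"
  show "\<exists>g\<in>carrier (LL X). g \<oplus>\<^bsub>LL X\<^esub> f = \<zero>\<^bsub>LL X\<^esub>"
    by (rule bexI[of _ "(-1) \<odot>\<^bsub>LL X\<^esub> f"], rule linf_eqI)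
       (use f in \<open>auto simp: linf_ops sc_neg[symmetric] l_neg\<close>)
qed (auto intro!: linf_eqI simp: linf_ops a_ac)

lemma linf_minus: assumes f: "f \<in> carrier (LL X)" and g: "g \<in> carrier (LL X)" and x: "x \<in> X"
  shows "(f \<ominus>\<^bsub>LL X\<^esub> g) x = f x \<ominus> g x"
proof -
  interpret A: abelian_group "LL X" by (rule linf_abelian_group)
  have "\<ominus>\<^bsub>LL X\<^esub> g = (-1) \<odot>\<^bsub>LL X\<^esub> g"
    by (rule A.minus_equality, rule linf_eqI) (use f g in \<open>auto simp: linf_ops sc_neg[symmetric] l_neg\<close>)
  then show ?thesis using f g x by (simp add: a_minus_def linf_ops sc_neg)
qed

lemma linf_ring: "ring (LL X)"
  by (intro ringI linf_abelian_group monoidI)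
     (auto intro!: linf_eqI simp: linf_ops m_assoc l_distr r_distr)

lemma linf_module: "module complex_cstar (LL X)"
  by (intro moduleI complex_cring linf_abelian_group)
     (auto intro!: linf_eqI simp: complex_cstar_def linf_ops sc_addl sc_addr sc_sc)

lemma linf_cstar_alg: assumes X: "X \<noteq> {}" shows "cstar_alg (LL X)"
proof -
  interpret A: abelian_group "LL X" by (rule linf_abelian_group)
  obtain x0 where x0: "x0 \<in> X" using X by blast
  have ge0: "0 \<le> nrm (LL X) f" if "f \<in> carrier (LL X)" for f
    using linf_le[OF that x0] nm_ge0[of "f x0"] that x0 by (meson linf_at order_trans)
  have smle: "nrm (LL X) (c \<odot>\<^bsub>LL X\<^esub> f) \<le> cmod c * nrm (LL X) f" if "f \<in> carrier (LL X)" for f c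
    using that linf_le by (intro linf_least[OF X]) (auto simp: linf_ops nm_sc intro!: mult_left_mono)
  show ?thesis
  proof (rule cstar_algI[OF linf_ring linf_module], goal_cases)
    case (1 f g c) then show ?case by (intro linf_eqI) (auto simp: linf_ops sc_ml)
  next
    case (2 f g c) then show ?case by (intro linf_eqI) (auto simp: linf_ops sc_mr)
  next
    case (3 f) then show ?case by simp
  next
    case (4 f) then show ?case by (intro linf_eqI) (auto simp: linf_ops)
  next
    case (5 f g) then show ?case by (intro linf_eqI) (auto simp: linf_ops st_add)
  next
    case (6 f c) then show ?case by (intro linf_eqI) (auto simp: linf_ops st_sc)
  next
    case (7 f g) then show ?case by (intro linf_eqI) (auto simp: linf_ops st_mult)
  next
    case (8 f) then show ?case by (rule ge0)
  next
    case (9 f)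
    show ?case
    proof
      assume z: "nrm (LL X) f = 0"
      have "f x = \<zero>" if x: "x \<in> X" for x
        using linf_le[OF 9 x] z nm_ge0[OF linf_at[OF 9 x]] nm_eq0[OF linf_at[OF 9 x]] by linarith
      then show "f = \<zero>\<^bsub>LL X\<^esub>" using 9 by (intro linf_eqI) (auto simp: linf_ops)
    next
      assume "f = \<zero>\<^bsub>LL X\<^esub>"
      then have "nrm (LL X) f \<le> 0" by (intro linf_least[OF X]) (auto simp: linf_ops)
      then show "nrm (LL X) f = 0" using ge0[OF 9] by simp
    qed
  next
    case (10 f g)
    show ?case
    proof (rule linf_least[OF X])
      fix x assume x: "x \<in> X"
      have "nm (f x \<oplus> g x) \<le> nm (f x) + nm (g x)" using 10 x by (intro nm_tri) auto
      also have "\<dots> \<le> nrm (LL X) f + nrm (LL X) g" using 10 x by (intro add_mono linf_le)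
      finally show "nm ((f \<oplus>\<^bsub>LL X\<^esub> g) x) \<le> nrm (LL X) f + nrm (LL X) g" using x by (simp add: linf_ops)
    qed
  next
    case (11 f c)
    show ?case
    proof (cases "c = 0")
      case True
      then show ?thesis using smle[OF 11, of 0] ge0[of "0 \<odot>\<^bsub>LL X\<^esub> f"] 11 by simp
    next
      case False
      have "(1/c) \<odot>\<^bsub>LL X\<^esub> (c \<odot>\<^bsub>LL X\<^esub> f) = f" using 11 False by (intro linf_eqI) (auto simp: linf_ops sc_sc)
      then have "nrm (LL X) f \<le> cmod (1/c) * nrm (LL X) (c \<odot>\<^bsub>LL X\<^esub> f)"
        using smle[of "c \<odot>\<^bsub>LL X\<^esub> f" "1/c"] 11 by simp
      then have "cmod c * nrm (LL X) f \<le> nrm (LL X) (c \<odot>\<^bsub>LL X\<^esub> f)" using False by (simp add: norm_divide field_simps)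
      then show ?thesis using smle[OF 11, of c] by simp
    qed
  next
    case (12 f g)
    show ?case
    proof (rule linf_least[OF X])
      fix x assume x: "x \<in> X"
      have "nm (f x \<otimes> g x) \<le> nm (f x) * nm (g x)" using 12 x by (intro nm_mult) auto
      also have "\<dots> \<le> nrm (LL X) f * nrm (LL X) g" using 12 x ge0 by (intro mult_mono linf_le) auto
      finally show "nm ((f \<otimes>\<^bsub>LL X\<^esub> g) x) \<le> nrm (LL X) f * nrm (LL X) g" using x by (simp add: linf_ops)
    qed
  next
    case (13 f)
    let ?F = "adj (LL X) f \<otimes>\<^bsub>LL X\<^esub> f"
    have F: "?F \<in> carrier (LL X)" using 13 by simp
    have at: "nm (?F x) = (nm (f x))\<^sup>2" if "x \<in> X" for x using 13 that by (simp add: linf_ops nm_cs)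
    have "nrm (LL X) ?F \<le> (nrm (LL X) f)\<^sup>2"
    proof (rule linf_least[OF X])
      fix x assume x: "x \<in> X"
      show "nm (?F x) \<le> (nrm (LL X) f)\<^sup>2" unfolding at[OF x] using 13 x linf_le by (intro power_mono) auto
    qed
    moreover have "nrm (LL X) f \<le> sqrt (nrm (LL X) ?F)"
    proof (rule linf_least[OF X])
      fix x assume x: "x \<in> X"
      have "(nm (f x))\<^sup>2 \<le> nrm (LL X) ?F" using linf_le[OF F x] at[OF x] by simp
      then show "nm (f x) \<le> sqrt (nrm (LL X) ?F)" by (rule real_le_rsqrt)
    qed
    then have "(nrm (LL X) f)\<^sup>2 \<le> nrm (LL X) ?F" using ge0[OF 13] ge0[OF F] by (metis power_mono real_sqrt_pow2)
    ultimately show ?case by simp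
  next
    case (14 s)
    then have s: "s n \<in> carrier (LL X)" for n by blast
    have d: "nm (s (Suc n) x \<ominus> s n x) \<le> (1/2) ^ n" if x: "x \<in> X" for n x
      using linf_le[of "s (Suc n) \<ominus>\<^bsub>LL X\<^esub> s n" X x] 14(2)[of n] s x by (simp add: linf_minus)
    have "\<exists>l. tends (\<lambda>n. s n x) l" if x: "x \<in> X" for x
      by (rule fast_tends) (use linf_at[OF s x] d[OF x] in auto)
    then obtain l where l: "\<And>x. x \<in> X \<Longrightarrow> tends (\<lambda>n. s n x) (l x)" by metis
    have b: "nm (s n x \<ominus> l x) \<le> 2 * (1/2) ^ n" if x: "x \<in> X" for n x
      by (rule fast_tends_bound[of "\<lambda>n. s n x"]) (use linf_at[OF s x] d[OF x] l[OF x] in auto)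
    define g where "g = restrict l X"
    obtain B where B: "\<forall>x\<in>X. nm (s 0 x) \<le> B" using linf_bounded[OF s] by blast
    have lc: "l x \<in> cr" if "x \<in> X" for x using tendsD(2)[OF l[OF that]] .
    have g: "g \<in> carrier (LL X)"
    proof (rule linfI[where B = "B + 2"])
      show "nm (g x) \<le> B + 2" if x: "x \<in> X" for x
        using nm_le_diff[of "l x" "s 0 x"] nm_minus_commute[of "l x" "s 0 x"] b[OF x, of 0] B x lc[OF x] linf_at[OF s[of 0] x]
        by (fastforce simp: g_def)
    qed (use lc in \<open>auto simp: g_def\<close>)
    have le: "nrm (LL X) (s n \<ominus>\<^bsub>LL X\<^esub> g) \<le> 2 * (1/2) ^ n" for n
      using b s g by (intro linf_least[OF X]) (simp add: linf_minus g_def)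
    have z: "(\<lambda>n. 2 * (1/2::real) ^ n) \<longlonglongrightarrow> 0" by (intro tendsto_mult_right_zero LIMSEQ_power_zero) auto
    have "(\<lambda>n. nrm (LL X) (s n \<ominus>\<^bsub>LL X\<^esub> g)) \<longlonglongrightarrow> 0"
      by (rule tendsto_sandwich[OF _ _ tendsto_const z]) (use le ge0 s g in \<open>auto intro!: always_eventually\<close>)
    then show ?case using g by blast
  qed
qed

end

lemma complex_ops:
  "x \<oplus>\<^bsub>complex_cstar\<^esub> y = x + y" "x \<otimes>\<^bsub>complex_cstar\<^esub> y = x * y" "\<zero>\<^bsub>complex_cstar\<^esub> = 0"
  "\<one>\<^bsub>complex_cstar\<^esub> = 1" "c \<odot>\<^bsub>complex_cstar\<^esub> x = c * x" "adj complex_cstar x = cnj x"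
  "nrm complex_cstar x = cmod x"
  by (simp_all add: complex_cstar_def)

lemma complex_abelian_group: "abelian_group complex_cstar"
proof (rule abelian_groupI)
  fix x :: complex
  show "\<exists>y\<in>carrier complex_cstar. y \<oplus>\<^bsub>complex_cstar\<^esub> x = \<zero>\<^bsub>complex_cstar\<^esub>"
    by (rule bexI[of _ "- x"]) (simp_all add: complex_ops)
qed (simp_all add: complex_ops)

lemma complex_minus: "x \<ominus>\<^bsub>complex_cstar\<^esub> y = x - y"
proof -
  interpret A: abelian_group complex_cstar by (rule complex_abelian_group)
  have "\<ominus>\<^bsub>complex_cstar\<^esub> y = - y"
    by (rule A.minus_equality) (simp_all add: complex_ops)
  then show ?thesis by (simp add: a_minus_def complex_ops)
qed

lemma complex_cstar_alg: "cstar_alg complex_cstar"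
proof -
  note ag = complex_abelian_group
  have r: "ring complex_cstar"
    by (intro ringI ag monoidI) (simp_all add: complex_ops algebra_simps)
  have cr: "cring complex_cstar"
    by (intro cringI ag comm_monoidI) (simp_all add: complex_ops algebra_simps)
  have md: "module complex_cstar complex_cstar"
    by (intro moduleI cr ag) (simp_all add: complex_ops algebra_simps)
  show ?thesis
  proof (rule cstar_algI[OF r md], goal_cases)
    case (14 s)
    have s: "cmod (s (Suc n) - s n) \<le> (1/2) ^ n" for n using 14(2)[of n] by (simp add: complex_minus complex_ops)
    have "summable (\<lambda>n. s (Suc n) - s n)"
      by (rule summable_comparison_test[OF _ summable_geometric[of "1/2::real"]]) (use s in auto)
    then have "convergent (\<lambda>n. \<Sum>i<n. s (Suc i) - s i)" by (simp add: summable_iff_convergent)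
    then have "convergent (\<lambda>n. s n - s 0)" by (simp add: sum_lessThan_telescope)
    then obtain L where "(\<lambda>n. s n - s 0) \<longlonglongrightarrow> L" unfolding convergent_def by blast
    then have "s \<longlonglongrightarrow> L + s 0" using tendsto_add[OF _ tendsto_const[of "s 0"]] by fastforce
    then have "(\<lambda>n. cmod (s n - (L + s 0))) \<longlonglongrightarrow> 0" by (simp add: LIM_zero tendsto_norm_zero)
    then show ?case by (auto simp: complex_minus complex_ops)
  qed (simp_all add: complex_ops algebra_simps norm_triangle_ineq norm_mult power2_eq_square)
qed

section \<open>Ultrapowers\<close>

text \<open>By compactness a bounded sequence clusters along \<open>\<omega>\<close>, and a cluster point along an ultrafilter is a
limit.\<close>

lemma ultrafilter_limit:
  fixes f :: "nat \<Rightarrow> real"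
  assumes u: "free_ultrafilter \<omega>" and b: "\<And>n. \<bar>f n\<bar> \<le> B"
  shows "\<exists>l. (f \<longlongrightarrow> l) \<omega>"
proof -
  have nb: "filtermap f \<omega> \<noteq> bot" using u by (simp add: free_ultrafilter_def filtermap_bot_iff)
  have "\<exists>x\<in>{-B..B}. inf (nhds x) (filtermap f \<omega>) \<noteq> bot"
  proof (rule compact_filter[THEN iffD1, rule_format, OF compact_Icc nb])
    show "eventually (\<lambda>x. x \<in> {-B..B}) (filtermap f \<omega>)"
      unfolding eventually_filtermap using b by (intro always_eventually) (auto simp: abs_le_iff minus_le_iff)
  qed
  then obtain x where x: "inf (nhds x) (filtermap f \<omega>) \<noteq> bot" by blast
  have "(f \<longlongrightarrow> x) \<omega>"
  proof (rule topological_tendstoI, rule ccontr)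
    fix S assume S: "open S" "x \<in> S" and n: "\<not> (\<forall>\<^sub>F n in \<omega>. f n \<in> S)"
    then have "\<forall>\<^sub>F n in \<omega>. f n \<notin> S" using u unfolding free_ultrafilter_def by blast
    then have 1: "eventually (\<lambda>y. y \<notin> S) (filtermap f \<omega>)" by (simp add: eventually_filtermap)
    have 2: "eventually (\<lambda>y. y \<in> S) (nhds x)" using S eventually_nhds by blast
    have "eventually (\<lambda>y. False) (inf (nhds x) (filtermap f \<omega>))"
      unfolding eventually_inf using 1 2 by blast
    then show False using x by (simp add: trivial_limit_def)
  qed
  then show ?thesis by blast
qed

locale ultrapower_alg = cstar_alg +
  fixes \<omega> :: "nat filter"
  assumes uf: "free_ultrafilter \<omega>"
begin

lemma nbot [simp]: "\<omega> \<noteq> bot" using uf by (simp add: free_ultrafilter_def)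

abbreviation "LN \<equiv> linf (UNIV :: nat set) D"
abbreviation "NS \<equiv> null_seqs \<omega> D"
abbreviation "U \<equiv> ultrapower \<omega> D"
definition q :: "(nat \<Rightarrow> 'a) \<Rightarrow> (nat \<Rightarrow> 'a) set" where "q s = NS +>\<^bsub>LN\<^esub> s"

sublocale L: cstar_alg LN by (rule linf_cstar_alg) simp

lemma seq_at [simp]: "s \<in> carrier LN \<Longrightarrow> s n \<in> cr" by simp
lemma seq_minus: "s \<in> carrier LN \<Longrightarrow> t \<in> carrier LN \<Longrightarrow> (s \<ominus>\<^bsub>LN\<^esub> t) n = s n \<ominus> t n"
  by (simp add: linf_minus)
lemma seqI: "(\<And>n. s n \<in> cr) \<Longrightarrow> (\<And>n. nm (s n) \<le> B) \<Longrightarrow> s \<in> carrier LN"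
  by (rule linfI) auto
lemma seq_le: "s \<in> carrier LN \<Longrightarrow> nm (s n) \<le> nrm LN s" by (rule linf_le) auto
lemma const_in [simp, intro]: "a \<in> cr \<Longrightarrow> (\<lambda>n. a) \<in> carrier LN" by (rule seqI[where B = "nm a"]) auto

lemma null_iff: "s \<in> NS \<longleftrightarrow> s \<in> carrier LN \<and> ((\<lambda>n. nm (s n)) \<longlongrightarrow> 0) \<omega>"
  by (simp add: null_seqs_def)

lemma nullI: "s \<in> carrier LN \<Longrightarrow> (\<And>n. nm (s n) \<le> r n) \<Longrightarrow> (r \<longlongrightarrow> 0) \<omega> \<Longrightarrow> s \<in> NS"
  unfolding null_iff
  by (auto intro!: tendsto_sandwich[where f="\<lambda>_. 0" and h=r and g="\<lambda>n. nm (s n)"] always_eventually)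

lemma null_ideal: "ideal NS LN"
proof (rule idealI)
  show "ring LN" by (rule linf_ring)
  show "subgroup NS (add_monoid LN)"
  proof (rule L.add.subgroupI)
    show "NS \<subseteq> carrier LN" by (auto simp: null_iff)
    have "\<zero>\<^bsub>LN\<^esub> \<in> NS" by (auto simp: null_iff linf_ops)
    then show "NS \<noteq> {}" by blast
    fix s assume s: "s \<in> NS"
    have sc: "s \<in> carrier LN" using s by (simp add: null_iff)
    show "\<ominus>\<^bsub>LN\<^esub> s \<in> NS"
      by (rule nullI[where r = "\<lambda>n. nm (s n)"]) (use s sc in \<open>auto simp: null_iff L.sc_neg linf_ops nm_sc\<close>)
    fix t assume t: "t \<in> NS"
    show "s \<oplus>\<^bsub>LN\<^esub> t \<in> NS"
      by (rule nullI[where r = "\<lambda>n. nm (s n) + nm (t n)"])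
         (use s t in \<open>auto simp: null_iff linf_ops nm_tri intro!: tendsto_add_zero\<close>)
  qed
  fix s x assume s: "s \<in> NS" and x: "x \<in> carrier LN"
  have sc: "s \<in> carrier LN" and s0: "((\<lambda>n. nm (s n)) \<longlongrightarrow> 0) \<omega>" using s by (auto simp: null_iff)
  show "x \<otimes>\<^bsub>LN\<^esub> s \<in> NS"
  proof (rule nullI[where r = "\<lambda>n. nrm LN x * nm (s n)"])
    show "nm ((x \<otimes>\<^bsub>LN\<^esub> s) n) \<le> nrm LN x * nm (s n)" for n
      using nm_mult[of "x n" "s n"] seq_le[OF x, of n] x sc mult_right_mono[OF seq_le[OF x, of n], of "nm (s n)"]
      by (simp add: linf_ops)
    show "((\<lambda>n. nrm LN x * nm (s n)) \<longlongrightarrow> 0) \<omega>" using s0 by (rule tendsto_mult_right_zero)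
  qed (use x sc in auto)
  show "s \<otimes>\<^bsub>LN\<^esub> x \<in> NS"
  proof (rule nullI[where r = "\<lambda>n. nm (s n) * nrm LN x"])
    show "nm ((s \<otimes>\<^bsub>LN\<^esub> x) n) \<le> nm (s n) * nrm LN x" for n
      using nm_mult[of "s n" "x n"] x sc mult_left_mono[OF seq_le[OF x, of n], of "nm (s n)"]
      by (simp add: linf_ops)
    show "((\<lambda>n. nm (s n) * nrm LN x) \<longlongrightarrow> 0) \<omega>" using s0 by (rule tendsto_mult_left_zero)
  qed (use x sc in auto)
qed

interpretation I: ideal NS LN by (rule null_ideal)

lemma q_eq_iff: "s \<in> carrier LN \<Longrightarrow> t \<in> carrier LN \<Longrightarrow> q s = q t \<longleftrightarrow> s \<ominus>\<^bsub>LN\<^esub> t \<in> NS"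
  unfolding q_def using L.quotient_eq_iff_same_a_r_cos[OF null_ideal] by simp

lemma q_mem: "s \<in> carrier LN \<Longrightarrow> t \<in> q s \<longleftrightarrow> t \<in> carrier LN \<and> t \<ominus>\<^bsub>LN\<^esub> s \<in> NS"
proof -
  assume s: "s \<in> carrier LN"
  have "t \<in> carrier LN" if "t \<in> q s" using that s I.a_elemrcos_carrier unfolding q_def by blast
  moreover have "t \<in> q s \<longleftrightarrow> t \<ominus>\<^bsub>LN\<^esub> s \<in> NS" if "t \<in> carrier LN"
    using I.a_rcos_module_minus[OF linf_ring s that] by (simp add: q_def)
  ultimately show ?thesis by blast
qed

lemma q_self: "s \<in> carrier LN \<Longrightarrow> s \<in> q s" unfolding q_def by (rule I.a_rcos_self)

lemma q_cong: "s \<in> carrier LN \<Longrightarrow> t \<in> q s \<Longrightarrow> q t = q s"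
  using q_mem q_eq_iff by blast

lemma U_carrier: "carrier U = q ` carrier LN"
  by (auto simp: ultrapower_def quot_cstar_def FactRing_def A_RCOSETS_def' q_def)

lemma q_in [simp, intro]: "s \<in> carrier LN \<Longrightarrow> q s \<in> carrier U" by (simp add: U_carrier)

lemma U_cases: assumes "X \<in> carrier U" obtains s where "s \<in> carrier LN" "X = q s"
  using assms by (auto simp: U_carrier)

lemma U_mult: "s \<in> carrier LN \<Longrightarrow> t \<in> carrier LN \<Longrightarrow> q s \<otimes>\<^bsub>U\<^esub> q t = q (s \<otimes>\<^bsub>LN\<^esub> t)"
  using I.rcoset_mult_add by (simp add: ultrapower_def quot_cstar_def FactRing_def q_def)
lemma U_add: "s \<in> carrier LN \<Longrightarrow> t \<in> carrier LN \<Longrightarrow> q s \<oplus>\<^bsub>U\<^esub> q t = q (s \<oplus>\<^bsub>LN\<^esub> t)"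
  using I.a_rcos_sum by (simp add: ultrapower_def quot_cstar_def FactRing_def q_def)
lemma U_one: "\<one>\<^bsub>U\<^esub> = q \<one>\<^bsub>LN\<^esub>"
  by (simp add: ultrapower_def quot_cstar_def FactRing_def q_def)
lemma U_zero: "\<zero>\<^bsub>U\<^esub> = q \<zero>\<^bsub>LN\<^esub>"
proof -
  have "NS +>\<^bsub>LN\<^esub> \<zero>\<^bsub>LN\<^esub> = NS" using I.a_rcos_const[of "\<zero>\<^bsub>LN\<^esub>"] I.zero_closed by simp
  then show ?thesis by (simp add: ultrapower_def quot_cstar_def FactRing_def q_def)
qed
lemma U_smult: assumes s: "s \<in> carrier LN" shows "c \<odot>\<^bsub>U\<^esub> q s = q (c \<odot>\<^bsub>LN\<^esub> s)"
proof -
  have "q (c \<odot>\<^bsub>LN\<^esub> t) = q (c \<odot>\<^bsub>LN\<^esub> s)" if t: "t \<in> q s" for t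
  proof -
    have tc: "t \<in> carrier LN" and n: "t \<ominus>\<^bsub>LN\<^esub> s \<in> NS" using t s by (auto simp: q_mem)
    have "c \<odot>\<^bsub>LN\<^esub> (t \<ominus>\<^bsub>LN\<^esub> s) \<in> NS"
      by (rule nullI[where r = "\<lambda>n. cmod c * nm ((t \<ominus>\<^bsub>LN\<^esub> s) n)"])
         (use n tc s in \<open>auto simp: linf_ops nm_sc seq_minus null_iff intro: tendsto_mult_right_zero\<close>)
    then show ?thesis using tc s by (simp add: q_eq_iff L.sc_minus)
  qed
  then have "(\<Union>t\<in>q s. q (c \<odot>\<^bsub>LN\<^esub> t)) = q (c \<odot>\<^bsub>LN\<^esub> s)" using q_self[OF s] by (intro SUP_eq_const) blast+
  then show ?thesis by (simp add: ultrapower_def quot_cstar_def q_def)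
qed

text \<open>An isometric bijection of the bounded sequences permutes the cosets of the null sequences. This
computes both the adjoint and the action on the ultrapower.\<close>

lemma image_q:
  assumes s: "s \<in> carrier LN"
    and F: "\<And>t. t \<in> carrier LN \<Longrightarrow> F t \<in> carrier LN"
    and G: "\<And>t. t \<in> carrier LN \<Longrightarrow> G t \<in> carrier LN \<and> F (G t) = t"
    and iso: "\<And>t u n. t \<in> carrier LN \<Longrightarrow> u \<in> carrier LN \<Longrightarrow> nm (F t n \<ominus> F u n) = nm (t n \<ominus> u n)"
  shows "F ` q s = q (F s)"
proof -
  have k: "F t \<ominus>\<^bsub>LN\<^esub> F u \<in> NS \<longleftrightarrow> t \<ominus>\<^bsub>LN\<^esub> u \<in> NS" if "t \<in> carrier LN" "u \<in> carrier LN" for t u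
    using that F iso by (simp add: null_iff seq_minus)
  have "F t \<in> q (F s)" if t: "t \<in> q s" for t
    using t s k F by (simp add: q_mem)
  moreover have "u \<in> F ` q s" if u: "u \<in> q (F s)" for u
  proof -
    have uc: "u \<in> carrier LN" and un: "u \<ominus>\<^bsub>LN\<^esub> F s \<in> NS" using u s F by (auto simp: q_mem)
    have "F (G u) = u" "G u \<in> carrier LN" using G uc by auto
    then show ?thesis using un k[of "G u" s] s by (intro image_eqI[of _ _ "G u"]) (auto simp: q_mem)
  qed
  ultimately show ?thesis by blast
qed

lemma U_adj: assumes s: "s \<in> carrier LN" shows "adj U (q s) = q (adj LN s)"
proof -
  have "adj LN ` q s = q (adj LN s)"
    by (rule image_q[OF s, where G = "adj LN"]) (auto simp: linf_ops st_minus[symmetric])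
  then show ?thesis by (simp add: ultrapower_def quot_cstar_def)
qed

text \<open>A representative can be set to zero wherever its norm exceeds the limit by \<open>e\<close>, which changes it
by a null sequence only; so the infimum over the representatives is the limit along \<open>\<omega>\<close>.\<close>

lemma nrm_lim: assumes s: "s \<in> carrier LN" shows "((\<lambda>n. nm (s n)) \<longlongrightarrow> nrm U (q s)) \<omega>"
proof -
  obtain l where l: "((\<lambda>n. nm (s n)) \<longlongrightarrow> l) \<omega>"
    using ultrafilter_limit[OF uf, of "\<lambda>n. nm (s n)" "nrm LN s"] s seq_le[OF s] by auto
  have l0: "0 \<le> l" by (rule tendsto_lowerbound[OF l]) (use s in auto)
  have nU: "nrm U (q s) = (INF t\<in>q s. nrm LN t)" by (simp add: ultrapower_def quot_cstar_def)
  have ge: "l \<le> nrm LN t" if t: "t \<in> q s" for t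
  proof -
    have tc: "t \<in> carrier LN" and n: "((\<lambda>n. nm (t n \<ominus> s n)) \<longlongrightarrow> 0) \<omega>"
      using t s by (auto simp: q_mem null_iff seq_minus)
    have "((\<lambda>n. nm (s n) - nm (t n)) \<longlongrightarrow> 0) \<omega>"
      by (rule Lim_null_comparison[OF _ n]) (use s tc nm_diff_abs nm_minus_commute in \<open>auto intro!: always_eventually simp: abs_minus_commute\<close>)
    from tendsto_diff[OF l this] have "((\<lambda>n. nm (t n)) \<longlongrightarrow> l) \<omega>" by simp
    then show ?thesis by (rule tendsto_upperbound) (use seq_le[OF tc] in auto)
  qed
  have "nrm U (q s) \<le> l + e" if e: "e > 0" for e
  proof -
    define t where "t = (\<lambda>n. if nm (s n) \<le> l + e then s n else \<zero>)"
    have tb: "nm (t n) \<le> l + e" for n using l0 e by (auto simp: t_def)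
    have tc: "t \<in> carrier LN" by (rule seqI[OF _ tb]) (use s in \<open>auto simp: t_def\<close>)
    have "\<forall>\<^sub>F n in \<omega>. nm (s n) < l + e" using order_tendstoD(2)[OF l, of "l + e"] e by simp
    then have "\<forall>\<^sub>F n in \<omega>. nm (t n \<ominus> s n) = 0"
      by (rule eventually_mono) (use s in \<open>auto simp: t_def\<close>)
    then have "((\<lambda>n. nm (t n \<ominus> s n)) \<longlongrightarrow> 0) \<omega>" by (rule tendsto_eventually)
    then have "t \<in> q s" using tc s by (simp add: q_mem null_iff seq_minus)
    then have "nrm U (q s) \<le> nrm LN t" unfolding nU
      by (intro cINF_lower) (auto intro!: bdd_belowI2[where m = l] ge)
    also have "\<dots> \<le> l + e" using tb by (intro linf_least) auto
    finally show ?thesis .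
  qed
  then have "nrm U (q s) \<le> l" by (rule field_le_epsilon)
  moreover have "l \<le> nrm U (q s)" unfolding nU using q_self[OF s] ge by (intro cINF_greatest) auto
  ultimately show ?thesis using l by simp
qed

lemma nrm_eqI: "s \<in> carrier LN \<Longrightarrow> ((\<lambda>n. nm (s n)) \<longlongrightarrow> l) \<omega> \<Longrightarrow> nrm U (q s) = l"
  using tendsto_unique[OF nbot] nrm_lim by blast

lemma nrm_le_seq: "s \<in> carrier LN \<Longrightarrow> nrm U (q s) \<le> nrm LN s"
  by (rule tendsto_upperbound[OF nrm_lim]) (auto simp: seq_le)

lemma U_abelian_group: "abelian_group U"
proof (rule abelian_groupI)
  show "\<zero>\<^bsub>U\<^esub> \<in> carrier U" by (simp add: U_zero)
  fix X assume "X \<in> carrier U"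
  then obtain s where s: "s \<in> carrier LN" "X = q s" by (rule U_cases)
  show "\<zero>\<^bsub>U\<^esub> \<oplus>\<^bsub>U\<^esub> X = X" using s by (simp add: U_zero U_add)
  show "\<exists>Y\<in>carrier U. Y \<oplus>\<^bsub>U\<^esub> X = \<zero>\<^bsub>U\<^esub>"
    using s by (intro bexI[of _ "q (\<ominus>\<^bsub>LN\<^esub> s)"]) (auto simp: U_zero U_add L.l_neg)
  fix Y assume "Y \<in> carrier U"
  then obtain t where t: "t \<in> carrier LN" "Y = q t" by (rule U_cases)
  show "X \<oplus>\<^bsub>U\<^esub> Y \<in> carrier U" "X \<oplus>\<^bsub>U\<^esub> Y = Y \<oplus>\<^bsub>U\<^esub> X" using s t by (simp_all add: U_add L.a_comm)
  fix Z assume "Z \<in> carrier U"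
  then obtain u where u: "u \<in> carrier LN" "Z = q u" by (rule U_cases)
  show "X \<oplus>\<^bsub>U\<^esub> Y \<oplus>\<^bsub>U\<^esub> Z = X \<oplus>\<^bsub>U\<^esub> (Y \<oplus>\<^bsub>U\<^esub> Z)" using s t u by (simp add: U_add L.a_assoc)
qed

lemma U_ring: "ring U"
proof (rule ringI[OF U_abelian_group])
  show "monoid U"
  proof (rule monoidI)
    show "\<one>\<^bsub>U\<^esub> \<in> carrier U" by (simp add: U_one)
    fix X assume "X \<in> carrier U"
    then obtain s where s: "s \<in> carrier LN" "X = q s" by (rule U_cases)
    show "\<one>\<^bsub>U\<^esub> \<otimes>\<^bsub>U\<^esub> X = X" "X \<otimes>\<^bsub>U\<^esub> \<one>\<^bsub>U\<^esub> = X" using s by (simp_all add: U_one U_mult)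
    fix Y assume "Y \<in> carrier U"
    then obtain t where t: "t \<in> carrier LN" "Y = q t" by (rule U_cases)
    show "X \<otimes>\<^bsub>U\<^esub> Y \<in> carrier U" using s t by (simp add: U_mult)
    fix Z assume "Z \<in> carrier U"
    then obtain u where u: "u \<in> carrier LN" "Z = q u" by (rule U_cases)
    show "X \<otimes>\<^bsub>U\<^esub> Y \<otimes>\<^bsub>U\<^esub> Z = X \<otimes>\<^bsub>U\<^esub> (Y \<otimes>\<^bsub>U\<^esub> Z)" using s t u by (simp add: U_mult L.m_assoc)
  qed
  fix X Y Z assume "X \<in> carrier U" "Y \<in> carrier U" "Z \<in> carrier U"
  then obtain s t u where s: "s \<in> carrier LN" "X = q s" and t: "t \<in> carrier LN" "Y = q t"
    and u: "u \<in> carrier LN" "Z = q u" by (metis U_cases)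
  show "(X \<oplus>\<^bsub>U\<^esub> Y) \<otimes>\<^bsub>U\<^esub> Z = X \<otimes>\<^bsub>U\<^esub> Z \<oplus>\<^bsub>U\<^esub> Y \<otimes>\<^bsub>U\<^esub> Z"
    "Z \<otimes>\<^bsub>U\<^esub> (X \<oplus>\<^bsub>U\<^esub> Y) = Z \<otimes>\<^bsub>U\<^esub> X \<oplus>\<^bsub>U\<^esub> Z \<otimes>\<^bsub>U\<^esub> Y"
    using s t u by (simp_all add: U_add U_mult L.l_distr L.r_distr)
qed

lemma U_minus: assumes s: "s \<in> carrier LN" and t: "t \<in> carrier LN" shows "q s \<ominus>\<^bsub>U\<^esub> q t = q (s \<ominus>\<^bsub>LN\<^esub> t)"
proof -
  interpret R: ring U by (rule U_ring)
  have "\<ominus>\<^bsub>U\<^esub> q t = q (\<ominus>\<^bsub>LN\<^esub> t)" by (rule R.minus_equality) (use t in \<open>auto simp: U_add U_zero L.l_neg\<close>)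
  then show ?thesis using s t by (simp add: a_minus_def U_add)
qed

lemma U_module: "module complex_cstar U"
proof (rule moduleI[OF complex_cring U_abelian_group])
  fix X c assume "X \<in> carrier U"
  then obtain s where s: "s \<in> carrier LN" "X = q s" by (rule U_cases)
  show "c \<odot>\<^bsub>U\<^esub> X \<in> carrier U" using s by (simp add: U_smult)
  show "\<one>\<^bsub>complex_cstar\<^esub> \<odot>\<^bsub>U\<^esub> X = X" using s by (simp add: U_smult complex_cstar_def)
  show "(c \<oplus>\<^bsub>complex_cstar\<^esub> d) \<odot>\<^bsub>U\<^esub> X = c \<odot>\<^bsub>U\<^esub> X \<oplus>\<^bsub>U\<^esub> d \<odot>\<^bsub>U\<^esub> X" for d
    using s by (simp add: U_smult U_add complex_cstar_def L.sc_addl)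
  show "(c \<otimes>\<^bsub>complex_cstar\<^esub> d) \<odot>\<^bsub>U\<^esub> X = c \<odot>\<^bsub>U\<^esub> (d \<odot>\<^bsub>U\<^esub> X)" for d
    using s by (simp add: U_smult complex_cstar_def L.sc_sc)
  fix Y assume "Y \<in> carrier U"
  then obtain t where t: "t \<in> carrier LN" "Y = q t" by (rule U_cases)
  show "c \<odot>\<^bsub>U\<^esub> (X \<oplus>\<^bsub>U\<^esub> Y) = c \<odot>\<^bsub>U\<^esub> X \<oplus>\<^bsub>U\<^esub> c \<odot>\<^bsub>U\<^esub> Y"
    using s t by (simp add: U_smult U_add L.sc_addr)
qed

lemma U_cstar_alg: "cstar_alg U"
proof (rule cstar_algI[OF U_ring U_module], goal_cases)
  case (1 X Y c) then show ?case by (elim U_cases) (simp add: U_mult U_smult L.sc_ml)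
next
  case (2 X Y c) then show ?case by (elim U_cases) (simp add: U_mult U_smult L.sc_mr)
next
  case (3 X) then show ?case by (elim U_cases) (simp add: U_adj)
next
  case (4 X) then show ?case by (elim U_cases) (simp add: U_adj)
next
  case (5 X Y) then show ?case by (elim U_cases) (simp add: U_add U_adj L.st_add)
next
  case (6 X c) then show ?case by (elim U_cases) (simp add: U_smult U_adj L.st_sc)
next
  case (7 X Y) then show ?case by (elim U_cases) (simp add: U_mult U_adj L.st_mult)
next
  case (8 X) then show ?case
    by (elim U_cases) (auto intro!: tendsto_lowerbound[OF nrm_lim])
next
  case (9 X)
  then obtain s where s: "s \<in> carrier LN" "X = q s" by (rule U_cases)
  have "q s = \<zero>\<^bsub>U\<^esub> \<longleftrightarrow> s \<in> NS" unfolding U_zero using q_eq_iff[OF s(1), of "\<zero>\<^bsub>LN\<^esub>"] s by (simp add: a_minus_def)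
  moreover have "s \<in> NS \<longleftrightarrow> nrm U (q s) = 0" using nrm_lim[OF s(1)] nrm_eqI[OF s(1), of 0] s(1) null_iff by metis
  ultimately show ?case using s by simp
next
  case (10 X Y)
  then obtain s t where s: "s \<in> carrier LN" "X = q s" and t: "t \<in> carrier LN" "Y = q t" by (metis U_cases)
  have "nrm U (q (s \<oplus>\<^bsub>LN\<^esub> t)) \<le> nrm U (q s) + nrm U (q t)"
    by (rule tendsto_le[OF nbot tendsto_add[OF nrm_lim nrm_lim] nrm_lim])
       (use s t in \<open>auto intro!: always_eventually simp: linf_ops nm_tri\<close>)
  then show ?case using s t by (simp add: U_add)
next
  case (11 X c)
  then obtain s where s: "s \<in> carrier LN" "X = q s" by (rule U_cases)
  have "nrm U (q (c \<odot>\<^bsub>LN\<^esub> s)) = cmod c * nrm U (q s)"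
    using tendsto_mult_left[OF nrm_lim[OF s(1)], of "cmod c"] s by (intro nrm_eqI) (simp_all add: linf_ops nm_sc)
  then show ?case using s by (simp add: U_smult)
next
  case (12 X Y)
  then obtain s t where s: "s \<in> carrier LN" "X = q s" and t: "t \<in> carrier LN" "Y = q t" by (metis U_cases)
  have "nrm U (q (s \<otimes>\<^bsub>LN\<^esub> t)) \<le> nrm U (q s) * nrm U (q t)"
    by (rule tendsto_le[OF nbot tendsto_mult[OF nrm_lim nrm_lim] nrm_lim])
       (use s t in \<open>auto intro!: always_eventually simp: linf_ops nm_mult\<close>)
  then show ?case using s t by (simp add: U_mult)
next
  case (13 X)
  then obtain s where s: "s \<in> carrier LN" "X = q s" by (rule U_cases)
  have "nrm U (q (adj LN s \<otimes>\<^bsub>LN\<^esub> s)) = (nrm U (q s))\<^sup>2"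
    using tendsto_power[OF nrm_lim[OF s(1)], of 2] s by (intro nrm_eqI) (simp_all add: linf_ops nm_cs)
  then show ?case using s by (simp add: U_adj U_mult)
next
  case (14 x)
  then have x: "x n \<in> carrier U" for n by blast
  interpret R: ring U by (rule U_ring)
  \<comment> \<open>Lift the successive differences to sequences of almost the same norm and sum them.\<close>
  have lift: "\<exists>d\<in>carrier LN. q d = x (Suc n) \<ominus>\<^bsub>U\<^esub> x n \<and> nrm LN d \<le> 2 * (1/2) ^ n" for n
  proof -
    obtain s where s: "s \<in> carrier LN" "x (Suc n) \<ominus>\<^bsub>U\<^esub> x n = q s" using x by (meson R.minus_closed U_cases)
    have "(INF t\<in>q s. nrm LN t) < 2 * (1/2) ^ n"
      using 14(2)[of n] s by (auto simp: ultrapower_def quot_cstar_def intro: le_less_trans)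
    moreover have "nrm LN ` q s \<noteq> {}" using q_self[OF s(1)] by blast
    ultimately obtain d where d: "d \<in> q s" "nrm LN d < 2 * (1/2) ^ n"
      using cInf_lessD[of "nrm LN ` q s" "2 * (1/2) ^ n"] by blast
    have "q d = q s" "d \<in> carrier LN" using q_cong[OF s(1) d(1)] q_mem[OF s(1)] d(1) by auto
    then show ?thesis using s(2) d(2) by (intro bexI[of _ d]) auto
  qed
  then obtain d where d: "\<And>n. d n \<in> carrier LN" "\<And>n. q (d n) = x (Suc n) \<ominus>\<^bsub>U\<^esub> x n"
    "\<And>n. nrm LN (d n) \<le> 2 * (1/2) ^ n" by metis
  obtain t0 where t0: "t0 \<in> carrier LN" "x 0 = q t0" using x by (meson U_cases)
  define t where "t = rec_nat t0 (\<lambda>n v. v \<oplus>\<^bsub>LN\<^esub> d n)"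
  have tS: "t (Suc n) = t n \<oplus>\<^bsub>LN\<^esub> d n" and t00: "t 0 = t0" for n by (simp_all add: t_def)
  have tc: "t n \<in> carrier LN" for n by (induction n) (auto simp: t00 tS t0 d)
  have tq: "q (t n) = x n" for n
  proof (induction n)
    case (Suc n)
    have "q (t (Suc n)) = x n \<oplus>\<^bsub>U\<^esub> (x (Suc n) \<ominus>\<^bsub>U\<^esub> x n)"
      unfolding tS U_add[OF tc d(1), symmetric] d(2) Suc by simp
    also have "\<dots> = x n \<oplus>\<^bsub>U\<^esub> (\<ominus>\<^bsub>U\<^esub> x n \<oplus>\<^bsub>U\<^esub> x (Suc n))"
      using x[of n] x[of "Suc n"] by (simp add: a_minus_def R.a_comm)
    also have "\<dots> = x (Suc n)" using x[of n] x[of "Suc n"] by (simp add: R.a_assoc[symmetric] R.r_neg)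
    finally show ?case .
  qed (simp add: t00 t0)
  have "\<exists>l. L.tends t l"
  proof (rule L.dominated_tends[where r = "\<lambda>n. 4 - 4 * (1/2) ^ n" and B = 4])
    fix n
    have "t (Suc n) \<ominus>\<^bsub>LN\<^esub> t n = d n" using tc[of n] d(1)[of n] by (simp add: tS L.abel)
    then show "nrm LN (t (Suc n) \<ominus>\<^bsub>LN\<^esub> t n) \<le> 4 - 4 * (1/2) ^ Suc n - (4 - 4 * (1/2) ^ n)" using d(3)[of n] by simp
  qed (use tc in auto)
  then obtain l where l: "L.tends t l" by blast
  have lc: "l \<in> carrier LN" using l by (rule L.tendsD)
  have z: "(\<lambda>n. nrm LN (t n \<ominus>\<^bsub>LN\<^esub> l)) \<longlonglongrightarrow> 0" using l by (rule L.tendsD)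
  have e: "x n \<ominus>\<^bsub>U\<^esub> q l = q (t n \<ominus>\<^bsub>LN\<^esub> l)" for n using U_minus[OF tc lc] tq by metis
  have "(\<lambda>n. nrm U (x n \<ominus>\<^bsub>U\<^esub> q l)) \<longlonglongrightarrow> 0"
  proof (rule tendsto_sandwich[OF _ _ tendsto_const z])
    show "\<forall>\<^sub>F n in sequentially. 0 \<le> nrm U (x n \<ominus>\<^bsub>U\<^esub> q l)"
      unfolding e using tc lc by (intro always_eventually allI tendsto_lowerbound[OF nrm_lim]) auto
    show "\<forall>\<^sub>F n in sequentially. nrm U (x n \<ominus>\<^bsub>U\<^esub> q l) \<le> nrm LN (t n \<ominus>\<^bsub>LN\<^esub> l)"
      unfolding e using tc lc by (intro always_eventually allI nrm_le_seq) auto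
  qed
  then show ?case using lc by blast
qed

end

section \<open>Continuous functions and partitions of unity\<close>

locale cfun_alg = cstar_alg +
  fixes T :: "'g topology"
  assumes compT: "compact_space T" and neT: "topspace T \<noteq> {}"
begin

abbreviation "TS \<equiv> topspace T"
abbreviation "LX \<equiv> linf TS D"

sublocale LX: cstar_alg LX by (rule linf_cstar_alg) (rule neT)

definition CF :: "('g \<Rightarrow> 'a) set" where
  "CF = {f \<in> extensional TS. continuous_map T (norm_topology D) f}"

text \<open>Stated with filters, continuity into the algebra reduces to limits of real functions.\<close>

lemma cont_iff: "continuous_map T (norm_topology D) f \<longleftrightarrow>
    (\<forall>t\<in>TS. f t \<in> cr) \<and> (\<forall>t\<in>TS. ((\<lambda>y. nm (f y \<ominus> f t)) \<longlongrightarrow> 0) (atin T t))"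
proof -
  have nt: "norm_topology D = MS.mtopology" by (simp add: norm_topology_def)
  have e: "(\<forall>\<epsilon>>0. \<forall>\<^sub>F y in atin T t. f y \<in> cr \<and> cdist D (f y) (f t) < \<epsilon>) \<longleftrightarrow>
      ((\<lambda>y. nm (f y \<ominus> f t)) \<longlongrightarrow> 0) (atin T t)" if c: "\<forall>t\<in>TS. f t \<in> cr" and t: "t \<in> TS" for t
  proof -
    have in_T: "\<forall>\<^sub>F y in atin T t. y \<in> TS"
      unfolding eventually_atin using t openin_topspace by blast
    have "(\<forall>\<^sub>F y in atin T t. f y \<in> cr \<and> cdist D (f y) (f t) < \<epsilon>) \<longleftrightarrow>
        (\<forall>\<^sub>F y in atin T t. dist (nm (f y \<ominus> f t)) 0 < \<epsilon>)" for \<epsilon>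
      by (rule eventually_subst, rule eventually_mono[OF in_T]) (use c t in \<open>auto simp: cdist_def\<close>)
    then show ?thesis by (simp add: tendsto_iff)
  qed
  show ?thesis
    unfolding nt continuous_map_atin MS.limitin_metric using e by blast
qed

lemma CF_iff: "f \<in> CF \<longleftrightarrow> f \<in> extensional TS \<and> (\<forall>t\<in>TS. f t \<in> cr) \<and>
    (\<forall>t\<in>TS. ((\<lambda>y. nm (f y \<ominus> f t)) \<longlongrightarrow> 0) (atin T t))"
  unfolding CF_def using cont_iff by auto

lemma CF_at [simp]: "f \<in> CF \<Longrightarrow> t \<in> TS \<Longrightarrow> f t \<in> cr" by (simp add: CF_iff)

lemma CF_lim: "f \<in> CF \<Longrightarrow> t \<in> TS \<Longrightarrow> ((\<lambda>y. nm (f y \<ominus> f t)) \<longlongrightarrow> 0) (atin T t)" by (simp add: CF_iff)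

lemma atin_TS: "t \<in> TS \<Longrightarrow> (\<And>y. y \<in> TS \<Longrightarrow> P y) \<Longrightarrow> \<forall>\<^sub>F y in atin T t. P y"
  unfolding eventually_atin using openin_topspace by blast

lemma CF_I:
  assumes "f \<in> extensional TS" "\<And>t. t \<in> TS \<Longrightarrow> f t \<in> cr"
    and r: "\<And>t y. t \<in> TS \<Longrightarrow> y \<in> TS \<Longrightarrow> nm (f y \<ominus> f t) \<le> r t y"
    and l: "\<And>t. t \<in> TS \<Longrightarrow> (r t \<longlongrightarrow> 0) (atin T t)"
  shows "f \<in> CF"
  unfolding CF_iff
proof (intro conjI ballI)
  fix t assume t: "t \<in> TS"
  show "((\<lambda>y. nm (f y \<ominus> f t)) \<longlongrightarrow> 0) (atin T t)"
    by (rule tendsto_sandwich[OF _ _ tendsto_const l[OF t]]) (use assms t in \<open>auto intro!: atin_TS\<close>)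
qed (use assms in auto)

lemma CF_sub_linf: assumes f: "f \<in> CF" shows "f \<in> carrier LX"
proof -
  have "continuous_map T MS.mtopology f" using f by (simp add: CF_def norm_topology_def)
  then have "compactin MS.mtopology (f ` TS)" using compT by (simp add: compact_space_def image_compactin)
  then have "MS.mbounded (f ` TS)" by (rule MS.compactin_imp_mbounded)
  then obtain c B where B: "f ` TS \<subseteq> MS.mcball c B" unfolding MS.mbounded_def by blast
  show ?thesis
  proof (rule linfI[where B = "nm c + B"])
    fix t assume t: "t \<in> TS"
    have "c \<in> cr" "nm (c \<ominus> f t) \<le> B" using B t f by (auto simp: MS.mcball_def cdist_def)
    then show "nm (f t) \<le> nm c + B" using nm_le_diff[of "f t" c] nm_minus_commute[of c "f t"] f t by simp
  qed (use f in \<open>auto simp: CF_iff\<close>)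
qed

lemma CF_sub_alg: "LX.sub_alg CF"
  unfolding LX.sub_alg_def
proof (intro conjI ballI allI impI subsetI)
  show "f \<in> CF \<Longrightarrow> f \<in> carrier LX" for f by (rule CF_sub_linf)
  show "\<one>\<^bsub>LX\<^esub> \<in> CF" by (rule CF_I[where r = "\<lambda>_ _. 0"]) (auto simp: linf_ext linf_ops)
  fix f assume f: "f \<in> CF"
  show "c \<odot>\<^bsub>LX\<^esub> f \<in> CF" for c
    by (rule CF_I[where r = "\<lambda>t y. cmod c * nm (f y \<ominus> f t)"])
       (use f in \<open>auto simp: linf_ext linf_ops sc_minus[symmetric] nm_sc intro!: tendsto_mult_right_zero CF_lim\<close>)
  show "adj LX f \<in> CF"
    by (rule CF_I[where r = "\<lambda>t y. nm (f y \<ominus> f t)"])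
       (use f in \<open>auto simp: linf_ext linf_ops st_minus[symmetric] intro!: CF_lim\<close>)
  fix g assume g: "g \<in> CF"
  show "f \<oplus>\<^bsub>LX\<^esub> g \<in> CF"
    by (rule CF_I[where r = "\<lambda>t y. nm (f y \<ominus> f t) + nm (g y \<ominus> g t)"])
       (use f g in \<open>auto simp: linf_ext linf_ops add_minus_swap nm_tri intro!: tendsto_add_zero CF_lim\<close>)
  show "f \<otimes>\<^bsub>LX\<^esub> g \<in> CF"
  proof (rule CF_I[where r = "\<lambda>t y. nm (f y \<ominus> f t) * nrm LX g + nm (f t) * nm (g y \<ominus> g t)"])
    fix t y assume ty: "t \<in> TS" "y \<in> TS"
    have "nm (f y \<otimes> g y \<ominus> f t \<otimes> g t) \<le> nm ((f y \<ominus> f t) \<otimes> g y) + nm (f t \<otimes> (g y \<ominus> g t))"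
      using f g ty by (simp add: mult_minus_split nm_tri)
    also have "\<dots> \<le> nm (f y \<ominus> f t) * nm (g y) + nm (f t) * nm (g y \<ominus> g t)"
      using f g ty by (intro add_mono nm_mult) auto
    also have "\<dots> \<le> nm (f y \<ominus> f t) * nrm LX g + nm (f t) * nm (g y \<ominus> g t)"
      using f g ty by (intro add_right_mono mult_left_mono linf_le CF_sub_linf) auto
    finally show "nm ((f \<otimes>\<^bsub>LX\<^esub> g) y \<ominus> (f \<otimes>\<^bsub>LX\<^esub> g) t) \<le> nm (f y \<ominus> f t) * nrm LX g + nm (f t) * nm (g y \<ominus> g t)"
      using ty by (simp add: linf_ops)
  next
    fix t assume t: "t \<in> TS"
    have "((\<lambda>y. nm (f y \<ominus> f t) * nrm LX g + nm (f t) * nm (g y \<ominus> g t)) \<longlongrightarrow> 0 * nrm LX g + nm (f t) * 0) (atin T t)"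
      using f g t by (intro tendsto_intros CF_lim)
    then show "((\<lambda>y. nm (f y \<ominus> f t) * nrm LX g + nm (f t) * nm (g y \<ominus> g t)) \<longlongrightarrow> 0) (atin T t)" by simp
  qed (use f g in \<open>auto simp: linf_ext linf_ops\<close>)
next
  fix s l assume a: "(\<forall>n. s n \<in> CF) \<and> LX.tends s l"
  then have s: "s n \<in> CF" for n by blast
  have sl: "s n \<in> carrier LX" for n using s CF_sub_linf by blast
  have l: "l \<in> carrier LX" and z: "(\<lambda>n. nrm LX (s n \<ominus>\<^bsub>LX\<^esub> l)) \<longlonglongrightarrow> 0" using a LX.tendsD by blast+
  show "l \<in> CF" unfolding CF_iff
  proof (intro conjI ballI)
    fix t assume t: "t \<in> TS"
    show "((\<lambda>y. nm (l y \<ominus> l t)) \<longlongrightarrow> 0) (atin T t)"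
    proof (rule tendstoI)
      fix e :: real assume e: "e > 0"
      then obtain n where n: "nrm LX (s n \<ominus>\<^bsub>LX\<^esub> l) < e / 3"
        using order_tendstoD(2)[OF z, of "e/3"] eventually_happens'[OF sequentially_bot] by fastforce
      have b: "nm (s n y \<ominus> l y) < e / 3" if y: "y \<in> TS" for y
        using linf_le[of "s n \<ominus>\<^bsub>LX\<^esub> l" TS y] n sl l y by (simp add: linf_minus)
      have "\<forall>\<^sub>F y in atin T t. nm (s n y \<ominus> s n t) < e / 3"
        using order_tendstoD(2)[OF CF_lim[OF s t], of "e/3"] e by simp
      moreover have "\<forall>\<^sub>F y in atin T t. y \<in> TS" using t by (rule atin_TS)
      ultimately show "\<forall>\<^sub>F y in atin T t. dist (nm (l y \<ominus> l t)) 0 < e"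
      proof eventually_elim
        case (elim y)
        have m: "l y \<in> cr" "l t \<in> cr" "s n y \<in> cr" "s n t \<in> cr" using l s t elim by auto
        have "nm (l y \<ominus> l t) \<le> nm (l y \<ominus> s n y) + (nm (s n y \<ominus> s n t) + nm (s n t \<ominus> l t))"
          using nm_tri3[of "l y" "s n y" "l t"] nm_tri3[of "s n y" "s n t" "l t"] m by linarith
        then have "nm (l y \<ominus> l t) < e"
          using b[OF elim(2)] b[OF t] elim(1) nm_minus_commute[of "l y" "s n y"] m by linarith
        then show ?case using nm_ge0[of "l y \<ominus> l t"] m by simp
      qed
    qed
  qed (use l in \<open>auto simp: linf_carrier\<close>)
qed

abbreviation "CA \<equiv> LX\<lparr>carrier := CF\<rparr>"

lemma CA_cstar_alg: "cstar_alg CA" by (rule LX.sub_cstar_alg[OF CF_sub_alg])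

text \<open>A finite number of the sets \<open>{y. \<rho> y t < e}\<close> cover the space, and the functions
\<open>max 0 (e - \<rho> y t)\<close> attached to them have a strictly positive sum, by which they are divided. In
the applications \<open>\<rho>\<close> measures the oscillation of the functions to be approximated.\<close>

lemma partition_of_unity:
  fixes \<rho> :: "'g \<Rightarrow> 'g \<Rightarrow> real"
  assumes cont: "\<And>t. t \<in> TS \<Longrightarrow> continuous_map T euclideanreal (\<lambda>y. \<rho> y t)"
    and zero: "\<And>t. t \<in> TS \<Longrightarrow> \<rho> t t = 0" and e: "e > 0"
  shows "\<exists>n u \<tau>. (\<forall>k<n. \<tau> k \<in> TS \<and> continuous_map T euclideanreal (u k) \<and>
             (\<forall>y\<in>TS. 0 \<le> u k y \<and> (u k y \<noteq> 0 \<longrightarrow> \<rho> y (\<tau> k) < e))) \<and>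
           (\<forall>y\<in>TS. (\<Sum>k<(n::nat). u k y) = (1::real))"
proof -
  define V where "V = (\<lambda>t. {y \<in> TS. \<rho> y t < e})"
  have op: "openin T (V t)" if "t \<in> TS" for t
  proof -
    have "openin T {y \<in> TS. \<rho> y t \<in> {..<e}}"
      using cont[OF that] by (rule openin_continuous_map_preimage) simp
    then show ?thesis by (simp add: V_def)
  qed
  have self: "t \<in> V t" if "t \<in> TS" for t using that zero e by (simp add: V_def)
  have "\<forall>W\<in>V ` TS. openin T W" "TS \<subseteq> \<Union>(V ` TS)" using op self by blast+
  then have "\<exists>F. finite F \<and> F \<subseteq> V ` TS \<and> TS \<subseteq> \<Union>F"
    using compT[unfolded compact_space_alt, rule_format, of "V ` TS"] by blast
  then obtain F where F: "finite F" "F \<subseteq> V ` TS" "TS \<subseteq> \<Union>F" by blast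
  then obtain C where C: "finite C" "C \<subseteq> TS" "F = V ` C" by (meson finite_subset_image)
  obtain \<tau> where \<tau>: "bij_betw \<tau> {..<card C} C" using ex_bij_betw_nat_finite[OF C(1)] by (auto simp: atLeast0LessThan)
  define n where "n = card C"
  have \<tau>T: "\<tau> k \<in> TS" if "k < n" for k using \<tau> that C(2) by (auto simp: n_def bij_betw_def)
  define v where "v = (\<lambda>k y. max 0 (e - \<rho> y (\<tau> k)))"
  define S where "S = (\<lambda>y. \<Sum>k<n. v k y)"
  have vc: "continuous_map T euclideanreal (v k)" if "k < n" for k
    unfolding v_def using cont[OF \<tau>T[OF that]] by (intro continuous_map_real_max continuous_map_diff) auto
  have Sc: "continuous_map T euclideanreal S" unfolding S_def using vc by (intro continuous_map_sum) auto
  have Sp: "S y > 0" if y: "y \<in> TS" for y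
  proof -
    obtain c where c: "c \<in> C" "y \<in> V c" using F(3) C(3) y by blast
    have "c \<in> \<tau> ` {..<n}" using \<tau> c(1) by (simp add: n_def bij_betw_def)
    then obtain k where k: "k < n" "\<tau> k = c" by auto
    have "v k y > 0" using c(2) k by (simp add: v_def V_def)
    then show ?thesis unfolding S_def using k(1) by (intro sum_pos2[of _ k]) (auto simp: v_def)
  qed
  define u where "u = (\<lambda>k y. v k y / S y)"
  have "continuous_map T euclideanreal (u k)" if "k < n" for k
    unfolding u_def using vc[OF that] Sc Sp by (intro continuous_map_real_divide) (auto simp: less_le)
  moreover have "0 \<le> u k y \<and> (u k y \<noteq> 0 \<longrightarrow> \<rho> y (\<tau> k) < e)" if "y \<in> TS" for k y
    using Sp[OF that] by (auto simp: u_def v_def)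
  moreover have "(\<Sum>k<n. u k y) = 1" if "y \<in> TS" for y
    using Sp[OF that] by (simp add: u_def sum_divide_distrib[symmetric]) (simp add: S_def)
  ultimately show ?thesis using \<tau>T by blast
qed

lemma CF_dist_cont:
  assumes f: "f \<in> CF" and t: "t \<in> TS" shows "continuous_map T euclideanreal (\<lambda>y. nm (f y \<ominus> f t))"
  unfolding continuous_map_atin limitin_canonical_iff
proof
  fix z assume z: "z \<in> TS"
  have "((\<lambda>y. nm (f y \<ominus> f t) - nm (f z \<ominus> f t)) \<longlongrightarrow> 0) (atin T z)"
  proof (rule Lim_null_comparison[OF _ CF_lim[OF f z]], rule atin_TS[OF z])
    fix y assume y: "y \<in> TS"
    show "norm (nm (f y \<ominus> f t) - nm (f z \<ominus> f t)) \<le> nm (f y \<ominus> f z)"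
      using nm_tri3[of "f y" "f z" "f t"] nm_tri3[of "f z" "f y" "f t"] nm_minus_commute[of "f y" "f z"] f y z t
      by (auto simp: abs_le_iff)
  qed
  then show "((\<lambda>y. nm (f y \<ominus> f t)) \<longlongrightarrow> nm (f z \<ominus> f t)) (atin T z)" by (simp add: LIM_zero_iff)
qed

end

lemma norm_topology_complex: "norm_topology complex_cstar = euclidean"
proof -
  have "cdist complex_cstar = dist"
    by (intro ext) (simp add: cdist_def complex_minus complex_ops dist_norm)
  then show ?thesis by (simp add: norm_topology_def)
qed

sublocale cfun_alg \<subseteq> CC: cfun_alg complex_cstar T
  by (intro cfun_alg.intro complex_cstar_alg cfun_alg_axioms.intro compT neT)

context cfun_alg
begin

lemma cont_alg_eq: "cont_alg T = CC.CA"
  by (simp add: cont_alg_def CC.CF_def norm_topology_complex)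

definition unit_fun :: "('g \<Rightarrow> real) \<Rightarrow> bool" where
  "unit_fun u \<longleftrightarrow> continuous_map T euclideanreal u \<and> (\<forall>t\<in>TS. 0 \<le> u t \<and> u t \<le> 1)"

definition cx :: "('g \<Rightarrow> real) \<Rightarrow> 'g \<Rightarrow> complex" where
  "cx u = (\<lambda>t\<in>TS. complex_of_real (u t))"

lemma cx_in [simp, intro]: assumes u: "continuous_map T euclideanreal u" shows "cx u \<in> CC.CF"
proof -
  have "continuous_map T euclidean (\<lambda>t. complex_of_real (u t))"
    using u unfolding continuous_map_atin limitin_canonical_iff by (auto intro: tendsto_of_real)
  then have "continuous_map T euclidean (cx u)"
    unfolding cx_def by (rule continuous_map_eq) simp
  then show ?thesis by (simp add: CC.CF_def norm_topology_complex cx_def)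
qed

lemma unit_fun_cx: "unit_fun u \<Longrightarrow> cx u \<in> CC.CF" by (simp add: unit_fun_def)
lemma cx_at [simp]: "t \<in> TS \<Longrightarrow> cx u t = complex_of_real (u t)" by (simp add: cx_def)

abbreviation "tens f a \<equiv> elem_tensor T D f a"

lemma tens_at [simp]: "t \<in> TS \<Longrightarrow> tens f a t = f t \<odot> a" by (simp add: elem_tensor_def)

lemma tens_in [simp, intro]: assumes f: "f \<in> CC.CF" and a: "a \<in> cr" shows "tens f a \<in> CF"
proof (rule CF_I[where r = "\<lambda>t y. cmod (f y - f t) * nm a"])
  show "tens f a \<in> extensional TS" by (simp add: elem_tensor_def)
  show "((\<lambda>y. cmod (f y - f t) * nm a) \<longlongrightarrow> 0) (atin T t)" if "t \<in> TS" for t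
    using CC.CF_lim[OF f that] by (simp add: complex_minus complex_ops tendsto_mult_left_zero)
  show "nm (tens f a y \<ominus> tens f a t) \<le> cmod (f y - f t) * nm a" if "t \<in> TS" "y \<in> TS" for t y
    using that a sc_addl[of a "f y" "- f t"] by (simp add: a_minus_def sc_lneg[symmetric] nm_sc[symmetric])
qed (use a in auto)

text \<open>A partition of unity with one base point for each of its members, of mesh less than \<open>e\<close> with respect
to \<open>\<rho>\<close>.\<close>

definition subordinate :: "('g \<Rightarrow> 'g \<Rightarrow> real) \<Rightarrow> real \<Rightarrow> nat \<Rightarrow> (nat \<Rightarrow> 'g \<Rightarrow> real) \<Rightarrow> (nat \<Rightarrow> 'g) \<Rightarrow> bool" where
  "subordinate \<rho> e n u \<tau> \<longleftrightarrow> (\<forall>k<n. \<tau> k \<in> TS \<and> unit_fun (u k) \<and> (\<forall>y\<in>TS. u k y \<noteq> 0 \<longrightarrow> \<rho> y (\<tau> k) < e)) \<and>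
     (\<forall>y\<in>TS. (\<Sum>k<n. u k y) = 1)"

definition pseudo_dist :: "('g \<Rightarrow> 'g \<Rightarrow> real) \<Rightarrow> bool" where
  "pseudo_dist \<rho> \<longleftrightarrow> (\<forall>t\<in>TS. continuous_map T euclideanreal (\<lambda>y. \<rho> y t) \<and> \<rho> t t = 0 \<and> (\<forall>y\<in>TS. 0 \<le> \<rho> y t))"

lemma subordinate_exists: assumes g: "pseudo_dist \<rho>" and e: "e > 0" shows "\<exists>n u \<tau>. subordinate \<rho> e n u \<tau>"
proof -
  obtain n u \<tau> where p: "\<forall>k<(n::nat). \<tau> k \<in> TS \<and> continuous_map T euclideanreal (u k) \<and>
             (\<forall>y\<in>TS. 0 \<le> u k y \<and> (u k y \<noteq> 0 \<longrightarrow> \<rho> y (\<tau> k) < e))"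
     "\<forall>y\<in>TS. (\<Sum>k<n. u k y) = (1::real)"
    using partition_of_unity[of \<rho> e] g e unfolding pseudo_dist_def by blast
  have "u k y \<le> 1" if "k < n" "y \<in> TS" for k y
  proof -
    have "u k y \<le> (\<Sum>k<n. u k y)" using p that by (intro member_le_sum) auto
    then show ?thesis using p that by simp
  qed
  then show ?thesis unfolding subordinate_def unit_fun_def using p by blast
qed

lemma pseudo_dist_add: "pseudo_dist \<rho> \<Longrightarrow> pseudo_dist \<sigma> \<Longrightarrow> pseudo_dist (\<lambda>y t. \<rho> y t + \<sigma> y t)"
  unfolding pseudo_dist_def by (auto intro: continuous_map_add)

lemma pseudo_dist_CF: "f \<in> CF \<Longrightarrow> pseudo_dist (\<lambda>y t. nm (f y \<ominus> f t))"
  unfolding pseudo_dist_def using CF_dist_cont by auto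

lemma pseudo_dist_sum: "finite I \<Longrightarrow> (\<And>i. i \<in> I \<Longrightarrow> pseudo_dist (\<rho> i)) \<Longrightarrow> pseudo_dist (\<lambda>y t. \<Sum>i\<in>I. \<rho> i y t)"
  unfolding pseudo_dist_def by (auto intro!: continuous_map_sum sum_nonneg)

lemma subordinate_mono: "subordinate \<rho> e n u \<tau> \<Longrightarrow> (\<And>y t. y \<in> TS \<Longrightarrow> t \<in> TS \<Longrightarrow> \<sigma> y t \<le> \<rho> y t) \<Longrightarrow> e \<le> d \<Longrightarrow> subordinate \<sigma> d n u \<tau>"
  unfolding subordinate_def by (meson order_le_less_trans order_less_le_trans)

lemma LX_finsum_at: "(\<And>k. k < n \<Longrightarrow> F k \<in> carrier LX) \<Longrightarrow> t \<in> TS \<Longrightarrow> LX.fsum n F t = fsum n (\<lambda>k. F k t)"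
proof (induction n)
  case (Suc n)
  have "F i t \<in> cr" if "i < Suc n" for i using Suc.prems that by (meson linf_at)
  then show ?case using Suc LX.fsum_Suc[of n F] fsum_Suc[of n "\<lambda>k. F k t"] by (simp add: linf_ops)
qed (simp add: linf_ops)

lemma convex_comb_near:
  assumes a: "a \<in> cr" and b: "\<And>k. k < n \<Longrightarrow> b k \<in> cr" and c: "\<And>k. k < n \<Longrightarrow> 0 \<le> (c k :: real)"
    and s: "(\<Sum>k<n. c k) = 1" and d: "\<And>k. k < n \<Longrightarrow> c k \<noteq> 0 \<Longrightarrow> nm (a \<ominus> b k) \<le> e"
  shows "nm (a \<ominus> fsum n (\<lambda>k. complex_of_real (c k) \<odot> b k)) \<le> e"
proof -
  have "fsum n (\<lambda>k. complex_of_real (c k) \<odot> a) = complex_of_real (\<Sum>k<n. c k) \<odot> a"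
    using a by (induction n) (simp_all add: fsum_Suc sc_addl)
  then have "a \<ominus> fsum n (\<lambda>k. complex_of_real (c k) \<odot> b k) =
      fsum n (\<lambda>k. complex_of_real (c k) \<odot> a) \<ominus> fsum n (\<lambda>k. complex_of_real (c k) \<odot> b k)"
    using a s by simp
  also have "\<dots> = fsum n (\<lambda>k. complex_of_real (c k) \<odot> (a \<ominus> b k))"
    using a b by (intro fsum_minusI[symmetric]) (auto simp: sc_minus)
  also have "nm \<dots> \<le> (\<Sum>k<n. nm (complex_of_real (c k) \<odot> (a \<ominus> b k)))" using a b by (intro fsum_nm) auto
  also have "\<dots> \<le> (\<Sum>k<n. c k * e)"
  proof (rule sum_mono)
    fix k assume k: "k \<in> {..<n}"
    show "nm (complex_of_real (c k) \<odot> (a \<ominus> b k)) \<le> c k * e"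
      using k a b c d by (cases "c k = 0") (auto simp: nm_sc intro!: mult_left_mono)
  qed
  also have "\<dots> = e" using s by (simp add: sum_distrib_right[symmetric])
  finally show ?thesis .
qed

definition approx :: "nat \<Rightarrow> (nat \<Rightarrow> 'g \<Rightarrow> real) \<Rightarrow> (nat \<Rightarrow> 'a) \<Rightarrow> 'g \<Rightarrow> 'a" where
  "approx n u b = LX.fsum n (\<lambda>k. tens (cx (u k)) (b k))"

lemma approx_in: "(\<And>k. k < n \<Longrightarrow> unit_fun (u k)) \<Longrightarrow> (\<And>k. k < n \<Longrightarrow> b k \<in> cr) \<Longrightarrow> approx n u b \<in> CF"
  unfolding approx_def by (intro LX.sub_finsum(2)[OF CF_sub_alg] tens_in unit_fun_cx)

text \<open>At each point only those \<open>k\<close> contribute for which \<open>F\<close> at the base point is \<open>e\<close>-close to \<open>F\<close> at the point.\<close>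

lemma approx_near:
  assumes F: "F \<in> CF" and f: "subordinate \<rho> e n u \<tau>"
    and le: "\<And>y t. y \<in> TS \<Longrightarrow> t \<in> TS \<Longrightarrow> nm (F y \<ominus> F t) \<le> \<rho> y t"
  shows "nrm LX (F \<ominus>\<^bsub>LX\<^esub> approx n u (\<lambda>k. F (\<tau> k))) \<le> e"
proof -
  have u: "unit_fun (u k)" "\<tau> k \<in> TS" "\<And>y. y \<in> TS \<Longrightarrow> u k y \<noteq> 0 \<Longrightarrow> \<rho> y (\<tau> k) < e" if "k < n" for k
    using f that by (auto simp: subordinate_def)
  have s: "(\<Sum>k<n. u k y) = 1" if "y \<in> TS" for y using f that by (auto simp: subordinate_def)
  have ap: "approx n u (\<lambda>k. F (\<tau> k)) \<in> CF" using u F by (intro approx_in) auto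
  show ?thesis
  proof (rule linf_least[OF neT])
    fix y assume y: "y \<in> TS"
    have "approx n u (\<lambda>k. F (\<tau> k)) y = fsum n (\<lambda>k. tens (cx (u k)) (F (\<tau> k)) y)"
      unfolding approx_def using u F y by (intro LX_finsum_at CF_sub_linf tens_in unit_fun_cx) auto
    also have "\<dots> = fsum n (\<lambda>k. complex_of_real (u k y) \<odot> F (\<tau> k))"
      using u F y by (intro fsum_cong) auto
    finally have e: "approx n u (\<lambda>k. F (\<tau> k)) y = \<dots>" .
    have "nm (F y \<ominus> fsum n (\<lambda>k. complex_of_real (u k y) \<odot> F (\<tau> k))) \<le> e"
    proof (rule convex_comb_near)
      show "nm (F y \<ominus> F (\<tau> k)) \<le> e" if "k < n" "u k y \<noteq> 0" for k
        using le[OF y u(2)[OF that(1)]] u(3)[OF that(1) y that(2)] by linarith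
    qed (use u F y s in \<open>auto simp: unit_fun_def\<close>)
    then show "nm ((F \<ominus>\<^bsub>LX\<^esub> approx n u (\<lambda>k. F (\<tau> k))) y) \<le> e"
      using F ap y by (simp add: linf_minus CF_sub_linf e)
  qed
qed

text \<open>Elementary tensors are continuous, and so are uniform limits of their sums. Conversely a fine
partition of unity approximates a continuous function by a sum of elementary tensors.\<close>

lemma cont_tensor_eq: "cont_tensor T D = CA"
proof -
  have nt: "norm_topology LX closure_of S = {F \<in> carrier LX. \<forall>r>0. \<exists>H\<in>S. H \<in> LX.MS.mball F r}" for S
    unfolding norm_topology_def by (rule LX.MS.metric_closure_of)
  have ca: "carrier (cont_alg T) = CC.CF" by (simp add: cont_alg_eq)
  have alg: "alg_tensor T D \<subseteq> CF"
    unfolding alg_tensor_def ca by (auto intro!: LX.sub_finsum(2)[OF CF_sub_alg] tens_in)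
  have "norm_topology LX closure_of alg_tensor T D = CF"
  proof (intro equalityI subsetI)
    fix F assume F: "F \<in> norm_topology LX closure_of alg_tensor T D"
    have "\<exists>H. H \<in> CF \<and> H \<in> carrier LX \<and> F \<in> carrier LX \<and> nrm LX (H \<ominus>\<^bsub>LX\<^esub> F) \<le> 1 / real (Suc n)" for n
    proof -
      obtain H where H: "H \<in> alg_tensor T D" "H \<in> LX.MS.mball F (1 / real (Suc n))"
        using F unfolding nt by (auto dest: spec[of _ "1 / real (Suc n)"])
      then have "H \<in> carrier LX" "F \<in> carrier LX" "nrm LX (F \<ominus>\<^bsub>LX\<^esub> H) < 1 / real (Suc n)"
        by (auto simp: LX.MS.mball_def cdist_def)
      then show ?thesis using alg H(1) LX.nm_minus_commute[of F H] by (auto intro!: exI[of _ H])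
    qed
    then obtain H where H: "\<And>n. H n \<in> CF" "\<And>n. H n \<in> carrier LX" "F \<in> carrier LX"
      "\<And>n. nrm LX (H n \<ominus>\<^bsub>LX\<^esub> F) \<le> 1 / real (Suc n)" by metis
    have "LX.tends H F"
      by (rule LX.tendsI[where r = "\<lambda>n. 1 / real (Suc n)"])
         (use H LIMSEQ_inverse_real_of_nat in \<open>auto simp: inverse_eq_divide\<close>)
    then show "F \<in> CF" using LX.sub_algD(7)[OF CF_sub_alg] H(1) by blast
  next
    fix F assume F: "F \<in> CF"
    show "F \<in> norm_topology LX closure_of alg_tensor T D"
      unfolding nt
    proof (intro CollectI conjI allI impI)
      show "F \<in> carrier LX" using F by (rule CF_sub_linf)
      fix r :: real assume r: "r > 0"
      obtain n u \<tau> where f: "subordinate (\<lambda>y t. nm (F y \<ominus> F t)) (r/2) n u \<tau>"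
        using subordinate_exists[OF pseudo_dist_CF[OF F], of "r/2"] r by auto
      let ?H = "approx n u (\<lambda>k. F (\<tau> k))"
      have n: "nrm LX (F \<ominus>\<^bsub>LX\<^esub> ?H) \<le> r/2" using approx_near[OF F f] by simp
      have u: "unit_fun (u k)" "\<tau> k \<in> TS" if "k < n" for k using f that by (auto simp: subordinate_def)
      have H: "?H \<in> CF" using u F by (intro approx_in) auto
      have "?H \<in> alg_tensor T D"
        unfolding alg_tensor_def approx_def ca mem_Collect_eq
        by (rule exI[of _ n], rule exI[of _ "\<lambda>k. cx (u k)"], rule exI[of _ "\<lambda>k. F (\<tau> k)"])
           (use u F unit_fun_cx in auto)
      moreover have "?H \<in> LX.MS.mball F r" using n r F H by (simp add: LX.MS.mball_def cdist_def CF_sub_linf)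
      ultimately show "\<exists>H\<in>alg_tensor T D. H \<in> LX.MS.mball F r" by blast
    qed
  qed
  then show ?thesis by (simp add: cont_tensor_def)
qed

end

section \<open>Positivity under homomorphisms\<close>

text \<open>A *-homomorphism carries a self-adjoint root to a self-adjoint root.\<close>

lemma hom_psd:
  assumes D: "cstar_alg D" and E: "cstar_alg E"
    and h: "\<And>x. x \<in> carrier D \<Longrightarrow> h x \<in> carrier E"
    and m: "\<And>x y. x \<in> carrier D \<Longrightarrow> y \<in> carrier D \<Longrightarrow> h (x \<otimes>\<^bsub>D\<^esub> y) = h x \<otimes>\<^bsub>E\<^esub> h y"
    and s: "\<And>x. x \<in> carrier D \<Longrightarrow> h (adj D x) = adj E (h x)"
    and p: "positive D x"
  shows "positive E (h x)"
proof -
  interpret D: cstar_alg D by (rule D)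
  interpret E: cstar_alg E by (rule E)
  obtain z where z: "z \<in> carrier D" "adj D z = z" "x = z \<otimes>\<^bsub>D\<^esub> z"
    using p unfolding D.positive_iff_psd D.psd_def by blast
  then have "h x = h z \<otimes>\<^bsub>E\<^esub> h z" "adj E (h z) = h z" "h z \<in> carrier E"
    using m s[of z] h by auto
  then show ?thesis unfolding E.positive_iff_psd E.psd_def by blast
qed

definition mat_map :: "nat \<Rightarrow> ('a \<Rightarrow> 'b) \<Rightarrow> (nat \<times> nat \<Rightarrow> 'a) \<Rightarrow> (nat \<times> nat \<Rightarrow> 'b)" where
  "mat_map n h X = (\<lambda>p\<in>{..<n} \<times> {..<n}. h (X p))"

lemma mat_map_at [simp]: "i < n \<Longrightarrow> j < n \<Longrightarrow> mat_map n h X (i, j) = h (X (i, j))"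
  by (simp add: mat_map_def)

lemma hom_mat_positive:
  assumes D: "cstar_alg D" and E: "cstar_alg E"
    and h: "\<And>x. x \<in> carrier D \<Longrightarrow> h x \<in> carrier E"
    and a: "\<And>x y. x \<in> carrier D \<Longrightarrow> y \<in> carrier D \<Longrightarrow> h (x \<oplus>\<^bsub>D\<^esub> y) = h x \<oplus>\<^bsub>E\<^esub> h y"
    and m: "\<And>x y. x \<in> carrier D \<Longrightarrow> y \<in> carrier D \<Longrightarrow> h (x \<otimes>\<^bsub>D\<^esub> y) = h x \<otimes>\<^bsub>E\<^esub> h y"
    and s: "\<And>x. x \<in> carrier D \<Longrightarrow> h (adj D x) = adj E (h x)"
    and p: "positive (mat_alg n D) X"
  shows "positive (mat_alg n E) (mat_map n h X)"
proof -
  interpret D: cstar_alg D by (rule D)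
  interpret E: cstar_alg E by (rule E)
  have "h \<zero>\<^bsub>D\<^esub> \<oplus>\<^bsub>E\<^esub> h \<zero>\<^bsub>D\<^esub> = h \<zero>\<^bsub>D\<^esub>" using a[of "\<zero>\<^bsub>D\<^esub>" "\<zero>\<^bsub>D\<^esub>"] by simp
  then have h0: "h \<zero>\<^bsub>D\<^esub> = \<zero>\<^bsub>E\<^esub>" using h[of "\<zero>\<^bsub>D\<^esub>"] by (metis D.zero_closed E.add.l_cancel_one)
  have hf: "h (D.fsum k f) = E.fsum k (\<lambda>i. h (f i))" if "\<And>i. i < k \<Longrightarrow> f i \<in> carrier D" for k f
    using that by (induction k) (auto simp: h0 D.fsum_Suc E.fsum_Suc a h)
  show ?thesis
    unfolding positive_mat_cstar
  proof (rule hom_psd[OF D.mat_cstar_alg E.mat_cstar_alg])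
    show cl: "mat_map n h X \<in> carrier (mat_cstar n E)" if "X \<in> carrier (mat_cstar n D)" for X
      using that h by (auto simp: E.mat_carrier E.is_mat_def mat_map_def)
    show "mat_map n h (X \<otimes>\<^bsub>mat_cstar n D\<^esub> Y) = mat_map n h X \<otimes>\<^bsub>mat_cstar n E\<^esub> mat_map n h Y"
      if "X \<in> carrier (mat_cstar n D)" "Y \<in> carrier (mat_cstar n D)" for X Y
      using that cl h by (intro E.mat_eqI) (auto simp: E.mat_mult D.mat_mult hf m intro!: E.fsum_cong)
    show "mat_map n h (adj (mat_cstar n D) X) = adj (mat_cstar n E) (mat_map n h X)"
      if "X \<in> carrier (mat_cstar n D)" for X
      using that cl s by (intro E.mat_eqI) (auto simp: E.mat_adj D.mat_adj)
    show "positive (mat_cstar n D) X" using p by (simp add: positive_mat_cstar)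
  qed
qed

lemma positive_mat1:
  assumes D: "cstar_alg D"
  shows "positive D x \<longleftrightarrow> positive (mat_alg 1 D) (\<lambda>p\<in>{..<1} \<times> {..<1}. x) \<and> x \<in> carrier D"
proof -
  interpret D: cstar_alg D by (rule D)
  interpret M: cstar_alg "mat_cstar 1 D" by (rule D.mat_cstar_alg)
  let ?h = "\<lambda>x. \<lambda>p\<in>{..<1::nat} \<times> {..<1::nat}. x"
  have cl: "?h x \<in> carrier (mat_cstar 1 D)" if "x \<in> carrier D" for x
    using that by (auto simp: D.mat_carrier D.is_mat_def)
  show ?thesis
  proof (intro iffI conjI)
    assume p: "positive D x"
    then show "x \<in> carrier D" by (simp add: positive_def)
    show "positive (mat_alg 1 D) (?h x)"
      unfolding positive_mat_cstar
    proof (rule hom_psd[OF D D.mat_cstar_alg cl _ _ p])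
      show "?h (x \<otimes>\<^bsub>D\<^esub> y) = ?h x \<otimes>\<^bsub>mat_cstar 1 D\<^esub> ?h y" if "x \<in> carrier D" "y \<in> carrier D" for x y
        using that cl by (intro D.mat_eqI) (auto simp: D.mat_mult D.fsum_Suc)
      show "?h (adj D x) = adj (mat_cstar 1 D) (?h x)" if "x \<in> carrier D" for x
        using that cl by (intro D.mat_eqI) (auto simp: D.mat_adj)
    qed
  next
    assume p: "positive (mat_alg 1 D) (?h x) \<and> x \<in> carrier D"
    then obtain Z where Z: "Z \<in> carrier (mat_cstar 1 D)" "adj (mat_cstar 1 D) Z = Z" "?h x = Z \<otimes>\<^bsub>mat_cstar 1 D\<^esub> Z"
      unfolding positive_mat_cstar M.positive_iff_psd M.psd_def by blast
    let ?z = "Z (0, 0)"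
    have zc: "?z \<in> carrier D" using Z(1) D.mat_entry by blast
    have "adj D ?z = ?z" using fun_cong[OF Z(2), of "(0, 0)"] by (simp add: D.mat_adj)
    moreover have "x = ?z \<otimes>\<^bsub>D\<^esub> ?z"
      using fun_cong[OF Z(3), of "(0, 0)"] zc D.fsum_Suc[of 0 "\<lambda>k. Z (0, k) \<otimes>\<^bsub>D\<^esub> Z (k, 0)"]
      by (simp add: D.mat_mult)
    ultimately show "positive D x" using zc unfolding D.positive_iff_psd D.psd_def by blast
  qed
qed

lemma cp_positive:
  assumes D: "cstar_alg D" and E: "cstar_alg E" and f: "completely_positive D E f" and p: "positive D x"
  shows "positive E (f x)"
proof -
  have x: "x \<in> carrier D" using p by (simp add: positive_def)
  have fx: "f x \<in> carrier E" using f x by (auto simp: completely_positive_def linear_maps_def)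
  have "positive (mat_alg 1 D) (\<lambda>p\<in>{..<1} \<times> {..<1}. x)" using positive_mat1[OF D] p by blast
  then have "positive (mat_alg 1 E) (\<lambda>p\<in>{..<1} \<times> {..<1}. f ((\<lambda>p\<in>{..<1::nat} \<times> {..<1::nat}. x) p))"
    using f unfolding completely_positive_def by blast
  also have "(\<lambda>p\<in>{..<1::nat} \<times> {..<1::nat}. f ((\<lambda>p\<in>{..<1::nat} \<times> {..<1::nat}. x) p)) = (\<lambda>p\<in>{..<1} \<times> {..<1}. f x)"
    by auto
  finally show ?thesis using positive_mat1[OF E] fx by blast
qed

context cstar_alg
begin

section \<open>Tents and products supported near the diagonal\<close>

text \<open>The left-hand side is the sum of \<open>(i - j) x i y j\<close>. Only \<open>\<bar>i - j\<bar> \<le> 1\<close> matters, and then \<open>i - j\<close> is determined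
by the residues of \<open>i\<close> and \<open>j\<close> modulo \<open>3\<close>. The right-hand side consists of six products of partial
sums whatever \<open>n\<close> is, which makes it bounded when the partial sums are.\<close>

lemma tridiagonal_identity:
  assumes x: "\<And>i. i < n \<Longrightarrow> x i \<in> cr" and y: "\<And>i. i < n \<Longrightarrow> y i \<in> cr"
    and o: "\<And>i j. i < n \<Longrightarrow> j < n \<Longrightarrow> i + 2 \<le> j \<or> j + 2 \<le> i \<Longrightarrow> x i \<otimes> y j = \<zero>"
    and X: "\<And>c. X c = fsum n (\<lambda>i. complex_of_real (c i) \<odot> x i)"
    and Y: "\<And>c. Y c = fsum n (\<lambda>i. complex_of_real (c i) \<odot> y i)"
    and R: "\<And>r i. R r i = (if i mod 3 = r mod (3::nat) then 1 else 0)"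
  shows "X real \<otimes> Y (\<lambda>_. 1) \<ominus> X (\<lambda>_. 1) \<otimes> Y real =
    fsum 3 (\<lambda>r. X (R (Suc r)) \<otimes> Y (R r) \<ominus> X (R r) \<otimes> Y (R (Suc r)))"
proof -
  define B where "B = (\<lambda>C :: nat \<Rightarrow> nat \<Rightarrow> real. fsum n (\<lambda>i. fsum n (\<lambda>j. complex_of_real (C i j) \<odot> (x i \<otimes> y j))))"
  have Bc: "B C \<in> cr" for C unfolding B_def using x y by (intro fsum_closed) auto
  have XY: "X c \<otimes> Y d = B (\<lambda>i j. c i * d j)" for c d
  proof -
    have "X c \<otimes> Y d = fsum n (\<lambda>i. (complex_of_real (c i) \<odot> x i) \<otimes> Y d)"
      unfolding X using x y by (intro fsum_mr) (auto simp: Y)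
    also have "\<dots> = B (\<lambda>i j. c i * d j)"
      unfolding B_def Y using x y by (intro fsum_cong fsum_mlI[symmetric]) (auto simp: sc_ml sc_mr sc_sc mult.commute intro!: fsum_mlI[symmetric])
    finally show ?thesis .
  qed
  have Badd: "B (\<lambda>i j. C i j + E i j) = B C \<oplus> B E" for C E
    unfolding B_def using x y by (intro fsum_addI) (auto simp: sc_addl intro!: fsum_addI)
  have Bminus: "B (\<lambda>i j. C i j - E i j) = B C \<ominus> B E" for C E
  proof -
    have "B (\<lambda>i j. C i j - E i j) \<oplus> B E = B C" using Badd[of "\<lambda>i j. C i j - E i j" E] by simp
    then have "(B (\<lambda>i j. C i j - E i j) \<oplus> B E) \<ominus> B E = B C \<ominus> B E" by simp
    then show ?thesis using Bc by (simp add: abel)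
  qed
  have Bcong: "B C = B E" if "\<And>i j. i < n \<Longrightarrow> j < n \<Longrightarrow> \<not> (i + 2 \<le> j \<or> j + 2 \<le> i) \<Longrightarrow> C i j = E i j" for C E
    unfolding B_def
  proof (intro fsum_cong)
    fix i j assume ij: "i < n" "j < n"
    show "complex_of_real (C i j) \<odot> (x i \<otimes> y j) = complex_of_real (E i j) \<odot> (x i \<otimes> y j)"
      using o[OF ij] that[OF ij] by (cases "i + 2 \<le> j \<or> j + 2 \<le> i") auto
  qed (use x y in auto)
  have key: "real i * 1 - 1 * real j =
      (R 1 i * R 0 j - R 0 i * R 1 j) + (R 2 i * R 1 j - R 1 i * R 2 j) + (R 3 i * R 2 j - R 2 i * R 3 j)"
    if "\<not> (i + 2 \<le> j \<or> j + 2 \<le> i)" for i j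
  proof -
    have "i = j \<or> i = Suc j \<or> j = Suc i" using that by arith
    then consider "i = j" | "i = Suc j" | "j = Suc i" by blast
    then show ?thesis
    proof cases
      case 1 then show ?thesis by (simp add: R)
    next
      case 2
      have "j mod 3 = 0 \<or> j mod 3 = 1 \<or> j mod 3 = 2" by linarith
      then show ?thesis using 2 by (elim disjE) (auto simp: R mod_Suc)
    next
      case 3
      have "i mod 3 = 0 \<or> i mod 3 = 1 \<or> i mod 3 = 2" by linarith
      then show ?thesis using 3 by (elim disjE) (auto simp: R mod_Suc)
    qed
  qed
  have "X real \<otimes> Y (\<lambda>_. 1) \<ominus> X (\<lambda>_. 1) \<otimes> Y real = B (\<lambda>i j. real i * 1 - 1 * real j)"
    unfolding XY Bminus ..
  also have "\<dots> = B (\<lambda>i j. (R 1 i * R 0 j - R 0 i * R 1 j) + (R 2 i * R 1 j - R 1 i * R 2 j) + (R 3 i * R 2 j - R 2 i * R 3 j))"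
    by (rule Bcong[OF key])
  also have "\<dots> = fsum 3 (\<lambda>r. X (R (Suc r)) \<otimes> Y (R r) \<ominus> X (R r) \<otimes> Y (R (Suc r)))"
    unfolding Badd Bminus XY[symmetric] using XY Bc
    by (simp add: numeral_3_eq_3 fsum_Suc numeral_2_eq_2)
  finally show ?thesis .
qed

end

text \<open>The tents over the integer points form a partition of unity on \<open>[0, N]\<close> that reproduces affine
functions exactly.\<close>

lemma tent_sum:
  fixes s :: real
  assumes s: "0 \<le> s" "s \<le> real N"
  shows "(\<Sum>i<Suc N. max 0 (1 - \<bar>s - real i\<bar>)) = 1"
    and "(\<Sum>i<Suc N. real i * max 0 (1 - \<bar>s - real i\<bar>)) = s"
proof -
  define m where "m = nat \<lfloor>s\<rfloor>"
  have m: "real m \<le> s" "s < real m + 1" using s by (auto simp: m_def)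
  have zero: "max 0 (1 - \<bar>s - real i\<bar>) = 0" if "i \<notin> {m, Suc m}" for i
  proof -
    have "i < m \<or> Suc m < i" using that by auto
    then have "real i + 1 \<le> real m \<or> real m + 2 \<le> real i" by auto
    then show ?thesis using m by auto
  qed
  have *: "(\<Sum>i<Suc N. c i * max 0 (1 - \<bar>s - real i\<bar>)) = c m * (1 - (s - real m)) + c (Suc m) * (s - real m)"
    for c :: "nat \<Rightarrow> real"
  proof -
    have mN: "m \<le> N" using m s by linarith
    \<comment> \<open>The tent over \<open>N + 1\<close> vanishes on \<open>[0, N]\<close>; with it the index \<open>Suc m\<close> is in range even for \<open>m = N\<close>.\<close>
    have "(\<Sum>i<Suc N. c i * max 0 (1 - \<bar>s - real i\<bar>)) = (\<Sum>i<Suc (Suc N). c i * max 0 (1 - \<bar>s - real i\<bar>))"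
      using s by simp
    also have "\<dots> = (\<Sum>i\<in>{m, Suc m}. c i * max 0 (1 - \<bar>s - real i\<bar>))"
      using mN zero by (intro sum.mono_neutral_right) auto
    also have "\<dots> = c m * (1 - (s - real m)) + c (Suc m) * (s - real m)"
      using m by (simp add: max_def algebra_simps)
    finally show ?thesis .
  qed
  show "(\<Sum>i<Suc N. max 0 (1 - \<bar>s - real i\<bar>)) = 1" using *[of "\<lambda>_. 1"] by simp
  show "(\<Sum>i<Suc N. real i * max 0 (1 - \<bar>s - real i\<bar>)) = s" using *[of real] by (simp add: algebra_simps)
qed

lemma tent_disjoint:
  fixes s :: real
  assumes "i + 2 \<le> j \<or> j + 2 \<le> i"
  shows "max 0 (1 - \<bar>s - real i\<bar>) * max 0 (1 - \<bar>s - real j\<bar>) = 0"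
proof -
  have "real i + 2 \<le> real j \<or> real j + 2 \<le> real i" using assms by linarith
  then show ?thesis by (auto simp: max_def)
qed

section \<open>The action on the ultrapower\<close>

locale compact_dynamics = ultrapower_alg +
  fixes G :: "('g, 'm) monoid_scheme" and T :: "'g topology" and \<alpha> :: "'g \<Rightarrow> 'a \<Rightarrow> 'a"
  assumes cg: "compact_group G T" and act: "cstar_action G T D \<alpha>"
begin

lemma TS_eq: "topspace T = carrier G" using cg by (rule compact_group.topspace_eq)

lemma is_group: "group G" using cg by (simp add: compact_group_def)

sublocale cfun_alg D T
proof
  show "compact_space T" using cg by (rule compact_group.compact)
  interpret group G by (rule is_group)
  show "topspace T \<noteq> {}" using one_closed by (auto simp: TS_eq)
qed

sublocale U: cstar_alg U by (rule U_cstar_alg)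

definition \<kappa> :: "'a \<Rightarrow> (nat \<Rightarrow> 'a) set" where "\<kappa> a = q (\<lambda>n. a)"

lemma const_seq_eq: "const_seq \<omega> D a = \<kappa> a" by (simp add: const_seq_def \<kappa>_def q_def)

lemma const_ops: "a \<in> cr \<Longrightarrow> b \<in> cr \<Longrightarrow> (\<lambda>n. a) \<otimes>\<^bsub>LN\<^esub> (\<lambda>n. b) = (\<lambda>n. a \<otimes> b)"
  "a \<in> cr \<Longrightarrow> b \<in> cr \<Longrightarrow> (\<lambda>n. a) \<oplus>\<^bsub>LN\<^esub> (\<lambda>n. b) = (\<lambda>n. a \<oplus> b)"
  "a \<in> cr \<Longrightarrow> c \<odot>\<^bsub>LN\<^esub> (\<lambda>n. a) = (\<lambda>n. c \<odot> a)" "a \<in> cr \<Longrightarrow> adj LN (\<lambda>n. a) = (\<lambda>n. st a)"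
  "\<one>\<^bsub>LN\<^esub> = (\<lambda>n. \<one>)"
  by (auto simp: linf_ops)

lemma \<kappa>_in [simp, intro]: "a \<in> cr \<Longrightarrow> \<kappa> a \<in> carrier U" by (simp add: \<kappa>_def)
lemma \<kappa>_mult: "a \<in> cr \<Longrightarrow> b \<in> cr \<Longrightarrow> \<kappa> (a \<otimes> b) = \<kappa> a \<otimes>\<^bsub>U\<^esub> \<kappa> b"
  by (simp add: \<kappa>_def U_mult const_ops)
lemma \<kappa>_add: "a \<in> cr \<Longrightarrow> b \<in> cr \<Longrightarrow> \<kappa> (a \<oplus> b) = \<kappa> a \<oplus>\<^bsub>U\<^esub> \<kappa> b"
  by (simp add: \<kappa>_def U_add const_ops)
lemma \<kappa>_sc: "a \<in> cr \<Longrightarrow> \<kappa> (c \<odot> a) = c \<odot>\<^bsub>U\<^esub> \<kappa> a" by (simp add: \<kappa>_def U_smult const_ops)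
lemma \<kappa>_st: "a \<in> cr \<Longrightarrow> \<kappa> (st a) = adj U (\<kappa> a)" by (simp add: \<kappa>_def U_adj const_ops)
lemma \<kappa>_one: "\<kappa> \<one> = \<one>\<^bsub>U\<^esub>" by (simp add: \<kappa>_def U_one const_ops)
lemma \<kappa>_nm: "a \<in> cr \<Longrightarrow> nrm U (\<kappa> a) = nm a" unfolding \<kappa>_def by (rule nrm_eqI) auto
lemma \<kappa>_minus: "a \<in> cr \<Longrightarrow> b \<in> cr \<Longrightarrow> \<kappa> (a \<ominus> b) = \<kappa> a \<ominus>\<^bsub>U\<^esub> \<kappa> b"
  unfolding a_minus_def by (simp add: \<kappa>_add sc_neg U.sc_neg \<kappa>_sc)
lemma \<kappa>_psd: "psd a \<Longrightarrow> U.psd (\<kappa> a)"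
proof -
  assume "psd a"
  then obtain z where z: "z \<in> cr" "st z = z" "a = z \<otimes> z" unfolding psd_def by blast
  then have "adj U (\<kappa> z) = \<kappa> z" using \<kappa>_st[of z] by simp
  then show "U.psd (\<kappa> a)" using U.psd_sq[of "\<kappa> z"] z by (simp add: \<kappa>_mult)
qed

definition RC :: "(nat \<Rightarrow> 'a) set set" where
  "RC = {x \<in> carrier U. \<forall>a\<in>cr. x \<otimes>\<^bsub>U\<^esub> \<kappa> a = \<kappa> a \<otimes>\<^bsub>U\<^esub> x}"

lemma rel_commutant_eq: "rel_commutant \<omega> D = U\<lparr>carrier := RC\<rparr>"
  by (simp add: rel_commutant_def RC_def const_seq_eq)

lemma RC_D: "x \<in> RC \<Longrightarrow> x \<in> carrier U" "x \<in> RC \<Longrightarrow> a \<in> cr \<Longrightarrow> x \<otimes>\<^bsub>U\<^esub> \<kappa> a = \<kappa> a \<otimes>\<^bsub>U\<^esub> x"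
  by (auto simp: RC_def)

lemma RC_sub_alg: "U.sub_alg RC"
  unfolding U.sub_alg_def
proof (intro conjI ballI allI impI subsetI)
  show "x \<in> RC \<Longrightarrow> x \<in> carrier U" for x by (rule RC_D)
  show "\<one>\<^bsub>U\<^esub> \<in> RC" by (simp add: RC_def)
  fix x assume x: "x \<in> RC"
  then have xc: "x \<in> carrier U" by (rule RC_D)
  show "c \<odot>\<^bsub>U\<^esub> x \<in> RC" for c using xc RC_D(2)[OF x] by (simp add: RC_def U.sc_ml U.sc_mr)
  show "adj U x \<in> RC"
    unfolding RC_def
  proof (intro CollectI conjI ballI)
    fix a assume a: "a \<in> cr"
    have "adj U (x \<otimes>\<^bsub>U\<^esub> \<kappa> (st a)) = adj U (\<kappa> (st a) \<otimes>\<^bsub>U\<^esub> x)" using RC_D(2)[OF x, of "st a"] a by simp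
    then show "adj U x \<otimes>\<^bsub>U\<^esub> \<kappa> a = \<kappa> a \<otimes>\<^bsub>U\<^esub> adj U x" using xc a by (simp add: U.st_mult \<kappa>_st)
  qed (use xc in simp)
  fix y assume y: "y \<in> RC"
  then have yc: "y \<in> carrier U" by (rule RC_D)
  show "x \<oplus>\<^bsub>U\<^esub> y \<in> RC" using xc yc RC_D(2)[OF x] RC_D(2)[OF y] by (simp add: RC_def U.l_distr U.r_distr)
  show "x \<otimes>\<^bsub>U\<^esub> y \<in> RC" unfolding RC_def
  proof (intro CollectI conjI ballI)
    fix a assume a: "a \<in> cr"
    have "x \<otimes>\<^bsub>U\<^esub> y \<otimes>\<^bsub>U\<^esub> \<kappa> a = x \<otimes>\<^bsub>U\<^esub> \<kappa> a \<otimes>\<^bsub>U\<^esub> y" using RC_D(2)[OF y a] xc yc a by (simp add: U.m_assoc)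
    then show "x \<otimes>\<^bsub>U\<^esub> y \<otimes>\<^bsub>U\<^esub> \<kappa> a = \<kappa> a \<otimes>\<^bsub>U\<^esub> (x \<otimes>\<^bsub>U\<^esub> y)" using RC_D(2)[OF x a] xc yc a by (simp add: U.m_assoc)
  qed (use xc yc in simp)
next
  fix s l assume a: "(\<forall>n. s n \<in> RC) \<and> U.tends s l"
  then have l: "l \<in> carrier U" using U.tendsD by blast
  then show "l \<in> RC" unfolding RC_def using a RC_D(2) U.tends_commute[of s l] by blast
qed

lemma RC_cstar_alg: "cstar_alg (rel_commutant \<omega> D)"
  unfolding rel_commutant_eq by (rule U.sub_cstar_alg[OF RC_sub_alg])

lemma RC_psd: "positive (rel_commutant \<omega> D) x \<Longrightarrow> U.psd x"
proof -
  assume p: "positive (rel_commutant \<omega> D) x"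
  have "positive U x"
    by (rule hom_psd[OF RC_cstar_alg U_cstar_alg, where h = "\<lambda>x. x"]) (use p RC_D in \<open>auto simp: rel_commutant_eq\<close>)
  then show ?thesis by (simp add: U.positive_iff_psd)
qed

lemma CA_alg: "cstar_alg (cont_alg T)" unfolding cont_alg_eq by (rule CC.CA_cstar_alg)
lemma CT_alg: "cstar_alg (cont_tensor T D)" unfolding cont_tensor_eq by (rule CA_cstar_alg)

lemma act_hom: "g \<in> carrier G \<Longrightarrow> \<alpha> g \<in> star_auts D" using act by (simp add: cstar_action_def)

lemma \<alpha>_ops:
  assumes g: "g \<in> carrier G" and a: "a \<in> cr"
  shows "\<alpha> g a \<in> cr" "b \<in> cr \<Longrightarrow> \<alpha> g (a \<oplus> b) = \<alpha> g a \<oplus> \<alpha> g b" "b \<in> cr \<Longrightarrow> \<alpha> g (a \<otimes> b) = \<alpha> g a \<otimes> \<alpha> g b"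
    "\<alpha> g (c \<odot> a) = c \<odot> \<alpha> g a" "\<alpha> g (st a) = st (\<alpha> g a)"
  using act_hom[OF g] a by (auto simp: star_auts_def star_homs_def linear_maps_def)

lemma \<alpha>_bij: "g \<in> carrier G \<Longrightarrow> bij_betw (\<alpha> g) cr cr" using act_hom by (simp add: star_auts_def)

lemma \<alpha>_minus: "g \<in> carrier G \<Longrightarrow> a \<in> cr \<Longrightarrow> b \<in> cr \<Longrightarrow> \<alpha> g (a \<ominus> b) = \<alpha> g a \<ominus> \<alpha> g b"
  by (simp add: a_minus_def \<alpha>_ops sc_neg)

lemma \<alpha>_one: assumes g: "g \<in> carrier G" shows "\<alpha> g \<one> = \<one>"
proof -
  obtain b where b: "b \<in> cr" "\<alpha> g b = \<one>" using \<alpha>_bij[OF g] one_closed unfolding bij_betw_def by (metis imageE)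
  have "\<alpha> g \<one> = \<alpha> g \<one> \<otimes> \<alpha> g b" using b g \<alpha>_ops by simp
  also have "\<dots> = \<alpha> g b" using b g \<alpha>_ops(3)[of g \<one> b] by simp
  finally show ?thesis using b by simp
qed

lemma \<alpha>_mult_group: "g \<in> carrier G \<Longrightarrow> h \<in> carrier G \<Longrightarrow> a \<in> cr \<Longrightarrow> \<alpha> (g \<otimes>\<^bsub>G\<^esub> h) a = \<alpha> g (\<alpha> h a)"
  using act by (simp add: cstar_action_def)

lemma \<alpha>_unit: assumes a: "a \<in> cr" shows "\<alpha> \<one>\<^bsub>G\<^esub> a = a"
proof -
  interpret Gr: group G by (rule is_group)
  have "\<alpha> \<one>\<^bsub>G\<^esub> (\<alpha> \<one>\<^bsub>G\<^esub> a) = \<alpha> \<one>\<^bsub>G\<^esub> a" using \<alpha>_mult_group[of "\<one>\<^bsub>G\<^esub>" "\<one>\<^bsub>G\<^esub>" a] a by simp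
  then show ?thesis using \<alpha>_bij[of "\<one>\<^bsub>G\<^esub>"] a \<alpha>_ops(1)[of "\<one>\<^bsub>G\<^esub>" a] unfolding bij_betw_def inj_on_def by blast
qed

text \<open>The image of the positive element \<open>\<parallel>a\<parallel>\<^sup>2 - a\<^sup>*a\<close> is \<open>\<parallel>a\<parallel>\<^sup>2 - \<alpha>(a)\<^sup>*\<alpha>(a)\<close>.\<close>

lemma \<alpha>_contr: assumes g: "g \<in> carrier G" and a: "a \<in> cr" shows "nm (\<alpha> g a) \<le> nm a"
proof -
  have "psd (rl ((nm a)\<^sup>2) \<ominus> st a \<otimes> a)"
    using a nm_cs by (intro rl_minus_psd) (auto simp: st_mult)
  then have "positive D (\<alpha> g (rl ((nm a)\<^sup>2) \<ominus> st a \<otimes> a))"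
    by (rule_tac hom_psd[OF cstar_alg_axioms cstar_alg_axioms, where h = "\<alpha> g"])
       (simp_all add: positive_iff_psd \<alpha>_ops[OF g])
  then have "psd (rl ((nm a)\<^sup>2) \<ominus> st (\<alpha> g a) \<otimes> \<alpha> g a)"
    using g a by (simp add: positive_iff_psd \<alpha>_minus \<alpha>_ops \<alpha>_one)
  then have "nm (st (\<alpha> g a) \<otimes> \<alpha> g a) \<le> nm (rl ((nm a)\<^sup>2))"
    using g a \<alpha>_ops by (intro psd_mono psd_st_mult) auto
  also have "\<dots> \<le> (nm a)\<^sup>2" using nm_rl[of "(nm a)\<^sup>2"] by simp
  finally have "(nm (\<alpha> g a))\<^sup>2 \<le> (nm a)\<^sup>2" using g a nm_cs \<alpha>_ops(1) by simp
  then show ?thesis by (rule power2_le_imp_le) (use a in simp)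
qed

lemma \<alpha>_inv: assumes g: "g \<in> carrier G" and a: "a \<in> cr"
  shows "inv\<^bsub>G\<^esub> g \<in> carrier G" "\<alpha> (inv\<^bsub>G\<^esub> g) (\<alpha> g a) = a" "\<alpha> g (\<alpha> (inv\<^bsub>G\<^esub> g) a) = a"
proof -
  interpret Gr: group G by (rule is_group)
  show i: "inv\<^bsub>G\<^esub> g \<in> carrier G" using g by simp
  show "\<alpha> (inv\<^bsub>G\<^esub> g) (\<alpha> g a) = a" using \<alpha>_mult_group[OF i g a] \<alpha>_unit[OF a] g by simp
  show "\<alpha> g (\<alpha> (inv\<^bsub>G\<^esub> g) a) = a" using \<alpha>_mult_group[OF g i a] \<alpha>_unit[OF a] g by simp
qed

lemma \<alpha>_iso: assumes g: "g \<in> carrier G" and a: "a \<in> cr" shows "nm (\<alpha> g a) = nm a"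
  using \<alpha>_contr[OF g a] \<alpha>_contr[OF \<alpha>_inv(1)[OF g a] \<alpha>_ops(1)[OF g a]] \<alpha>_inv(2)[OF g a] by simp

lemma \<alpha>_seq: assumes g: "g \<in> carrier G" and s: "s \<in> carrier LN" shows "(\<lambda>n. \<alpha> g (s n)) \<in> carrier LN"
  by (rule seqI[where B = "nrm LN s"]) (use g s seq_le[OF s] in \<open>auto simp: \<alpha>_ops \<alpha>_iso\<close>)

lemma ultra_q: assumes g: "g \<in> carrier G" and s: "s \<in> carrier LN"
  shows "ultra_action \<alpha> g (q s) = q (\<lambda>n. \<alpha> g (s n))"
  unfolding ultra_action_def
proof (rule image_q[OF s, where G = "\<lambda>s n. \<alpha> (inv\<^bsub>G\<^esub> g) (s n)"])
  fix t assume t: "t \<in> carrier LN"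
  show "(\<lambda>n. \<alpha> g (t n)) \<in> carrier LN" using g t by (rule \<alpha>_seq)
  have i: "inv\<^bsub>G\<^esub> g \<in> carrier G" using \<alpha>_inv(1)[OF g, of \<one>] by simp
  show "(\<lambda>n. \<alpha> (inv\<^bsub>G\<^esub> g) (t n)) \<in> carrier LN \<and> (\<lambda>n. \<alpha> g (\<alpha> (inv\<^bsub>G\<^esub> g) (t n))) = t"
    using \<alpha>_seq[OF i t] \<alpha>_inv(3)[OF g] t by auto
  fix u n assume u: "u \<in> carrier LN"
  show "nm (\<alpha> g (t n) \<ominus> \<alpha> g (u n)) = nm (t n \<ominus> u n)"
    using g t u by (simp add: \<alpha>_minus[symmetric] \<alpha>_iso)
qed

lemma ultra_ops:
  assumes g: "g \<in> carrier G" and x: "x \<in> carrier U"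
  shows "ultra_action \<alpha> g x \<in> carrier U"
    "y \<in> carrier U \<Longrightarrow> ultra_action \<alpha> g (x \<oplus>\<^bsub>U\<^esub> y) = ultra_action \<alpha> g x \<oplus>\<^bsub>U\<^esub> ultra_action \<alpha> g y"
    "y \<in> carrier U \<Longrightarrow> ultra_action \<alpha> g (x \<otimes>\<^bsub>U\<^esub> y) = ultra_action \<alpha> g x \<otimes>\<^bsub>U\<^esub> ultra_action \<alpha> g y"
    "y \<in> carrier U \<Longrightarrow> nrm U (ultra_action \<alpha> g x \<ominus>\<^bsub>U\<^esub> ultra_action \<alpha> g y) = nrm U (x \<ominus>\<^bsub>U\<^esub> y)"
proof -
  obtain s where s: "s \<in> carrier LN" "x = q s" using x by (rule U_cases)
  note as = \<alpha>_seq[OF g s(1)]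
  show "ultra_action \<alpha> g x \<in> carrier U" using as g s by (simp add: ultra_q)
  assume "y \<in> carrier U"
  then obtain t where t: "t \<in> carrier LN" "y = q t" by (rule U_cases)
  note at = \<alpha>_seq[OF g t(1)]
  have e: "(\<lambda>n. \<alpha> g ((s \<oplus>\<^bsub>LN\<^esub> t) n)) = (\<lambda>n. \<alpha> g (s n)) \<oplus>\<^bsub>LN\<^esub> (\<lambda>n. \<alpha> g (t n))"
    "(\<lambda>n. \<alpha> g ((s \<otimes>\<^bsub>LN\<^esub> t) n)) = (\<lambda>n. \<alpha> g (s n)) \<otimes>\<^bsub>LN\<^esub> (\<lambda>n. \<alpha> g (t n))"
    using s t g by (auto simp: linf_ops \<alpha>_ops)
  show "ultra_action \<alpha> g (x \<oplus>\<^bsub>U\<^esub> y) = ultra_action \<alpha> g x \<oplus>\<^bsub>U\<^esub> ultra_action \<alpha> g y"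
    using s t as at g e(1) by (simp add: ultra_q U_add)
  show "ultra_action \<alpha> g (x \<otimes>\<^bsub>U\<^esub> y) = ultra_action \<alpha> g x \<otimes>\<^bsub>U\<^esub> ultra_action \<alpha> g y"
    using s t as at g e(2) by (simp add: ultra_q U_mult)
  have "(\<lambda>n. nm (((\<lambda>n. \<alpha> g (s n)) \<ominus>\<^bsub>LN\<^esub> (\<lambda>n. \<alpha> g (t n))) n)) = (\<lambda>n. nm ((s \<ominus>\<^bsub>LN\<^esub> t) n))"
    using s t as at g by (auto simp: seq_minus \<alpha>_minus[symmetric] \<alpha>_iso)
  then have "nrm U (q ((\<lambda>n. \<alpha> g (s n)) \<ominus>\<^bsub>LN\<^esub> (\<lambda>n. \<alpha> g (t n)))) = nrm U (q (s \<ominus>\<^bsub>LN\<^esub> t))"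
    using nrm_lim[of "s \<ominus>\<^bsub>LN\<^esub> t"] s t as at by (intro nrm_eqI) auto
  then show "nrm U (ultra_action \<alpha> g x \<ominus>\<^bsub>U\<^esub> ultra_action \<alpha> g y) = nrm U (x \<ominus>\<^bsub>U\<^esub> y)"
    using s t as at g by (simp add: ultra_q U_minus)
qed

lemma ultra_\<kappa>: "g \<in> carrier G \<Longrightarrow> a \<in> cr \<Longrightarrow> ultra_action \<alpha> g (\<kappa> a) = \<kappa> (\<alpha> g a)"
  by (simp add: \<kappa>_def ultra_q)

end

context cstar_alg
begin

section \<open>Diagonal matrices and limits of positive matrices\<close>

definition diag_mat :: "nat \<Rightarrow> 'a \<Rightarrow> (nat \<times> nat \<Rightarrow> 'a)" where
  "diag_mat n c = (\<lambda>p\<in>{..<n} \<times> {..<n}. if fst p = snd p then c else \<zero>)"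

lemma diag_mat_in [simp, intro]: "c \<in> cr \<Longrightarrow> diag_mat n c \<in> carrier (MM n)"
  by (auto simp: mat_carrier diag_mat_def is_mat_def)

lemma diag_mat_at [simp]: "i < n \<Longrightarrow> j < n \<Longrightarrow> diag_mat n c (i, j) = (if i = j then c else \<zero>)"
  by (simp add: diag_mat_def)

lemma diag_mat_mult_left: assumes c: "c \<in> cr" and Y: "Y \<in> carrier (MM n)" and ij: "i < n" "j < n"
  shows "(diag_mat n c \<otimes>\<^bsub>MM n\<^esub> Y) (i, j) = c \<otimes> Y (i, j)"
proof -
  have "(diag_mat n c \<otimes>\<^bsub>MM n\<^esub> Y) (i, j) = fsum n (\<lambda>k. if k = i then c \<otimes> Y (i, j) else \<zero>)"
    unfolding mat_mult[OF ij] using c Y ij by (intro fsum_cong) auto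
  then show ?thesis using fsum_delta c Y ij by simp
qed

lemma diag_mat_mult_right: assumes c: "c \<in> cr" and Y: "Y \<in> carrier (MM n)" and ij: "i < n" "j < n"
  shows "(Y \<otimes>\<^bsub>MM n\<^esub> diag_mat n c) (i, j) = Y (i, j) \<otimes> c"
proof -
  have "(Y \<otimes>\<^bsub>MM n\<^esub> diag_mat n c) (i, j) = fsum n (\<lambda>k. if k = j then Y (i, j) \<otimes> c else \<zero>)"
    unfolding mat_mult[OF ij] using c Y ij by (intro fsum_cong) auto
  then show ?thesis using fsum_delta c Y ij by simp
qed

lemma diag_mat_mult_positive:
  assumes c: "psd c" and Y: "positive (MM n) Y"
    and com: "\<And>i j. i < n \<Longrightarrow> j < n \<Longrightarrow> c \<otimes> Y (i, j) = Y (i, j) \<otimes> c"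
  shows "positive (MM n) (diag_mat n c \<otimes>\<^bsub>MM n\<^esub> Y)"
proof -
  interpret M: cstar_alg "MM n" by (rule mat_cstar_alg)
  have Yp: "M.psd Y" using Y by (simp add: M.positive_iff_psd)
  then have Yc: "Y \<in> carrier (MM n)" by simp
  obtain d where d: "d \<in> cr" "st d = d" "c = d \<otimes> d" using c unfolding psd_def by blast
  have "diag_mat n d \<otimes>\<^bsub>MM n\<^esub> diag_mat n d = diag_mat n c"
    using d by (intro mat_eqI) (auto simp: diag_mat_mult_left)
  moreover have "adj (MM n) (diag_mat n d) = diag_mat n d"
    using d by (intro mat_eqI) (auto simp: mat_adj)
  ultimately have "M.psd (diag_mat n c)" using M.psd_sq[of "diag_mat n d"] d by simp
  moreover have "diag_mat n c \<otimes>\<^bsub>MM n\<^esub> Y = Y \<otimes>\<^bsub>MM n\<^esub> diag_mat n c"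
    using c Yc com by (intro mat_eqI) (auto simp: diag_mat_mult_left diag_mat_mult_right)
  ultimately show ?thesis unfolding M.positive_iff_psd using Yp by (intro M.psd_mult_commute)
qed

lemma mat_fsum_at: assumes "\<And>k. k < m \<Longrightarrow> Z k \<in> carrier (MM n)" and ij: "i < n" "j < n"
  shows "finsum (MM n) Z {..<m} (i, j) = fsum m (\<lambda>k. Z k (i, j))"
proof -
  interpret M: cstar_alg "MM n" by (rule mat_cstar_alg)
  show ?thesis using assms(1)
  proof (induction m)
    case 0 then show ?case using ij by (simp add: mat_zero)
  next
    case (Suc m)
    have "Z k (i, j) \<in> cr" if "k < Suc m" for k using Suc.prems that ij by (meson mat_entry)
    then show ?case using Suc M.fsum_Suc[of m Z] fsum_Suc[of m "\<lambda>k. Z k (i, j)"] ij by (simp add: mat_add)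
  qed
qed

lemma mat_positive_lim:
  assumes Z: "\<And>k. positive (MM n) (Z k)" and L: "\<And>i j. i < n \<Longrightarrow> j < n \<Longrightarrow> tends (\<lambda>k. Z k (i, j)) (L (i, j))"
    and Lc: "L \<in> carrier (MM n)"
  shows "positive (MM n) L"
proof -
  interpret M: cstar_alg "MM n" by (rule mat_cstar_alg)
  have Zp: "M.psd (Z k)" for k using Z by (simp add: M.positive_iff_psd)
  then have Zc: "Z k \<in> carrier (MM n)" for k by simp
  have "M.tends Z L"
  proof (rule M.tendsI[where r = "\<lambda>k. \<Sum>i<n. \<Sum>j<n. nm (Z k (i, j) \<ominus> L (i, j))"])
    fix k
    have "op_norm n (Z k \<ominus>\<^bsub>MM n\<^esub> L) \<le> (\<Sum>i<n. \<Sum>j<n. nm ((Z k \<ominus>\<^bsub>MM n\<^esub> L) (i, j)))"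
      using Zc Lc by (intro op_norm_le_sum mat_is_mat) auto
    also have "\<dots> = (\<Sum>i<n. \<Sum>j<n. nm (Z k (i, j) \<ominus> L (i, j)))"
      using Zc Lc by (intro sum.cong) (auto simp: mat_minus)
    finally show "nrm (MM n) (Z k \<ominus>\<^bsub>MM n\<^esub> L) \<le> \<dots>" by (simp add: mat_cstar_simps)
  next
    show "(\<lambda>k. \<Sum>i<n. \<Sum>j<n. nm (Z k (i, j) \<ominus> L (i, j))) \<longlonglongrightarrow> 0"
      using L tendsD(3) by (intro tendsto_null_sum) auto
  qed (use Zc Lc in auto)
  then show ?thesis unfolding M.positive_iff_psd using Zp by (rule M.psd_lim)
qed

end

section \<open>Order zero maps on the functions on the group\<close>

locale rokhlin_map = compact_dynamics D \<omega> G T \<alpha>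
  for D :: "('a, 's) cstar_scheme" (structure) and \<omega> and G :: "('g, 'm) monoid_scheme"
    and T :: "'g topology" and \<alpha> +
  fixes \<phi> :: "('g \<Rightarrow> complex) \<Rightarrow> (nat \<Rightarrow> 'a) set"
  assumes oz: "order_zero (cont_alg T) (rel_commutant \<omega> D) \<phi>"
    and ct: "contractive (cont_alg T) (rel_commutant \<omega> D) \<phi>"
    and eqv: "equivariant G (cont_alg T) (shift G) (ultra_action \<alpha>) \<phi>"
begin

abbreviation "cont u \<equiv> continuous_map T euclideanreal u"

lemma CA_simps: "carrier (cont_alg T) = CC.CF" "monoid.mult (cont_alg T) = monoid.mult CC.LX"
  "add (cont_alg T) = add CC.LX" "smult (cont_alg T) = smult CC.LX" "one (cont_alg T) = one CC.LX"
  "zero (cont_alg T) = zero CC.LX" "adj (cont_alg T) = adj CC.LX" "nrm (cont_alg T) = nrm CC.LX"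
  by (simp_all add: cont_alg_eq)

lemma RC_simps: "carrier (rel_commutant \<omega> D) = RC" "monoid.mult (rel_commutant \<omega> D) = monoid.mult U"
  "add (rel_commutant \<omega> D) = add U" "smult (rel_commutant \<omega> D) = smult U"
  "zero (rel_commutant \<omega> D) = zero U" "nrm (rel_commutant \<omega> D) = nrm U"
  by (simp_all add: rel_commutant_eq)

lemma \<phi>_lin: "\<phi> \<in> linear_maps (cont_alg T) (rel_commutant \<omega> D)"
  using oz by (simp add: order_zero_def completely_positive_def)

lemma \<phi>_RC: "f \<in> CC.CF \<Longrightarrow> \<phi> f \<in> RC"
  using \<phi>_lin by (auto simp: linear_maps_def CA_simps RC_simps)
lemma \<phi>_in [simp]: "f \<in> CC.CF \<Longrightarrow> \<phi> f \<in> carrier U" using \<phi>_RC RC_D by blast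
lemma \<phi>_add: "f \<in> CC.CF \<Longrightarrow> h \<in> CC.CF \<Longrightarrow> \<phi> (f \<oplus>\<^bsub>CC.LX\<^esub> h) = \<phi> f \<oplus>\<^bsub>U\<^esub> \<phi> h"
  using \<phi>_lin by (auto simp: linear_maps_def CA_simps RC_simps)
lemma \<phi>_sc: "f \<in> CC.CF \<Longrightarrow> \<phi> (c \<odot>\<^bsub>CC.LX\<^esub> f) = c \<odot>\<^bsub>U\<^esub> \<phi> f"
  using \<phi>_lin by (auto simp: linear_maps_def CA_simps RC_simps)

lemma \<phi>_nm: assumes f: "f \<in> CC.CF" and K: "\<And>t. t \<in> TS \<Longrightarrow> cmod (f t) \<le> K"
  shows "nrm U (\<phi> f) \<le> K"
proof -
  have "nrm U (\<phi> f) \<le> nrm CC.LX f"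
    using ct f unfolding contractive_def CA_simps RC_simps by blast
  also have "\<dots> \<le> K" using K by (intro CC.linf_least[OF neT]) (simp add: complex_ops)
  finally show ?thesis .
qed

definition P :: "('g \<Rightarrow> real) \<Rightarrow> (nat \<Rightarrow> 'a) set" where "P u = \<phi> (cx u)"

lemma P_in [simp, intro]: "cont u \<Longrightarrow> P u \<in> carrier U" by (simp add: P_def)
lemma P_comm: "cont u \<Longrightarrow> a \<in> cr \<Longrightarrow> P u \<otimes>\<^bsub>U\<^esub> \<kappa> a = \<kappa> a \<otimes>\<^bsub>U\<^esub> P u"
  unfolding P_def by (intro RC_D(2) \<phi>_RC cx_in)
lemma P_cong: "(\<And>t. t \<in> TS \<Longrightarrow> u t = v t) \<Longrightarrow> P u = P v"
  unfolding P_def cx_def by (metis (mono_tags, lifting) restrict_ext)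
lemma P_add: "cont u \<Longrightarrow> cont v \<Longrightarrow> P (\<lambda>t. u t + v t) = P u \<oplus>\<^bsub>U\<^esub> P v"
proof -
  assume a: "cont u" "cont v"
  have "cx (\<lambda>t. u t + v t) = cx u \<oplus>\<^bsub>CC.LX\<^esub> cx v"
    by (rule extensionalityI[of _ TS]) (auto simp: cx_def CC.linf_ops complex_ops linf_def)
  then show ?thesis using a \<phi>_add by (simp add: P_def)
qed
lemma P_sc: "cont u \<Longrightarrow> P (\<lambda>t. c * u t) = complex_of_real c \<odot>\<^bsub>U\<^esub> P u"
proof -
  assume a: "cont u"
  have "cx (\<lambda>t. c * u t) = complex_of_real c \<odot>\<^bsub>CC.LX\<^esub> cx u"
    by (rule extensionalityI[of _ TS]) (auto simp: cx_def CC.linf_ops complex_ops linf_def)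
  then show ?thesis using a \<phi>_sc by (simp add: P_def)
qed
lemma P_zero: "P (\<lambda>t. 0) = \<zero>\<^bsub>U\<^esub>" using P_sc[of "\<lambda>t. 0" 0] by simp
lemma P_sum: "(\<And>i. i < n \<Longrightarrow> cont (u i)) \<Longrightarrow> P (\<lambda>t. \<Sum>i<n. c i * u i t) = U.fsum n (\<lambda>i. complex_of_real (c i) \<odot>\<^bsub>U\<^esub> P (u i))"
proof (induction n)
  case (Suc n)
  have "P (\<lambda>t. \<Sum>i<Suc n. c i * u i t) = P (\<lambda>t. (\<Sum>i<n. c i * u i t) + c n * u n t)"
    by simp
  also have "\<dots> = P (\<lambda>t. \<Sum>i<n. c i * u i t) \<oplus>\<^bsub>U\<^esub> P (\<lambda>t. c n * u n t)"
    using Suc.prems by (intro P_add continuous_map_sum continuous_map_real_mult) auto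
  finally show ?case using Suc U.fsum_Suc[of n "\<lambda>i. complex_of_real (c i) \<odot>\<^bsub>U\<^esub> P (u i)"] by (simp add: P_sc)
qed (simp add: P_zero)

lemma cx_positive: assumes u: "cont u" and p: "\<And>t. t \<in> TS \<Longrightarrow> 0 \<le> u t" shows "positive (cont_alg T) (cx u)"
proof -
  interpret A: cstar_alg "cont_alg T" by (rule CA_alg)
  let ?z = "cx (\<lambda>t. sqrt (u t))"
  have c: "cont (\<lambda>t. sqrt (u t))"
    using u unfolding continuous_map_atin limitin_canonical_iff by (auto intro: tendsto_real_sqrt)
  have "cx u = ?z \<otimes>\<^bsub>CC.LX\<^esub> ?z"
    by (rule extensionalityI[of _ TS]) (use p in \<open>auto simp: cx_def CC.linf_ops complex_ops linf_def simp flip: of_real_mult\<close>)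
  moreover have "adj CC.LX ?z = ?z"
    by (rule extensionalityI[of _ TS]) (auto simp: cx_def CC.linf_ops complex_ops linf_def)
  ultimately show ?thesis unfolding A.positive_iff_psd A.psd_def using c by (auto simp: CA_simps)
qed

lemma P_psd: assumes "cont u" "\<And>t. t \<in> TS \<Longrightarrow> 0 \<le> u t" shows "U.psd (P u)"
  unfolding P_def
  using cp_positive[OF CA_alg RC_cstar_alg _ cx_positive[OF assms]] oz RC_psd by (simp add: order_zero_def)

lemma P_orth:
  assumes u: "cont u" "\<And>t. t \<in> TS \<Longrightarrow> 0 \<le> u t" and v: "cont v" "\<And>t. t \<in> TS \<Longrightarrow> 0 \<le> v t"
    and z: "\<And>t. t \<in> TS \<Longrightarrow> u t * v t = 0"
  shows "P u \<otimes>\<^bsub>U\<^esub> P v = \<zero>\<^bsub>U\<^esub>"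
proof -
  have a: "cx u \<otimes>\<^bsub>CC.LX\<^esub> cx v = \<zero>\<^bsub>CC.LX\<^esub>"
    by (rule extensionalityI[of _ TS]) (use z in \<open>auto simp: cx_def CC.linf_ops complex_ops linf_def\<close>)
  have b: "cx v \<otimes>\<^bsub>CC.LX\<^esub> cx u = \<zero>\<^bsub>CC.LX\<^esub>"
    by (rule extensionalityI[of _ TS]) (use z in \<open>auto simp: cx_def CC.linf_ops complex_ops linf_def\<close>)
  have "\<phi> (cx u) \<otimes>\<^bsub>rel_commutant \<omega> D\<^esub> \<phi> (cx v) = \<zero>\<^bsub>rel_commutant \<omega> D\<^esub>"
    using oz cx_positive[OF u] cx_positive[OF v] a b unfolding order_zero_def CA_simps by blast
  then show ?thesis by (simp add: P_def RC_simps)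
qed

lemma P_nm: assumes "cont u" "\<And>t. t \<in> TS \<Longrightarrow> \<bar>u t\<bar> \<le> K" shows "nrm U (P u) \<le> K"
  unfolding P_def by (rule \<phi>_nm) (use assms in auto)

abbreviation "gg \<equiv> P (\<lambda>_. 1)"

text \<open>Slice \<open>N k\<close> by the tents \<open>w i\<close>. The elements \<open>x i = P (w i)\<close> and \<open>y i = P (w i h)\<close> satisfy the
hypotheses of \<open>tridiagonal_identity\<close> because \<open>\<phi>\<close> has order zero, and the partial sums that occur
there are images of functions with values in the unit interval, hence contractions. So \<open>N\<close> times
the difference of the two sides has norm at most \<open>6\<close>.\<close>

lemma P_mult:
  assumes k: "unit_fun k" and h: "unit_fun h"
  shows "P k \<otimes>\<^bsub>U\<^esub> P h = gg \<otimes>\<^bsub>U\<^esub> P (\<lambda>t. k t * h t)"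
proof -
  have kc: "cont k" "\<And>t. t \<in> TS \<Longrightarrow> 0 \<le> k t \<and> k t \<le> 1" and hc: "cont h" "\<And>t. t \<in> TS \<Longrightarrow> 0 \<le> h t \<and> h t \<le> 1"
    using k h by (auto simp: unit_fun_def)
  let ?d = "P k \<otimes>\<^bsub>U\<^esub> P h \<ominus>\<^bsub>U\<^esub> gg \<otimes>\<^bsub>U\<^esub> P (\<lambda>t. k t * h t)"
  have khc: "cont (\<lambda>t. k t * h t)" using kc hc by (intro continuous_map_real_mult) auto
  have dc: "?d \<in> carrier U" using kc hc khc by simp
  have bound: "real N * nrm U ?d \<le> 6" for N
  proof -
    define w where "w = (\<lambda>i t. max 0 (1 - \<bar>real N * k t - real i\<bar>))"
    have wc: "cont (w i)" for i
      unfolding w_def using kc(1)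
      by (intro continuous_map_real_max continuous_map_diff continuous_map_real_abs continuous_map_real_mult) auto
    have s: "0 \<le> real N * k t" "real N * k t \<le> real N" if "t \<in> TS" for t
      using kc(2)[OF that] by (auto simp: mult_left_le)
    have w1: "(\<Sum>i<Suc N. w i t) = 1" and wk: "(\<Sum>i<Suc N. real i * w i t) = real N * k t" if "t \<in> TS" for t
      unfolding w_def using tent_sum[OF s[OF that]] by auto
    have w0: "0 \<le> w i t" for i t by (simp add: w_def)
    define x y where "x = (\<lambda>i. P (w i))" and "y = (\<lambda>i. P (\<lambda>t. w i t * h t))"
    have whc: "cont (\<lambda>t. w i t * h t)" for i using wc hc(1) by (intro continuous_map_real_mult)
    define X Y where "X = (\<lambda>c. U.fsum (Suc N) (\<lambda>i. complex_of_real (c i) \<odot>\<^bsub>U\<^esub> x i))"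
      and "Y = (\<lambda>c. U.fsum (Suc N) (\<lambda>i. complex_of_real (c i) \<odot>\<^bsub>U\<^esub> y i))"
    define R :: "nat \<Rightarrow> nat \<Rightarrow> real" where "R = (\<lambda>r i. if i mod 3 = r mod 3 then 1 else 0)"
    have XP: "X c = P (\<lambda>t. \<Sum>i<Suc N. c i * w i t)" for c
      unfolding X_def x_def using wc by (intro P_sum[symmetric])
    have YP: "Y c = P (\<lambda>t. \<Sum>i<Suc N. c i * (w i t * h t))" for c
      unfolding Y_def y_def using whc by (intro P_sum[symmetric])
    have tri: "X real \<otimes>\<^bsub>U\<^esub> Y (\<lambda>_. 1) \<ominus>\<^bsub>U\<^esub> X (\<lambda>_. 1) \<otimes>\<^bsub>U\<^esub> Y real =
      U.fsum 3 (\<lambda>r. X (R (Suc r)) \<otimes>\<^bsub>U\<^esub> Y (R r) \<ominus>\<^bsub>U\<^esub> X (R r) \<otimes>\<^bsub>U\<^esub> Y (R (Suc r)))"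
    proof (rule U.tridiagonal_identity[where n = "Suc N" and x = x and y = y])
      show "x i \<in> carrier U" "y i \<in> carrier U" for i using wc whc by (auto simp: x_def y_def)
      fix i j :: nat assume ij: "i + 2 \<le> j \<or> j + 2 \<le> i"
      show "x i \<otimes>\<^bsub>U\<^esub> y j = \<zero>\<^bsub>U\<^esub>"
        unfolding x_def y_def
      proof (rule P_orth[OF wc w0 whc])
        show "0 \<le> w j t * h t" if "t \<in> TS" for t using w0 hc(2)[OF that] by simp
        show "w i t * (w j t * h t) = 0" for t
          using tent_disjoint[OF ij, of "real N * k t"] by (simp add: w_def mult.assoc[symmetric])
      qed
    qed (simp_all add: X_def Y_def R_def)
    have "X real = complex_of_real (real N) \<odot>\<^bsub>U\<^esub> P k"
      unfolding XP P_sc[OF kc(1), symmetric] by (rule P_cong) (rule wk)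
    moreover have "X (\<lambda>_. 1) = gg" unfolding XP by (rule P_cong) (use w1 in simp)
    moreover have "Y (\<lambda>_. 1) = P h"
      unfolding YP by (rule P_cong) (use w1 in \<open>simp del: sum.lessThan_Suc add: sum_distrib_right[symmetric]\<close>)
    moreover have "Y real = complex_of_real (real N) \<odot>\<^bsub>U\<^esub> P (\<lambda>t. k t * h t)"
      unfolding YP P_sc[OF khc, symmetric]
      by (rule P_cong) (use wk in \<open>simp del: sum.lessThan_Suc add: sum_distrib_right[symmetric] mult.assoc[symmetric]\<close>)
    ultimately have "complex_of_real (real N) \<odot>\<^bsub>U\<^esub> ?d =
        U.fsum 3 (\<lambda>r. X (R (Suc r)) \<otimes>\<^bsub>U\<^esub> Y (R r) \<ominus>\<^bsub>U\<^esub> X (R r) \<otimes>\<^bsub>U\<^esub> Y (R (Suc r)))"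
      using tri kc(1) hc(1) khc by (simp add: U.sc_minus U.sc_ml U.sc_mr)
    then have "real N * nrm U ?d = nrm U (U.fsum 3 (\<lambda>r. X (R (Suc r)) \<otimes>\<^bsub>U\<^esub> Y (R r) \<ominus>\<^bsub>U\<^esub> X (R r) \<otimes>\<^bsub>U\<^esub> Y (R (Suc r))))"
      using U.nm_sc[OF dc, of "complex_of_real (real N)"] by simp
    also have "\<dots> \<le> (\<Sum>r<3::nat. 2)"
    proof -
      have Rs: "0 \<le> R r i \<and> R r i \<le> 1" for r i by (simp add: R_def)
      have part: "0 \<le> (\<Sum>i<Suc N. R r i * w i t) \<and> (\<Sum>i<Suc N. R r i * w i t) \<le> 1" if "t \<in> TS" for r t
      proof
        show "0 \<le> (\<Sum>i<Suc N. R r i * w i t)" using Rs w0 by (intro sum_nonneg) simp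
        have "(\<Sum>i<Suc N. R r i * w i t) \<le> (\<Sum>i<Suc N. w i t)"
          using Rs w0 by (intro sum_mono) (simp add: mult_left_le_one_le)
        then show "(\<Sum>i<Suc N. R r i * w i t) \<le> 1" using w1[OF that] by simp
      qed
      have Rw: "cont (\<lambda>t. \<Sum>i<Suc N. R r i * w i t)" for r
        using wc by (intro continuous_map_sum continuous_map_real_mult) auto
      have Rwh: "cont (\<lambda>t. \<Sum>i<Suc N. R r i * (w i t * h t))" for r
        using whc
        by (intro continuous_map_sum continuous_map_real_mult) (auto simp: wc hc(1))
      have XR: "X (R r) \<in> carrier U" "nrm U (X (R r)) \<le> 1" for r
        unfolding XP using Rw part by (auto intro!: P_nm)
      have YR: "Y (R r) \<in> carrier U" "nrm U (Y (R r)) \<le> 1" for r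
        unfolding YP
      proof -
        show "P (\<lambda>t. \<Sum>i<Suc N. R r i * (w i t * h t)) \<in> carrier U" using Rwh by (rule P_in)
        show "nrm U (P (\<lambda>t. \<Sum>i<Suc N. R r i * (w i t * h t))) \<le> 1"
        proof (rule P_nm[OF Rwh])
          fix t assume t: "t \<in> TS"
          have "(\<Sum>i<Suc N. R r i * (w i t * h t)) = (\<Sum>i<Suc N. R r i * w i t) * h t"
            by (simp only: sum_distrib_right mult.assoc)
          then show "\<bar>\<Sum>i<Suc N. R r i * (w i t * h t)\<bar> \<le> 1"
            using part[OF t, of r] hc(2)[OF t] by (simp only: abs_mult) (simp add: mult_le_one)
        qed
      qed
      have XY: "nrm U (X (R r) \<otimes>\<^bsub>U\<^esub> Y (R s)) \<le> 1" for r s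
      proof -
        have "nrm U (X (R r) \<otimes>\<^bsub>U\<^esub> Y (R s)) \<le> nrm U (X (R r)) * nrm U (Y (R s))"
          by (rule U.nm_mult[OF XR(1) YR(1)])
        also have "\<dots> \<le> 1 * 1"
          by (rule mult_mono[OF XR(2) YR(2) zero_le_one U.nm_ge0[OF YR(1)]])
        finally show ?thesis by simp
      qed
      have "nrm U (U.fsum 3 (\<lambda>r. X (R (Suc r)) \<otimes>\<^bsub>U\<^esub> Y (R r) \<ominus>\<^bsub>U\<^esub> X (R r) \<otimes>\<^bsub>U\<^esub> Y (R (Suc r))))
         \<le> (\<Sum>r<3. nrm U (X (R (Suc r)) \<otimes>\<^bsub>U\<^esub> Y (R r) \<ominus>\<^bsub>U\<^esub> X (R r) \<otimes>\<^bsub>U\<^esub> Y (R (Suc r))))"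
        using XR YR by (intro U.fsum_nm) auto
      also have "\<dots> \<le> (\<Sum>r<3::nat. 2)"
      proof (rule sum_mono)
        fix r
        show "nrm U (X (R (Suc r)) \<otimes>\<^bsub>U\<^esub> Y (R r) \<ominus>\<^bsub>U\<^esub> X (R r) \<otimes>\<^bsub>U\<^esub> Y (R (Suc r))) \<le> 2"
          using U.nm_tri'[OF U.m_closed[OF XR(1) YR(1)] U.m_closed[OF XR(1) YR(1)], of "Suc r" r r "Suc r"]
            XY[of "Suc r" r] XY[of r "Suc r"] by linarith
      qed
      finally show ?thesis .
    qed
    finally show ?thesis by simp
  qed
  have "nrm U ?d = 0"
  proof (rule ccontr)
    assume "nrm U ?d \<noteq> 0"
    then have p: "nrm U ?d > 0" using U.nm_ge0[OF dc] by linarith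
    obtain N where "6 < real N * nrm U ?d" using p reals_Archimedean3 by blast
    then show False using bound[of N] by linarith
  qed
  then have d0: "?d = \<zero>\<^bsub>U\<^esub>" using U.nm_eq0[OF dc] by blast
  show ?thesis
    by (rule U.minus_eq0[OF _ _ d0]; intro U.m_closed P_in kc(1) hc(1) khc) simp
qed

text \<open>With \<open>r k\<close> the positive root of \<open>P (u k)\<close>, the sum is the inner product of the columns \<open>r k\<close> and
\<open>r k b k\<close>. The inner squares of the two columns are \<open>\<phi>(1)\<close> and an element below \<open>M\<^sup>2 \<phi>(1)\<close>, so
Cauchy-Schwarz applies.\<close>

lemma convex_bound:
  assumes u: "\<And>k. k < n \<Longrightarrow> unit_fun (u k)" and s: "\<And>t. t \<in> TS \<Longrightarrow> (\<Sum>k<n. u k t) = 1"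
    and b: "\<And>k. k < n \<Longrightarrow> b k \<in> cr" "\<And>k. k < n \<Longrightarrow> nm (b k) \<le> M" and M: "0 \<le> M"
  shows "nrm U (U.fsum n (\<lambda>k. P (u k) \<otimes>\<^bsub>U\<^esub> \<kappa> (b k))) \<le> M"
proof -
  have uc: "cont (u k)" if "k < n" for k using u[OF that] by (simp add: unit_fun_def)
  have up: "U.psd (P (u k))" if "k < n" for k using u[OF that] by (intro P_psd) (auto simp: unit_fun_def)
  have "\<exists>r. U.psd r \<and> r \<otimes>\<^bsub>U\<^esub> r = P (u k) \<and> (\<forall>w\<in>carrier U. P (u k) \<otimes>\<^bsub>U\<^esub> w = w \<otimes>\<^bsub>U\<^esub> P (u k) \<longrightarrow> r \<otimes>\<^bsub>U\<^esub> w = w \<otimes>\<^bsub>U\<^esub> r)"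
    if "k < n" for k using U.psd_sqrt[OF up[OF that]] .
  then obtain r where r: "\<And>k. k < n \<Longrightarrow> U.psd (r k)" "\<And>k. k < n \<Longrightarrow> r k \<otimes>\<^bsub>U\<^esub> r k = P (u k)"
    "\<And>k w. k < n \<Longrightarrow> w \<in> carrier U \<Longrightarrow> P (u k) \<otimes>\<^bsub>U\<^esub> w = w \<otimes>\<^bsub>U\<^esub> P (u k) \<Longrightarrow> r k \<otimes>\<^bsub>U\<^esub> w = w \<otimes>\<^bsub>U\<^esub> r k"
    by metis
  have rc: "r k \<in> carrier U" "adj U (r k) = r k" if "k < n" for k using r(1)[OF that] U.psd_sa by auto
  have rk: "r k \<otimes>\<^bsub>U\<^esub> \<kappa> a = \<kappa> a \<otimes>\<^bsub>U\<^esub> r k" if "k < n" "a \<in> cr" for k a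
    using r(3)[OF that(1), of "\<kappa> a"] P_comm[OF uc[OF that(1)]] that by blast
  define v where "v = (\<lambda>k. r k \<otimes>\<^bsub>U\<^esub> \<kappa> (b k))"
  have rv: "U.isvec n r" and vv: "U.isvec n v" using rc b(1) by (auto simp: U.isvec_def v_def)
  have e1: "U.ip n r v = U.fsum n (\<lambda>k. P (u k) \<otimes>\<^bsub>U\<^esub> \<kappa> (b k))"
    unfolding U.ip_def v_def
    by (rule U.fsum_cong) (use rc b uc in \<open>auto simp: U.m_assoc[symmetric] r(2)\<close>)
  have sumP: "U.fsum n (\<lambda>k. P (u k)) = gg"
  proof -
    have "U.fsum n (\<lambda>k. P (u k)) = U.fsum n (\<lambda>k. complex_of_real 1 \<odot>\<^bsub>U\<^esub> P (u k))"
      using uc by (intro U.fsum_cong) auto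
    also have "\<dots> = P (\<lambda>t. \<Sum>k<n. 1 * u k t)" using uc by (intro P_sum[symmetric])
    also have "\<dots> = gg" by (rule P_cong) (use s in simp)
    finally show ?thesis .
  qed
  have "U.ip n r r = U.fsum n (\<lambda>k. P (u k))"
    unfolding U.ip_def by (rule U.fsum_cong) (use rc uc r(2) in auto)
  then have n1: "U.vnorm n r \<le> 1" unfolding U.vnorm_def sumP using P_nm[of "\<lambda>_. 1" 1] sumP by simp
  let ?M2 = "complex_of_real (M\<^sup>2)"
  have e3: "U.ip n v v = U.fsum n (\<lambda>k. P (u k) \<otimes>\<^bsub>U\<^esub> \<kappa> (st (b k) \<otimes> b k))"
    unfolding U.ip_def
  proof (rule U.fsum_cong)
    fix k assume k: "k < n"
    have m: "r k \<in> carrier U" "\<kappa> (b k) \<in> carrier U" "\<kappa> (st (b k)) \<in> carrier U" using rc b k by auto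
    have "adj U (v k) \<otimes>\<^bsub>U\<^esub> v k = \<kappa> (st (b k)) \<otimes>\<^bsub>U\<^esub> (r k \<otimes>\<^bsub>U\<^esub> r k) \<otimes>\<^bsub>U\<^esub> \<kappa> (b k)"
      unfolding v_def using m rc(2)[OF k] b(1)[OF k] by (simp add: U.st_mult \<kappa>_st U.m_assoc)
    also have "\<dots> = P (u k) \<otimes>\<^bsub>U\<^esub> \<kappa> (st (b k)) \<otimes>\<^bsub>U\<^esub> \<kappa> (b k)"
      using r(2)[OF k] P_comm[OF uc[OF k], of "st (b k)"] b(1)[OF k] by simp
    also have "\<dots> = P (u k) \<otimes>\<^bsub>U\<^esub> \<kappa> (st (b k) \<otimes> b k)"
      using m uc[OF k] b(1)[OF k] by (simp add: \<kappa>_mult U.m_assoc)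
    finally show "adj U (v k) \<otimes>\<^bsub>U\<^esub> v k = P (u k) \<otimes>\<^bsub>U\<^esub> \<kappa> (st (b k) \<otimes> b k)" .
  qed (use b uc in auto)
  have "U.psd (?M2 \<odot>\<^bsub>U\<^esub> gg \<ominus>\<^bsub>U\<^esub> U.ip n v v)"
  proof -
    have ps: "U.psd (P (u k) \<otimes>\<^bsub>U\<^esub> \<kappa> (rl (M\<^sup>2) \<ominus> st (b k) \<otimes> b k))" if k: "k < n" for k
    proof (rule U.psd_mult_commute[OF up[OF k]])
      have "nm (st (b k) \<otimes> b k) \<le> M\<^sup>2" using b k by (simp add: nm_cs power_mono)
      then show "U.psd (\<kappa> (rl (M\<^sup>2) \<ominus> st (b k) \<otimes> b k))"
        using b k by (intro \<kappa>_psd rl_minus_psd) (auto simp: st_mult)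
    qed (use P_comm uc b k in auto)
    have e: "P (u k) \<otimes>\<^bsub>U\<^esub> \<kappa> (rl (M\<^sup>2) \<ominus> st (b k) \<otimes> b k) = ?M2 \<odot>\<^bsub>U\<^esub> P (u k) \<ominus>\<^bsub>U\<^esub> P (u k) \<otimes>\<^bsub>U\<^esub> \<kappa> (st (b k) \<otimes> b k)"
      if k: "k < n" for k
    proof -
      have "\<kappa> (rl (M\<^sup>2) \<ominus> st (b k) \<otimes> b k) = U.rl (M\<^sup>2) \<ominus>\<^bsub>U\<^esub> \<kappa> (st (b k) \<otimes> b k)"
        using b(1)[OF k] by (subst \<kappa>_minus) (simp_all only: \<kappa>_sc \<kappa>_one one_closed sc_closed m_closed st_closed)
      then show ?thesis using b(1)[OF k] uc[OF k]
        by (simp add: a_minus_def U.r_distr U.r_minus U.sc_mr del: of_real_power)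
    qed
    have "U.fsum n (\<lambda>k. P (u k) \<otimes>\<^bsub>U\<^esub> \<kappa> (rl (M\<^sup>2) \<ominus> st (b k) \<otimes> b k)) =
        U.fsum n (\<lambda>k. ?M2 \<odot>\<^bsub>U\<^esub> P (u k)) \<ominus>\<^bsub>U\<^esub> U.ip n v v"
      unfolding e3 using b uc e by (intro U.fsum_minusI) auto
    also have "U.fsum n (\<lambda>k. ?M2 \<odot>\<^bsub>U\<^esub> P (u k)) = ?M2 \<odot>\<^bsub>U\<^esub> gg"
      unfolding sumP[symmetric] using uc by (intro U.fsum_sc[symmetric]) auto
    finally have eq: "U.fsum n (\<lambda>k. P (u k) \<otimes>\<^bsub>U\<^esub> \<kappa> (rl (M\<^sup>2) \<ominus> st (b k) \<otimes> b k)) =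
        ?M2 \<odot>\<^bsub>U\<^esub> gg \<ominus>\<^bsub>U\<^esub> U.ip n v v" .
    have "U.psd (U.fsum n (\<lambda>k. P (u k) \<otimes>\<^bsub>U\<^esub> \<kappa> (rl (M\<^sup>2) \<ominus> st (b k) \<otimes> b k)))"
      by (rule U.fsum_psd) (rule ps)
    then show ?thesis unfolding eq .
  qed
  then have "nrm U (U.ip n v v) \<le> nrm U (?M2 \<odot>\<^bsub>U\<^esub> gg)" using vv by (intro U.psd_mono U.ip_psd) auto
  also have "\<dots> \<le> M\<^sup>2" using P_nm[of "\<lambda>_. 1" 1] by (simp add: U.nm_sc mult_left_le norm_power)
  finally have n2: "U.vnorm n v \<le> M" using M by (simp add: U.vnorm_def real_le_lsqrt)
  have "nrm U (U.ip n r v) \<le> U.vnorm n r * U.vnorm n v" using rv vv by (rule U.cauchy_schwarz)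
  also have "\<dots> \<le> 1 * M" using n1 n2 rv vv by (intro mult_mono) auto
  finally show ?thesis unfolding e1 by simp
qed

end

context rokhlin_map
begin

section \<open>Extending an order zero map to the tensor product\<close>

text \<open>The graph, on sums of elementary tensors, of the map that sends the tensor of \<open>f\<close> and \<open>a\<close> to
\<open>\<phi>(f)a\<close>. As a relation it can be introduced before it is known that the value does not depend on
the way in which a function is written as such a sum; \<open>rel_bound\<close> settles this.\<close>

inductive rel :: "('g \<Rightarrow> 'a) \<Rightarrow> (nat \<Rightarrow> 'a) set \<Rightarrow> bool" where
  rel_tens: "unit_fun u \<Longrightarrow> a \<in> cr \<Longrightarrow> rel (tens (cx u) a) (P u \<otimes>\<^bsub>U\<^esub> \<kappa> a)"
| rel_add: "rel F y \<Longrightarrow> rel H z \<Longrightarrow> rel (F \<oplus>\<^bsub>LX\<^esub> H) (y \<oplus>\<^bsub>U\<^esub> z)"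

lemma unit_cont: "unit_fun u \<Longrightarrow> cont u" by (simp add: unit_fun_def)

lemma rel_in: "rel F y \<Longrightarrow> F \<in> CF \<and> y \<in> carrier U"
proof (induction rule: rel.induct)
  case (rel_tens u a)
  then show ?case using unit_cont by auto
next
  case (rel_add F y H z)
  then show ?case using LX.sub_algD(3)[OF CF_sub_alg] by auto
qed

lemma rel_CF: "rel F y \<Longrightarrow> F \<in> CF" and rel_U: "rel F y \<Longrightarrow> y \<in> carrier U" using rel_in by blast+
lemma rel_LX: "rel F y \<Longrightarrow> F \<in> carrier LX" using rel_CF CF_sub_linf by blast

lemma rel_sc: "rel F y \<Longrightarrow> rel (c \<odot>\<^bsub>LX\<^esub> F) (c \<odot>\<^bsub>U\<^esub> y)"
proof (induction rule: rel.induct)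
  case (rel_tens u a)
  have "c \<odot>\<^bsub>LX\<^esub> tens (cx u) a = tens (cx u) (c \<odot> a)"
    by (rule linf_eqI) (use rel_tens unit_cont in \<open>auto simp: linf_ops sc_sc mult.commute intro!: CF_sub_linf\<close>)
  moreover have "c \<odot>\<^bsub>U\<^esub> (P u \<otimes>\<^bsub>U\<^esub> \<kappa> a) = P u \<otimes>\<^bsub>U\<^esub> \<kappa> (c \<odot> a)"
    using rel_tens unit_cont by (simp add: \<kappa>_sc U.sc_mr)
  ultimately show ?case using rel.rel_tens[of u "c \<odot> a"] rel_tens by simp
next
  case (rel_add F y H z)
  then show ?case using rel.rel_add[OF rel_add.IH] rel_LX rel_U by (simp add: LX.sc_addr U.sc_addr)
qed

lemma rel_minus: "rel F y \<Longrightarrow> rel H z \<Longrightarrow> rel (F \<ominus>\<^bsub>LX\<^esub> H) (y \<ominus>\<^bsub>U\<^esub> z)"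
  using rel_add[of F y "(-1) \<odot>\<^bsub>LX\<^esub> H" "(-1) \<odot>\<^bsub>U\<^esub> z"] rel_sc[of H z "-1"] rel_LX[of H z] rel_U[of H z]
  by (simp add: a_minus_def LX.sc_neg U.sc_neg)

lemma unit_const: "0 \<le> c \<Longrightarrow> c \<le> 1 \<Longrightarrow> unit_fun (\<lambda>_. c)" by (simp add: unit_fun_def)

lemma rel_zero: "rel \<zero>\<^bsub>LX\<^esub> \<zero>\<^bsub>U\<^esub>"
  using rel_sc[OF rel_tens[OF unit_const[of 0] zero_closed], of 0] unit_cont[OF unit_const[of 0]] CF_sub_linf[OF tens_in[OF cx_in zero_closed]]
  by simp

lemma rel_approx:
  assumes "\<And>k. k < n \<Longrightarrow> unit_fun (u k)" "\<And>k. k < n \<Longrightarrow> b k \<in> cr"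
  shows "rel (approx n u b) (U.fsum n (\<lambda>k. P (u k) \<otimes>\<^bsub>U\<^esub> \<kappa> (b k)))"
  using assms
proof (induction n)
  case 0 then show ?case by (simp add: approx_def rel_zero)
next
  case (Suc n)
  have t: "tens (cx (u k)) (b k) \<in> carrier LX" if "k < Suc n" for k
    using Suc.prems that unit_fun_cx by (intro CF_sub_linf tens_in) auto
  have p: "P (u k) \<otimes>\<^bsub>U\<^esub> \<kappa> (b k) \<in> carrier U" if "k < Suc n" for k
    using Suc.prems that unit_cont by (intro U.m_closed P_in \<kappa>_in) auto
  have "approx (Suc n) u b = approx n u b \<oplus>\<^bsub>LX\<^esub> tens (cx (u n)) (b n)"
    unfolding approx_def by (rule LX.fsum_Suc) (rule t)
  moreover have "U.fsum (Suc n) (\<lambda>k. P (u k) \<otimes>\<^bsub>U\<^esub> \<kappa> (b k)) = U.fsum n (\<lambda>k. P (u k) \<otimes>\<^bsub>U\<^esub> \<kappa> (b k)) \<oplus>\<^bsub>U\<^esub> P (u n) \<otimes>\<^bsub>U\<^esub> \<kappa> (b n)"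
    by (rule U.fsum_Suc) (rule p)
  ultimately show ?case using Suc by (simp add: rel_add rel_tens)
qed

text \<open>The pseudo-distance that measures fineness depends on the functions entering the sum of elementary
tensors, and adding two sums means adding the two pseudo-distances.\<close>

lemma rel_riemann:
  "rel F y \<Longrightarrow> \<exists>\<rho>. pseudo_dist \<rho> \<and> (\<forall>e>0. \<exists>d>0. \<forall>n u \<tau>. subordinate \<rho> d n u \<tau> \<longrightarrow>
     nrm U (y \<ominus>\<^bsub>U\<^esub> U.fsum n (\<lambda>k. P (u k) \<otimes>\<^bsub>U\<^esub> \<kappa> (F (\<tau> k)))) \<le> e)"
proof (induction rule: rel.induct)
  case (rel_tens w a)
  define \<rho> where "\<rho> = (\<lambda>y t. \<bar>w y - w t\<bar>)"
  have wc: "cont w" using rel_tens unit_cont by blast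
  have "pseudo_dist \<rho>" unfolding pseudo_dist_def \<rho>_def using wc by (auto intro!: continuous_map_real_abs continuous_map_diff)
  moreover have "\<exists>d>0. \<forall>n u \<tau>. subordinate \<rho> d n u \<tau> \<longrightarrow>
     nrm U (P w \<otimes>\<^bsub>U\<^esub> \<kappa> a \<ominus>\<^bsub>U\<^esub> U.fsum n (\<lambda>k. P (u k) \<otimes>\<^bsub>U\<^esub> \<kappa> (tens (cx w) a (\<tau> k)))) \<le> e" if e: "e > 0" for e
  proof (intro exI[of _ "e / (nm a + 1)"] conjI allI impI)
    have na: "nm a \<ge> 0" using rel_tens by simp
    show "e / (nm a + 1) > 0" using na e by simp
    fix n u \<tau> assume s: "subordinate \<rho> (e / (nm a + 1)) n u \<tau>"
    let ?d = "e / (nm a + 1)"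
    have u: "unit_fun (u k)" "\<tau> k \<in> TS" "cont (u k)" if "k < n" for k
      using s that unit_cont by (auto simp: subordinate_def)
    define v where "v = (\<lambda>t. \<Sum>k<n. w (\<tau> k) * u k t)"
    have vc: "cont v" unfolding v_def using u by (intro continuous_map_sum continuous_map_real_mult) auto
    have Pv: "P v = U.fsum n (\<lambda>k. complex_of_real (w (\<tau> k)) \<odot>\<^bsub>U\<^esub> P (u k))"
      unfolding v_def using u by (intro P_sum)
    have "U.fsum n (\<lambda>k. P (u k) \<otimes>\<^bsub>U\<^esub> \<kappa> (tens (cx w) a (\<tau> k))) = P v \<otimes>\<^bsub>U\<^esub> \<kappa> a"
      unfolding Pv using u rel_tens by (intro U.fsum_mrI) (auto simp: \<kappa>_sc U.sc_ml U.sc_mr)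
    then have lq: "P w \<otimes>\<^bsub>U\<^esub> \<kappa> a \<ominus>\<^bsub>U\<^esub> U.fsum n (\<lambda>k. P (u k) \<otimes>\<^bsub>U\<^esub> \<kappa> (tens (cx w) a (\<tau> k)))
        = (P w \<ominus>\<^bsub>U\<^esub> P v) \<otimes>\<^bsub>U\<^esub> \<kappa> a" (is "?l = _")
      using rel_tens vc wc by (simp add: a_minus_def U.l_distr U.l_minus)
    have df: "P w \<ominus>\<^bsub>U\<^esub> P v = P (\<lambda>t. w t + (-1) * v t)"
      using P_add[OF wc, of "\<lambda>t. (-1) * v t"] P_sc[OF vc, of "-1"] vc by (simp add: a_minus_def U.sc_neg continuous_map_minus)
    have bd: "nrm U (P (\<lambda>t. w t + (-1) * v t)) \<le> ?d"
    proof (rule P_nm)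
      show "cont (\<lambda>t. w t + (-1) * v t)" using wc vc by (intro continuous_map_add continuous_map_real_mult) auto
      fix t assume t: "t \<in> TS"
      have s1: "(\<Sum>k<n. u k t) = 1" using s t by (simp add: subordinate_def)
      have "w t + (-1) * v t = (\<Sum>k<n. u k t * (w t - w (\<tau> k)))"
      proof -
        have "w t = w t * (\<Sum>k<n. u k t)" using s1 by simp
        also have "\<dots> = (\<Sum>k<n. u k t * w t)" by (simp add: sum_distrib_left mult.commute)
        finally show ?thesis by (simp add: v_def right_diff_distrib sum_subtractf mult.commute)
      qed
      also have "\<bar>\<dots>\<bar> \<le> (\<Sum>k<n. \<bar>u k t * (w t - w (\<tau> k))\<bar>)" by (rule sum_abs)
      also have "\<dots> \<le> (\<Sum>k<n. u k t * ?d)"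
      proof (rule sum_mono)
        fix k assume k: "k \<in> {..<n}"
        have "0 \<le> u k t" using u(1)[of k] k t by (simp add: unit_fun_def)
        moreover have "u k t \<noteq> 0 \<Longrightarrow> \<bar>w t - w (\<tau> k)\<bar> \<le> ?d" using s k t by (auto simp: subordinate_def \<rho>_def less_imp_le)
        ultimately show "\<bar>u k t * (w t - w (\<tau> k))\<bar> \<le> u k t * ?d"
          using mult_left_mono[of "\<bar>w t - w (\<tau> k)\<bar>" ?d "u k t"]
          by (cases "u k t = 0") (simp_all add: abs_mult)
      qed
      also have "\<dots> = ?d" unfolding sum_distrib_right[symmetric] s1 by simp
      finally show "\<bar>w t + (-1) * v t\<bar> \<le> ?d" .
    qed
    have "nrm U ?l \<le> nrm U (P w \<ominus>\<^bsub>U\<^esub> P v) * nrm U (\<kappa> a)"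
      unfolding lq by (rule U.nm_mult[OF U.minus_closed[OF P_in[OF wc] P_in[OF vc]] \<kappa>_in[OF rel_tens(2)]])
    also have "\<dots> \<le> ?d * nm a"
      unfolding df \<kappa>_nm[OF rel_tens(2)] using bd na by (rule mult_right_mono)
    also have "?d * nm a \<le> e" using na e by (simp add: field_simps)
    finally show "nrm U ?l \<le> e" .
  qed
  ultimately show ?case by blast
next
  case (rel_add F y H z)
  obtain \<rho> where \<rho>: "pseudo_dist \<rho>" "\<forall>e>0. \<exists>d>0. \<forall>n u \<tau>. subordinate \<rho> d n u \<tau> \<longrightarrow>
     nrm U (y \<ominus>\<^bsub>U\<^esub> U.fsum n (\<lambda>k. P (u k) \<otimes>\<^bsub>U\<^esub> \<kappa> (F (\<tau> k)))) \<le> e" using rel_add.IH(1) by blast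
  obtain \<sigma> where \<sigma>: "pseudo_dist \<sigma>" "\<forall>e>0. \<exists>d>0. \<forall>n u \<tau>. subordinate \<sigma> d n u \<tau> \<longrightarrow>
     nrm U (z \<ominus>\<^bsub>U\<^esub> U.fsum n (\<lambda>k. P (u k) \<otimes>\<^bsub>U\<^esub> \<kappa> (H (\<tau> k)))) \<le> e" using rel_add.IH(2) by blast
  have m: "F \<in> CF" "H \<in> CF" "y \<in> carrier U" "z \<in> carrier U" using rel_add rel_in by blast+
  show ?case
  proof (intro exI[of _ "\<lambda>y t. \<rho> y t + \<sigma> y t"] conjI allI impI)
    show "pseudo_dist (\<lambda>y t. \<rho> y t + \<sigma> y t)" using \<rho>(1) \<sigma>(1) by (rule pseudo_dist_add)
    fix e :: real assume e: "e > 0"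
    obtain d1 where d1: "d1 > 0" "\<And>n u \<tau>. subordinate \<rho> d1 n u \<tau> \<Longrightarrow>
      nrm U (y \<ominus>\<^bsub>U\<^esub> U.fsum n (\<lambda>k. P (u k) \<otimes>\<^bsub>U\<^esub> \<kappa> (F (\<tau> k)))) \<le> e/2" using \<rho>(2) e by (meson half_gt_zero)
    obtain d2 where d2: "d2 > 0" "\<And>n u \<tau>. subordinate \<sigma> d2 n u \<tau> \<Longrightarrow>
      nrm U (z \<ominus>\<^bsub>U\<^esub> U.fsum n (\<lambda>k. P (u k) \<otimes>\<^bsub>U\<^esub> \<kappa> (H (\<tau> k)))) \<le> e/2" using \<sigma>(2) e by (meson half_gt_zero)
    show "\<exists>d>0. \<forall>n u \<tau>. subordinate (\<lambda>y t. \<rho> y t + \<sigma> y t) d n u \<tau> \<longrightarrow>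
      nrm U (y \<oplus>\<^bsub>U\<^esub> z \<ominus>\<^bsub>U\<^esub> U.fsum n (\<lambda>k. P (u k) \<otimes>\<^bsub>U\<^esub> \<kappa> ((F \<oplus>\<^bsub>LX\<^esub> H) (\<tau> k)))) \<le> e"
    proof (intro exI[of _ "min d1 d2"] conjI allI impI)
      show "min d1 d2 > 0" using d1 d2 by simp
      fix n u \<tau> assume s: "subordinate (\<lambda>y t. \<rho> y t + \<sigma> y t) (min d1 d2) n u \<tau>"
      have s1: "subordinate \<rho> d1 n u \<tau>" by (rule subordinate_mono[OF s]) (use \<sigma>(1) in \<open>auto simp: pseudo_dist_def\<close>)
      have s2: "subordinate \<sigma> d2 n u \<tau>" by (rule subordinate_mono[OF s]) (use \<rho>(1) in \<open>auto simp: pseudo_dist_def\<close>)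
      have u: "cont (u k)" "\<tau> k \<in> TS" if "k < n" for k using s that unit_cont by (auto simp: subordinate_def)
      let ?S1 = "U.fsum n (\<lambda>k. P (u k) \<otimes>\<^bsub>U\<^esub> \<kappa> (F (\<tau> k)))" and ?S2 = "U.fsum n (\<lambda>k. P (u k) \<otimes>\<^bsub>U\<^esub> \<kappa> (H (\<tau> k)))"
      have S: "?S1 \<in> carrier U" "?S2 \<in> carrier U" using u m by (auto intro!: U.fsum_closed)
      have "U.fsum n (\<lambda>k. P (u k) \<otimes>\<^bsub>U\<^esub> \<kappa> ((F \<oplus>\<^bsub>LX\<^esub> H) (\<tau> k))) = ?S1 \<oplus>\<^bsub>U\<^esub> ?S2"
        using u m by (intro U.fsum_addI) (auto simp: linf_ops \<kappa>_add U.r_distr)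
      then have "y \<oplus>\<^bsub>U\<^esub> z \<ominus>\<^bsub>U\<^esub> U.fsum n (\<lambda>k. P (u k) \<otimes>\<^bsub>U\<^esub> \<kappa> ((F \<oplus>\<^bsub>LX\<^esub> H) (\<tau> k))) = (y \<ominus>\<^bsub>U\<^esub> ?S1) \<oplus>\<^bsub>U\<^esub> (z \<ominus>\<^bsub>U\<^esub> ?S2)"
        using U.add_minus_swap[OF m(3,4) S] by simp
      then show "nrm U (y \<oplus>\<^bsub>U\<^esub> z \<ominus>\<^bsub>U\<^esub> U.fsum n (\<lambda>k. P (u k) \<otimes>\<^bsub>U\<^esub> \<kappa> ((F \<oplus>\<^bsub>LX\<^esub> H) (\<tau> k)))) \<le> e"
        using U.nm_tri[OF U.minus_closed[OF m(3) S(1)] U.minus_closed[OF m(4) S(2)]] d1(2)[OF s1] d2(2)[OF s2] by simp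
    qed
  qed
qed

text \<open>The value is approximated by Riemann sums, to which \<open>convex_bound\<close> applies.\<close>

lemma rel_bound: assumes r: "rel F y" shows "nrm U y \<le> nrm LX F"
proof (rule field_le_epsilon)
  fix e :: real assume e: "e > 0"
  have FC: "F \<in> CF" "F \<in> carrier LX" and yU: "y \<in> carrier U" using rel_CF[OF r] rel_LX[OF r] rel_U[OF r] by auto
  obtain \<rho> where \<rho>: "pseudo_dist \<rho>" "\<forall>e>0. \<exists>d>0. \<forall>n u \<tau>. subordinate \<rho> d n u \<tau> \<longrightarrow>
     nrm U (y \<ominus>\<^bsub>U\<^esub> U.fsum n (\<lambda>k. P (u k) \<otimes>\<^bsub>U\<^esub> \<kappa> (F (\<tau> k)))) \<le> e" using rel_riemann[OF r] by blast
  obtain d where d: "d > 0" "\<And>n u \<tau>. subordinate \<rho> d n u \<tau> \<Longrightarrow>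
     nrm U (y \<ominus>\<^bsub>U\<^esub> U.fsum n (\<lambda>k. P (u k) \<otimes>\<^bsub>U\<^esub> \<kappa> (F (\<tau> k)))) \<le> e" using \<rho>(2) e by blast
  obtain n u \<tau> where s: "subordinate \<rho> d n u \<tau>" using subordinate_exists[OF \<rho>(1) d(1)] by blast
  let ?S = "U.fsum n (\<lambda>k. P (u k) \<otimes>\<^bsub>U\<^esub> \<kappa> (F (\<tau> k)))"
  have u: "unit_fun (u k)" "\<tau> k \<in> TS" if "k < n" for k using s that by (auto simp: subordinate_def)
  have S: "?S \<in> carrier U" using u unit_cont FC by (auto intro!: U.fsum_closed)
  have "nrm U ?S \<le> nrm LX F"
    by (rule convex_bound) (use u s FC in \<open>auto simp: subordinate_def intro!: linf_le\<close>)
  then show "nrm U y \<le> nrm LX F + e"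
    using U.nm_le_diff[OF yU S] d(2)[OF s] by linarith
qed

lemma rel_dense: assumes F: "F \<in> CF" and e: "e > 0" shows "\<exists>H y. rel H y \<and> nrm LX (H \<ominus>\<^bsub>LX\<^esub> F) \<le> e"
proof -
  obtain n u \<tau> where s: "subordinate (\<lambda>y t. nm (F y \<ominus> F t)) e n u \<tau>"
    using subordinate_exists[OF pseudo_dist_CF[OF F] e] by blast
  have u: "unit_fun (u k)" "F (\<tau> k) \<in> cr" if "k < n" for k using s that F by (auto simp: subordinate_def)
  have r: "rel (approx n u (\<lambda>k. F (\<tau> k))) (U.fsum n (\<lambda>k. P (u k) \<otimes>\<^bsub>U\<^esub> \<kappa> (F (\<tau> k))))"
    by (rule rel_approx) (use u in auto)
  have "nrm LX (F \<ominus>\<^bsub>LX\<^esub> approx n u (\<lambda>k. F (\<tau> k))) \<le> e" by (rule approx_near[OF F s]) simp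
  then show ?thesis using r LX.nm_minus_commute[OF CF_sub_linf[OF F] rel_LX[OF r]] by auto
qed

definition apx :: "(nat \<Rightarrow> 'g \<Rightarrow> 'a) \<Rightarrow> (nat \<Rightarrow> (nat \<Rightarrow> 'a) set) \<Rightarrow> ('g \<Rightarrow> 'a) \<Rightarrow> (nat \<Rightarrow> 'a) set \<Rightarrow> bool" where
  "apx H y F l \<longleftrightarrow> (\<forall>n. rel (H n) (y n)) \<and> LX.tends H F \<and> U.tends y l"

text \<open>Extension by continuity. The limit exists and is independent of the approximating sequence since
\<open>rel_bound\<close> applies to differences.\<close>

definition \<Psi> :: "('g \<Rightarrow> 'a) \<Rightarrow> (nat \<Rightarrow> 'a) set" where
  "\<Psi> F = (SOME l. \<exists>H y. apx H y F l)"

lemma apx_exists: assumes F: "F \<in> CF" shows "\<exists>l H y. apx H y F l"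
proof -
  have "\<exists>H y. rel H y \<and> nrm LX (H \<ominus>\<^bsub>LX\<^esub> F) \<le> (1/2) ^ (n + 1)" for n
    by (rule rel_dense[OF F]) simp
  then obtain H y where H: "\<And>n. rel (H n) (y n)" "\<And>n. nrm LX (H n \<ominus>\<^bsub>LX\<^esub> F) \<le> (1/2) ^ (n + 1)" by metis
  have Fc: "F \<in> carrier LX" using F by (rule CF_sub_linf)
  have Hc: "H n \<in> carrier LX" for n using rel_LX[OF H(1)] .
  have "LX.tends H F"
    by (rule LX.tendsI[OF Hc Fc H(2)]) (intro LIMSEQ_ignore_initial_segment LIMSEQ_power_zero, simp)
  moreover have "\<exists>l. U.tends y l"
  proof (rule U.fast_tends)
    show "y n \<in> carrier U" for n using rel_U[OF H(1)] .
    fix n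
    have "nrm U (y (Suc n) \<ominus>\<^bsub>U\<^esub> y n) \<le> nrm LX (H (Suc n) \<ominus>\<^bsub>LX\<^esub> H n)"
      by (rule rel_bound[OF rel_minus[OF H(1) H(1)]])
    also have "\<dots> \<le> nrm LX (H (Suc n) \<ominus>\<^bsub>LX\<^esub> F) + nrm LX (F \<ominus>\<^bsub>LX\<^esub> H n)" by (rule LX.nm_tri3[OF Hc Fc Hc])
    also have "\<dots> \<le> (1/2) ^ (Suc n + 1) + (1/2) ^ (n + 1)"
      using H(2)[of "Suc n"] H(2)[of n] LX.nm_minus_commute[OF Fc Hc] by (intro add_mono) auto
    also have "\<dots> \<le> (1/2) ^ n" by simp
    finally show "nrm U (y (Suc n) \<ominus>\<^bsub>U\<^esub> y n) \<le> (1/2) ^ n" .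
  qed
  ultimately show ?thesis using H(1) unfolding apx_def by blast
qed

lemma apx_unique: assumes "apx H y F l" "apx H' y' F l'" shows "l = l'"
proof -
  have r: "rel (H n \<ominus>\<^bsub>LX\<^esub> H' n) (y n \<ominus>\<^bsub>U\<^esub> y' n)" for n using assms unfolding apx_def by (intro rel_minus) auto
  have "LX.tends (\<lambda>n. H n \<ominus>\<^bsub>LX\<^esub> H' n) (F \<ominus>\<^bsub>LX\<^esub> F)" using assms unfolding apx_def by (intro LX.tends_minus) auto
  then have "(\<lambda>n. nrm LX (H n \<ominus>\<^bsub>LX\<^esub> H' n)) \<longlonglongrightarrow> nrm LX (F \<ominus>\<^bsub>LX\<^esub> F)" by (rule LX.tends_nm)
  moreover have "F \<in> carrier LX" using assms LX.tendsD(2) unfolding apx_def by blast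
  ultimately have z: "(\<lambda>n. nrm LX (H n \<ominus>\<^bsub>LX\<^esub> H' n)) \<longlonglongrightarrow> 0" by simp
  have c: "U.tends (\<lambda>n. y n \<ominus>\<^bsub>U\<^esub> y' n) (l \<ominus>\<^bsub>U\<^esub> l')" using assms unfolding apx_def by (intro U.tends_minus) auto
  have lc: "l \<in> carrier U" "l' \<in> carrier U" using assms U.tendsD(2) unfolding apx_def by blast+
  have "nrm U (l \<ominus>\<^bsub>U\<^esub> l') \<le> 0"
    by (rule LIMSEQ_le[OF U.tends_nm[OF c] z]) (use rel_bound[OF r] in blast)
  then have "nrm U (l \<ominus>\<^bsub>U\<^esub> l') = 0" using U.nm_ge0[OF U.minus_closed[OF lc]] by linarith
  then have "l \<ominus>\<^bsub>U\<^esub> l' = \<zero>\<^bsub>U\<^esub>" using U.nm_eq0[OF U.minus_closed[OF lc]] by blast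
  then show ?thesis by (rule U.minus_eq0[OF lc])
qed

lemma \<Psi>_apx: "apx H y F l \<Longrightarrow> \<Psi> F = l"
  unfolding \<Psi>_def by (rule some_equality) (use apx_unique in blast)+

lemma \<Psi>_ex: "F \<in> CF \<Longrightarrow> \<exists>H y. apx H y F (\<Psi> F)"
  using apx_exists \<Psi>_apx by metis

lemma \<Psi>_in: "F \<in> CF \<Longrightarrow> \<Psi> F \<in> carrier U"
  using \<Psi>_ex U.tendsD(2) unfolding apx_def by blast

lemma \<Psi>_rel: assumes "rel F y" shows "\<Psi> F = y"
  by (rule \<Psi>_apx[of "\<lambda>_. F" "\<lambda>_. y"])
     (use assms rel_LX rel_U in \<open>auto simp: apx_def intro!: LX.tends_const U.tends_const\<close>)

lemma \<Psi>_add: assumes F: "F \<in> CF" and K: "K \<in> CF" shows "\<Psi> (F \<oplus>\<^bsub>LX\<^esub> K) = \<Psi> F \<oplus>\<^bsub>U\<^esub> \<Psi> K"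
proof -
  obtain H y H' y' where "apx H y F (\<Psi> F)" "apx H' y' K (\<Psi> K)" using \<Psi>_ex F K by meson
  then have "apx (\<lambda>n. H n \<oplus>\<^bsub>LX\<^esub> H' n) (\<lambda>n. y n \<oplus>\<^bsub>U\<^esub> y' n) (F \<oplus>\<^bsub>LX\<^esub> K) (\<Psi> F \<oplus>\<^bsub>U\<^esub> \<Psi> K)"
    unfolding apx_def by (auto intro: rel_add LX.tends_add U.tends_add)
  then show ?thesis by (rule \<Psi>_apx)
qed

lemma \<Psi>_sc: assumes F: "F \<in> CF" shows "\<Psi> (c \<odot>\<^bsub>LX\<^esub> F) = c \<odot>\<^bsub>U\<^esub> \<Psi> F"
proof -
  obtain H y where "apx H y F (\<Psi> F)" using \<Psi>_ex F by meson
  then have "apx (\<lambda>n. c \<odot>\<^bsub>LX\<^esub> H n) (\<lambda>n. c \<odot>\<^bsub>U\<^esub> y n) (c \<odot>\<^bsub>LX\<^esub> F) (c \<odot>\<^bsub>U\<^esub> \<Psi> F)"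
    unfolding apx_def by (auto intro: rel_sc LX.tends_sc U.tends_sc)
  then show ?thesis by (rule \<Psi>_apx)
qed

lemma \<Psi>_est: assumes F: "F \<in> CF" and r: "rel K z" shows "nrm U (z \<ominus>\<^bsub>U\<^esub> \<Psi> F) \<le> nrm LX (K \<ominus>\<^bsub>LX\<^esub> F)"
proof -
  obtain H y where a: "\<And>n. rel (H n) (y n)" "LX.tends H F" "U.tends y (\<Psi> F)" using \<Psi>_ex[OF F] unfolding apx_def by blast
  have "(\<lambda>n. nrm U (z \<ominus>\<^bsub>U\<^esub> y n)) \<longlonglongrightarrow> nrm U (z \<ominus>\<^bsub>U\<^esub> \<Psi> F)"
    using a rel_U[OF r] by (intro U.tends_nm U.tends_minus U.tends_const)
  moreover have "(\<lambda>n. nrm LX (K \<ominus>\<^bsub>LX\<^esub> H n)) \<longlonglongrightarrow> nrm LX (K \<ominus>\<^bsub>LX\<^esub> F)"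
    using a rel_LX[OF r] by (intro LX.tends_nm LX.tends_minus LX.tends_const)
  ultimately show ?thesis by (rule LIMSEQ_le) (use rel_bound[OF rel_minus[OF r a(1)]] in blast)
qed

lemma tens_mult: assumes u: "unit_fun u" and v: "unit_fun v" and a: "a \<in> cr" and b: "b \<in> cr"
  shows "tens (cx u) a \<otimes>\<^bsub>LX\<^esub> tens (cx v) b = tens (cx (\<lambda>t. u t * v t)) (a \<otimes> b)"
proof (rule linf_eqI)
  have uv: "cont (\<lambda>t. u t * v t)" using u v unit_cont by (intro continuous_map_real_mult) auto
  show "tens (cx u) a \<otimes>\<^bsub>LX\<^esub> tens (cx v) b \<in> carrier LX" "tens (cx (\<lambda>t. u t * v t)) (a \<otimes> b) \<in> carrier LX"
    using CF_sub_linf[OF tens_in[OF unit_fun_cx[OF u] a]] CF_sub_linf[OF tens_in[OF unit_fun_cx[OF v] b]]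
      CF_sub_linf[OF tens_in[OF cx_in[OF uv] m_closed[OF a b]]] by auto
  show "(tens (cx u) a \<otimes>\<^bsub>LX\<^esub> tens (cx v) b) t = tens (cx (\<lambda>t. u t * v t)) (a \<otimes> b) t" if "t \<in> TS" for t
    using that a b by (simp add: linf_ops sc_ml sc_mr sc_sc mult.commute)
qed

lemma gg_in [simp]: "gg \<in> carrier U" by simp

lemma rel_mult_tens: assumes u: "unit_fun u" and a: "a \<in> cr"
  shows "rel H z \<Longrightarrow> \<exists>w. rel (tens (cx u) a \<otimes>\<^bsub>LX\<^esub> H) w \<and> P u \<otimes>\<^bsub>U\<^esub> \<kappa> a \<otimes>\<^bsub>U\<^esub> z = gg \<otimes>\<^bsub>U\<^esub> w"
proof (induction rule: rel.induct)
  case (rel_tens v b)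
  have uv: "unit_fun (\<lambda>t. u t * v t)" using u rel_tens(1)
    by (auto simp: unit_fun_def intro!: continuous_map_real_mult mult_le_one)
  have c: "P u \<in> carrier U" "P v \<in> carrier U" "P (\<lambda>t. u t * v t) \<in> carrier U" "\<kappa> a \<in> carrier U" "\<kappa> b \<in> carrier U"
    using u rel_tens uv a unit_cont by auto
  have "P u \<otimes>\<^bsub>U\<^esub> \<kappa> a \<otimes>\<^bsub>U\<^esub> (P v \<otimes>\<^bsub>U\<^esub> \<kappa> b) = P u \<otimes>\<^bsub>U\<^esub> (\<kappa> a \<otimes>\<^bsub>U\<^esub> P v) \<otimes>\<^bsub>U\<^esub> \<kappa> b"
    using c by (simp add: U.m_assoc)
  also have "\<dots> = (P u \<otimes>\<^bsub>U\<^esub> P v) \<otimes>\<^bsub>U\<^esub> (\<kappa> a \<otimes>\<^bsub>U\<^esub> \<kappa> b)"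
    unfolding P_comm[OF unit_cont[OF rel_tens(1)] a, symmetric] using c by (simp add: U.m_assoc)
  also have "\<dots> = gg \<otimes>\<^bsub>U\<^esub> (P (\<lambda>t. u t * v t) \<otimes>\<^bsub>U\<^esub> \<kappa> (a \<otimes> b))"
    unfolding P_mult[OF u rel_tens(1)] \<kappa>_mult[OF a rel_tens(2)] using c by (simp add: U.m_assoc)
  finally show ?case using rel.rel_tens[OF uv, of "a \<otimes> b"] a rel_tens tens_mult[OF u] by auto
next
  case (rel_add F y H z)
  obtain w w' where w: "rel (tens (cx u) a \<otimes>\<^bsub>LX\<^esub> F) w" "P u \<otimes>\<^bsub>U\<^esub> \<kappa> a \<otimes>\<^bsub>U\<^esub> y = gg \<otimes>\<^bsub>U\<^esub> w"
    and w': "rel (tens (cx u) a \<otimes>\<^bsub>LX\<^esub> H) w'" "P u \<otimes>\<^bsub>U\<^esub> \<kappa> a \<otimes>\<^bsub>U\<^esub> z = gg \<otimes>\<^bsub>U\<^esub> w'" using rel_add by blast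
  have m: "F \<in> carrier LX" "H \<in> carrier LX" "tens (cx u) a \<in> carrier LX" "y \<in> carrier U" "z \<in> carrier U"
    "P u \<otimes>\<^bsub>U\<^esub> \<kappa> a \<in> carrier U" "w \<in> carrier U" "w' \<in> carrier U"
    using rel_add rel_LX rel_U rel.rel_tens[OF u a] w(1) w'(1) by blast+
  have "tens (cx u) a \<otimes>\<^bsub>LX\<^esub> (F \<oplus>\<^bsub>LX\<^esub> H) = (tens (cx u) a \<otimes>\<^bsub>LX\<^esub> F) \<oplus>\<^bsub>LX\<^esub> (tens (cx u) a \<otimes>\<^bsub>LX\<^esub> H)"
    using m(1-3) by (simp add: LX.r_distr)
  moreover have "P u \<otimes>\<^bsub>U\<^esub> \<kappa> a \<otimes>\<^bsub>U\<^esub> (y \<oplus>\<^bsub>U\<^esub> z) = gg \<otimes>\<^bsub>U\<^esub> (w \<oplus>\<^bsub>U\<^esub> w')"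
    using U.r_distr[OF m(4,5,6)] U.r_distr[OF m(7,8) gg_in] w(2) w'(2) by simp
  ultimately show ?case using rel.rel_add[OF w(1) w'(1)] by metis
qed

text \<open>Elements \<open>P u\<close> and \<open>\<kappa> a\<close> commute, so \<open>P_mult\<close> makes the relation multiplicative up to the factor
\<open>gg\<close>, the image of the unit.\<close>

lemma rel_mult: "rel F y \<Longrightarrow> rel H z \<Longrightarrow> \<exists>w. rel (F \<otimes>\<^bsub>LX\<^esub> H) w \<and> y \<otimes>\<^bsub>U\<^esub> z = gg \<otimes>\<^bsub>U\<^esub> w"
proof (induction rule: rel.induct)
  case (rel_tens u a)
  then show ?case by (intro rel_mult_tens)
next
  case (rel_add F y K x)
  obtain w w' where w: "rel (F \<otimes>\<^bsub>LX\<^esub> H) w" "y \<otimes>\<^bsub>U\<^esub> z = gg \<otimes>\<^bsub>U\<^esub> w"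
    and w': "rel (K \<otimes>\<^bsub>LX\<^esub> H) w'" "x \<otimes>\<^bsub>U\<^esub> z = gg \<otimes>\<^bsub>U\<^esub> w'" using rel_add by blast
  have m: "F \<in> carrier LX" "K \<in> carrier LX" "H \<in> carrier LX" "y \<in> carrier U" "x \<in> carrier U" "z \<in> carrier U"
    "w \<in> carrier U" "w' \<in> carrier U"
    using rel_add rel_LX rel_U w(1) w'(1) by blast+
  have "(F \<oplus>\<^bsub>LX\<^esub> K) \<otimes>\<^bsub>LX\<^esub> H = (F \<otimes>\<^bsub>LX\<^esub> H) \<oplus>\<^bsub>LX\<^esub> (K \<otimes>\<^bsub>LX\<^esub> H)" using m(1-3) by (simp add: LX.l_distr)
  moreover have "(y \<oplus>\<^bsub>U\<^esub> x) \<otimes>\<^bsub>U\<^esub> z = gg \<otimes>\<^bsub>U\<^esub> (w \<oplus>\<^bsub>U\<^esub> w')"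
    using U.l_distr[OF m(4,5,6)] U.r_distr[OF m(7,8) gg_in] w(2) w'(2) by simp
  ultimately show ?case using rel.rel_add[OF w(1) w'(1)] by metis
qed

lemma \<Psi>_orth:
  assumes F: "F \<in> CF" and K: "K \<in> CF" and z: "F \<otimes>\<^bsub>LX\<^esub> K = \<zero>\<^bsub>LX\<^esub>"
  shows "\<Psi> F \<otimes>\<^bsub>U\<^esub> \<Psi> K = \<zero>\<^bsub>U\<^esub>"
proof -
  obtain H y H' y' where a: "apx H y F (\<Psi> F)" "apx H' y' K (\<Psi> K)" using \<Psi>_ex F K by meson
  have c: "U.tends (\<lambda>n. y n \<otimes>\<^bsub>U\<^esub> y' n) (\<Psi> F \<otimes>\<^bsub>U\<^esub> \<Psi> K)" using a unfolding apx_def by (intro U.tends_mult) auto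
  have "LX.tends (\<lambda>n. H n \<otimes>\<^bsub>LX\<^esub> H' n) (F \<otimes>\<^bsub>LX\<^esub> K)" using a unfolding apx_def by (intro LX.tends_mult) auto
  then have l: "(\<lambda>n. nrm LX (H n \<otimes>\<^bsub>LX\<^esub> H' n)) \<longlonglongrightarrow> 0" using LX.tends_nm z by fastforce
  have le: "nrm U (y n \<otimes>\<^bsub>U\<^esub> y' n) \<le> nrm LX (H n \<otimes>\<^bsub>LX\<^esub> H' n)" for n
  proof -
    obtain w where w: "rel (H n \<otimes>\<^bsub>LX\<^esub> H' n) w" "y n \<otimes>\<^bsub>U\<^esub> y' n = gg \<otimes>\<^bsub>U\<^esub> w"
      using rel_mult a unfolding apx_def by blast
    have wU: "w \<in> carrier U" using rel_U[OF w(1)] .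
    have "nrm U (gg \<otimes>\<^bsub>U\<^esub> w) \<le> nrm U gg * nrm U w" by (rule U.nm_mult[OF gg_in wU])
    also have "\<dots> \<le> 1 * nrm U w" using P_nm[of "\<lambda>_. 1" 1] U.nm_ge0[OF wU] by (intro mult_right_mono) auto
    finally show ?thesis using w(2) rel_bound[OF w(1)] by simp
  qed
  have "nrm U (\<Psi> F \<otimes>\<^bsub>U\<^esub> \<Psi> K) \<le> 0" by (rule LIMSEQ_le[OF U.tends_nm[OF c] l]) (use le in blast)
  moreover have m: "\<Psi> F \<otimes>\<^bsub>U\<^esub> \<Psi> K \<in> carrier U" using \<Psi>_in F K by simp
  ultimately have "nrm U (\<Psi> F \<otimes>\<^bsub>U\<^esub> \<Psi> K) = 0" using U.nm_ge0[OF m] by linarith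
  then show ?thesis using U.nm_eq0[OF m] by blast
qed

abbreviation "\<beta> g F \<equiv> shift_tensor G \<alpha> g F"

lemma inv_shift: "g \<in> carrier G \<Longrightarrow> h \<in> carrier G \<Longrightarrow> inv\<^bsub>G\<^esub> g \<otimes>\<^bsub>G\<^esub> h \<in> carrier G"
  using is_group by (simp add: group.inv_closed group.is_monoid monoid.m_closed)

lemma \<beta>_at: "g \<in> carrier G \<Longrightarrow> t \<in> TS \<Longrightarrow> \<beta> g F t = \<alpha> g (F (inv\<^bsub>G\<^esub> g \<otimes>\<^bsub>G\<^esub> t))"
  by (simp add: shift_tensor_def TS_eq)

lemma cont_translate: assumes g: "g \<in> carrier G" shows "continuous_map T T (\<lambda>h. inv\<^bsub>G\<^esub> g \<otimes>\<^bsub>G\<^esub> h)"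
proof -
  have i: "inv\<^bsub>G\<^esub> g \<in> topspace T" using \<alpha>_inv(1)[OF g, of \<one>] by (simp add: TS_eq)
  have "continuous_map T (prod_topology T T) (\<lambda>h. (inv\<^bsub>G\<^esub> g, h))"
    using i by (intro continuous_map_pairedI) auto
  from continuous_map_compose[OF this compact_group.continuous_mult[OF cg]]
  show ?thesis by (simp add: comp_def)
qed

lemma \<beta>_LX: assumes g: "g \<in> carrier G" and F: "F \<in> carrier LX" shows "\<beta> g F \<in> carrier LX"
proof (rule linfI[where B = "nrm LX F"])
  show "\<beta> g F \<in> extensional TS" by (simp add: shift_tensor_def TS_eq)
  fix t assume t: "t \<in> TS"
  have s: "inv\<^bsub>G\<^esub> g \<otimes>\<^bsub>G\<^esub> t \<in> TS" using inv_shift g t by (simp add: TS_eq)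
  show "\<beta> g F t \<in> cr" "nm (\<beta> g F t) \<le> nrm LX F"
    using g t linf_at[OF F s] linf_le[OF F s] by (simp_all add: \<beta>_at \<alpha>_ops \<alpha>_iso)
qed

lemma \<beta>_minus_le: assumes g: "g \<in> carrier G" and F: "F \<in> carrier LX" and H: "H \<in> carrier LX"
  shows "nrm LX (\<beta> g F \<ominus>\<^bsub>LX\<^esub> \<beta> g H) \<le> nrm LX (F \<ominus>\<^bsub>LX\<^esub> H)"
proof (rule linf_least[OF neT])
  fix t assume t: "t \<in> TS"
  have s: "inv\<^bsub>G\<^esub> g \<otimes>\<^bsub>G\<^esub> t \<in> TS" using inv_shift g t by (simp add: TS_eq)
  have "(\<beta> g F \<ominus>\<^bsub>LX\<^esub> \<beta> g H) t = \<alpha> g ((F \<ominus>\<^bsub>LX\<^esub> H) (inv\<^bsub>G\<^esub> g \<otimes>\<^bsub>G\<^esub> t))"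
    using g t s F H linf_at[OF F s] linf_at[OF H s] by (simp add: linf_minus \<beta>_LX \<beta>_at \<alpha>_minus)
  then show "nm ((\<beta> g F \<ominus>\<^bsub>LX\<^esub> \<beta> g H) t) \<le> nrm LX (F \<ominus>\<^bsub>LX\<^esub> H)"
    using linf_le[of "F \<ominus>\<^bsub>LX\<^esub> H" TS, OF _ s] linf_at[of "F \<ominus>\<^bsub>LX\<^esub> H" TS, OF _ s] F H g by (simp add: \<alpha>_iso)
qed

text \<open>The translate of an elementary tensor is elementary, and \<open>\<phi>\<close> is equivariant.\<close>

lemma rel_\<beta>: assumes g: "g \<in> carrier G" shows "rel F y \<Longrightarrow> rel (\<beta> g F) (ultra_action \<alpha> g y)"
proof (induction rule: rel.induct)
  case (rel_tens u a)
  define v where "v = (\<lambda>t. u (inv\<^bsub>G\<^esub> g \<otimes>\<^bsub>G\<^esub> t))"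
  have s: "inv\<^bsub>G\<^esub> g \<otimes>\<^bsub>G\<^esub> t \<in> TS" if "t \<in> TS" for t using inv_shift g that by (simp add: TS_eq)
  have v: "unit_fun v"
    using rel_tens(1) continuous_map_compose[OF cont_translate[OF g], of euclideanreal u] s
    by (auto simp: unit_fun_def v_def comp_def)
  have sh: "shift G g (cx u) = cx v"
    by (rule extensionalityI[of _ TS]) (use s in \<open>auto simp: shift_def cx_def v_def TS_eq\<close>)
  have "\<beta> g (tens (cx u) a) = tens (cx v) (\<alpha> g a)"
    using shift_tensor_elem_tensor[OF cg act g _ rel_tens(2), of "cx u"] unit_fun_cx[OF rel_tens(1)] sh
    by (simp add: CA_simps)
  moreover have "ultra_action \<alpha> g (P u) = P v"
    using eqv g unit_fun_cx[OF rel_tens(1)] sh unfolding equivariant_def CA_simps P_def by metis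
  moreover have "ultra_action \<alpha> g (P u \<otimes>\<^bsub>U\<^esub> \<kappa> a) = ultra_action \<alpha> g (P u) \<otimes>\<^bsub>U\<^esub> \<kappa> (\<alpha> g a)"
    using ultra_ops(3)[OF g, of "P u" "\<kappa> a"] ultra_\<kappa>[OF g rel_tens(2)] unit_cont[OF rel_tens(1)] rel_tens(2) by simp
  ultimately show ?case using rel.rel_tens[OF v, of "\<alpha> g a"] \<alpha>_ops(1)[OF g rel_tens(2)] by simp
next
  case (rel_add F y H z)
  have m: "F \<in> carrier LX" "H \<in> carrier LX" "y \<in> carrier U" "z \<in> carrier U"
    using rel_add rel_LX rel_U by blast+
  have "\<beta> g (F \<oplus>\<^bsub>LX\<^esub> H) = \<beta> g F \<oplus>\<^bsub>LX\<^esub> \<beta> g H"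
  proof (rule linf_eqI)
    fix t assume t: "t \<in> TS"
    have s: "inv\<^bsub>G\<^esub> g \<otimes>\<^bsub>G\<^esub> t \<in> TS" using inv_shift g t by (simp add: TS_eq)
    show "\<beta> g (F \<oplus>\<^bsub>LX\<^esub> H) t = (\<beta> g F \<oplus>\<^bsub>LX\<^esub> \<beta> g H) t"
      using g t s linf_at[OF m(1) s] linf_at[OF m(2) s] by (simp add: linf_ops \<beta>_at \<alpha>_ops)
  qed (use m g in \<open>auto intro!: \<beta>_LX linf_closed\<close>)
  then show ?case using rel.rel_add[OF rel_add.IH] ultra_ops(2)[OF g m(3,4)] by simp
qed

lemma \<beta>_CF: assumes g: "g \<in> carrier G" and F: "F \<in> CF" shows "\<beta> g F \<in> CF" "\<Psi> (\<beta> g F) = ultra_action \<alpha> g (\<Psi> F)"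
proof -
  obtain H y where a: "\<And>n. rel (H n) (y n)" "LX.tends H F" "U.tends y (\<Psi> F)" using \<Psi>_ex[OF F] unfolding apx_def by blast
  have Fc: "F \<in> carrier LX" using F by (rule CF_sub_linf)
  have r: "rel (\<beta> g (H n)) (ultra_action \<alpha> g (y n))" for n using rel_\<beta>[OF g a(1)] .
  have c: "LX.tends (\<lambda>n. \<beta> g (H n)) (\<beta> g F)"
    by (rule LX.tendsI[OF rel_LX[OF r] \<beta>_LX[OF g Fc] \<beta>_minus_le[OF g rel_LX[OF a(1)] Fc] LX.tendsD(3)[OF a(2)]])
  show "\<beta> g F \<in> CF" using LX.sub_algD(7)[OF CF_sub_alg _ c] rel_CF[OF r] by blast
  have "U.tends (\<lambda>n. ultra_action \<alpha> g (y n)) (ultra_action \<alpha> g (\<Psi> F))"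
    by (rule U.tendsI[OF rel_U[OF r] ultra_ops(1)[OF g \<Psi>_in[OF F]] _ U.tendsD(3)[OF a(3)]])
       (use ultra_ops(4)[OF g rel_U[OF a(1)] \<Psi>_in[OF F]] in simp)
  then show "\<Psi> (\<beta> g F) = ultra_action \<alpha> g (\<Psi> F)"
    using r c by (intro \<Psi>_apx[of "\<lambda>n. \<beta> g (H n)" "\<lambda>n. ultra_action \<alpha> g (y n)"]) (auto simp: apx_def)
qed

text \<open>By simultaneous Riemann sums for its finitely many entries, the image matrix is a limit of sums of
products of a positive diagonal matrix \<open>P (u k l)\<close> with the positive matrix of values of \<open>X\<close> at a base
point. The two factors commute.\<close>

lemma \<Psi>_cp: assumes X: "positive (mat_alg n (cont_tensor T D)) X"
  shows "positive (mat_alg n U) (mat_map n \<Psi> X)"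
proof -
  interpret B: cstar_alg CA by (rule CA_cstar_alg)
  have X': "positive (mat_alg n CA) X" using X by (simp add: cont_tensor_eq)
  then have XM: "X \<in> carrier (mat_cstar n CA)" unfolding positive_mat_cstar by (simp add: positive_def)
  have Xe: "X (i, j) \<in> CF" if "i < n" "j < n" for i j using B.mat_entry[OF XM that] by simp
  have ev: "positive (mat_alg n D) (mat_map n (\<lambda>F. F t) X)" if t: "t \<in> TS" for t
    by (rule hom_mat_positive[OF CA_cstar_alg cstar_alg_axioms _ _ _ _ X'])
       (use t in \<open>auto simp: linf_ops\<close>)
  have evk: "positive (mat_cstar n U) (mat_map n \<kappa> (mat_map n (\<lambda>F. F t) X))" if t: "t \<in> TS" for t
    unfolding positive_mat_cstar[symmetric]
    by (rule hom_mat_positive[OF cstar_alg_axioms U_cstar_alg _ _ _ _ ev[OF t]])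
       (auto simp: \<kappa>_mult \<kappa>_add \<kappa>_st)
  define \<rho> where "\<rho> = (\<lambda>y t. \<Sum>p\<in>{..<n}\<times>{..<n}. nm (X p y \<ominus> X p t))"
  have pd: "pseudo_dist \<rho>" unfolding \<rho>_def by (rule pseudo_dist_sum) (use Xe in \<open>auto intro!: pseudo_dist_CF\<close>)
  have "\<exists>m u \<tau>. subordinate \<rho> (1 / real (Suc k)) m u \<tau>" for k by (rule subordinate_exists[OF pd]) simp
  then obtain m u \<tau> where s: "\<And>k. subordinate \<rho> (1 / real (Suc k)) (m k) (u k) (\<tau> k)" by metis
  have u: "unit_fun (u k i)" "\<tau> k i \<in> TS" "cont (u k i)" if "i < m k" for k i
    using s[of k] that unit_cont by (auto simp: subordinate_def)
  define Z where "Z = (\<lambda>k. finsum (mat_cstar n U) (\<lambda>l. U.diag_mat n (P (u k l)) \<otimes>\<^bsub>mat_cstar n U\<^esub>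
      mat_map n \<kappa> (mat_map n (\<lambda>F. F (\<tau> k l)) X)) {..<m k})"
  interpret M: cstar_alg "mat_cstar n U" by (rule U.mat_cstar_alg)
  have Tp: "positive (mat_cstar n U) (U.diag_mat n (P (u k l)) \<otimes>\<^bsub>mat_cstar n U\<^esub>
      mat_map n \<kappa> (mat_map n (\<lambda>F. F (\<tau> k l)) X))" if l: "l < m k" for k l
  proof (rule U.diag_mat_mult_positive)
    show "U.psd (P (u k l))" using u[OF l] by (intro P_psd) (auto simp: unit_fun_def)
    show "positive (mat_cstar n U) (mat_map n \<kappa> (mat_map n (\<lambda>F. F (\<tau> k l)) X))" using evk u[OF l] by blast
    fix i j assume ij: "i < n" "j < n"
    then show "P (u k l) \<otimes>\<^bsub>U\<^esub> mat_map n \<kappa> (mat_map n (\<lambda>F. F (\<tau> k l)) X) (i, j) =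
        mat_map n \<kappa> (mat_map n (\<lambda>F. F (\<tau> k l)) X) (i, j) \<otimes>\<^bsub>U\<^esub> P (u k l)"
      using P_comm[OF u(3)[OF l] CF_at[OF Xe[OF ij] u(2)[OF l]]] by simp
  qed
  have Tc: "U.diag_mat n (P (u k l)) \<otimes>\<^bsub>mat_cstar n U\<^esub> mat_map n \<kappa> (mat_map n (\<lambda>F. F (\<tau> k l)) X) \<in> carrier (mat_cstar n U)"
    if "l < m k" for k l using Tp[OF that] by (simp add: positive_def)
  have Zp: "positive (mat_cstar n U) (Z k)" for k
    unfolding Z_def M.positive_iff_psd by (rule M.fsum_psd) (use Tp in \<open>simp add: M.positive_iff_psd\<close>)
  have Ze: "Z k (i, j) = U.fsum (m k) (\<lambda>l. P (u k l) \<otimes>\<^bsub>U\<^esub> \<kappa> (X (i, j) (\<tau> k l)))" if ij: "i < n" "j < n" for k i j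
  proof -
    have mk: "mat_map n \<kappa> (mat_map n (\<lambda>F. F t) X) \<in> carrier (mat_cstar n U)" if "t \<in> TS" for t
      using evk[OF that] by (simp add: positive_def)
    have "Z k (i, j) = U.fsum (m k) (\<lambda>l. (U.diag_mat n (P (u k l)) \<otimes>\<^bsub>mat_cstar n U\<^esub>
      mat_map n \<kappa> (mat_map n (\<lambda>F. F (\<tau> k l)) X)) (i, j))"
      unfolding Z_def by (rule U.mat_fsum_at[OF Tc ij])
    also have "\<dots> = U.fsum (m k) (\<lambda>l. P (u k l) \<otimes>\<^bsub>U\<^esub> \<kappa> (X (i, j) (\<tau> k l)))"
    proof (rule U.fsum_cong)
      fix l assume l: "l < m k"
      show "(U.diag_mat n (P (u k l)) \<otimes>\<^bsub>mat_cstar n U\<^esub> mat_map n \<kappa> (mat_map n (\<lambda>F. F (\<tau> k l)) X)) (i, j)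
          = P (u k l) \<otimes>\<^bsub>U\<^esub> \<kappa> (X (i, j) (\<tau> k l))"
        using U.diag_mat_mult_left[OF P_in[OF u(3)[OF l]] mk[OF u(2)[OF l]] ij] ij by simp
      show "P (u k l) \<otimes>\<^bsub>U\<^esub> \<kappa> (X (i, j) (\<tau> k l)) \<in> carrier U"
        using P_in[OF u(3)[OF l]] \<kappa>_in[OF CF_at[OF Xe[OF ij] u(2)[OF l]]] by simp
    qed
    finally show ?thesis .
  qed
  have "positive (mat_cstar n U) (mat_map n \<Psi> X)"
  proof (rule U.mat_positive_lim[OF Zp])
    show "mat_map n \<Psi> X \<in> carrier (mat_cstar n U)"
      using Xe \<Psi>_in by (auto simp: U.mat_carrier U.is_mat_def mat_map_def)
    fix i j assume ij: "i < n" "j < n"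
    have r: "rel (approx (m k) (u k) (\<lambda>l. X (i, j) (\<tau> k l))) (Z k (i, j))" for k
      unfolding Ze[OF ij] by (rule rel_approx) (use u Xe[OF ij] in auto)
    have le: "nm (X (i, j) y \<ominus> X (i, j) t) \<le> \<rho> y t" if "y \<in> TS" "t \<in> TS" for y t
      unfolding \<rho>_def
      by (rule member_le_sum[where i = "(i, j)" and f = "\<lambda>p. nm (X p y \<ominus> X p t)"])
         (use that ij Xe in \<open>auto intro!: nm_ge0\<close>)
    have "U.tends (\<lambda>k. Z k (i, j)) (\<Psi> (X (i, j)))"
    proof (rule U.tendsI[where r = "\<lambda>k. 1 / real (Suc k)"])
      show "Z k (i, j) \<in> carrier U" for k using rel_U[OF r] .
      show "\<Psi> (X (i, j)) \<in> carrier U" using \<Psi>_in Xe ij by blast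
      show "(\<lambda>k. 1 / real (Suc k)) \<longlonglongrightarrow> 0" using LIMSEQ_inverse_real_of_nat by (simp add: inverse_eq_divide)
      fix k
      have "nrm U (Z k (i, j) \<ominus>\<^bsub>U\<^esub> \<Psi> (X (i, j))) \<le> nrm LX (approx (m k) (u k) (\<lambda>l. X (i, j) (\<tau> k l)) \<ominus>\<^bsub>LX\<^esub> X (i, j))"
        by (rule \<Psi>_est[OF Xe[OF ij] r])
      also have "\<dots> = nrm LX (X (i, j) \<ominus>\<^bsub>LX\<^esub> approx (m k) (u k) (\<lambda>l. X (i, j) (\<tau> k l)))"
        by (rule LX.nm_minus_commute[OF rel_LX[OF r] CF_sub_linf[OF Xe[OF ij]]])
      also have "\<dots> \<le> 1 / real (Suc k)" by (rule approx_near[OF Xe[OF ij] s le])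
      finally show "nrm U (Z k (i, j) \<ominus>\<^bsub>U\<^esub> \<Psi> (X (i, j))) \<le> 1 / real (Suc k)" .
    qed
    then show "U.tends (\<lambda>k. Z k (i, j)) (mat_map n \<Psi> X (i, j))" using ij by simp
  qed
  then show ?thesis by (simp add: positive_mat_cstar)
qed

lemma \<Psi>_linear: "\<Psi> \<in> linear_maps (cont_tensor T D) U"
  unfolding linear_maps_def cont_tensor_eq by (auto simp: \<Psi>_in \<Psi>_add \<Psi>_sc)

lemma \<Psi>_order_zero: "order_zero (cont_tensor T D) U \<Psi>"
proof -
  have "completely_positive (cont_tensor T D) U \<Psi>"
    unfolding completely_positive_def using \<Psi>_linear \<Psi>_cp by (simp add: mat_map_def)
  moreover have "\<Psi> a \<otimes>\<^bsub>U\<^esub> \<Psi> b = \<zero>\<^bsub>U\<^esub>"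
    if "positive (cont_tensor T D) a" "positive (cont_tensor T D) b"
      "a \<otimes>\<^bsub>cont_tensor T D\<^esub> b = \<zero>\<^bsub>cont_tensor T D\<^esub>" for a b
    using that \<Psi>_orth[of a b] by (simp add: cont_tensor_eq positive_def)
  ultimately show ?thesis unfolding order_zero_def by blast
qed

lemma \<Psi>_equivariant: "equivariant G (cont_tensor T D) (shift_tensor G \<alpha>) (ultra_action \<alpha>) \<Psi>"
  unfolding equivariant_def cont_tensor_eq using \<beta>_CF(2) by simp

lemma one_cont_alg: "\<one>\<^bsub>cont_alg T\<^esub> = cx (\<lambda>_. 1)"
  unfolding CA_simps by (rule extensionalityI[of _ TS]) (auto simp: cx_def CC.linf_ops linf_def complex_ops)

lemma \<Psi>_one_tensor: "a \<in> cr \<Longrightarrow> \<Psi> (elem_tensor T D \<one>\<^bsub>cont_alg T\<^esub> a) = gg \<otimes>\<^bsub>U\<^esub> \<kappa> a"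
  unfolding one_cont_alg by (rule \<Psi>_rel[OF rel_tens]) (simp_all add: unit_const)

lemma gg_eq: "gg = \<phi> \<one>\<^bsub>cont_alg T\<^esub>" by (simp add: P_def one_cont_alg)

lemma gg_positive: "positive (rel_commutant \<omega> D) gg"
  unfolding P_def using cp_positive[OF CA_alg RC_cstar_alg _ cx_positive[of "\<lambda>_. 1"]] oz by (simp add: order_zero_def)

end

context cstar_alg
begin

section \<open>Gram matrices and matrices over a commutant\<close>

text \<open>This is \<open>Y\<^sup>*Y\<close> for the matrix \<open>Y\<close> with first row \<open>v\<close> and zeros elsewhere.\<close>

lemma gram_positive:
  assumes v: "\<And>i. i < n \<Longrightarrow> v i \<in> cr"
  shows "positive (mat_alg n D) (\<lambda>p\<in>{..<n} \<times> {..<n}. st (v (fst p)) \<otimes> v (snd p))"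
proof -
  interpret M: cstar_alg "MM n" by (rule mat_cstar_alg)
  define Y where "Y = (\<lambda>p\<in>{..<n} \<times> {..<n}. if fst p = 0 then v (snd p) else \<zero>)"
  have Y: "Y \<in> carrier (MM n)" using v by (auto simp: mat_carrier Y_def is_mat_def)
  have "(\<lambda>p\<in>{..<n} \<times> {..<n}. st (v (fst p)) \<otimes> v (snd p)) = adj (MM n) Y \<otimes>\<^bsub>MM n\<^esub> Y" (is "?X = _")
  proof (rule mat_eqI)
    show "?X \<in> carrier (MM n)" using v by (auto simp: mat_carrier is_mat_def)
    fix i j assume ij: "i < n" "j < n"
    have "(adj (MM n) Y \<otimes>\<^bsub>MM n\<^esub> Y) (i, j) = fsum n (\<lambda>k. if k = 0 then st (v i) \<otimes> v j else \<zero>)"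
      unfolding mat_mult[OF ij] using v ij by (intro fsum_cong) (auto simp: mat_adj Y_def)
    also have "\<dots> = st (v i) \<otimes> v j" using fsum_delta[of 0 n] v ij by simp
    finally show "?X (i, j) = (adj (MM n) Y \<otimes>\<^bsub>MM n\<^esub> Y) (i, j)" using ij by simp
  qed (use Y in auto)
  then show ?thesis unfolding positive_mat_cstar M.positive_iff_psd using M.psd_st_mult[OF Y] by simp
qed

text \<open>The columns of the square root.\<close>

lemma positive_gram_vectors:
  assumes X: "positive (mat_alg n D) X"
  shows "\<exists>c. (\<forall>i<n. isvec n (c i)) \<and> (\<forall>i<n. \<forall>j<n. X (i, j) = ip n (c i) (c j))"
proof -
  interpret M: cstar_alg "MM n" by (rule mat_cstar_alg)
  obtain Z where Z: "Z \<in> carrier (MM n)" "adj (MM n) Z = Z" "X = Z \<otimes>\<^bsub>MM n\<^esub> Z"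
    using X unfolding positive_mat_cstar M.positive_iff_psd M.psd_def by blast
  define c where "c = (\<lambda>i k. Z (k, i))"
  have "isvec n (c i)" if "i < n" for i using mat_entry[OF Z(1)] that by (auto simp: isvec_def c_def)
  moreover have "X (i, j) = ip n (c i) (c j)" if ij: "i < n" "j < n" for i j
  proof -
    have "X (i, j) = (adj (MM n) Z \<otimes>\<^bsub>MM n\<^esub> Z) (i, j)" using Z by simp
    also have "\<dots> = ip n (c i) (c j)"
      unfolding mat_mult[OF ij] ip_def using ij Z(1) by (intro fsum_cong) (auto simp: mat_adj c_def)
    finally show ?thesis .
  qed
  ultimately show ?thesis by blast
qed

text \<open>The matrix commutes with the scalar matrices of elements of \<open>C\<close>. Hence so does its root, whose
entries therefore lie in the commutant.\<close>

lemma positive_commutant_matrix: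
  assumes S: "sub_alg S" and C: "C \<subseteq> cr" and SC: "\<And>x. x \<in> S \<longleftrightarrow> x \<in> cr \<and> (\<forall>c\<in>C. c \<otimes> x = x \<otimes> c)"
    and X: "positive (mat_alg n D) X" and XS: "\<And>i j. i < n \<Longrightarrow> j < n \<Longrightarrow> X (i, j) \<in> S"
  shows "positive (mat_alg n (D\<lparr>carrier := S\<rparr>)) X"
proof -
  interpret M: cstar_alg "MM n" by (rule mat_cstar_alg)
  let ?E = "D\<lparr>carrier := S\<rparr>"
  interpret E: cstar_alg ?E by (rule sub_cstar_alg[OF S])
  interpret ME: cstar_alg "mat_cstar n ?E" by (rule E.mat_cstar_alg)
  have Xp: "M.psd X" using X by (simp add: positive_mat_cstar M.positive_iff_psd)
  have Xc: "X \<in> carrier (MM n)" using Xp by simp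
  obtain Z where Z: "M.psd Z" "Z \<otimes>\<^bsub>MM n\<^esub> Z = X"
    and Zc: "\<forall>W\<in>carrier (MM n). X \<otimes>\<^bsub>MM n\<^esub> W = W \<otimes>\<^bsub>MM n\<^esub> X \<longrightarrow> Z \<otimes>\<^bsub>MM n\<^esub> W = W \<otimes>\<^bsub>MM n\<^esub> Z"
    using M.psd_sqrt[OF Xp] by blast
  have Zm: "Z \<in> carrier (MM n)" using Z(1) by simp
  have ZS: "Z (i, j) \<in> S" if ij: "i < n" "j < n" for i j
    unfolding SC
  proof (intro conjI ballI)
    show "Z (i, j) \<in> cr" using mat_entry[OF Zm ij] .
    fix c assume c: "c \<in> C"
    then have cc: "c \<in> cr" using C by blast
    have "X \<otimes>\<^bsub>MM n\<^esub> diag_mat n c = diag_mat n c \<otimes>\<^bsub>MM n\<^esub> X"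
    proof (rule mat_eqI)
      fix k l assume kl: "k < n" "l < n"
      have "c \<otimes> X (k, l) = X (k, l) \<otimes> c" using XS[OF kl] SC c by blast
      then show "(X \<otimes>\<^bsub>MM n\<^esub> diag_mat n c) (k, l) = (diag_mat n c \<otimes>\<^bsub>MM n\<^esub> X) (k, l)"
        using kl Xc cc by (simp add: diag_mat_mult_left diag_mat_mult_right)
    qed (use Xc cc in auto)
    then have "Z \<otimes>\<^bsub>MM n\<^esub> diag_mat n c = diag_mat n c \<otimes>\<^bsub>MM n\<^esub> Z" using Zc diag_mat_in[OF cc] by blast
    then have "(Z \<otimes>\<^bsub>MM n\<^esub> diag_mat n c) (i, j) = (diag_mat n c \<otimes>\<^bsub>MM n\<^esub> Z) (i, j)" by simp
    then show "c \<otimes> Z (i, j) = Z (i, j) \<otimes> c"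
      using diag_mat_mult_left[OF cc Zm ij] diag_mat_mult_right[OF cc Zm ij] by simp
  qed
  have ZE: "Z \<in> carrier (mat_cstar n ?E)" using ZS Zm by (auto simp: E.mat_carrier E.is_mat_def mat_carrier)
  have XE: "X \<in> carrier (mat_cstar n ?E)" using XS Xc by (auto simp: E.mat_carrier E.is_mat_def mat_carrier)
  have "X = Z \<otimes>\<^bsub>mat_cstar n ?E\<^esub> Z"
  proof (rule E.mat_eqI[OF XE])
    fix i j assume ij: "i < n" "j < n"
    have "X (i, j) = fsum n (\<lambda>k. Z (i, k) \<otimes> Z (k, j))" using Z(2) mat_mult[OF ij] by metis
    also have "\<dots> = finsum ?E (\<lambda>k. Z (i, k) \<otimes> Z (k, j)) {..<n}"
      by (rule sub_finsum(1)[OF S, symmetric]) (use ZS ij sub_algD(4)[OF S] in blast)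
    also have "\<dots> = (Z \<otimes>\<^bsub>mat_cstar n ?E\<^esub> Z) (i, j)" unfolding E.mat_mult[OF ij] by simp
    finally show "X (i, j) = (Z \<otimes>\<^bsub>mat_cstar n ?E\<^esub> Z) (i, j)" .
  qed (use ZE in auto)
  moreover have "adj (mat_cstar n ?E) Z = Z"
  proof (rule E.mat_eqI[OF _ ZE])
    fix i j assume ij: "i < n" "j < n"
    have "st (Z (j, i)) = Z (i, j)" using M.psd_sa[OF Z(1)] mat_adj[OF ij, of Z] by simp
    then show "adj (mat_cstar n ?E) Z (i, j) = Z (i, j)" by (simp add: E.mat_adj[OF ij])
  qed (use ZE in auto)
  ultimately show ?thesis
    unfolding positive_mat_cstar ME.positive_iff_psd ME.psd_def using ZE by blast
qed

end

section \<open>Restricting a splitting to the functions on the group\<close>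

locale splitting_map = compact_dynamics D \<omega> G T \<alpha>
  for D :: "('a, 's) cstar_scheme" (structure) and \<omega> and G :: "('g, 'm) monoid_scheme"
    and T :: "'g topology" and \<alpha> +
  fixes \<psi> :: "('g \<Rightarrow> 'a) \<Rightarrow> (nat \<Rightarrow> 'a) set" and e :: "(nat \<Rightarrow> 'a) set"
  assumes oz: "order_zero (cont_tensor T D) U \<psi>"
    and eqv: "equivariant G (cont_tensor T D) (shift_tensor G \<alpha>) (ultra_action \<alpha>) \<psi>"
    and ep: "positive (rel_commutant \<omega> D) e"
    and e1: "positive U (\<one>\<^bsub>U\<^esub> \<ominus>\<^bsub>U\<^esub> e)"
    and unit_factor: "\<And>a. a \<in> cr \<Longrightarrow> \<psi> (elem_tensor T D \<one>\<^bsub>cont_alg T\<^esub> a) = e \<otimes>\<^bsub>U\<^esub> \<kappa> a"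
begin

sublocale B: cstar_alg CA by (rule CA_cstar_alg)

text \<open>The embeddings of the two tensor factors.\<close>

definition \<eta> :: "'a \<Rightarrow> ('g \<Rightarrow> 'a)" where "\<eta> a = tens \<one>\<^bsub>CC.LX\<^esub> a"
definition \<iota> :: "('g \<Rightarrow> complex) \<Rightarrow> ('g \<Rightarrow> 'a)" where "\<iota> f = tens f \<one>"

lemma \<eta>_at: "t \<in> TS \<Longrightarrow> a \<in> cr \<Longrightarrow> \<eta> a t = a" by (simp add: \<eta>_def CC.linf_ops complex_ops)
lemma \<iota>_at: "t \<in> TS \<Longrightarrow> \<iota> f t = f t \<odot> \<one>" by (simp add: \<iota>_def)
lemma one_CC: "\<one>\<^bsub>CC.LX\<^esub> \<in> CC.CF" using CC.LX.sub_algD(2)[OF CC.CF_sub_alg] .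
lemma \<eta>_in [simp, intro]: "a \<in> cr \<Longrightarrow> \<eta> a \<in> CF" unfolding \<eta>_def using one_CC by (rule tens_in)
lemma \<iota>_in [simp, intro]: "f \<in> CC.CF \<Longrightarrow> \<iota> f \<in> CF" unfolding \<iota>_def by (rule tens_in) auto
lemma CF_LX [simp]: "F \<in> CF \<Longrightarrow> F \<in> carrier LX" by (rule CF_sub_linf)
lemma CF_m [simp, intro]: "F \<in> CF \<Longrightarrow> H \<in> CF \<Longrightarrow> F \<otimes>\<^bsub>LX\<^esub> H \<in> CF" "F \<in> CF \<Longrightarrow> adj LX F \<in> CF"
  using LX.sub_algD(4,6)[OF CF_sub_alg] by blast+

lemma CF_eqI: "F \<in> CF \<Longrightarrow> H \<in> CF \<Longrightarrow> (\<And>t. t \<in> TS \<Longrightarrow> F t = H t) \<Longrightarrow> F = H"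
  by (rule linf_eqI[where X = TS]) auto

lemma \<eta>_one: "\<eta> \<one> = \<one>\<^bsub>LX\<^esub>"
  by (rule linf_eqI) (auto simp: \<eta>_at linf_ops)
lemma \<eta>_mult: "a \<in> cr \<Longrightarrow> b \<in> cr \<Longrightarrow> \<eta> a \<otimes>\<^bsub>LX\<^esub> \<eta> b = \<eta> (a \<otimes> b)"
  by (rule CF_eqI) (auto simp: \<eta>_at linf_ops)
lemma \<eta>_st: "a \<in> cr \<Longrightarrow> adj LX (\<eta> a) = \<eta> (st a)"
  by (rule CF_eqI) (auto simp: \<eta>_at linf_ops)

lemma \<psi>_lin: "\<psi> \<in> linear_maps CA U"
  using oz by (simp add: order_zero_def completely_positive_def cont_tensor_eq)
lemma \<psi>_in [simp, intro]: "F \<in> CF \<Longrightarrow> \<psi> F \<in> carrier U" using \<psi>_lin by (auto simp: linear_maps_def)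
lemma \<psi>_add: "F \<in> CF \<Longrightarrow> H \<in> CF \<Longrightarrow> \<psi> (F \<oplus>\<^bsub>LX\<^esub> H) = \<psi> F \<oplus>\<^bsub>U\<^esub> \<psi> H" using \<psi>_lin by (auto simp: linear_maps_def)
lemma \<psi>_sc: "F \<in> CF \<Longrightarrow> \<psi> (c \<odot>\<^bsub>LX\<^esub> F) = c \<odot>\<^bsub>U\<^esub> \<psi> F" using \<psi>_lin by (auto simp: linear_maps_def)
lemma \<psi>_minus: "F \<in> CF \<Longrightarrow> H \<in> CF \<Longrightarrow> \<psi> (F \<ominus>\<^bsub>LX\<^esub> H) = \<psi> F \<ominus>\<^bsub>U\<^esub> \<psi> H"
  using \<psi>_add[of F "(-1) \<odot>\<^bsub>LX\<^esub> H"] \<psi>_sc[of H "-1"] LX.sub_algD(5)[OF CF_sub_alg, of H "-1"]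
  by (simp add: a_minus_def LX.sc_neg U.sc_neg)
lemma \<psi>_cp: "completely_positive (cont_tensor T D) U \<psi>" using oz by (simp add: order_zero_def)
lemma \<psi>_\<eta>: "a \<in> cr \<Longrightarrow> \<psi> (\<eta> a) = e \<otimes>\<^bsub>U\<^esub> \<kappa> a"
  using unit_factor by (simp add: \<eta>_def cont_alg_eq)

lemma e_RC: "e \<in> RC" using ep by (simp add: positive_def rel_commutant_eq)
lemma e_in [simp]: "e \<in> carrier U" using e_RC RC_D by blast
lemma e_comm: "a \<in> cr \<Longrightarrow> e \<otimes>\<^bsub>U\<^esub> \<kappa> a = \<kappa> a \<otimes>\<^bsub>U\<^esub> e" using RC_D(2)[OF e_RC] .

lemma gram:
  assumes v: "\<And>i. i < n \<Longrightarrow> v i \<in> CF"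
  shows "\<exists>c. (\<forall>i<n. U.isvec n (c i)) \<and> (\<forall>i<n. \<forall>k<n. \<psi> (adj LX (v i) \<otimes>\<^bsub>LX\<^esub> v k) = U.ip n (c i) (c k))"
proof -
  have "positive (mat_alg n CA) (\<lambda>p\<in>{..<n} \<times> {..<n}. adj CA (v (fst p)) \<otimes>\<^bsub>CA\<^esub> v (snd p))" (is "positive _ ?X")
    by (rule B.gram_positive) (use v in simp)
  then have "positive (mat_alg n U) (\<lambda>p\<in>{..<n} \<times> {..<n}. \<psi> (?X p))"
    using \<psi>_cp unfolding completely_positive_def cont_tensor_eq by blast
  from U.positive_gram_vectors[OF this] obtain c where
    c: "\<forall>i<n. U.isvec n (c i)" "\<forall>i<n. \<forall>k<n. (\<lambda>p\<in>{..<n} \<times> {..<n}. \<psi> (?X p)) (i, k) = U.ip n (c i) (c k)" by blast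
  then show ?thesis by (intro exI[of _ c]) simp
qed

text \<open>Let \<open>c 0\<close>, \<open>c 1\<close>, \<open>c 2\<close> be columns whose Gram matrix is the image of the Gram matrix of \<open>1\<close>, \<open>1 \<otimes> a\<close> and \<open>F\<close>.
As \<open>\<psi>(1 \<otimes> b) = eb = be\<close> for all \<open>b\<close> in the algebra, the column \<open>c 1 - c 0 a\<close> has inner square zero. By
Cauchy-Schwarz it is orthogonal to \<open>c 2\<close>, which is the claim.\<close>

lemma bimodule:
  assumes F: "F \<in> CF" and a: "a \<in> cr"
  shows "\<psi> (adj LX F \<otimes>\<^bsub>LX\<^esub> \<eta> a) = \<psi> (adj LX F) \<otimes>\<^bsub>U\<^esub> \<kappa> a"
    and "\<psi> (adj LX (\<eta> a) \<otimes>\<^bsub>LX\<^esub> F) = adj U (\<kappa> a) \<otimes>\<^bsub>U\<^esub> \<psi> F"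
proof -
  define v where "v = (\<lambda>i::nat. if i = 0 then \<eta> \<one> else if i = 1 then \<eta> a else F)"
  have v: "v i \<in> CF" for i using F a by (simp add: v_def)
  obtain c where c: "\<And>i. i < 3 \<Longrightarrow> U.isvec 3 (c i)"
    "\<And>i k. i < 3 \<Longrightarrow> k < 3 \<Longrightarrow> \<psi> (adj LX (v i) \<otimes>\<^bsub>LX\<^esub> v k) = U.ip 3 (c i) (c k)"
    using gram[of 3 v] v by blast
  have vec: "U.isvec 3 (c 0)" "U.isvec 3 (c 1)" "U.isvec 3 (c 2)" using c(1) by simp_all
  have ka: "\<kappa> a \<in> carrier U" "adj U (\<kappa> a) = \<kappa> (st a)" using a by (simp_all add: \<kappa>_st)
  have i00: "U.ip 3 (c 0) (c 0) = e" using c(2)[of 0 0] by (simp add: v_def \<eta>_st \<eta>_mult \<psi>_\<eta> \<kappa>_one)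
  have i01: "U.ip 3 (c 0) (c 1) = e \<otimes>\<^bsub>U\<^esub> \<kappa> a" using c(2)[of 0 1] a by (simp add: v_def \<eta>_st \<eta>_mult \<psi>_\<eta>)
  have i10: "U.ip 3 (c 1) (c 0) = e \<otimes>\<^bsub>U\<^esub> \<kappa> (st a)" using c(2)[of 1 0] a by (simp add: v_def \<eta>_st \<eta>_mult \<psi>_\<eta>)
  have i11: "U.ip 3 (c 1) (c 1) = e \<otimes>\<^bsub>U\<^esub> \<kappa> (st a) \<otimes>\<^bsub>U\<^esub> \<kappa> a"
    using c(2)[of 1 1] a by (simp add: v_def \<eta>_st \<eta>_mult \<psi>_\<eta> \<kappa>_mult U.m_assoc)
  define w where "w = (\<lambda>k. c 1 k \<ominus>\<^bsub>U\<^esub> c 0 k \<otimes>\<^bsub>U\<^esub> \<kappa> a)"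
  have wv: "U.isvec 3 w" unfolding w_def using vec ka by (intro U.vec_ops)
  have "U.ip 3 w w = (U.ip 3 (c 1) (c 1) \<ominus>\<^bsub>U\<^esub> adj U (\<kappa> a) \<otimes>\<^bsub>U\<^esub> U.ip 3 (c 0) (c 1)) \<ominus>\<^bsub>U\<^esub>
      (U.ip 3 (c 1) (c 0) \<otimes>\<^bsub>U\<^esub> \<kappa> a \<ominus>\<^bsub>U\<^esub> adj U (\<kappa> a) \<otimes>\<^bsub>U\<^esub> U.ip 3 (c 0) (c 0) \<otimes>\<^bsub>U\<^esub> \<kappa> a)"
    unfolding w_def using vec ka(1) by (simp add: U.ip_minusr U.ip_minusl U.ip_mr U.ip_ml U.m_assoc)
  also have "\<dots> = \<zero>\<^bsub>U\<^esub>"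
  proof -
    have s: "\<kappa> (st a) \<in> carrier U" using a by simp
    have p: "\<kappa> (st a) \<otimes>\<^bsub>U\<^esub> (e \<otimes>\<^bsub>U\<^esub> \<kappa> a) = e \<otimes>\<^bsub>U\<^esub> \<kappa> (st a) \<otimes>\<^bsub>U\<^esub> \<kappa> a"
      using e_comm[of "st a"] a s ka(1) by (simp add: U.m_assoc[symmetric])
    have p': "\<kappa> (st a) \<otimes>\<^bsub>U\<^esub> e \<otimes>\<^bsub>U\<^esub> \<kappa> a = e \<otimes>\<^bsub>U\<^esub> \<kappa> (st a) \<otimes>\<^bsub>U\<^esub> \<kappa> a" using e_comm[of "st a"] a by simp
    show ?thesis unfolding i00 i01 i10 i11 ka(2) p p' using s ka(1) by simp
  qed
  finally have w0: "U.vnorm 3 w = 0" by (simp add: U.vnorm_def)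
  have z: "U.ip 3 (c 2) w = \<zero>\<^bsub>U\<^esub>" "U.ip 3 w (c 2) = \<zero>\<^bsub>U\<^esub>"
  proof -
    have m: "U.ip 3 (c 2) w \<in> carrier U" using vec(3) wv by simp
    have "nrm U (U.ip 3 (c 2) w) \<le> 0" using U.cauchy_schwarz[OF vec(3) wv] w0 by simp
    then have "nrm U (U.ip 3 (c 2) w) = 0" using U.nm_ge0[OF m] by linarith
    then show z1: "U.ip 3 (c 2) w = \<zero>\<^bsub>U\<^esub>" using U.nm_eq0[OF m] by blast
    show "U.ip 3 w (c 2) = \<zero>\<^bsub>U\<^esub>" using U.ip_st[OF vec(3) wv] z1 by simp
  qed
  have "U.ip 3 (c 2) w = U.ip 3 (c 2) (c 1) \<ominus>\<^bsub>U\<^esub> U.ip 3 (c 2) (c 0) \<otimes>\<^bsub>U\<^esub> \<kappa> a"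
    unfolding w_def using vec ka(1) by (simp add: U.ip_minusr U.ip_mr)
  then have d1: "U.ip 3 (c 2) (c 1) \<ominus>\<^bsub>U\<^esub> U.ip 3 (c 2) (c 0) \<otimes>\<^bsub>U\<^esub> \<kappa> a = \<zero>\<^bsub>U\<^esub>"
    unfolding z(1) by (rule sym)
  have r1: "U.ip 3 (c 2) (c 1) = U.ip 3 (c 2) (c 0) \<otimes>\<^bsub>U\<^esub> \<kappa> a"
    by (rule U.minus_eq0[OF _ _ d1]; intro U.m_closed U.ip_closed vec ka(1))
  have "U.ip 3 w (c 2) = U.ip 3 (c 1) (c 2) \<ominus>\<^bsub>U\<^esub> adj U (\<kappa> a) \<otimes>\<^bsub>U\<^esub> U.ip 3 (c 0) (c 2)"
    unfolding w_def using vec ka(1) by (simp add: U.ip_minusl U.ip_ml)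
  then have d2: "U.ip 3 (c 1) (c 2) \<ominus>\<^bsub>U\<^esub> adj U (\<kappa> a) \<otimes>\<^bsub>U\<^esub> U.ip 3 (c 0) (c 2) = \<zero>\<^bsub>U\<^esub>"
    unfolding z(2) by (rule sym)
  have r2: "U.ip 3 (c 1) (c 2) = adj U (\<kappa> a) \<otimes>\<^bsub>U\<^esub> U.ip 3 (c 0) (c 2)"
    by (rule U.minus_eq0[OF _ _ d2]; intro U.m_closed U.ip_closed U.st_closed vec ka(1))
  have "adj LX F \<otimes>\<^bsub>LX\<^esub> \<eta> \<one> = adj LX F" using F by (simp add: \<eta>_one)
  then show "\<psi> (adj LX F \<otimes>\<^bsub>LX\<^esub> \<eta> a) = \<psi> (adj LX F) \<otimes>\<^bsub>U\<^esub> \<kappa> a"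
    using r1 c(2)[of 2 1] c(2)[of 2 0] by (simp add: v_def)
  have "adj LX (\<eta> \<one>) \<otimes>\<^bsub>LX\<^esub> F = F" using F by (simp add: \<eta>_one)
  then show "\<psi> (adj LX (\<eta> a) \<otimes>\<^bsub>LX\<^esub> F) = adj U (\<kappa> a) \<otimes>\<^bsub>U\<^esub> \<psi> F"
    using r2 c(2)[of 1 2] c(2)[of 0 2] by (simp add: v_def)
qed

definition \<phi> :: "('g \<Rightarrow> complex) \<Rightarrow> (nat \<Rightarrow> 'a) set" where "\<phi> f = \<psi> (\<iota> f)"

text \<open>The tensors \<open>f \<otimes> 1\<close> and \<open>1 \<otimes> a\<close> commute; evaluate \<open>\<psi>\<close> on their product in both orders.\<close>

lemma \<phi>_RC: assumes f: "f \<in> CC.CF" shows "\<phi> f \<in> RC"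
  unfolding RC_def
proof (intro CollectI conjI ballI)
  show "\<phi> f \<in> carrier U" using f by (simp add: \<phi>_def)
  fix a assume a: "a \<in> cr"
  have "\<psi> (\<iota> f \<otimes>\<^bsub>LX\<^esub> \<eta> a) = \<psi> (\<iota> f) \<otimes>\<^bsub>U\<^esub> \<kappa> a"
    using bimodule(1)[of "adj LX (\<iota> f)" a] f a by simp
  moreover have "\<psi> (\<eta> a \<otimes>\<^bsub>LX\<^esub> \<iota> f) = \<kappa> a \<otimes>\<^bsub>U\<^esub> \<psi> (\<iota> f)"
    using bimodule(2)[of "\<iota> f" "st a"] f a by (simp add: \<eta>_st \<kappa>_st)
  moreover have "\<iota> f \<otimes>\<^bsub>LX\<^esub> \<eta> a = \<eta> a \<otimes>\<^bsub>LX\<^esub> \<iota> f"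
    using f a by (intro CF_eqI) (auto simp: \<eta>_at \<iota>_at linf_ops sc_ml sc_mr)
  ultimately show "\<phi> f \<otimes>\<^bsub>U\<^esub> \<kappa> a = \<kappa> a \<otimes>\<^bsub>U\<^esub> \<phi> f" by (simp add: \<phi>_def)
qed

lemma CC_m: "f \<in> CC.CF \<Longrightarrow> h \<in> CC.CF \<Longrightarrow> f \<otimes>\<^bsub>CC.LX\<^esub> h \<in> CC.CF" "f \<in> CC.CF \<Longrightarrow> h \<in> CC.CF \<Longrightarrow> f \<oplus>\<^bsub>CC.LX\<^esub> h \<in> CC.CF"
  "f \<in> CC.CF \<Longrightarrow> c \<odot>\<^bsub>CC.LX\<^esub> f \<in> CC.CF" "f \<in> CC.CF \<Longrightarrow> adj CC.LX f \<in> CC.CF"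
  by (fact CC.LX.sub_algD(4)[OF CC.CF_sub_alg] CC.LX.sub_algD(3)[OF CC.CF_sub_alg]
      CC.LX.sub_algD(5)[OF CC.CF_sub_alg] CC.LX.sub_algD(6)[OF CC.CF_sub_alg])+

lemma \<iota>_mult: "f \<in> CC.CF \<Longrightarrow> h \<in> CC.CF \<Longrightarrow> \<iota> (f \<otimes>\<^bsub>CC.LX\<^esub> h) = \<iota> f \<otimes>\<^bsub>LX\<^esub> \<iota> h"
  using CC_m by (intro CF_eqI) (auto simp: \<iota>_at linf_ops CC.linf_ops complex_ops sc_ml sc_sc)
lemma \<iota>_add: "f \<in> CC.CF \<Longrightarrow> h \<in> CC.CF \<Longrightarrow> \<iota> (f \<oplus>\<^bsub>CC.LX\<^esub> h) = \<iota> f \<oplus>\<^bsub>LX\<^esub> \<iota> h"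
  using CC_m LX.sub_algD(3)[OF CF_sub_alg] by (intro CF_eqI) (auto simp: \<iota>_at linf_ops CC.linf_ops complex_ops sc_addl)
lemma \<iota>_sc: "f \<in> CC.CF \<Longrightarrow> \<iota> (c \<odot>\<^bsub>CC.LX\<^esub> f) = c \<odot>\<^bsub>LX\<^esub> \<iota> f"
  using CC_m LX.sub_algD(5)[OF CF_sub_alg] by (intro CF_eqI) (auto simp: \<iota>_at linf_ops CC.linf_ops complex_ops sc_sc)
lemma \<iota>_st: "f \<in> CC.CF \<Longrightarrow> \<iota> (adj CC.LX f) = adj LX (\<iota> f)"
  using CC_m by (intro CF_eqI) (auto simp: \<iota>_at linf_ops CC.linf_ops complex_ops st_sc)

lemma \<phi>_linear: "\<phi> \<in> linear_maps (cont_alg T) (rel_commutant \<omega> D)"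
  unfolding linear_maps_def cont_alg_eq rel_commutant_eq
  using \<phi>_RC by (auto simp: \<phi>_def \<iota>_add \<iota>_sc \<psi>_add \<psi>_sc)

lemma \<phi>_cp: "completely_positive (cont_alg T) (rel_commutant \<omega> D) \<phi>"
  unfolding completely_positive_def
proof (intro conjI allI impI \<phi>_linear)
  fix n X assume X: "positive (mat_alg n (cont_alg T)) X"
  then have "X \<in> carrier (mat_alg n (cont_alg T))" by (simp add: positive_def)
  then have Xe: "X (i, k) \<in> CC.CF" if "i < n" "k < n" for i k
    using that by (auto simp: mat_alg_def cont_alg_eq PiE_iff)
  have "positive (mat_alg n (cont_tensor T D)) (mat_map n \<iota> X)"
    by (rule hom_mat_positive[OF CA_alg CT_alg _ _ _ _ X])
       (auto simp: cont_alg_eq cont_tensor_eq \<iota>_add \<iota>_mult \<iota>_st)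
  then have "positive (mat_alg n U) (\<lambda>p\<in>{..<n} \<times> {..<n}. \<psi> (mat_map n \<iota> X p))"
    using \<psi>_cp unfolding completely_positive_def by blast
  also have "(\<lambda>p\<in>{..<n} \<times> {..<n}. \<psi> (mat_map n \<iota> X p)) = (\<lambda>p\<in>{..<n} \<times> {..<n}. \<phi> (X p))" (is "_ = ?Y")
    by (rule restrict_ext) (simp add: \<phi>_def mat_map_def)
  finally have p: "positive (mat_alg n U) ?Y" .
  show "positive (mat_alg n (rel_commutant \<omega> D)) ?Y"
    unfolding rel_commutant_eq
  proof (rule U.positive_commutant_matrix[OF RC_sub_alg _ _ p, where C = "\<kappa> ` cr"])
    show "x \<in> RC \<longleftrightarrow> x \<in> carrier U \<and> (\<forall>c\<in>\<kappa> ` cr. c \<otimes>\<^bsub>U\<^esub> x = x \<otimes>\<^bsub>U\<^esub> c)" for x by (auto simp: RC_def)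
    show "?Y (i, k) \<in> RC" if "i < n" "k < n" for i k using \<phi>_RC[OF Xe[OF that]] that by simp
  qed auto
qed

lemma \<phi>_order_zero: "order_zero (cont_alg T) (rel_commutant \<omega> D) \<phi>"
proof -
  have "\<phi> f \<otimes>\<^bsub>rel_commutant \<omega> D\<^esub> \<phi> h = \<zero>\<^bsub>rel_commutant \<omega> D\<^esub>"
    if f: "positive (cont_alg T) f" and h: "positive (cont_alg T) h"
      and z: "f \<otimes>\<^bsub>cont_alg T\<^esub> h = \<zero>\<^bsub>cont_alg T\<^esub>" "h \<otimes>\<^bsub>cont_alg T\<^esub> f = \<zero>\<^bsub>cont_alg T\<^esub>" for f h
  proof -
    have c: "f \<in> CC.CF" "h \<in> CC.CF" using f h by (simp_all add: positive_def cont_alg_eq)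
    have ip: "positive (cont_tensor T D) (\<iota> k)" if "positive (cont_alg T) k" for k
      by (rule hom_psd[OF CA_alg CT_alg _ _ _ that]) (auto simp: cont_alg_eq cont_tensor_eq \<iota>_mult \<iota>_st)
    have "\<iota> \<zero>\<^bsub>CC.LX\<^esub> = \<zero>\<^bsub>LX\<^esub>" using \<iota>_sc[OF c(1), of 0] c(1) CC.CF_sub_linf[OF c(1)] by simp
    then have "\<iota> f \<otimes>\<^bsub>LX\<^esub> \<iota> h = \<zero>\<^bsub>LX\<^esub>" "\<iota> h \<otimes>\<^bsub>LX\<^esub> \<iota> f = \<zero>\<^bsub>LX\<^esub>"
      using z c by (simp_all add: cont_alg_eq \<iota>_mult[symmetric])
    then have "\<psi> (\<iota> f) \<otimes>\<^bsub>U\<^esub> \<psi> (\<iota> h) = \<zero>\<^bsub>U\<^esub>"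
      using oz ip[OF f] ip[OF h] unfolding order_zero_def by (auto simp: cont_tensor_eq)
    then show ?thesis by (simp add: \<phi>_def rel_commutant_eq)
  qed
  then show ?thesis unfolding order_zero_def using \<phi>_cp by blast
qed

text \<open>The Gram matrix of \<open>1\<close> and \<open>f \<otimes> 1\<close> gives columns with inner product \<open>\<phi>(f)\<close> and inner squares \<open>e\<close> and
\<open>\<psi>(f\<^sup>*f \<otimes> 1) \<le> K\<^sup>2e\<close>, where \<open>K\<close> is the norm of \<open>f\<close>.\<close>

lemma \<phi>_contractive: "contractive (cont_alg T) (rel_commutant \<omega> D) \<phi>"
  unfolding contractive_def
proof
  fix f assume "f \<in> carrier (cont_alg T)"
  then have f: "f \<in> CC.CF" by (simp add: cont_alg_eq)
  define K where "K = nrm CC.LX f"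
  have K: "0 \<le> K" using CC.LX.nm_ge0[OF CC.CF_sub_linf[OF f]] by (simp add: K_def)
  have ne: "nrm U e \<le> 1"
  proof -
    have "nrm U e \<le> nrm U \<one>\<^bsub>U\<^esub>"
      using RC_psd[OF ep] e1 by (intro U.psd_mono) (simp_all add: U.positive_iff_psd)
    then show ?thesis using U.nm_one_le by linarith
  qed
  define F where "F = \<iota> f"
  have F: "F \<in> CF" using f by (simp add: F_def)
  have nF: "nrm LX F \<le> K"
  proof (rule linf_least[OF neT])
    fix t assume t: "t \<in> TS"
    have "nm (F t) \<le> cmod (f t)" unfolding F_def using \<iota>_at[OF t] nm_one_sc by simp
    also have "\<dots> \<le> K" using CC.linf_le[OF CC.CF_sub_linf[OF f] t] by (simp add: K_def complex_ops)
    finally show "nm (F t) \<le> K" .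
  qed
  define v where "v = (\<lambda>i::nat. if i = 0 then \<eta> \<one> else F)"
  have v: "v i \<in> CF" for i using F by (simp add: v_def)
  obtain c where c: "\<And>i. i < 2 \<Longrightarrow> U.isvec 2 (c i)"
    "\<And>i k. i < 2 \<Longrightarrow> k < 2 \<Longrightarrow> \<psi> (adj LX (v i) \<otimes>\<^bsub>LX\<^esub> v k) = U.ip 2 (c i) (c k)"
    using gram[of 2 v] v by blast
  have vec: "U.isvec 2 (c 0)" "U.isvec 2 (c 1)" using c(1) by simp_all
  have i00: "U.ip 2 (c 0) (c 0) = e" using c(2)[of 0 0] by (simp add: v_def \<eta>_st \<eta>_mult \<psi>_\<eta> \<kappa>_one)
  have i01: "U.ip 2 (c 0) (c 1) = \<phi> f" using c(2)[of 0 1] F by (simp add: v_def \<eta>_one F_def[symmetric] \<phi>_def)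
  have i11: "U.ip 2 (c 1) (c 1) = \<psi> (adj LX F \<otimes>\<^bsub>LX\<^esub> F)" using c(2)[of 1 1] by (simp add: v_def)
  have n0: "U.vnorm 2 (c 0) \<le> 1" unfolding U.vnorm_def i00 using ne by simp
  have n1: "U.vnorm 2 (c 1) \<le> K"
  proof -
    let ?P = "adj LX F \<otimes>\<^bsub>LX\<^esub> F" and ?K2 = "complex_of_real (K\<^sup>2) \<odot>\<^bsub>LX\<^esub> \<eta> \<one>"
    have PC: "?P \<in> CF" using F by simp
    have KC: "?K2 \<in> CF" using LX.sub_algD(5)[OF CF_sub_alg] by simp
    have "B.psd (B.rl (K\<^sup>2) \<ominus>\<^bsub>CA\<^esub> ?P)"
    proof (rule B.rl_minus_psd)
      show "?P \<in> carrier CA" using PC by simp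
      show "adj CA ?P = ?P" using F by (simp add: LX.st_mult)
      show "nrm CA ?P \<le> K\<^sup>2" using LX.nm_cs[of F] F nF by (simp add: power_mono)
    qed
    then have "positive (cont_tensor T D) (?K2 \<ominus>\<^bsub>LX\<^esub> ?P)"
      unfolding cont_tensor_eq B.positive_iff_psd LX.sub_minus[OF CF_sub_alg KC PC, symmetric]
      by (simp add: \<eta>_one)
    then have "positive U (\<psi> (?K2 \<ominus>\<^bsub>LX\<^esub> ?P))" using cp_positive[OF CT_alg U_cstar_alg \<psi>_cp] by blast
    then have "U.psd (complex_of_real (K\<^sup>2) \<odot>\<^bsub>U\<^esub> e \<ominus>\<^bsub>U\<^esub> \<psi> ?P)"
      using \<psi>_minus[OF KC PC] by (simp add: U.positive_iff_psd \<psi>_sc \<psi>_\<eta> \<kappa>_one)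
    then have "nrm U (U.ip 2 (c 1) (c 1)) \<le> nrm U (complex_of_real (K\<^sup>2) \<odot>\<^bsub>U\<^esub> e)"
      using U.ip_psd[OF vec(2)] unfolding i11 by (intro U.psd_mono) auto
    also have "\<dots> \<le> K\<^sup>2" using ne by (simp add: U.nm_sc mult_left_le norm_power)
    finally show ?thesis using K by (simp add: U.vnorm_def real_le_lsqrt)
  qed
  have "nrm U (\<phi> f) \<le> U.vnorm 2 (c 0) * U.vnorm 2 (c 1)" using U.cauchy_schwarz[OF vec] unfolding i01 .
  also have "\<dots> \<le> 1 * K" using n0 n1 vec by (intro mult_mono) auto
  finally show "nrm (rel_commutant \<omega> D) (\<phi> f) \<le> nrm (cont_alg T) f"
    by (simp add: rel_commutant_eq cont_alg_eq K_def)
qed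

lemma \<phi>_equivariant: "equivariant G (cont_alg T) (shift G) (ultra_action \<alpha>) \<phi>"
  unfolding equivariant_def
proof (intro ballI)
  fix g f assume g: "g \<in> carrier G" and f: "f \<in> carrier (cont_alg T)"
  then have fc: "f \<in> CC.CF" by (simp add: cont_alg_eq)
  have "\<iota> (shift G g f) = shift_tensor G \<alpha> g (\<iota> f)"
    using shift_tensor_elem_tensor[OF cg act g f one_closed] \<alpha>_one[OF g] by (simp add: \<iota>_def)
  then show "\<phi> (shift G g f) = ultra_action \<alpha> g (\<phi> f)"
    using eqv g \<iota>_in[OF fc] unfolding equivariant_def \<phi>_def cont_tensor_eq by simp
qed

lemma \<phi>_one: "\<phi> \<one>\<^bsub>cont_alg T\<^esub> = e"
proof -
  have "\<iota> \<one>\<^bsub>cont_alg T\<^esub> = \<eta> \<one>" by (simp add: \<iota>_def \<eta>_def cont_alg_eq)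
  then show ?thesis using \<psi>_\<eta>[OF one_closed] by (simp add: \<phi>_def \<kappa>_one)
qed

end

context compact_dynamics
begin

section \<open>The equivalence\<close>

lemma first_factor_hom: "(\<lambda>a. elem_tensor T D \<one>\<^bsub>cont_alg T\<^esub> a) \<in> star_homs D (cont_tensor T D)"
proof -
  have one: "\<one>\<^bsub>CC.LX\<^esub> \<in> CC.CF" using CC.LX.sub_algD(2)[OF CC.CF_sub_alg] .
  have t: "tens \<one>\<^bsub>CC.LX\<^esub> a \<in> CF" "tens \<one>\<^bsub>CC.LX\<^esub> a \<in> carrier LX" if "a \<in> cr" for a
    using tens_in[OF one that] CF_sub_linf by auto
  have at: "tens \<one>\<^bsub>CC.LX\<^esub> a s = a" if "s \<in> TS" "a \<in> cr" for a s
    using that by (simp add: CC.linf_ops complex_ops)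
  have "tens \<one>\<^bsub>CC.LX\<^esub> (a \<oplus> b) = tens \<one>\<^bsub>CC.LX\<^esub> a \<oplus>\<^bsub>LX\<^esub> tens \<one>\<^bsub>CC.LX\<^esub> b"
    "tens \<one>\<^bsub>CC.LX\<^esub> (a \<otimes> b) = tens \<one>\<^bsub>CC.LX\<^esub> a \<otimes>\<^bsub>LX\<^esub> tens \<one>\<^bsub>CC.LX\<^esub> b" if ab: "a \<in> cr" "b \<in> cr" for a b
    using t[OF ab(1)] t[OF ab(2)] t[of "a \<oplus> b"] t[of "a \<otimes> b"] ab
    by (auto intro!: linf_eqI simp: linf_ops at simp del: tens_at)
  moreover have "tens \<one>\<^bsub>CC.LX\<^esub> (c \<odot> a) = c \<odot>\<^bsub>LX\<^esub> tens \<one>\<^bsub>CC.LX\<^esub> a" "tens \<one>\<^bsub>CC.LX\<^esub> (st a) = adj LX (tens \<one>\<^bsub>CC.LX\<^esub> a)"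
    if a: "a \<in> cr" for a c
    using t[OF a] t[of "c \<odot> a"] t[of "st a"] a
    by (auto intro!: linf_eqI simp: linf_ops at simp del: tens_at)
  ultimately show ?thesis
    unfolding star_homs_def linear_maps_def cont_alg_eq cont_tensor_eq using t by simp
qed

lemma first_factor_equivariant:
  "equivariant G D \<alpha> (shift_tensor G \<alpha>) (\<lambda>a. elem_tensor T D \<one>\<^bsub>cont_alg T\<^esub> a)"
  unfolding equivariant_def
proof (intro ballI)
  fix g a assume g: "g \<in> carrier G" and a: "a \<in> cr"
  interpret Gr: group G by (rule is_group)
  have one: "\<one>\<^bsub>cont_alg T\<^esub> \<in> carrier (cont_alg T)"
    using CC.LX.sub_algD(2)[OF CC.CF_sub_alg] by (simp add: cont_alg_eq)
  have "shift G g \<one>\<^bsub>cont_alg T\<^esub> = \<one>\<^bsub>cont_alg T\<^esub>"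
    using g by (auto simp: shift_def cont_alg_eq linf_def TS_eq fun_eq_iff)
  then show "elem_tensor T D \<one>\<^bsub>cont_alg T\<^esub> (\<alpha> g a) = shift_tensor G \<alpha> g (elem_tensor T D \<one>\<^bsub>cont_alg T\<^esub> a)"
    using shift_tensor_elem_tensor[OF cg act g one a] by simp
qed

lemma rokhlin_iff_split:
  "weak_tracial_Rokhlin \<omega> G T D \<alpha> \<longleftrightarrow>
    tracially_seq_split \<omega> G D \<alpha> (cont_tensor T D) (shift_tensor G \<alpha>)
      (\<lambda>a. elem_tensor T D \<one>\<^bsub>cont_alg T\<^esub> a)"
proof
  assume R: "weak_tracial_Rokhlin \<omega> G T D \<alpha>"
  show "tracially_seq_split \<omega> G D \<alpha> (cont_tensor T D) (shift_tensor G \<alpha>) (\<lambda>a. elem_tensor T D \<one>\<^bsub>cont_alg T\<^esub> a)"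
    unfolding tracially_seq_split_def
  proof (intro conjI allI impI first_factor_hom first_factor_equivariant)
    fix x assume x: "positive U x \<and> x \<noteq> \<zero>\<^bsub>U\<^esub>"
    obtain \<phi> where \<phi>: "order_zero (cont_alg T) (rel_commutant \<omega> D) \<phi>"
      "contractive (cont_alg T) (rel_commutant \<omega> D) \<phi>"
      "equivariant G (cont_alg T) (shift G) (ultra_action \<alpha>) \<phi>"
      "cuntz_le U (\<one>\<^bsub>U\<^esub> \<ominus>\<^bsub>U\<^esub> \<phi> \<one>\<^bsub>cont_alg T\<^esub>) x"
      using R x unfolding weak_tracial_Rokhlin_def by blast
    interpret K: rokhlin_map D \<omega> G T \<alpha> \<phi>
      by (intro rokhlin_map.intro compact_dynamics_axioms rokhlin_map_axioms.intro \<phi>)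
    show "\<exists>\<psi> g. order_zero (cont_tensor T D) U \<psi> \<and>
             equivariant G (cont_tensor T D) (shift_tensor G \<alpha>) (ultra_action \<alpha>) \<psi> \<and>
             positive (rel_commutant \<omega> D) g \<and>
             (\<forall>a\<in>carrier D. \<psi> (elem_tensor T D \<one>\<^bsub>cont_alg T\<^esub> a) = g \<otimes>\<^bsub>U\<^esub> const_seq \<omega> D a \<and>
                             \<psi> (elem_tensor T D \<one>\<^bsub>cont_alg T\<^esub> a) = const_seq \<omega> D a \<otimes>\<^bsub>U\<^esub> g) \<and>
             cuntz_le U (\<one>\<^bsub>U\<^esub> \<ominus>\<^bsub>U\<^esub> g) x"
    proof (intro exI[of _ K.\<Psi>] exI[of _ K.gg] conjI ballI K.\<Psi>_order_zero K.\<Psi>_equivariant K.gg_positive)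
      fix a assume a: "a \<in> cr"
      show "K.\<Psi> (elem_tensor T D \<one>\<^bsub>cont_alg T\<^esub> a) = K.gg \<otimes>\<^bsub>U\<^esub> const_seq \<omega> D a"
        using K.\<Psi>_one_tensor[OF a] by (simp add: const_seq_eq)
      show "K.\<Psi> (elem_tensor T D \<one>\<^bsub>cont_alg T\<^esub> a) = const_seq \<omega> D a \<otimes>\<^bsub>U\<^esub> K.gg"
        using K.\<Psi>_one_tensor[OF a] K.P_comm[OF _ a, of "\<lambda>_. 1"] by (simp add: const_seq_eq)
    next
      show "cuntz_le U (\<one>\<^bsub>U\<^esub> \<ominus>\<^bsub>U\<^esub> K.gg) x" using \<phi>(4) by (simp add: K.gg_eq)
    qed
  qed
next
  assume S: "tracially_seq_split \<omega> G D \<alpha> (cont_tensor T D) (shift_tensor G \<alpha>) (\<lambda>a. elem_tensor T D \<one>\<^bsub>cont_alg T\<^esub> a)"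
  show "weak_tracial_Rokhlin \<omega> G T D \<alpha>"
    unfolding weak_tracial_Rokhlin_def
  proof (intro allI impI)
    fix x assume x: "positive U x \<and> x \<noteq> \<zero>\<^bsub>U\<^esub>"
    obtain \<psi> e where \<psi>: "order_zero (cont_tensor T D) U \<psi>"
      "equivariant G (cont_tensor T D) (shift_tensor G \<alpha>) (ultra_action \<alpha>) \<psi>"
      "positive (rel_commutant \<omega> D) e"
      "\<And>a. a \<in> cr \<Longrightarrow> \<psi> (elem_tensor T D \<one>\<^bsub>cont_alg T\<^esub> a) = e \<otimes>\<^bsub>U\<^esub> const_seq \<omega> D a"
      "cuntz_le U (\<one>\<^bsub>U\<^esub> \<ominus>\<^bsub>U\<^esub> e) x"
      using S x unfolding tracially_seq_split_def by blast
    interpret K: splitting_map D \<omega> G T \<alpha> \<psi> e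
      by (intro splitting_map.intro compact_dynamics_axioms splitting_map_axioms.intro \<psi>(1-3))
         (use \<psi>(4,5) in \<open>simp_all add: const_seq_eq cuntz_le_def\<close>)
    show "\<exists>\<phi>. order_zero (cont_alg T) (rel_commutant \<omega> D) \<phi> \<and>
             contractive (cont_alg T) (rel_commutant \<omega> D) \<phi> \<and>
             equivariant G (cont_alg T) (shift G) (ultra_action \<alpha>) \<phi> \<and>
             cuntz_le U (\<one>\<^bsub>U\<^esub> \<ominus>\<^bsub>U\<^esub> \<phi> \<one>\<^bsub>cont_alg T\<^esub>) x"
      using K.\<phi>_order_zero K.\<phi>_contractive K.\<phi>_equivariant K.\<phi>_one \<psi>(5) by (intro exI[of _ K.\<phi>]) simp
  qed
qed

end

theorem corollary3p7:
  fixes G :: "'g monoid" and T :: "'g topology"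
    and A :: "'a cstar" and \<alpha> :: "'g \<Rightarrow> 'a \<Rightarrow> 'a"
    and \<omega> :: "nat filter"
  assumes "free_ultrafilter \<omega>"
    and "compact_group G T"
    and "unital_cstar_algebra A"
    and "separable_cstar A"
    and "cstar_action G T A \<alpha>"
  shows "weak_tracial_Rokhlin \<omega> G T A \<alpha> \<longleftrightarrow>
    tracially_seq_split \<omega> G A \<alpha> (cont_tensor T A) (shift_tensor G \<alpha>)
      (\<lambda>a. elem_tensor T A \<one>\<^bsub>cont_alg T\<^esub> a)"
proof -
  interpret compact_dynamics A \<omega> G T \<alpha>
    using assms by (intro compact_dynamics.intro ultrapower_alg.intro cstar_alg.intro ultrapower_alg_axioms.intro compact_dynamics_axioms.intro)
  show ?thesis by (rule rokhlin_iff_split)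
qed

end
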